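(* Let $N\ge 2$ and let $G=(C(G),u)$ be a compact matrix quantum group with $S_N\subseteq G\subseteq B_N^{\#+}$ corresponding to a linear category of partitions $\mathscr K\subseteq\mathscr P_{N\text{-lin}}$ with $\uparrow\otimes\uparrow\in\mathscr K$. Then, for each choice of sign $\pm$, the quantum group $G^{\rm irr}_\pm$ satisfies $S_{N-1}\subseteq G^{\rm irr}_\pm\subseteq O_{N-1}^+$ and it corresponds to the category $$\mathcal V_{(N,\pm)}\mathscr K=\{\mathcal V_{(N,\pm)}p\mid p\in\mathscr K\}\subseteq\mathscr P_{(N-1)\text{-lin}}.$$
   Context: **Partitions.** For $k,l\in\mathbb N_0$ let $\mathscr P(k,l)$ be the set of partitions (into disjoint non-empty blocks) of a set of $k$ upper and $l$ lower points (two rows). $\mathscr P_{N\text{-lin}}(k,l)$ is the complex vector space with basis $\mathscr P(k,l)$, and $\mathscr P_{N\text{-lin}}=\bigcup_{k,l}\mathscr P_{N\text{-lin}}(k,l)$. Operations: tensor product $p\otimes q$ (horizontal juxtaposition, $q$ to the right); composition $qp\in\mathscr P_{N\text{-lin}}(k,m)$ for $p\in\mathscr P(k,l)$, $q\in\mathscr P(l,m)$ (place $q$ below $p$, identify the lower row of $p$ with the upper row of $q$, join blocks accordingly, and replace each connected component containing neither upper nor lower points of the result by a factor $N$); involution $p^*$ (reflection at the horizontal axis). Tensor product and composition are extended bilinearly, $*$ antilinearly. In $\mathscr P_{(N-1)\text{-lin}}$ the factor is $N-1$. Rotations: $\operatorname{Lrot}$ moves the leftmost upper point to the left end of the lower row;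 $\operatorname{Rrot}$ moves the last lower point to the right end of the upper row (keeping blocks); extended linearly. Notation: $\uparrow\in\mathscr P(0,1)$ is the singleton, $|\in\mathscr P(1,1)$ the identity partition (one block), $\sqcap\in\mathscr P(0,2)$ the pair partition (one block). A linear category of partitions is a collection $\mathscr K$ of subspaces $\mathscr K(k,l)\subseteq\mathscr P_{N\text{-lin}}(k,l)$ containing $|$ and $\sqcap$ and closed under tensor product, composition and involution. $\langle\,\cdot\,\rangle_{N\text{-lin}}$ denotes the smallest linear category containing the given elements. **Linear maps.** For $p\in\mathscr P(k,l)$, $T_p:(\mathbb C^N)^{\otimes k}\to(\mathbb C^N)^{\otimes l}$, $T_p(e_{i_1}\otimes\cdots\otimes e_{i_k})=\sum_{j_1,\dots,j_l=1}^N\delta_p(\mathbf i,\mathbf j)\,e_{j_1}\otimes\cdots\otimes e_{j_l}$, where $\delta_p(\mathbf i,\mathbf j)=1$ if, labelling the upper points by $\mathbf i$ and lower points by $\mathbf j$, points in the same block have equal labels, and $0$ otherwise; extended linearly in $p$. **Quantum groups.** A compact matrix quantum group (CMQG) is $G=(C(G),u)$, with $C(G)$ a unital C*-algebra generated by the entries of $u\in M_N(C(G))$, $u$ and $u^t$ invertible, and $u_{ij}\mapsto\sum_k u_{ik}\otimes u_{kj}$ extending to a unital $*$-homomorphism $C(G)\to C(G)\otimes_{\min}C(G)$. One always uses the full (universal) C*-completion of the Hopf $*$-algebra generated by the $u_{ij}$. $H=(C(H),v)\subseteq G=(C(G),u)$ means $u,v$ have the same size and $u_{ij}\mapsto v_{ij}$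 defines a surjective $*$-homomorphism $C(G)\to C(H)$. $S_N$ is the group of permutation matrices with $C(S_N)$ and its coordinate functions. $O_N^+$: $C(O_N^+)$ is universal with $u_{ij}=u_{ij}^*$, $uu^t=u^tu=1$. $\operatorname{Mor}(u^{\otimes k},u^{\otimes l})=\{T\mid Tu^{\otimes k}=u^{\otimes l}T\}$. A CMQG $G$ with $S_N\subseteq G\subseteq O_N^+$ *corresponds* to a linear category $\mathscr K\subseteq\mathscr P_{N\text{-lin}}$ if $\operatorname{Mor}(u^{\otimes k},u^{\otimes l})=\{T_p\mid p\in\mathscr K(k,l)\}$ for all $k,l$ (by Tannaka–Krein every such $G$ corresponds to some $\mathscr K$ and each $\mathscr K$ determines a unique $G$). $B_N^{\#+}$ is the quantum group corresponding to $\langle\uparrow\otimes\uparrow\rangle_{N\text{-lin}}$. **The quantum groups $G^{\rm irr}_\pm$.** Let $U_{(N,\pm)}\in M_N(\mathbb C)$ be the orthogonal matrices with $[U_{(N,\pm)}]_{ij}=\delta_{ij}-\frac1{N-1}\bigl(1\pm\frac1{\sqrt N}\bigr)$ and $[U_{(N,\pm)}]_{iN}=[U_{(N,\pm)}]_{Nj}=[U_{(N,\pm)}]_{NN}=\pm\frac1{\sqrt N}$ for $i,j\in\{1,\dots,N-1\}$, and let $V_{(N,\pm)}$ be the $(N-1)\times N$ matrix of the first $N-1$ rows of $U_{(N,\pm)}$. For $S_N\subseteq G=(C(G),u)\subseteq B_N^{\#+}$ put $G^{\rm irr}_\pm:=(A,v)$, $v=V_{(N,\pm)}uV_{(N,\pm)}^*\in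 M_{N-1}(C(G))$, $A\subseteq C(G)$ the C*-subalgebra generated by the entries of $v$. **The map $\mathcal V_{(N,\pm)}$.** Let $b_k\in\mathscr P(0,k)$ be the partition with a single block; for $I\subseteq\{1,\dots,k\}$ let $b_{k,I}$ be obtained from $b_k$ by turning the points of $I$ into singletons (the remaining points form one block); $b_{k,i}:=\sum_{|I|=i}b_{k,I}$ for $i<k$ and $b_{k,k}:=(N-1)\uparrow^{\otimes k}$. The linear map $\mathcal V_{(N,\pm)}:\mathscr P_{N\text{-lin}}\to\mathscr P_{(N-1)\text{-lin}}$ is defined by $$\mathcal V_{(N,\pm)}b_k=\sum_{i=0}^k\Bigl(\tfrac{-1}{N-1}\bigl(1\pm\tfrac1{\sqrt N}\bigr)\Bigr)^i b_{k,i}+\Bigl(\tfrac{\pm1}{\sqrt N}\Bigr)^k\uparrow^{\otimes k},$$ $\mathcal V_{(N,\pm)}\operatorname{Rrot}^kb_{k+l}=\operatorname{Rrot}^k\mathcal V_{(N,\pm)}b_{k+l}$, for a general partition by acting on each block separately (replacing each block by the corresponding linear combination on the same points and expanding multilinearly), and then by linear extension. *)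

theory Defs
  imports
    Complex_Main
    "HOL-Library.Disjoint_Sets"
    "HOL-Library.FuncSet"
    "HOL-Library.Nonpos_Ints"
    "HOL-Combinatorics.Permutations"
    "HOL-Algebra.Module"
begin

section \<open>Partitions and linear categories of partitions\<close>

text \<open>A point is a pair (row, position); row 0 is the upper and row 1 the lower row, and positions
  count from 0. In a composition the intermediate picture has the three rows 0, 1, 2.\<close>

type_synonym point = "nat \<times> nat"
type_synonym ptn = "point set set"
type_synonym lin_ptn = "ptn \<Rightarrow> complex"

definition points :: "nat \<Rightarrow> nat \<Rightarrow> point set" where
  "points k l = {0} \<times> {..<k} \<union> {1} \<times> {..<l}"

definition partitions :: "nat \<Rightarrow> nat \<Rightarrow> ptn set" where
  "partitions k l = {p. partition_on (points k l) p}"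

definition lin_partitions :: "nat \<Rightarrow> nat \<Rightarrow> lin_ptn set" where
  "lin_partitions k l = {f. \<forall>p. f p \<noteq> 0 \<longrightarrow> p \<in> partitions k l}"

definition basis_vec :: "'a \<Rightarrow> 'a \<Rightarrow> complex" where
  "basis_vec x = (\<lambda>y. if y = x then 1 else 0)"

definition singleton_ptn :: ptn where "singleton_ptn = {{(1, 0)}}"
definition identity_ptn :: ptn where "identity_ptn = {{(0, 0), (1, 0)}}"
definition pair_ptn :: ptn where "pair_ptn = {{(1, 0), (1, 1)}}"

text \<open>The numbers k and l of upper and lower points of the left factor have to be supplied, since
  they determine by how much the right factor is shifted.\<close>

definition tensor_ptn :: "nat \<Rightarrow> nat \<Rightarrow> ptn \<Rightarrow> ptn \<Rightarrow> ptn" where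
  "tensor_ptn k l p q = p \<union> (`) (\<lambda>(r, i). (r, (if r = 0 then k else l) + i)) ` q"

definition involution_ptn :: "ptn \<Rightarrow> ptn" where
  "involution_ptn p = (`) (\<lambda>(r, i). (1 - r, i)) ` p"

text \<open>Connected components of the three-row picture obtained by placing q below p.\<close>

definition stacked_components :: "ptn \<Rightarrow> ptn \<Rightarrow> ptn" where
  "stacked_components q p =
     (let R = p \<union> (`) (\<lambda>(r, i). (r + 1, i)) ` q
      in \<Union>R // (\<Union>B\<in>R. B \<times> B)\<^sup>*)"

definition compose_ptn :: "ptn \<Rightarrow> ptn \<Rightarrow> ptn" where
  "compose_ptn q p =
     (\<lambda>C. (\<lambda>(r, i). (if r = 2 then 1 else r, i)) ` {x \<in> C. fst x \<noteq> 1}) ` stacked_components q p - {{}}"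

definition num_loops :: "ptn \<Rightarrow> ptn \<Rightarrow> nat" where
  "num_loops q p = card {C \<in> stacked_components q p. \<forall>x\<in>C. fst x = 1}"

definition tensor_lin :: "nat \<Rightarrow> nat \<Rightarrow> nat \<Rightarrow> nat \<Rightarrow> lin_ptn \<Rightarrow> lin_ptn \<Rightarrow> lin_ptn" where
  "tensor_lin k l k' l' f g = (\<lambda>r. \<Sum>p\<in>partitions k l. \<Sum>q\<in>partitions k' l'.
     f p * g q * basis_vec (tensor_ptn k l p q) r)"

text \<open>Composition of \<open>g\<close> in \<open>(l, m)\<close> with \<open>f\<close> in \<open>(k, l)\<close>; every loop contributes a factor N.\<close>

definition compose_lin :: "nat \<Rightarrow> nat \<Rightarrow> nat \<Rightarrow> nat \<Rightarrow> lin_ptn \<Rightarrow> lin_ptn \<Rightarrow> lin_ptn" where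
  "compose_lin N k l m g f = (\<lambda>r. \<Sum>q\<in>partitions l m. \<Sum>p\<in>partitions k l.
     g q * f p * of_nat N ^ num_loops q p * basis_vec (compose_ptn q p) r)"

definition involution_lin :: "nat \<Rightarrow> nat \<Rightarrow> lin_ptn \<Rightarrow> lin_ptn" where
  "involution_lin k l f = (\<lambda>r. \<Sum>p\<in>partitions k l. cnj (f p) * basis_vec (involution_ptn p) r)"

type_synonym ptn_family = "nat \<Rightarrow> nat \<Rightarrow> lin_ptn set"

definition linear_category :: "nat \<Rightarrow> ptn_family \<Rightarrow> bool" where
  "linear_category N K \<longleftrightarrow>
     (\<forall>k l. K k l \<subseteq> lin_partitions k l \<and> (\<lambda>_. 0) \<in> K k l \<and>
        (\<forall>f\<in>K k l. \<forall>g\<in>K k l. (\<lambda>p. f p + g p) \<in> K k l) \<and>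
        (\<forall>c. \<forall>f\<in>K k l. (\<lambda>p. c * f p) \<in> K k l)) \<and>
     basis_vec identity_ptn \<in> K 1 1 \<and>
     basis_vec pair_ptn \<in> K 0 2 \<and>
     (\<forall>k l k' l'. \<forall>f\<in>K k l. \<forall>g\<in>K k' l'. tensor_lin k l k' l' f g \<in> K (k + k') (l + l')) \<and>
     (\<forall>k l m. \<forall>f\<in>K k l. \<forall>g\<in>K l m. compose_lin N k l m g f \<in> K k m) \<and>
     (\<forall>k l. \<forall>f\<in>K k l. involution_lin k l f \<in> K l k)"

definition generated_category :: "nat \<Rightarrow> ptn_family \<Rightarrow> ptn_family" where
  "generated_category N S =
     (\<lambda>k l. \<Inter>{K k l | K. linear_category N K \<and> (\<forall>k' l'. S k' l' \<subseteq> K k' l')})"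

definition two_singletons :: lin_ptn where
  "two_singletons = basis_vec (tensor_ptn 0 1 singleton_ptn singleton_ptn)"

section \<open>The linear maps associated with partitions\<close>

text \<open>A linear map from the k-th to the l-th tensor power of \<open>\<complex>\<^sup>n\<close> is represented by its matrix
  with respect to the standard bases: \<open>T j i\<close> is the coefficient of \<open>e\<^sub>j\<close> in the image of \<open>e\<^sub>i\<close>,
  and it is 0 outside the index range. Multi-indices are lists with entries below n.\<close>

type_synonym tensor_map = "nat list \<Rightarrow> nat list \<Rightarrow> complex"

definition multi_indices :: "nat \<Rightarrow> nat \<Rightarrow> nat list set" where
  "multi_indices n k = {xs. length xs = k \<and> set xs \<subseteq> {..<n}}"

definition label :: "nat list \<Rightarrow> nat list \<Rightarrow> point \<Rightarrow> nat" where
  "label i j = (\<lambda>(r, a). if r = 0 then i ! a else j ! a)"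

definition ptn_delta :: "ptn \<Rightarrow> nat list \<Rightarrow> nat list \<Rightarrow> complex" where
  "ptn_delta p i j = (if \<forall>B\<in>p. \<forall>x\<in>B. \<forall>y\<in>B. label i j x = label i j y then 1 else 0)"

definition ptn_map :: "nat \<Rightarrow> nat \<Rightarrow> nat \<Rightarrow> lin_ptn \<Rightarrow> tensor_map" where
  "ptn_map n k l f = (\<lambda>j i. if j \<in> multi_indices n l \<and> i \<in> multi_indices n k
     then \<Sum>p\<in>partitions k l. f p * ptn_delta p i j else 0)"

section \<open>Unital C*-algebras\<close>

definition complex_ring :: "complex ring" where
  "complex_ring = \<lparr>carrier = UNIV, mult = (*), one = 1, zero = 0, add = (+)\<rparr>"

record 'a star_algebra = "(complex, 'a) module" +
  adj :: "'a \<Rightarrow> 'a"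

record 'a cstar_algebra = "'a star_algebra" +
  cnorm :: "'a \<Rightarrow> real"

definition is_star_algebra :: "('a, 'm) star_algebra_scheme \<Rightarrow> bool" where
  "is_star_algebra A \<longleftrightarrow> ring A \<and> module complex_ring A \<and>
     (\<forall>c. \<forall>x\<in>carrier A. \<forall>y\<in>carrier A.
        (c \<odot>\<^bsub>A\<^esub> x) \<otimes>\<^bsub>A\<^esub> y = c \<odot>\<^bsub>A\<^esub> (x \<otimes>\<^bsub>A\<^esub> y) \<and> x \<otimes>\<^bsub>A\<^esub> (c \<odot>\<^bsub>A\<^esub> y) = c \<odot>\<^bsub>A\<^esub> (x \<otimes>\<^bsub>A\<^esub> y)) \<and>
     (\<forall>x\<in>carrier A. adj A x \<in> carrier A \<and> adj A (adj A x) = x) \<and>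
     (\<forall>x\<in>carrier A. \<forall>y\<in>carrier A. adj A (x \<oplus>\<^bsub>A\<^esub> y) = adj A x \<oplus>\<^bsub>A\<^esub> adj A y) \<and>
     (\<forall>x\<in>carrier A. \<forall>y\<in>carrier A. adj A (x \<otimes>\<^bsub>A\<^esub> y) = adj A y \<otimes>\<^bsub>A\<^esub> adj A x) \<and>
     (\<forall>c. \<forall>x\<in>carrier A. adj A (c \<odot>\<^bsub>A\<^esub> x) = cnj c \<odot>\<^bsub>A\<^esub> adj A x)"

definition cstar_seminorm :: "('a, 'm) star_algebra_scheme \<Rightarrow> ('a \<Rightarrow> real) \<Rightarrow> bool" where
  "cstar_seminorm A \<nu> \<longleftrightarrow>
     (\<forall>x\<in>carrier A. \<forall>y\<in>carrier A. \<nu> (x \<oplus>\<^bsub>A\<^esub> y) \<le> \<nu> x + \<nu> y) \<and>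
     (\<forall>c. \<forall>x\<in>carrier A. \<nu> (c \<odot>\<^bsub>A\<^esub> x) = cmod c * \<nu> x) \<and>
     (\<forall>x\<in>carrier A. \<forall>y\<in>carrier A. \<nu> (x \<otimes>\<^bsub>A\<^esub> y) \<le> \<nu> x * \<nu> y) \<and>
     (\<forall>x\<in>carrier A. \<nu> (adj A x \<otimes>\<^bsub>A\<^esub> x) = (\<nu> x)\<^sup>2)"

definition cauchy_seqs :: "('a, 'm) star_algebra_scheme \<Rightarrow> ('a \<Rightarrow> real) \<Rightarrow> (nat \<Rightarrow> 'a) set" where
  "cauchy_seqs A \<nu> = {X. (\<forall>n. X n \<in> carrier A) \<and>
     (\<forall>e>0. \<exists>M. \<forall>m\<ge>M. \<forall>n\<ge>M. \<nu> (X m \<ominus>\<^bsub>A\<^esub> X n) < e)}"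

definition is_cstar_algebra :: "('a, 'm) cstar_algebra_scheme \<Rightarrow> bool" where
  "is_cstar_algebra A \<longleftrightarrow> is_star_algebra A \<and> cstar_seminorm A (cnorm A) \<and>
     (\<forall>x\<in>carrier A. cnorm A x = 0 \<longrightarrow> x = \<zero>\<^bsub>A\<^esub>) \<and>
     (\<forall>X\<in>cauchy_seqs A (cnorm A). \<exists>x\<in>carrier A. (\<lambda>n. cnorm A (X n \<ominus>\<^bsub>A\<^esub> x)) \<longlonglongrightarrow> 0)"

definition star_hom ::
    "('a, 'm) star_algebra_scheme \<Rightarrow> ('b, 'n) star_algebra_scheme \<Rightarrow> ('a \<Rightarrow> 'b) \<Rightarrow> bool" where
  "star_hom A B \<phi> \<longleftrightarrow> \<phi> \<in> ring_hom A B \<and>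
     (\<forall>c. \<forall>x\<in>carrier A. \<phi> (c \<odot>\<^bsub>A\<^esub> x) = c \<odot>\<^bsub>B\<^esub> \<phi> x) \<and>
     (\<forall>x\<in>carrier A. \<phi> (adj A x) = adj B (\<phi> x))"

definition star_subalgebra :: "('a, 'm) star_algebra_scheme \<Rightarrow> 'a set \<Rightarrow> bool" where
  "star_subalgebra A S \<longleftrightarrow> S \<subseteq> carrier A \<and> \<one>\<^bsub>A\<^esub> \<in> S \<and>
     (\<forall>x\<in>S. \<forall>y\<in>S. x \<oplus>\<^bsub>A\<^esub> y \<in> S \<and> x \<otimes>\<^bsub>A\<^esub> y \<in> S) \<and>
     (\<forall>c. \<forall>x\<in>S. c \<odot>\<^bsub>A\<^esub> x \<in> S) \<and> (\<forall>x\<in>S. adj A x \<in> S)"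

definition norm_closed :: "('a, 'm) cstar_algebra_scheme \<Rightarrow> 'a set \<Rightarrow> bool" where
  "norm_closed A S \<longleftrightarrow> (\<forall>X x. (\<forall>n. X n \<in> S) \<and> x \<in> carrier A \<and>
     (\<lambda>n. cnorm A (X n \<ominus>\<^bsub>A\<^esub> x)) \<longlonglongrightarrow> 0 \<longrightarrow> x \<in> S)"

definition star_generated :: "('a, 'm) star_algebra_scheme \<Rightarrow> 'a set \<Rightarrow> 'a set" where
  "star_generated A S = \<Inter>{T. star_subalgebra A T \<and> S \<subseteq> T}"

definition cstar_generated :: "('a, 'm) cstar_algebra_scheme \<Rightarrow> 'a set \<Rightarrow> 'a set" where
  "cstar_generated A S = \<Inter>{T. star_subalgebra A T \<and> norm_closed A T \<and> S \<subseteq> T}"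

text \<open>Separation and completion of a *-algebra with respect to a C*-seminorm: Cauchy sequences
  modulo null sequences.\<close>

definition cauchy_class ::
    "('a, 'm) star_algebra_scheme \<Rightarrow> ('a \<Rightarrow> real) \<Rightarrow> (nat \<Rightarrow> 'a) \<Rightarrow> (nat \<Rightarrow> 'a) set" where
  "cauchy_class A \<nu> X = {Y \<in> cauchy_seqs A \<nu>. (\<lambda>n. \<nu> (X n \<ominus>\<^bsub>A\<^esub> Y n)) \<longlonglongrightarrow> 0}"

definition rep :: "(nat \<Rightarrow> 'a) set \<Rightarrow> nat \<Rightarrow> 'a" where
  "rep P = (SOME X. X \<in> P)"

definition completion ::
    "('a, 'm) star_algebra_scheme \<Rightarrow> ('a \<Rightarrow> real) \<Rightarrow> (nat \<Rightarrow> 'a) set cstar_algebra" where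
  "completion A \<nu> = \<lparr>
     carrier = cauchy_class A \<nu> ` cauchy_seqs A \<nu>,
     mult = (\<lambda>P Q. cauchy_class A \<nu> (\<lambda>n. rep P n \<otimes>\<^bsub>A\<^esub> rep Q n)),
     one = cauchy_class A \<nu> (\<lambda>_. \<one>\<^bsub>A\<^esub>),
     zero = cauchy_class A \<nu> (\<lambda>_. \<zero>\<^bsub>A\<^esub>),
     add = (\<lambda>P Q. cauchy_class A \<nu> (\<lambda>n. rep P n \<oplus>\<^bsub>A\<^esub> rep Q n)),
     smult = (\<lambda>c P. cauchy_class A \<nu> (\<lambda>n. c \<odot>\<^bsub>A\<^esub> rep P n)),
     adj = (\<lambda>P. cauchy_class A \<nu> (\<lambda>n. adj A (rep P n))),
     cnorm = (\<lambda>P. lim (\<lambda>n. \<nu> (rep P n)))\<rparr>"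

text \<open>The monoid algebra \<open>\<complex>[M]\<close> of a monoid \<open>M\<close> with an involutive anti-automorphism \<open>\<sigma>\<close>:
  finitely supported functions with the convolution product.\<close>

definition monoid_algebra ::
    "('a, 'm) monoid_scheme \<Rightarrow> ('a \<Rightarrow> 'a) \<Rightarrow> ('a \<Rightarrow> complex) star_algebra" where
  "monoid_algebra M \<sigma> = \<lparr>
     carrier = {f. finite {x. f x \<noteq> 0} \<and> {x. f x \<noteq> 0} \<subseteq> carrier M},
     mult = (\<lambda>f g z. \<Sum>x | f x \<noteq> 0. \<Sum>y | g y \<noteq> 0. if x \<otimes>\<^bsub>M\<^esub> y = z then f x * g y else 0),
     one = basis_vec \<one>\<^bsub>M\<^esub>,
     zero = (\<lambda>_. 0),
     add = (\<lambda>f g x. f x + g x),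
     smult = (\<lambda>c f x. c * f x),
     adj = (\<lambda>f x. if x \<in> carrier M then cnj (f (\<sigma> x)) else 0)\<rparr>"

subsection \<open>The minimal tensor product\<close>

definition is_state :: "('a, 'm) star_algebra_scheme \<Rightarrow> ('a \<Rightarrow> complex) \<Rightarrow> bool" where
  "is_state A \<phi> \<longleftrightarrow>
     (\<forall>x\<in>carrier A. \<forall>y\<in>carrier A. \<phi> (x \<oplus>\<^bsub>A\<^esub> y) = \<phi> x + \<phi> y) \<and>
     (\<forall>c. \<forall>x\<in>carrier A. \<phi> (c \<odot>\<^bsub>A\<^esub> x) = c * \<phi> x) \<and>
     (\<forall>x\<in>carrier A. \<phi> (adj A x \<otimes>\<^bsub>A\<^esub> x) \<in> \<real>\<^sub>\<ge>\<^sub>0) \<and> \<phi> \<one>\<^bsub>A\<^esub> = 1"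

text \<open>Formal linear combinations of elementary tensors, not yet divided by the bilinearity
  relations; the minimal seminorm below vanishes on these relations, so that the separation
  performed by \<open>completion\<close> divides them out.\<close>

definition formal_tensors ::
    "('a, 'm) star_algebra_scheme \<Rightarrow> ('b, 'n) star_algebra_scheme \<Rightarrow> ('a \<times> 'b \<Rightarrow> complex) star_algebra" where
  "formal_tensors A B = monoid_algebra (A \<times>\<times> B) (map_prod (adj A) (adj B))"

definition product_functional ::
    "('a \<Rightarrow> complex) \<Rightarrow> ('b \<Rightarrow> complex) \<Rightarrow> ('a \<times> 'b \<Rightarrow> complex) \<Rightarrow> complex" where
  "product_functional \<phi> \<psi> t = (\<Sum>(a, b) | t (a, b) \<noteq> 0. t (a, b) * \<phi> a * \<psi> b)"

text \<open>The spatial norm with respect to the universal representations, i.e. the supremum of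
  \<open>\<parallel>(\<pi>\<^sub>\<phi> \<otimes> \<pi>\<^sub>\<psi>)(t)\<parallel>\<close> over the GNS representations of all states \<open>\<phi>\<close>, \<open>\<psi>\<close>. The vectors
  \<open>(\<pi>\<^sub>\<phi> \<otimes> \<pi>\<^sub>\<psi>)(s)\<close> applied to the cyclic vector are dense, and their squared norm is the value of
  the product functional at \<open>s\<^sup>* s\<close>.\<close>

definition min_seminorm ::
    "('a, 'm) star_algebra_scheme \<Rightarrow> ('b, 'n) star_algebra_scheme \<Rightarrow> ('a \<times> 'b \<Rightarrow> complex) \<Rightarrow> real" where
  "min_seminorm A B t =
     (let X = formal_tensors A B in
      Sup (insert 0 {sqrt (Re (product_functional \<phi> \<psi> (adj X (t \<otimes>\<^bsub>X\<^esub> s) \<otimes>\<^bsub>X\<^esub> (t \<otimes>\<^bsub>X\<^esub> s)))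
                         / Re (product_functional \<phi> \<psi> (adj X s \<otimes>\<^bsub>X\<^esub> s))) | \<phi> \<psi> s.
             is_state A \<phi> \<and> is_state B \<psi> \<and> s \<in> carrier X \<and>
             product_functional \<phi> \<psi> (adj X s \<otimes>\<^bsub>X\<^esub> s) \<noteq> 0}))"

definition min_tensor :: "('a, 'm) star_algebra_scheme \<Rightarrow> ('b, 'n) star_algebra_scheme \<Rightarrow>
    (nat \<Rightarrow> 'a \<times> 'b \<Rightarrow> complex) set cstar_algebra" where
  "min_tensor A B = completion (formal_tensors A B) (min_seminorm A B)"

definition pure_tensor :: "('a, 'm) star_algebra_scheme \<Rightarrow> ('b, 'n) star_algebra_scheme \<Rightarrow>
    'a \<Rightarrow> 'b \<Rightarrow> (nat \<Rightarrow> 'a \<times> 'b \<Rightarrow> complex) set" where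
  "pure_tensor A B a b = cauchy_class (formal_tensors A B) (min_seminorm A B) (\<lambda>_. basis_vec (a, b))"

subsection \<open>Universal C*-algebras\<close>

definition universal_seminorm :: "('a, 'm) star_algebra_scheme \<Rightarrow> 'a set \<Rightarrow> 'a \<Rightarrow> real" where
  "universal_seminorm A R x = Sup {\<nu> x | \<nu>. cstar_seminorm A \<nu> \<and> (\<forall>r\<in>R. \<nu> r = 0)}"

text \<open>The free unital *-algebra on a set of generators; the letter \<open>(g, True)\<close> stands for the
  adjoint of the generator \<open>g\<close>.\<close>

definition free_star_algebra :: "'g set \<Rightarrow> (('g \<times> bool) list \<Rightarrow> complex) star_algebra" where
  "free_star_algebra S = monoid_algebra
     \<lparr>carrier = lists (S \<times> UNIV), mult = (@), one = []\<rparr> (\<lambda>w. rev (map (\<lambda>(g, b). (g, \<not> b)) w))"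

definition free_gen :: "'g \<Rightarrow> ('g \<times> bool) list \<Rightarrow> complex" where
  "free_gen g = basis_vec [(g, False)]"

section \<open>Compact matrix quantum groups\<close>

record 'a qgroup =
  qdim :: nat
  qalg :: "'a cstar_algebra"
  qfund :: "nat \<Rightarrow> nat \<Rightarrow> 'a"

definition entries :: "'a qgroup \<Rightarrow> 'a set" where
  "entries G = {qfund G i j | i j. i < qdim G \<and> j < qdim G}"

definition matrix_invertible :: "('a, 'm) ring_scheme \<Rightarrow> nat \<Rightarrow> (nat \<Rightarrow> nat \<Rightarrow> 'a) \<Rightarrow> bool" where
  "matrix_invertible A n u \<longleftrightarrow> (\<exists>w. \<forall>i<n. \<forall>j<n. w i j \<in> carrier A \<and>
     (\<Oplus>\<^bsub>A\<^esub>k\<in>{..<n}. u i k \<otimes>\<^bsub>A\<^esub> w k j) = (if i = j then \<one>\<^bsub>A\<^esub> else \<zero>\<^bsub>A\<^esub>) \<and>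
     (\<Oplus>\<^bsub>A\<^esub>k\<in>{..<n}. w i k \<otimes>\<^bsub>A\<^esub> u k j) = (if i = j then \<one>\<^bsub>A\<^esub> else \<zero>\<^bsub>A\<^esub>))"

definition is_cmqg :: "'a qgroup \<Rightarrow> bool" where
  "is_cmqg G \<longleftrightarrow>
     (let A = qalg G; n = qdim G; u = qfund G in
      is_cstar_algebra A \<and> entries G \<subseteq> carrier A \<and> cstar_generated A (entries G) = carrier A \<and>
      matrix_invertible A n u \<and> matrix_invertible A n (\<lambda>i j. u j i) \<and>
      (\<exists>\<Delta>. star_hom A (min_tensor A A) \<Delta> \<and>
         (\<forall>i<n. \<forall>j<n. \<Delta> (u i j) =
            (\<Oplus>\<^bsub>min_tensor A A\<^esub>k\<in>{..<n}. pure_tensor A A (u i k) (u k j)))))"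

text \<open>\<open>C(G)\<close> is the full completion of the *-algebra generated by the entries: the norm is the
  largest C*-seminorm on that *-algebra.\<close>

definition is_full :: "'a qgroup \<Rightarrow> bool" where
  "is_full G \<longleftrightarrow>
     (let P = (qalg G)\<lparr>carrier := star_generated (qalg G) (entries G)\<rparr> in
      \<forall>\<nu>. cstar_seminorm P \<nu> \<longrightarrow> (\<forall>x\<in>carrier P. \<nu> x \<le> cnorm P x))"

definition qsubgroup :: "'a qgroup \<Rightarrow> 'b qgroup \<Rightarrow> bool" where
  "qsubgroup H G \<longleftrightarrow> qdim H = qdim G \<and>
     (\<exists>\<phi>. star_hom (qalg G) (qalg H) \<phi> \<and> \<phi> ` carrier (qalg G) = carrier (qalg H) \<and>
        (\<forall>i<qdim G. \<forall>j<qdim G. \<phi> (qfund G i j) = qfund H i j))"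

definition permutation_matrices :: "nat \<Rightarrow> (nat \<Rightarrow> nat \<Rightarrow> complex) set" where
  "permutation_matrices n = {P. \<exists>\<pi>. \<pi> permutes {..<n} \<and>
     P = (\<lambda>i j. if i < n \<and> j < n \<and> i = \<pi> j then 1 else 0)}"

text \<open>Functions on the finite set of permutation matrices are represented by their extensions by 0.\<close>

definition sym_qgroup :: "nat \<Rightarrow> ((nat \<Rightarrow> nat \<Rightarrow> complex) \<Rightarrow> complex) qgroup" where
  "sym_qgroup n = \<lparr>
     qdim = n,
     qalg = \<lparr>
       carrier = {f. \<forall>P. P \<notin> permutation_matrices n \<longrightarrow> f P = 0},
       mult = (\<lambda>f g P. f P * g P),
       one = (\<lambda>P. if P \<in> permutation_matrices n then 1 else 0),
       zero = (\<lambda>_. 0),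
       add = (\<lambda>f g P. f P + g P),
       smult = (\<lambda>c f P. c * f P),
       adj = (\<lambda>f P. cnj (f P)),
       cnorm = (\<lambda>f. Sup ((\<lambda>P. cmod (f P)) ` permutation_matrices n))\<rparr>,
     qfund = (\<lambda>i j P. if P \<in> permutation_matrices n then P i j else 0)\<rparr>"

definition orthogonal_relations :: "nat \<Rightarrow> (((nat \<times> nat) \<times> bool) list \<Rightarrow> complex) set" where
  "orthogonal_relations n =
     (let F = free_star_algebra ({..<n} \<times> {..<n}); x = (\<lambda>i j. free_gen (i, j));
          \<delta> = (\<lambda>i j. if i = j then \<one>\<^bsub>F\<^esub> else \<zero>\<^bsub>F\<^esub>) in
      {x i j \<ominus>\<^bsub>F\<^esub> adj F (x i j) | i j. i < n \<and> j < n} \<union>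
      {(\<Oplus>\<^bsub>F\<^esub>k\<in>{..<n}. x i k \<otimes>\<^bsub>F\<^esub> x j k) \<ominus>\<^bsub>F\<^esub> \<delta> i j | i j. i < n \<and> j < n} \<union>
      {(\<Oplus>\<^bsub>F\<^esub>k\<in>{..<n}. x k i \<otimes>\<^bsub>F\<^esub> x k j) \<ominus>\<^bsub>F\<^esub> \<delta> i j | i j. i < n \<and> j < n})"

definition free_orthogonal_qgroup ::
    "nat \<Rightarrow> (nat \<Rightarrow> ((nat \<times> nat) \<times> bool) list \<Rightarrow> complex) set qgroup" where
  "free_orthogonal_qgroup n =
     (let F = free_star_algebra ({..<n} \<times> {..<n}); \<nu> = universal_seminorm F (orthogonal_relations n) in
      \<lparr>qdim = n, qalg = completion F \<nu>, qfund = (\<lambda>i j. cauchy_class F \<nu> (\<lambda>_. free_gen (i, j)))\<rparr>)"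

definition fund_power :: "'a qgroup \<Rightarrow> nat list \<Rightarrow> nat list \<Rightarrow> 'a" where
  "fund_power G is js = foldr (\<lambda>(i, j) x. qfund G i j \<otimes>\<^bsub>qalg G\<^esub> x) (zip is js) \<one>\<^bsub>qalg G\<^esub>"

definition Mor :: "'a qgroup \<Rightarrow> nat \<Rightarrow> nat \<Rightarrow> tensor_map set" where
  "Mor G k l =
     (let A = qalg G; I = multi_indices (qdim G) k; J = multi_indices (qdim G) l in
      {T. (\<forall>j i. j \<notin> J \<or> i \<notin> I \<longrightarrow> T j i = 0) \<and>
          (\<forall>j\<in>J. \<forall>i\<in>I. (\<Oplus>\<^bsub>A\<^esub>i'\<in>I. T j i' \<odot>\<^bsub>A\<^esub> fund_power G i' i) =
                        (\<Oplus>\<^bsub>A\<^esub>j'\<in>J. T j' i \<odot>\<^bsub>A\<^esub> fund_power G j j'))})"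

definition corresponds :: "'a qgroup \<Rightarrow> ptn_family \<Rightarrow> bool" where
  "corresponds G K \<longleftrightarrow> linear_category (qdim G) K \<and>
     (\<forall>k l. Mor G k l = ptn_map (qdim G) k l ` K k l)"

text \<open>Quantum groups are only determined up to isomorphism by their category, hence a predicate.\<close>

definition is_B_sharp_plus :: "nat \<Rightarrow> 'a qgroup \<Rightarrow> bool" where
  "is_B_sharp_plus N B \<longleftrightarrow> is_cmqg B \<and> is_full B \<and>
     qsubgroup (sym_qgroup N) B \<and> qsubgroup B (free_orthogonal_qgroup N) \<and>
     corresponds B (generated_category N (\<lambda>k l. if k = 0 \<and> l = 2 then {two_singletons} else {}))"

section \<open>The irreducible part\<close>

text \<open>Indices start at 0, so the distinguished last index is \<open>N - 1\<close>. The sign is \<open>s = 1\<close> or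
  \<open>s = -1\<close>.\<close>

definition U_matrix :: "nat \<Rightarrow> real \<Rightarrow> nat \<Rightarrow> nat \<Rightarrow> complex" where
  "U_matrix N s i j = of_real
     (if i < N - 1 \<and> j < N - 1
      then (if i = j then 1 else 0) - 1 / (real N - 1) * (1 + s / sqrt (real N))
      else s / sqrt (real N))"

definition irr_fund :: "real \<Rightarrow> 'a qgroup \<Rightarrow> nat \<Rightarrow> nat \<Rightarrow> 'a" where
  "irr_fund s G i j =
     (let A = qalg G; N = qdim G in
      \<Oplus>\<^bsub>A\<^esub>a\<in>{..<N}. \<Oplus>\<^bsub>A\<^esub>b\<in>{..<N}. (U_matrix N s i a * cnj (U_matrix N s j b)) \<odot>\<^bsub>A\<^esub> qfund G a b)"

definition irr_qgroup :: "real \<Rightarrow> 'a qgroup \<Rightarrow> 'a qgroup" where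
  "irr_qgroup s G =
     (let n = qdim G - 1; v = irr_fund s G in
      \<lparr>qdim = n,
       qalg = (qalg G)\<lparr>carrier := cstar_generated (qalg G) {v i j | i j. i < n \<and> j < n}\<rparr>,
       qfund = v\<rparr>)"

section \<open>The map on partitions\<close>

text \<open>Everything below is formulated for a single block given as an arbitrary set \<open>B\<close> of points. This
  builds in the compatibility with rotations, which only relabel the points.\<close>

definition singletons :: "point set \<Rightarrow> ptn" where
  "singletons I = (\<lambda>x. {x}) ` I"

definition block_level :: "nat \<Rightarrow> point set \<Rightarrow> nat \<Rightarrow> lin_ptn" where
  "block_level N B i = (\<lambda>Q.
     if i < card B
     then \<Sum>I | I \<subseteq> B \<and> card I = i. basis_vec (insert (B - I) (singletons I)) Q
     else (of_nat N - 1) * basis_vec (singletons B) Q)"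

definition V_block :: "nat \<Rightarrow> real \<Rightarrow> point set \<Rightarrow> lin_ptn" where
  "V_block N s B = (\<lambda>Q.
     (\<Sum>i=0..card B. of_real (- 1 / (real N - 1) * (1 + s / sqrt (real N))) ^ i * block_level N B i Q)
     + of_real (s / sqrt (real N)) ^ card B * basis_vec (singletons B) Q)"

definition V_ptn :: "nat \<Rightarrow> real \<Rightarrow> ptn \<Rightarrow> lin_ptn" where
  "V_ptn N s p = (\<lambda>r. \<Sum>f\<in>(\<Pi>\<^sub>E B\<in>p. {Q. partition_on B Q}).
     (\<Prod>B\<in>p. V_block N s B (f B)) * basis_vec (\<Union>B\<in>p. f B) r)"

definition V_lin :: "nat \<Rightarrow> real \<Rightarrow> nat \<Rightarrow> nat \<Rightarrow> lin_ptn \<Rightarrow> lin_ptn" where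
  "V_lin N s k l f = (\<lambda>r. \<Sum>p\<in>partitions k l. f p * V_ptn N s p r)"

definition V_family :: "nat \<Rightarrow> real \<Rightarrow> ptn_family \<Rightarrow> ptn_family" where
  "V_family N s K = (\<lambda>k l. V_lin N s k l ` K k l)"

end

theory Submission
  imports Defs "HOL-Computational_Algebra.Polynomial"
begin

text \<open>
Write \<open>V\<close> for the \<open>(N - 1) \<times> N\<close> matrix of the first rows of \<open>U\<close>. It satisfies \<open>V V\<^sup>* = 1\<close>, and \<open>V\<^sup>* V\<close> is the
projection \<open>P\<close> onto the orthogonal complement of the vector with constant entries. Since the two singletons give an
intertwiner of \<open>u\<close>, the projection \<open>P\<close> commutes with \<open>u\<close>; hence \<open>v = V u V\<^sup>*\<close> is again an orthogonal matrix with
self-adjoint entries, and \<open>T \<mapsto> V\<^bsup>\<otimes>l\<^esup> T V\<^sup>*\<^bsup>\<otimes>k\<^esup>\<close> maps the intertwiners of \<open>u\<close> onto those of \<open>v\<close>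
(\<open>Mor_irr\<close>). On partitions this conjugation is the map \<open>\<V>\<close> (\<open>ptn_map_Vl_conj\<close>): both sides factorise over
the blocks, and on one block the formula for \<open>\<V>\<close> is the expansion of a product of sums.

What remains splits into an analytic and a combinatorial part.

The comultiplication of \<open>G\<close> has values in the completion of \<open>C(G) \<otimes> C(G)\<close> and must be corestricted to
the completion of \<open>A \<otimes> A\<close>, where \<open>A\<close> is generated by the entries of \<open>v\<close>. States extend from C*-subalgebras, so the
minimal norm does not grow when the algebra shrinks; fullness of \<open>G\<close> shows that the comultiplication is contractive on
the *-algebra of the entries, and the corestriction extends by continuity (\<open>irr_cmqg\<close>). The inclusion into the free
orthogonal quantum group needs that the universal norm is finite, that homomorphisms out of a completion exist, and
that their images are closed. All of this rests on positivity of \<open>x\<^sup>* x\<close>, which is obtained for seminorms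
without spectral theory: square roots are limits of real polynomials. The inclusion of the smaller permutation group is
restriction of functions along \<open>\<pi> \<mapsto> \<pi> \<oplus> 1\<close>.

That \<open>\<V>\<close> maps a category to a category is an identity between formal partitions, whereas the linear maps
\<open>T\<^sub>p\<close> are linearly dependent for small \<open>N\<close>. The identities, for instance \<open>\<V> q \<cdot> \<V> p = \<V> (q \<cdot> \<pi>\<^bsup>\<otimes>l\<^esup> \<cdot> p)\<close> with
the partition form \<open>\<pi>\<close> of \<open>P\<close>, have coefficients that are rational functions of \<open>x = \<plusminus>\<surd>N\<close> with
poles at 0 and 1 only. For large natural numbers \<open>x\<close> they follow from the functoriality and injectivity of
\<open>p \<mapsto> T\<^sub>p\<close>, and a rational function with infinitely many zeros vanishes (\<open>interpolation\<close>).
\<close>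

abbreviation (input) car :: "('a, 'm) partial_object_scheme => 'a set" where "car == carrier"
abbreviation (input) mi :: "nat => nat => nat list set" where "mi == multi_indices"
abbreviation (input) bv :: "'a => 'a => complex" where "bv == basis_vec"

section \<open>Real commutative C*-seminorms on polynomials\<close>

text \<open>A seminorm on real polynomials with \<open>N (p\<^sup>2) \<le> N (p\<^sup>2 + q\<^sup>2)\<close> is what evaluation at a self-adjoint element
of a C*-algebra induces. All positivity arguments are done for these seminorms.\<close>

locale real_cstar_poly =
 fixes N :: "real poly => real"
 assumes N_add: "N (p + q) <= N p + N q"
  and N_smult: "N (smult c p) = \<bar>c\<bar> * N p"
  and N_mult: "N (p * q) <= N p * N q"
  and N_sum_sq: "N p * N p <= N (p * p + q * q)"
begin

lemma N_zero [simp]: "N 0 = 0"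
 using N_smult[of 0 0] by simp

lemma N_minus [simp]: "N (- p) = N p"
 using N_smult[of "-1" p] by simp

lemma N_nonneg [simp]: "0 <= N p"
 using N_add[of p "- p"] by simp

lemma N_diff: "N (p - q) <= N p + N q"
 using N_add[of p "- q"] by simp

lemma N_square: "N (p * p) = N p * N p"
 using N_mult[of p p] N_sum_sq[of p 0] by simp

lemma N_one: "N 1 <= 1"
proof (rule ccontr)
 assume *: "~ N 1 <= 1"
 have "N 1 * N 1 = N 1" by (metis N_square mult_1_right)
 with * show False using mult_strict_right_mono[of 1 "N 1" "N 1"] by linarith
qed

lemma N_const: "N [:c:] <= \<bar>c\<bar>"
 using N_smult[of c 1] N_one mult_left_le[of "N 1" "\<bar>c\<bar>"] by (simp add: one_pCons)

lemma N_power: "N (p ^ Suc n) <= N p ^ Suc n"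
proof (induction n)
 case (Suc n)
 have "N (p ^ Suc (Suc n)) <= N p * N (p ^ Suc n)"
  using N_mult[of p "p ^ Suc n"] by simp
 also have "... <= N p * N p ^ Suc n" by (rule mult_left_mono[OF Suc]) simp
 finally show ?case by simp
qed simp

lemma N_power_two: "N (p ^ (2 ^ n)) = N p ^ (2 ^ n)"
proof (induction n)
 case (Suc n)
 have "p ^ (2 ^ Suc n) = p ^ (2 ^ n) * p ^ (2 ^ n)" by (simp add: mult_2 power_add)
 then have "N (p ^ (2 ^ Suc n)) = N (p ^ (2 ^ n)) * N (p ^ (2 ^ n))" by (simp only: N_square)
 also have "... = N p ^ (2 ^ Suc n)" by (simp add: Suc mult_2 power_add)
 finally show ?case .
qed simp

text \<open>The binomial series of \<open>1 - sqrt (1 - h)\<close> is replaced by the fixed point iteration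
 \<open>y \<mapsto> (h + y\<^sup>2) / 2\<close>, which is a contraction on the ball of radius \<open>\<rho> < 1\<close>.\<close>

lemma sqrt_sequence:
 assumes "N h <= \<rho>" "\<rho> < 1"
 shows "EX s. ALL n. N (s (Suc n) - s n) <= \<rho> ^ Suc n & N ((1 - h) - s n * s n) <= 2 * \<rho> ^ Suc n"
proof -
 define y where "y = rec_nat (0 :: real poly) (%_ z. smult (1/2) (h + z * z))"
 have y0: "y 0 = 0" and yS: "y (Suc n) = smult (1/2) (h + y n * y n)" for n
  by (simp_all add: y_def)
 have r0: "0 <= \<rho>" using assms(1) N_nonneg[of h] by linarith
 have bound: "N (y n) <= \<rho>" for n
 proof (induction n)
  case 0 show ?case using r0 by (simp add: y0)
 next
  case (Suc n)
  have "N (y n * y n) <= \<rho> * \<rho>" unfolding N_square by (intro mult_mono Suc r0 N_nonneg)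
  also have "... <= \<rho>" using r0 assms(2) by (simp add: mult_left_le)
  finally show ?case using N_add[of h "y n * y n"] assms(1) by (simp add: yS N_smult)
 qed
 have step: "N (y (Suc n) - y n) <= \<rho> ^ Suc n" for n
 proof (induction n)
  case 0
  show ?case using assms(1) r0 by (simp add: y0 yS N_smult)
 next
  case (Suc n)
  have "y (Suc (Suc n)) - y (Suc n) =
  smult (1/2) ((y (Suc n) + y n) * (y (Suc n) - y n))"
  unfolding yS[of "Suc n"] yS[of n]
  by (simp add: smult_diff_right[symmetric] algebra_simps)
  then have "N (y (Suc (Suc n)) - y (Suc n)) = 1/2 * N ((y (Suc n) + y n) * (y (Suc n) - y n))"
  by (simp add: N_smult)
  also have "... <= 1/2 * (N (y (Suc n) + y n) * N (y (Suc n) - y n))"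
  by (rule mult_left_mono[OF N_mult]) simp
  also have "... <= 1/2 * ((2 * \<rho>) * \<rho> ^ Suc n)"
  proof (intro mult_left_mono mult_mono Suc)
  show "N (y (Suc n) + y n) <= 2 * \<rho>"
  using N_add[of "y (Suc n)" "y n"] bound[of n] bound[of "Suc n"] by linarith
  qed (use r0 in auto)
  also have "... = \<rho> ^ Suc (Suc n)" by simp
  finally show ?case .
 qed
 have eq: "(1 - h) - (1 - y n) * (1 - y n) = smult (-2) (y (Suc n) - y n)" for n
  unfolding yS by (simp add: algebra_simps smult_diff_right smult_add_right numeral_poly)
 have "N ((1 - h) - (1 - y n) * (1 - y n)) <= 2 * \<rho> ^ Suc n" for n
  unfolding eq N_smult using step[of n] by simp
 moreover have "N ((1 - y (Suc n)) - (1 - y n)) <= \<rho> ^ Suc n" for n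
  using step[of n] N_minus[of "y (Suc n) - y n"] by simp
 ultimately show ?thesis by (intro exI[of _ "%n. 1 - y n"]) blast
qed

lemma approx_sqrt:
 assumes "N h <= \<rho>" "\<rho> < 1" "0 < e"
 shows "EX s. N ((1 - h) - s * s) < e"
proof -
 have r0: "0 <= \<rho>" using assms(1) N_nonneg[of h] by linarith
 have "(%n. \<rho> ^ n) \<longlonglongrightarrow> 0" using r0 assms(2) by (intro LIMSEQ_power_zero) auto
 then obtain n where n: "\<rho> ^ n < e / 2"
  using assms(3) by (fastforce simp: lim_sequentially r0 dist_real_def dest: spec[of _ "e/2"])
 obtain s where "N ((1 - h) - s n * s n) <= 2 * \<rho> ^ Suc n"
  using sqrt_sequence[OF assms(1,2)] by blast
 also have "... <= 2 * \<rho> ^ n" using r0 assms(2) power_decreasing[of n "Suc n" \<rho>] by simp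
 also have "... < e" using n by simp
 finally show ?thesis by blast
qed

definition pos :: "real poly => bool" where
 "pos z \<longleftrightarrow> (ALL e>0. EX s. N (z - s * s) < e)"

lemma pos_if_near_const:
 assumes "N ([:t:] - z) <= t"
 shows "pos z"
 unfolding pos_def
proof (intro allI impI)
 fix e :: real assume e: "0 < e"
 show "EX s. N (z - s * s) < e"
 proof (cases "t = 0")
  case True
  then have "N z = 0" using assms N_nonneg[of z] by simp
  then show ?thesis using e by (intro exI[of _ 0]) simp
 next
  case False
  have t: "t > 0" using False assms N_nonneg[of "[:t:] - z"] by linarith
  define w where "w = 1 - smult (1/t) z"
  have zw: "z = smult t (1 - w)" using t by (simp add: w_def)
  have "[:t:] - z = smult t w" using t by (simp add: w_def smult_diff_right one_pCons)
  then have Nw: "N w <= 1" using assms t by (simp add: N_smult)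
  define d where "d = min (1/2) (e / (2 * t))"
  have d: "0 < d" "d < 1" "t * d <= e / 2"
  using e t by (auto simp: d_def min_def field_simps)
  have "N (smult (1 - d) w) <= 1 - d" using Nw d by (simp add: N_smult mult_left_le)
  then obtain s where s: "N ((1 - smult (1 - d) w) - s * s) < e / (2 * t)"
  using approx_sqrt[of "smult (1 - d) w" "1 - d" "e / (2 * t)"] d e t by auto
  define s' where "s' = smult (sqrt t) s"
  have ss: "s' * s' = smult t (s * s)" using t by (simp add: s'_def)
  have "z - s' * s' = smult t ((1 - smult (1 - d) w) - s * s) + smult (- t * d) w"
  unfolding ss zw by (simp add: smult_diff_right smult_add_right smult_diff_left algebra_simps)
  then have "N (z - s' * s') <= t * N ((1 - smult (1 - d) w) - s * s) + t * d * N w"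
  using N_add[of "smult t ((1 - smult (1 - d) w) - s * s)" "smult (- t * d) w"] t d
  by (simp add: N_smult abs_mult)
  also have "... < t * (e / (2 * t)) + t * d * 1"
  using s t Nw d by (intro add_less_le_mono mult_strict_left_mono mult_left_mono) auto
  also have "... <= e" using t d by simp
  finally show ?thesis by blast
 qed
qed

lemma chebyshev_two:
 assumes "N s <= 1"
 shows "N (1 - 2 * (s * s)) <= 1"
proof (rule field_le_epsilon)
 fix e :: real assume "0 < e"
 then have e: "0 < e / 2" by simp
 have "N ([:1:] - (1 - s * s)) <= 1"
  using assms N_nonneg[of s] by (simp add: N_square one_pCons[symmetric] mult_le_one)
 then obtain c where c: "N ((1 - s * s) - c * c) < e / 2"
  using pos_if_near_const[of 1 "1 - s * s"] e unfolding pos_def by blast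
 let ?r = "(1 - s * s) - c * c" and ?d = "c * c - s * s"
 have "N ?d * N ?d <= N (?d * ?d + (2 * (c * s)) * (2 * (c * s)))" by (rule N_sum_sq)
 also have "?d * ?d + (2 * (c * s)) * (2 * (c * s)) = (1 - ?r) * (1 - ?r)"
  by (simp add: algebra_simps)
 also have "N ... = N (1 - ?r) * N (1 - ?r)" by (rule N_square)
 finally have "N ?d <= N (1 - ?r)"
  using N_nonneg by (meson abs_le_square_iff abs_of_nonneg mult_mono' not_le mult_strict_mono')
 also have "... <= 1 + N ?r" using N_diff[of 1 ?r] N_one by linarith
 finally have d: "N ?d <= 1 + e / 2" using c by linarith
 have "1 - 2 * (s * s) = ?d + ?r" by (simp add: algebra_simps)
 then show "N (1 - 2 * (s * s)) <= 1 + e" using N_add[of ?d ?r] d c by simp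
qed

lemma square_near_const:
 assumes "N s * N s <= 2 * t"
 shows "N ([:t:] - s * s) <= t"
proof (cases "t = 0")
 case True
 then show ?thesis using assms by (simp add: N_square)
next
 case False
 then have t: "t > 0" using assms zero_le_square[of "N s"] by linarith
 define s' where "s' = smult (1 / sqrt (2 * t)) s"
 have ss: "s' * s' = smult (1 / (2 * t)) (s * s)" using t by (simp add: s'_def)
 have "N s' * N s' = N s * N s / (2 * t)" using t by (simp add: s'_def N_smult)
 also have "... <= 1" using assms t by simp
 finally have "N s' <= 1"
  by (metis N_nonneg linorder_not_less mult_less_cancel_left1 less_le_trans mult.right_neutral mult_strict_mono' not_one_le_zero order_less_imp_le zero_le_one)
 from chebyshev_two[OF this] have "N (smult t (1 - 2 * (s' * s'))) <= t"
  using t by (simp only: N_smult) (simp add: mult_left_le)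
 also have "smult t (1 - 2 * (s' * s')) = [:t:] - s * s"
  unfolding ss using t by (simp add: smult_diff_right numeral_poly one_pCons)
 finally show ?thesis .
qed

lemma near_const_if_pos:
 assumes "pos z" "N z <= 2 * t"
 shows "N ([:t:] - z) <= t"
proof (rule field_le_epsilon)
 fix e :: real assume e: "0 < e"
 then obtain s where s: "N (z - s * s) < e / 2" using assms(1) unfolding pos_def
  by (meson half_gt_zero)
 have "N (s * s) <= N z + N (z - s * s)" using N_diff[of z "z - s * s"] by simp
 then have "N s * N s <= 2 * (t + e / 4)" using s assms(2) by (simp add: N_square)
 from square_near_const[OF this] have *: "N ([:t + e / 4:] - s * s) <= t + e / 4" .
 have "[:t:] - z = (([:t + e / 4:] - s * s) - [:e / 4:]) - (z - s * s)" by simp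
 then have "N ([:t:] - z) = N ((([:t + e / 4:] - s * s) - [:e / 4:]) - (z - s * s))"
  by (rule arg_cong)
 also have "... <= N ([:t + e / 4:] - s * s) + N [:e / 4:] + N (z - s * s)"
  using N_diff[of "([:t + e / 4:] - s * s) - [:e / 4:]" "z - s * s"]
  N_diff[of "[:t + e / 4:] - s * s" "[:e / 4:]"] by linarith
 finally have "N ([:t:] - z) <= N ([:t + e / 4:] - s * s) + N [:e / 4:] + N (z - s * s)" .
 then show "N ([:t:] - z) <= t + e" using * s N_const[of "e / 4"] e by simp
qed

lemma pos_add:
 assumes "pos z" "pos w"
 shows "pos (z + w)"
proof -
 let ?t = "N z / 2" and ?u = "N w / 2"
 have "N ([:?t + ?u:] - (z + w)) <= N ([:?t:] - z) + N ([:?u:] - w)"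
  using N_add[of "[:?t:] - z" "[:?u:] - w"] by (simp add: algebra_simps)
 also have "... <= ?t + ?u" using assms by (intro add_mono near_const_if_pos) auto
 finally show ?thesis by (rule pos_if_near_const)
qed

lemma pos_mult:
 assumes "pos z" "pos w"
 shows "pos (z * w)"
 unfolding pos_def
proof (intro allI impI)
 fix e :: real assume e: "0 < e"
 define d where "d = min 1 (e / (N z + N w + 2))"
 have nn: "0 < N z + N w + 2" using N_nonneg[of z] N_nonneg[of w] by linarith
 have d: "0 < d" "d <= 1" "d * (N z + N w + 2) <= e"
  using e nn by (auto simp: d_def pos_le_divide_eq[symmetric])
 obtain s where s: "N (z - s * s) < d" using assms(1) d(1) unfolding pos_def by blast
 obtain r where r: "N (w - r * r) < d" using assms(2) d(1) unfolding pos_def by blast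
 have rr: "N (r * r) <= N w + d" using N_diff[of w "w - r * r"] r by simp
 have eq: "z * w - (s * r) * (s * r) = z * (w - r * r) + (z - s * s) * (r * r)"
  by (simp add: algebra_simps)
 have "N (z * w - (s * r) * (s * r)) <= N z * N (w - r * r) + N (z - s * s) * N (r * r)"
  unfolding eq using N_add[of "z * (w - r * r)" "(z - s * s) * (r * r)"] N_mult[of z "w - r * r"]
  N_mult[of "z - s * s" "r * r"] by linarith
 also have "... <= N z * d + d * (N w + d)"
  using r s rr d by (intro add_mono mult_mono) auto
 also have "... <= N z * d + d * (N w + 1)" using d by simp
 also have "... < d * (N z + N w + 2)" using d by (simp add: algebra_simps)
 also have "... <= e" by (rule d)
 finally show "EX s. N (z * w - s * s) < e" by blast
qed

lemma pos_square: "pos (s * s)"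
 unfolding pos_def by (intro allI impI exI[of _ s]) simp

lemma pos_one: "pos 1"
 using pos_square[of 1] by simp

lemma pos_zero: "pos 0"
 using pos_square[of 0] by simp

lemma pos_power: "pos e ==> pos (e ^ n)"
 by (induction n) (auto simp: pos_one intro: pos_mult)

lemma N_le_if_pos:
 assumes "pos ([:D:] - z)" "pos ([:D:] + z)" "0 <= D"
 shows "N z <= D"
proof -
 have "N z * N z <= D * D"
 proof (rule field_le_epsilon)
  fix e :: real assume "0 < e"
  then obtain c where c: "N (([:D:] - z) * ([:D:] + z) - c * c) < e"
  using pos_mult[OF assms(1,2)] unfolding pos_def by blast
  have "N z * N z <= N (z * z + c * c)" by (rule N_sum_sq)
  also have "z * z + c * c = [:D * D:] - (([:D:] - z) * ([:D:] + z) - c * c)"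
  by (simp add: algebra_simps)
  also have "N ... <= D * D + e"
  using N_diff[of "[:D * D:]" "([:D:] - z) * ([:D:] + z) - c * c"] N_const[of "D * D"] c
  by simp
  finally show "N z * N z <= D * D + e" .
 qed
 then show ?thesis using assms(3) N_nonneg[of z]
  by (meson linorder_not_le mult_strict_mono')
qed

lemma pos_one_minus_bump:
 assumes "pos e"
 shows "pos (1 - (1 - e) * e ^ m)"
proof -
 have "pos (SUM j<m. e ^ j)"
  by (induction m) (auto intro: pos_add pos_power assms simp: pos_zero)
 then have "pos ((e - 1) * (e - 1) * (SUM j<m. e ^ j) + e)"
  by (intro pos_add pos_mult[OF pos_square] assms)
 also have "(e - 1) * (e - 1) * (SUM j<m. e ^ j) + e = (e - 1) * (e ^ m - 1) + e"
  by (simp add: power_diff_1_eq algebra_simps)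
 also have "... = 1 - (1 - e) * e ^ m" by (simp add: algebra_simps)
 finally show ?thesis .
qed

text \<open>If the norm exceeded one, the powers of \<open>e\<close> would grow geometrically, and so would these differences of consecutive
powers.\<close>

lemma N_le_one_if_bumps_bounded:
 assumes "!!n. N ((1 - e) * e ^ (2 * n)) <= 1"
 shows "N e <= 1"
proof (rule ccontr)
 assume "~ N e <= 1"
 then have E: "N e > 1" by simp
 then obtain m where m: "1 / (N e - 1) < N e ^ m" using real_arch_pow by blast
 define l where "l = 2 ^ (m + 1) - (1::nat)"
 have "(1::nat) <= 2 ^ m" by simp
 then have l2: "Suc (Suc (2 * l)) = 2 ^ (m + 2)"
  unfolding l_def power_add power_one_right power2_eq_square by linarith
 have lm: "m <= 2 * l" "2 * l > 0" using less_exp[of "m + 1"] by (simp_all add: l_def)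
 have "N e ^ Suc (Suc (2 * l)) <= N (e ^ Suc (2 * l)) * N e"
  using N_power_two[of e "m + 2"] N_mult[of "e ^ Suc (2 * l)" e]
  unfolding l2[symmetric] by (simp add: mult.commute)
 then have "N e ^ Suc (2 * l) <= N (e ^ Suc (2 * l))" using E by (simp add: mult.commute)
 also have "e ^ Suc (2 * l) = e ^ (2 * l) - (1 - e) * e ^ (2 * l)" by (simp add: algebra_simps)
 also have "N ... <= N (e ^ (2 * l)) + 1"
  using N_diff[of "e ^ (2 * l)" "(1 - e) * e ^ (2 * l)"] assms[of l] by linarith
 also have "N (e ^ (2 * l)) <= N e ^ (2 * l)"
  using N_power[of e "2 * l - 1"] lm by simp
 finally have "N e ^ (2 * l) * (N e - 1) <= 1" by (simp add: algebra_simps)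
 moreover have "N e ^ m <= N e ^ (2 * l)" using E lm by (intro power_increasing) auto
 then have "N e ^ m * (N e - 1) <= N e ^ (2 * l) * (N e - 1)" using E by simp
 ultimately show False using m E by (simp add: field_simps)
qed

lemma chebyshev_three:
 assumes "N s <= 1"
 shows "N (4 * (s * s * s) - 3 * s) <= 1"
proof -
 let ?T = "4 * (s * s * s) - 3 * s" and ?U = "4 * (s * s) - 1"
 have "N ([:1:] - (1 - s * s)) <= 1"
  using assms N_nonneg[of s] by (simp add: N_square one_pCons[symmetric] mult_le_one)
 then have pos: "pos (1 - s * s)" by (rule pos_if_near_const)
 have "N ?T * N ?T <= 1"
 proof (rule field_le_epsilon)
  fix e :: real assume e: "0 < e"
  define K where "K = N (?U * ?U) + 1"
  have K: "K > 0" using N_nonneg[of "?U * ?U"] unfolding K_def by linarith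
  obtain c where c: "N ((1 - s * s) - c * c) < e / K"
  using pos e K unfolding pos_def by (meson divide_pos_pos)
  have "N ?T * N ?T <= N (?T * ?T + (c * ?U) * (c * ?U))" by (rule N_sum_sq)
  also have "?T * ?T + (c * ?U) * (c * ?U) = 1 - ((1 - s * s) - c * c) * (?U * ?U)"
  by (simp add: algebra_simps)
  also have "N ... <= 1 + N ((1 - s * s) - c * c) * N (?U * ?U)"
  using N_diff[of 1 "((1 - s * s) - c * c) * (?U * ?U)"] N_one
  N_mult[of "(1 - s * s) - c * c" "?U * ?U"] by linarith
  also have "... <= 1 + e / K * K"
  using c e K by (intro add_left_mono mult_mono) (auto simp: K_def)
  finally show "N ?T * N ?T <= 1 + e" using K by simp
 qed
 then show ?thesis
  by (meson linorder_not_le less_1_mult)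
qed

end

text \<open>Here \<open>N\<close> measures an element of the domain of a homomorphism and \<open>M\<close> its image: an arbitrarily large bound in
the domain is brought down to 2, and the error in the range stays below \<open>1/24\<close>, uniformly in \<open>k\<close>.\<close>

lemma truncation:
 assumes "real_cstar_poly N" "real_cstar_poly M"
  and "N p <= 2 * 3 ^ k" "M p <= 1"
 shows "EX q. N q <= 2 & M q <= 1 & M (p - q) <= (1 - 1 / 9 ^ k) / 24"
 using assms(3,4)
proof (induction k arbitrary: p)
 interpret M: real_cstar_poly M by fact
 case 0
 then show ?case by (intro exI[of _ p]) simp
next
 interpret N: real_cstar_poly N by fact
 interpret M: real_cstar_poly M by fact
 case (Suc k)
 define R :: real where "R = 2 * 3 ^ Suc k"
 define c where "c = 4 / (3 * R\<^sup>2)"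
 have R: "R > 0" by (simp add: R_def)
 have R1: "R >= 1" using one_le_power[of "3::real" "Suc k"] unfolding R_def by linarith
 have c: "c > 0" using R by (simp add: c_def)
 define s where "s = smult (1 / R) p"
 define p' where "p' = p * (1 - smult c (p * p))"
 have "N s <= 1" using Suc.prems(1) R by (simp add: s_def N.N_smult R_def)
 from N.chebyshev_three[OF this]
 have T: "N (smult (- R / 3) (4 * (s * s * s) - 3 * s)) <= R / 3"
  using R unfolding N.N_smult by (simp add: mult_left_le)
 have "smult (- R / 3) (4 * (s * s * s) - 3 * s) = p'"
  using R by (simp add: s_def p'_def smult_diff_right numeral_poly c_def
  power2_eq_square algebra_simps)
 with T have "N p' <= R / 3" by (simp only:)
 then have Np: "N p' <= 2 * 3 ^ k" by (simp add: R_def)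
 have c1: "1 / c = 3 * R\<^sup>2 / 4" by (simp add: c_def)
 have "1 <= R\<^sup>2" using R1 by (rule one_le_power)
 then have "1 <= 2 * (1 / c)" unfolding c1 by linarith
 moreover have "M p * M p <= 1" using Suc.prems(2) M.N_nonneg by (simp add: mult_le_one)
 ultimately have "M p * M p <= 2 * (1 / c)" by linarith
 from M.square_near_const[OF this]
 have "c * M ([:1 / c:] - p * p) <= 1" using c by (simp add: field_simps)
 moreover have "1 - smult c (p * p) = smult c ([:1 / c:] - p * p)"
  using c by (simp add: smult_diff_right one_pCons)
 ultimately have M1: "M (1 - smult c (p * p)) <= 1" using c by (simp add: M.N_smult)
 have "M p' <= M p * M (1 - smult c (p * p))" unfolding p'_def by (rule M.N_mult)
 also have "... <= 1" using Suc.prems(2) M1 M.N_nonneg by (simp add: mult_le_one)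
 finally have Mp: "M p' <= 1" .
 from Suc.IH[OF Np Mp] obtain q where
  q: "N q <= 2" "M q <= 1" "M (p' - q) <= (1 - 1 / 9 ^ k) / 24" by blast
 have "M (p - p') = c * M (p * (p * p))"
  using c by (simp add: p'_def algebra_simps M.N_smult)
 also have "... <= c * (M p * (M p * M p))"
  using c M.N_mult[of p "p * p"] by (simp add: M.N_square)
 also have "... <= c * 1"
  using c Suc.prems(2) M.N_nonneg[of p] by (intro mult_left_mono mult_le_one) auto
 finally have "M (p - p') <= c" by simp
 then have "M (p - q) <= c + (1 - 1 / 9 ^ k) / 24"
 proof -
  have "M (p - q) <= M (p - p') + M (p' - q)" using M.N_add[of "p - p'" "p' - q"] by simp
  with q(3) \<open>M (p - p') <= c\<close> show ?thesis by linarith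
 qed
 also have "c = 1 / (3 * 9 ^ Suc k)"
  unfolding c_def R_def by (simp add: power2_eq_square power_mult_distrib[symmetric] field_simps)
 finally show ?case using q by (intro exI[of _ q]) (simp add: field_simps)
qed

section \<open>Star-algebras and C*-seminorms\<close>

locale star_alg =
 fixes A :: "('a, 'm) star_algebra_scheme" (structure)
 assumes star_algebra: "is_star_algebra A"

sublocale star_alg \<subseteq> ring A
 using star_algebra by (simp add: is_star_algebra_def)

context star_alg
begin

abbreviation star :: "'a => 'a" where "star == adj A"

lemma smult_closed [simp, intro]: "x : car A ==> c \<odot> x : car A"
 using star_algebra unfolding is_star_algebra_def module_def module_axioms_def
 by (auto simp: complex_ring_def)

lemma smult_l_distr: "x : car A ==> (c + d) \<odot> x = c \<odot> x \<oplus> d \<odot> x"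
 using star_algebra unfolding is_star_algebra_def module_def module_axioms_def
 by (auto simp: complex_ring_def)

lemma smult_r_distr:
 "x : car A ==> y : car A ==> c \<odot> (x \<oplus> y) = c \<odot> x \<oplus> c \<odot> y"
 using star_algebra unfolding is_star_algebra_def module_def module_axioms_def
 by (auto simp: complex_ring_def)

lemma smult_smult: "x : car A ==> c \<odot> (d \<odot> x) = (c * d) \<odot> x"
 using star_algebra unfolding is_star_algebra_def module_def module_axioms_def
 by (auto simp: complex_ring_def)

lemma smult_one [simp]: "x : car A ==> 1 \<odot> x = x"
 using star_algebra unfolding is_star_algebra_def module_def module_axioms_def
 by (auto simp: complex_ring_def)

lemma smult_mult_left:
 "x : car A ==> y : car A ==> (c \<odot> x) \<otimes> y = c \<odot> (x \<otimes> y)"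
 using star_algebra unfolding is_star_algebra_def by auto

lemma smult_mult_right:
 "x : car A ==> y : car A ==> x \<otimes> (c \<odot> y) = c \<odot> (x \<otimes> y)"
 using star_algebra unfolding is_star_algebra_def by auto

lemma star_closed [simp, intro]: "x : car A ==> star x : car A"
 using star_algebra unfolding is_star_algebra_def by auto

lemma star_star [simp]: "x : car A ==> star (star x) = x"
 using star_algebra unfolding is_star_algebra_def by auto

lemma star_add:
 "x : car A ==> y : car A ==> star (x \<oplus> y) = star x \<oplus> star y"
 using star_algebra unfolding is_star_algebra_def by auto

lemma star_mult:
 "x : car A ==> y : car A ==> star (x \<otimes> y) = star y \<otimes> star x"
 using star_algebra unfolding is_star_algebra_def by auto

lemma star_smult: "x : car A ==> star (c \<odot> x) = cnj c \<odot> star x"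
 using star_algebra unfolding is_star_algebra_def by auto

lemma smult_zero_left [simp]:
 assumes "x : car A" shows "0 \<odot> x = \<zero>"
proof -
 have "0 \<odot> x \<oplus> 0 \<odot> x = 0 \<odot> x" using smult_l_distr[OF assms, of 0 0] by simp
 then show ?thesis using assms add.l_cancel_one by blast
qed

lemma smult_zero_right [simp]: "c \<odot> \<zero> = \<zero>"
proof -
 have "c \<odot> \<zero> = c \<odot> (0 \<odot> \<zero>)" by simp
 then show ?thesis using smult_smult[of \<zero> c 0] by simp
qed

lemma smult_minus_left:
 assumes "x : car A" shows "(- c) \<odot> x = \<ominus> (c \<odot> x)"
 using assms smult_l_distr[OF assms, of "-c" c]
 by (intro minus_equality[symmetric]) auto

lemma smult_minus_right:
 assumes "x : car A" shows "c \<odot> (\<ominus> x) = \<ominus> (c \<odot> x)"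
 using assms smult_r_distr[of "\<ominus> x" x c] l_neg[OF assms]
 by (intro minus_equality[symmetric]) auto

lemma smult_minus_one: "x : car A ==> (- 1) \<odot> x = \<ominus> x"
 using smult_minus_left[of x 1] by simp

lemma smult_diff:
 "x : car A ==> y : car A ==> c \<odot> (x \<ominus> y) = c \<odot> x \<ominus> c \<odot> y"
 by (simp add: a_minus_def smult_r_distr smult_minus_right)

lemma star_zero [simp]: "star \<zero> = \<zero>"
 using star_smult[of \<zero> 0] by simp

lemma star_one [simp]: "star \<one> = \<one>"
 using star_mult[of "star \<one>" \<one>] by simp

lemma star_minus: "x : car A ==> star (\<ominus> x) = \<ominus> star x"
 using star_smult[of x "-1"] by (simp add: smult_minus_one)

lemma star_diff:
 "x : car A ==> y : car A ==> star (x \<ominus> y) = star x \<ominus> star y"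
 by (simp add: a_minus_def star_add star_minus)

lemma smult_two: "x : car A ==> 2 \<odot> x = x \<oplus> x"
 using smult_l_distr[of x 1 1] by simp

definition sa :: "'a set" where
 "sa = {x : car A. star x = x}"

lemma saD: "x : sa ==> x : car A" "x : sa ==> star x = x"
 by (auto simp: sa_def)

lemma sa_square: "x : car A ==> star x \<otimes> x : sa" "x : car A ==> x \<otimes> star x : sa"
 by (auto simp: sa_def star_mult)

definition ev :: "'a => real poly => 'a" where
 "ev h p = fold_coeffs (%a y. (complex_of_real a \<odot> \<one>) \<oplus> h \<otimes> y) p \<zero>"

lemma ev_zero [simp]: "ev h 0 = \<zero>"
 by (simp add: ev_def)

lemma ev_pCons:
 assumes "h : car A"
 shows "ev h (pCons a p) = (complex_of_real a \<odot> \<one>) \<oplus> h \<otimes> ev h p"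
 using assms by (cases "p = 0 & a = 0") (auto simp: ev_def)

lemma ev_closed [simp]: "h : car A ==> ev h p : car A"
 by (induction p) (simp_all add: ev_pCons)

lemma ev_const [simp]: "h : car A ==> ev h [:c:] = complex_of_real c \<odot> \<one>"
 by (simp add: ev_pCons)

lemma ev_one [simp]: "h : car A ==> ev h 1 = \<one>"
 by (simp add: one_pCons)

lemma ev_X [simp]: "h : car A ==> ev h [:0, 1:] = h"
 by (simp add: ev_pCons)

lemma ev_X' [simp]: "h : car A ==> ev h (pCons 0 1) = h"
 by (simp add: ev_pCons)

lemma ev_add:
 assumes h: "h : car A"
 shows "ev h (p + q) = ev h p \<oplus> ev h q"
proof (induction p q rule: poly_induct2)
 case (pCons a p b q)
 show ?case using h
  by (simp add: ev_pCons pCons smult_l_distr r_distr a_ac)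
qed simp

lemma ev_smult:
 assumes h: "h : car A"
 shows "ev h (smult c p) = complex_of_real c \<odot> ev h p"
proof (induction p)
 case (pCons a p)
 show ?case using h
  by (simp add: ev_pCons pCons smult_r_distr smult_mult_right smult_smult)
qed simp

lemma ev_minus: "h : car A ==> ev h (- p) = \<ominus> ev h p"
 using ev_smult[of h "-1" p] by (simp add: smult_minus_one)

lemma ev_diff: "h : car A ==> ev h (p - q) = ev h p \<ominus> ev h q"
 using ev_add[of h p "- q"] by (simp add: ev_minus a_minus_def)

lemma ev_mult:
 assumes h: "h : car A"
 shows "ev h (p * q) = ev h p \<otimes> ev h q"
proof (induction p)
 case (pCons a p)
 have "pCons a p * q = smult a q + pCons 0 (p * q)" by simp
 then show ?case using h
  by (simp add: ev_add ev_pCons pCons ev_smult smult_mult_left l_distr m_assoc)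
qed (use h in simp)

lemma ev_commute: "h : car A ==> ev h p \<otimes> ev h q = ev h q \<otimes> ev h p"
 by (metis ev_mult mult.commute)

lemma star_ev:
 assumes h: "h : sa"
 shows "star (ev h p) = ev h p"
proof (induction p)
 case (pCons a p)
 have h': "h : car A" using h by (rule saD)
 have "h \<otimes> ev h p = ev h p \<otimes> h" using ev_commute[OF h', of "[:0,1:]" p] h' by simp
 then show ?case using h' h
  by (simp add: ev_pCons star_add star_mult star_smult pCons saD)
qed simp

lemma ev_intertwine:
 assumes x: "x : car A" and h: "h : car A" and k: "k : car A"
  and eq: "x \<otimes> h = k \<otimes> x"
 shows "x \<otimes> ev h p = ev k p \<otimes> x"
proof (induction p)
 case (pCons a p)
 have "x \<otimes> (h \<otimes> ev h p) = k \<otimes> ev k p \<otimes> x"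
  using x h k by (simp add: m_assoc[symmetric] eq) (simp add: m_assoc pCons)
 then show ?case using x h k
  by (simp add: ev_pCons l_distr r_distr smult_mult_left smult_mult_right)
qed (use x in simp)

end

locale cstar_semi = star_alg A for A :: "('a, 'm) star_algebra_scheme" (structure) +
 fixes nu :: "'a => real"
 assumes cstar_seminorm: "cstar_seminorm A nu"
begin

lemma nu_add: "x : car A ==> y : car A ==> nu (x \<oplus> y) <= nu x + nu y"
 using cstar_seminorm by (simp add: cstar_seminorm_def)

lemma nu_smult: "x : car A ==> nu (c \<odot> x) = cmod c * nu x"
 using cstar_seminorm by (simp add: cstar_seminorm_def)

lemma nu_mult: "x : car A ==> y : car A ==> nu (x \<otimes> y) <= nu x * nu y"
 using cstar_seminorm by (simp add: cstar_seminorm_def)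

lemma nu_cstar: "x : car A ==> nu (star x \<otimes> x) = (nu x)\<^sup>2"
 using cstar_seminorm by (simp add: cstar_seminorm_def)

lemma nu_zero [simp]: "nu \<zero> = 0"
 using nu_smult[of \<zero> 0] by simp

lemma nu_minus [simp]: "x : car A ==> nu (\<ominus> x) = nu x"
 using nu_smult[of x "-1"] by (simp add: smult_minus_one)

lemma nu_nonneg [simp]: "x : car A ==> 0 <= nu x"
 using nu_add[of x "\<ominus> x"] by (simp add: r_neg)

lemma nu_diff: "x : car A ==> y : car A ==> nu (x \<ominus> y) <= nu x + nu y"
 using nu_add[of x "\<ominus> y"] by (simp add: a_minus_def)

lemma nu_diff_commute: "x : car A ==> y : car A ==> nu (x \<ominus> y) = nu (y \<ominus> x)"
 using nu_minus[of "x \<ominus> y"] by (simp add: a_minus_def minus_add a_comm)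

lemma nu_triangle:
 assumes "x : car A" "y : car A" "z : car A"
 shows "nu (x \<ominus> z) <= nu (x \<ominus> y) + nu (y \<ominus> z)"
proof -
 have "x \<ominus> z = (x \<ominus> y) \<oplus> (y \<ominus> z)" using assms by algebra
 then show ?thesis using nu_add[of "x \<ominus> y" "y \<ominus> z"] assms by simp
qed

lemma nu_le_add_diff:
 assumes "x : car A" "y : car A"
 shows "nu x <= nu y + nu (x \<ominus> y)"
proof -
 have "x = y \<oplus> (x \<ominus> y)" using assms by algebra
 then show ?thesis using nu_add[of y "x \<ominus> y"] assms by simp
qed

lemma nu_abs_diff:
 assumes "x : car A" "y : car A"
 shows "\<bar>nu x - nu y\<bar> <= nu (x \<ominus> y)"
 using nu_le_add_diff[OF assms] nu_le_add_diff[OF assms(2,1)] nu_diff_commute[OF assms] by simp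

lemma nu_star [simp]:
 assumes x: "x : car A" shows "nu (star x) = nu x"
proof -
 have *: "nu y <= nu (star y)" if y: "y : car A" for y
 proof (cases "nu y = 0")
  case False
  have "nu y * nu y <= nu (star y) * nu y"
  using nu_cstar[OF y] nu_mult[of "star y" y] y by (simp add: power2_eq_square)
  then show ?thesis using False nu_nonneg[OF y] by (simp add: mult_le_cancel_right)
 qed (use y in simp)
 show ?thesis using *[OF x] *[of "star x"] x by simp
qed

lemma nu_one: "nu \<one> <= 1"
proof -
 have "nu \<one> * nu \<one> = nu \<one>" using nu_cstar[of \<one>] by (simp add: power2_eq_square)
 then show ?thesis by (metis mult_cancel_right1 order_refl zero_le_one)
qed

lemma real_cstar_poly_ev:
 assumes h: "h : sa"
 shows "real_cstar_poly (%p. nu (ev h p))"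
proof
 note hc = saD(1)[OF h]
 fix p q c
 show "nu (ev h (p + q)) <= nu (ev h p) + nu (ev h q)" using hc by (simp add: ev_add nu_add)
 show "nu (ev h (smult c p)) = \<bar>c\<bar> * nu (ev h p)" using hc by (simp add: ev_smult nu_smult)
 show "nu (ev h (p * q)) <= nu (ev h p) * nu (ev h q)" using hc by (simp add: ev_mult nu_mult)
 define a b w where "a = ev h p" and "b = ev h q" and "w = a \<oplus> \<i> \<odot> b"
 have ab: "a : car A" "b : car A" "star a = a" "star b = b" "b \<otimes> a = a \<otimes> b"
  unfolding a_def b_def using hc h star_ev ev_commute by auto
 have wc: "w : car A" using ab by (simp add: w_def)
 have sw: "star w = a \<oplus> (- \<i>) \<odot> b" using ab by (simp add: w_def star_add star_smult)
 have "star w \<otimes> w = (a \<otimes> a \<oplus> b \<otimes> b) \<oplus> (\<i> \<odot> (a \<otimes> b) \<oplus> (- \<i>) \<odot> (a \<otimes> b))"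
  unfolding sw unfolding w_def using ab
  by (simp add: l_distr r_distr smult_mult_left smult_mult_right smult_smult smult_r_distr a_ac)
 also have "\<i> \<odot> (a \<otimes> b) \<oplus> (- \<i>) \<odot> (a \<otimes> b) = \<zero>"
  using ab smult_l_distr[of "a \<otimes> b" \<i> "-\<i>"] by simp
 finally have ww: "star w \<otimes> w = a \<otimes> a \<oplus> b \<otimes> b" using ab by simp
 have "w \<oplus> star w = (a \<oplus> a) \<oplus> (\<i> \<odot> b \<oplus> (- \<i>) \<odot> b)"
  unfolding sw unfolding w_def using ab by (simp add: a_ac)
 also have "... = 2 \<odot> a" using ab smult_l_distr[of b \<i> "-\<i>"] by (simp add: smult_two)
 finally have "2 * nu a <= 2 * nu w"
  using nu_add[of w "star w"] wc ab by (simp add: nu_smult)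
 then have "nu a * nu a <= nu w * nu w" using ab wc by (intro mult_mono) auto
 also have "... = nu (a \<otimes> a \<oplus> b \<otimes> b)"
  using nu_cstar[OF wc] by (simp add: ww power2_eq_square)
 finally show "nu (ev h p) * nu (ev h p) <= nu (ev h (p * p + q * q))"
  using hc by (simp add: a_def b_def ev_add ev_mult)
qed

definition npos :: "'a => bool" where
 "npos z \<longleftrightarrow> z : car A & (EX t::real. nu (complex_of_real t \<odot> \<one> \<ominus> z) <= t)"

lemma npos_add:
 assumes "npos z" "npos w" shows "npos (z \<oplus> w)"
proof -
 obtain t u :: real where *: "nu (complex_of_real t \<odot> \<one> \<ominus> z) <= t" "nu (complex_of_real u \<odot> \<one> \<ominus> w) <= u"
  using assms by (auto simp: npos_def)
 have c: "z : car A" "w : car A" using assms by (auto simp: npos_def)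
 have "complex_of_real (t + u) \<odot> \<one> \<ominus> (z \<oplus> w) =
  (complex_of_real t \<odot> \<one> \<ominus> z) \<oplus> (complex_of_real u \<odot> \<one> \<ominus> w)"
  using c by (simp add: smult_l_distr a_minus_def minus_add a_ac)
 then have "nu (complex_of_real (t + u) \<odot> \<one> \<ominus> (z \<oplus> w)) <= t + u"
  using * c nu_add[of "complex_of_real t \<odot> \<one> \<ominus> z" "complex_of_real u \<odot> \<one> \<ominus> w"] by simp
 then show ?thesis using c unfolding npos_def by blast
qed

lemma npos_half:
 assumes "npos (2 \<odot> z)" "z : car A" shows "npos z"
proof -
 obtain t :: real where t: "nu (complex_of_real t \<odot> \<one> \<ominus> 2 \<odot> z) <= t"
  using assms by (auto simp: npos_def)
 have "(1/2) \<odot> (complex_of_real t \<odot> \<one> \<ominus> 2 \<odot> z) = complex_of_real (t/2) \<odot> \<one> \<ominus> z"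
  using assms by (simp add: smult_diff smult_smult)
 then have "nu (complex_of_real (t/2) \<odot> \<one> \<ominus> z) = 1/2 * nu (complex_of_real t \<odot> \<one> \<ominus> 2 \<odot> z)"
  using nu_smult[of "complex_of_real t \<odot> \<one> \<ominus> 2 \<odot> z" "1/2"] assms by simp
 then show ?thesis using t assms unfolding npos_def by (intro conjI exI[of _ "t/2"]) auto
qed

lemma pos_ev_iff:
 assumes h: "h : sa"
 shows "real_cstar_poly.pos (%p. nu (ev h p)) p \<longleftrightarrow> npos (ev h p)"
proof -
 interpret P: real_cstar_poly "%p. nu (ev h p)" by (rule real_cstar_poly_ev[OF h])
 have eq: "ev h ([:t:] - p) = complex_of_real t \<odot> \<one> \<ominus> ev h p" for t
  using saD(1)[OF h] by (simp add: ev_diff del: ev_const) (simp add: saD(1)[OF h])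
 show ?thesis
  using P.pos_if_near_const[of _ p] P.near_const_if_pos[of p "nu (ev h p)"] saD(1)[OF h]
  unfolding npos_def eq by auto
qed

lemma npos_square:
 assumes h: "h : sa" shows "npos (h \<otimes> h)"
proof -
 interpret P: real_cstar_poly "%p. nu (ev h p)" by (rule real_cstar_poly_ev[OF h])
 have "npos (ev h ([:0,1:] * [:0,1:]))" using P.pos_square pos_ev_iff[OF h] by blast
 moreover have "ev h ([:0,1:] * [:0,1:]) = h \<otimes> h"
  using saD(1)[OF h] by (simp only: ev_mult ev_X)
 ultimately show ?thesis by simp
qed

lemma nu_le_one_if_npos:
 assumes h: "h : sa" and "npos (\<one> \<ominus> h \<otimes> h)"
 shows "nu h <= 1"
proof -
 interpret P: real_cstar_poly "%p. nu (ev h p)" by (rule real_cstar_poly_ev[OF h])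
 note hc = saD(1)[OF h]
 let ?X = "[:0, 1:] :: real poly"
 have "ev h (1 - ?X * ?X) = \<one> \<ominus> h \<otimes> h" using hc by (simp only: ev_diff ev_mult ev_X ev_one)
 then have "P.pos (1 - ?X * ?X)" using assms pos_ev_iff[OF h] by simp
 moreover have "P.pos (1 + ?X * ?X)" by (intro P.pos_add P.pos_one P.pos_square)
 ultimately have "nu (ev h (?X * ?X)) <= 1" using P.N_le_if_pos[of 1 "?X * ?X"]
  by (simp only: one_pCons[symmetric] zero_le_one simp_thms)
 then have "nu h * nu h <= 1" using P.N_square[of ?X] hc by (simp only: ev_X)
 then show ?thesis using nu_nonneg[OF hc] by (meson linorder_not_le less_1_mult)
qed

lemma npos_star_mult_add:
 assumes y: "y : car A"
 shows "npos (star y \<otimes> y \<oplus> y \<otimes> star y)"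
proof -
 define p m where "p = y \<oplus> star y" and "m = y \<ominus> star y"
 have c: "p : car A" "m : car A" using y by (auto simp: p_def m_def)
 have alg: "(y \<oplus> z) \<otimes> (y \<oplus> z) \<oplus> \<ominus> ((y \<ominus> z) \<otimes> (y \<ominus> z)) =
  (z \<otimes> y \<oplus> y \<otimes> z) \<oplus> (z \<otimes> y \<oplus> y \<otimes> z)" if "z : car A" for z
 proof -
  have add: "(a \<oplus> b \<oplus> (c \<oplus> d)) \<oplus> \<ominus> (a \<oplus> \<ominus> b \<oplus> (\<ominus> c \<oplus> d)) = (c \<oplus> b) \<oplus> (c \<oplus> b)"
  if "a : car A" "b : car A" "c : car A" "d : car A" for a b c d
  using that by algebra
  have "(y \<oplus> z) \<otimes> (y \<oplus> z) = y \<otimes> y \<oplus> y \<otimes> z \<oplus> (z \<otimes> y \<oplus> z \<otimes> z)"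
  "(y \<ominus> z) \<otimes> (y \<ominus> z) = y \<otimes> y \<oplus> \<ominus> (y \<otimes> z) \<oplus> (\<ominus> (z \<otimes> y) \<oplus> z \<otimes> z)"
  using y that
  by (simp_all add: a_minus_def l_distr r_distr l_minus r_minus minus_add minus_minus a_assoc a_comm a_lcomm)
  then show ?thesis using add y that by simp
 qed
 have "p : sa" using y by (simp add: sa_def p_def star_add a_comm)
 moreover have "star m = \<ominus> m"
  using y by (simp add: m_def star_diff) (simp add: a_minus_def minus_add a_comm)
 then have "\<i> \<odot> m : sa"
  using c by (simp add: sa_def star_smult smult_minus_left smult_minus_right)
 ultimately have "npos (p \<otimes> p \<oplus> (\<i> \<odot> m) \<otimes> (\<i> \<odot> m))" by (intro npos_add npos_square)
 also have "(\<i> \<odot> m) \<otimes> (\<i> \<odot> m) = \<ominus> (m \<otimes> m)"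
  using c by (simp add: smult_mult_left smult_mult_right smult_smult smult_minus_one)
 also have "p \<otimes> p \<oplus> \<ominus> (m \<otimes> m) = 2 \<odot> (star y \<otimes> y \<oplus> y \<otimes> star y)"
  using y star_closed[OF y] unfolding p_def m_def
  by (simp add: smult_two alg)
 finally show ?thesis by (rule npos_half) (use y in auto)
qed

text \<open>Kaplansky's theorem that elements \<open>x\<^sup>*x\<close> are positive.\<close>

lemma nu_one_minus_mult_star:
 assumes x: "x : car A" and "nu x <= 1"
 shows "nu (\<one> \<ominus> x \<otimes> star x) <= 1"
proof -
 define h k where "h = star x \<otimes> x" and "k = x \<otimes> star x"
 have hs: "h : sa" and ks: "k : sa" using sa_square[OF x] by (auto simp: h_def k_def)
 note hc = saD(1)[OF hs] and kc = saD(1)[OF ks]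
 interpret H: real_cstar_poly "%p. nu (ev h p)" by (rule real_cstar_poly_ev[OF hs])
 interpret K: real_cstar_poly "%p. nu (ev k p)" by (rule real_cstar_poly_ev[OF ks])
 let ?X = "[:0, 1:] :: real poly"
 define e where "e = 1 - ?X"
 have "nu h <= 1" using nu_cstar[OF x] assms(2) x by (simp add: h_def power_le_one)
 moreover have "ev h ([:1:] - e) = h" unfolding e_def one_pCons[symmetric] using hc by simp
 ultimately have eH: "H.pos e" using H.pos_if_near_const[of 1 e] by simp
 have "nu k <= 1" using nu_cstar[of "star x"] assms(2) x by (simp add: k_def power_le_one)
 moreover have "ev k ([:1:] - e) = k" unfolding e_def one_pCons[symmetric] using kc by simp
 ultimately have eK: "K.pos e" using K.pos_if_near_const[of 1 e] by simp
 have "nu (ev k ((1 - e) * e ^ (2 * n))) <= 1" for n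
 proof -
  define f where "f = (1 - e) * e ^ (2 * n)"
  have "e ^ (2 * n) = e ^ n * e ^ n" "1 - e = ?X" by (simp_all add: mult_2 power_add e_def)
  then have f: "f = e ^ n * ?X * e ^ n" "f = ?X * (e ^ n * e ^ n)"
  unfolding f_def by (simp_all only: mult_ac)
  define y where "y = x \<otimes> ev h (e ^ n)"
  have y: "y : car A" using x hc by (simp add: y_def)
  have sy: "star y = ev h (e ^ n) \<otimes> star x"
  using x hc by (simp add: y_def star_mult star_ev[OF hs])
  have "star y \<otimes> y = ev h f"
  unfolding f(1) ev_mult[OF hc] ev_X[OF hc] unfolding sy unfolding y_def
  using x hc by (simp add: h_def m_assoc)
  moreover have "y \<otimes> star y = ev k f"
  proof -
  have xe: "x \<otimes> ev h p = ev k p \<otimes> x" for p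
  by (rule ev_intertwine[OF x hc kc]) (use x in "simp add: h_def k_def m_assoc")
  have "y \<otimes> star y = x \<otimes> ev h (e ^ n * e ^ n) \<otimes> star x"
  unfolding sy unfolding y_def using x hc by (simp add: m_assoc ev_mult)
  also have "... = ev k (e ^ n * e ^ n) \<otimes> k"
  unfolding xe using x hc kc by (simp add: m_assoc k_def)
  also have "... = ev k f" unfolding f(2) ev_mult[OF kc, of ?X] ev_X[OF kc]
  using ev_commute[OF kc, of "?X" "e ^ n * e ^ n"] ev_X[OF kc] by simp
  finally show ?thesis .
  qed
  ultimately have s: "npos (ev h f \<oplus> ev k f)" using npos_star_mult_add[OF y] by simp
  have "npos (ev h (1 - f))"
  using H.pos_one_minus_bump[OF eH, of "2 * n"] pos_ev_iff[OF hs] by (simp add: f_def)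
  from npos_add[OF this s] have "npos (ev k (1 + f))"
  using hc kc by (simp add: ev_diff ev_add a_minus_def a_assoc r_neg1)
  then have "K.pos (1 + f)" using pos_ev_iff[OF ks] by simp
  moreover have "K.pos (1 - f)" unfolding f_def by (rule K.pos_one_minus_bump[OF eK])
  ultimately show ?thesis using K.N_le_if_pos[of 1 f]
  by (simp add: one_pCons[symmetric] f_def)
 qed
 then have "nu (ev k e) <= 1" by (rule K.N_le_one_if_bumps_bounded)
 then show ?thesis using kc unfolding e_def by (simp only: ev_diff ev_X ev_one) (simp add: k_def)
qed

lemma nu_one_minus_star_mult:
 assumes "x : car A" "nu x <= 1"
 shows "nu (\<one> \<ominus> star x \<otimes> x) <= 1"
 using nu_one_minus_mult_star[of "star x"] assms by simp

end

section \<open>Sequences, completeness and star-subalgebras\<close>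

context cstar_semi
begin

definition asym :: "(nat => 'a) => (nat => 'a) => bool" where
 "asym X Y \<longleftrightarrow> (ALL n. X n : car A) & (ALL n. Y n : car A) & (%n. nu (X n \<ominus> Y n)) \<longlonglongrightarrow> 0"

lemma asymD:
 assumes "asym X Y"
 shows "X n : car A" "Y n : car A" "(%n. nu (X n \<ominus> Y n)) \<longlonglongrightarrow> 0"
 using assms by (auto simp: asym_def)

lemma asymI:
 assumes "!!n. X n : car A" "!!n. Y n : car A"
  and "!!n. nu (X n \<ominus> Y n) <= f n" "f \<longlonglongrightarrow> 0"
 shows "asym X Y"
 unfolding asym_def
proof (intro conjI allI)
 show "(%n. nu (X n \<ominus> Y n)) \<longlonglongrightarrow> 0"
  by (rule tendsto_sandwich[OF _ _ tendsto_const assms(4)]) (use assms in auto)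
qed (use assms in auto)

lemma asym_refl: "(!!n. X n : car A) ==> asym X X"
 by (rule asymI[where f = "%_. 0"]) (auto simp: a_minus_def r_neg)

lemma asym_sym: "asym X Y ==> asym Y X"
 using nu_diff_commute by (auto simp: asym_def)

lemma asym_trans: "asym X Y ==> asym Y Z ==> asym X Z"
 by (rule asymI[where f = "%n. nu (X n \<ominus> Y n) + nu (Y n \<ominus> Z n)"])
  (auto dest: asymD intro!: nu_triangle tendsto_add_zero)

lemma asym_add:
 assumes "asym X X'" "asym Y Y'" shows "asym (%n. X n \<oplus> Y n) (%n. X' n \<oplus> Y' n)"
proof (rule asymI[where f = "%n. nu (X n \<ominus> X' n) + nu (Y n \<ominus> Y' n)"])
 note c = asymD(1,2)[OF assms(1)] asymD(1,2)[OF assms(2)]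
 fix n
 have "(X n \<oplus> Y n) \<ominus> (X' n \<oplus> Y' n) = (X n \<ominus> X' n) \<oplus> (Y n \<ominus> Y' n)"
  using c by (simp add: a_minus_def minus_add a_ac)
 then show "nu ((X n \<oplus> Y n) \<ominus> (X' n \<oplus> Y' n)) <= nu (X n \<ominus> X' n) + nu (Y n \<ominus> Y' n)"
  using nu_add c by simp
qed (use asymD[OF assms(1)] asymD[OF assms(2)] in "auto intro: tendsto_add_zero")

lemma asym_smult:
 assumes "asym X X'" shows "asym (%n. c \<odot> X n) (%n. c \<odot> X' n)"
proof (rule asymI[where f = "%n. cmod c * nu (X n \<ominus> X' n)"])
 fix n
 show "nu (c \<odot> X n \<ominus> c \<odot> X' n) <= cmod c * nu (X n \<ominus> X' n)"
  using asymD[OF assms] by (simp add: smult_diff[symmetric] nu_smult)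
qed (use asymD[OF assms] in "auto intro: tendsto_mult_right_zero")

lemma asym_star:
 assumes "asym X X'" shows "asym (%n. star (X n)) (%n. star (X' n))"
proof (rule asymI[where f = "%n. nu (X n \<ominus> X' n)"])
 fix n
 show "nu (star (X n) \<ominus> star (X' n)) <= nu (X n \<ominus> X' n)"
  using asymD[OF assms] by (simp add: star_diff[symmetric])
qed (use asymD[OF assms] in auto)

lemma asym_mult:
 assumes "asym X X'" "asym Y Y'" and bX: "!!n. nu (X n) <= B" and bY: "!!n. nu (Y' n) <= C"
 shows "asym (%n. X n \<otimes> Y n) (%n. X' n \<otimes> Y' n)"
proof (rule asymI[where f = "%n. B * nu (Y n \<ominus> Y' n) + nu (X n \<ominus> X' n) * C"])
 note c = asymD(1,2)[OF assms(1)] asymD(1,2)[OF assms(2)]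
 have B: "0 <= B" "0 <= C" using bX[of 0] bY[of 0] nu_nonneg c by (meson order_trans)+
 fix n
 have "X n \<otimes> Y n \<ominus> X' n \<otimes> Y' n = X n \<otimes> (Y n \<ominus> Y' n) \<oplus> (X n \<ominus> X' n) \<otimes> Y' n"
  using c[of n] by (simp add: a_minus_def r_distr l_distr l_minus r_minus a_assoc r_neg1)
 then have "nu (X n \<otimes> Y n \<ominus> X' n \<otimes> Y' n) \<le>
  nu (X n \<otimes> (Y n \<ominus> Y' n)) + nu ((X n \<ominus> X' n) \<otimes> Y' n)"
  using c[of n] nu_add by simp
 also have "... <= nu (X n) * nu (Y n \<ominus> Y' n) + nu (X n \<ominus> X' n) * nu (Y' n)"
  using c[of n] by (intro add_mono nu_mult) auto
 also have "... <= B * nu (Y n \<ominus> Y' n) + nu (X n \<ominus> X' n) * C"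
  using bX bY c[of n] B by (intro add_mono mult_mono) auto
 finally show "nu (X n \<otimes> Y n \<ominus> X' n \<otimes> Y' n) \<le>
  B * nu (Y n \<ominus> Y' n) + nu (X n \<ominus> X' n) * C" .
qed (use asymD[OF assms(1)] asymD[OF assms(2)]
  in "auto intro!: tendsto_add_zero tendsto_mult_right_zero tendsto_mult_left_zero")

abbreviation conv :: "(nat => 'a) => 'a => bool" where
 "conv X x == asym X (%_. x)"

lemma asym_const_iff:
 "x : car A ==> y : car A ==> asym (%_. x) (%_. y) \<longleftrightarrow> nu (x \<ominus> y) = 0"
 by (auto simp: asym_def LIMSEQ_const_iff)

lemma cauchyD:
 assumes "X : cauchy_seqs A nu" "0 < e"
 obtains M where "!!m n. m >= M ==> n >= M ==> nu (X m \<ominus> X n) < e"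
 using assms unfolding cauchy_seqs_def by blast

lemma cauchy_bounded:
 assumes "X : cauchy_seqs A nu"
 obtains B where "!!n. nu (X n) <= B"
proof -
 have c: "X n : car A" for n using assms by (auto simp: cauchy_seqs_def)
 obtain M where M: "nu (X m \<ominus> X n) < 1" if "m >= M" "n >= M" for m n
  using cauchyD[OF assms, of 1] zero_less_one by metis
 define B where "B = Max ((%n. nu (X n)) ` {..M}) + 1"
 have le: "nu (X n) <= B - 1" if "n <= M" for n
  using that by (auto simp: B_def intro!: Max_ge)
 have "nu (X n) <= B" for n
 proof (cases "n <= M")
  case False
  then have "nu (X n \<ominus> X M) < 1" by (intro M) auto
  then show ?thesis using nu_le_add_diff[of "X n" "X M"] c le[of M] by fastforce
 qed (use le in fastforce)
 then show ?thesis using that by blast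
qed

lemma cauchy_asym:
 assumes X: "X : cauchy_seqs A nu" and "asym X Y"
 shows "Y : cauchy_seqs A nu"
 unfolding cauchy_seqs_def
proof (safe)
 note c = asymD(1,2)[OF assms(2)]
 fix e :: real assume e: "0 < e"
 have e3: "0 < e / 3" using e by simp
 obtain M where M: "!!m n. m >= M ==> n >= M ==> nu (X m \<ominus> X n) < e / 3"
  using cauchyD[OF X e3] by metis
 obtain L where L: "!!n. n >= L ==> nu (X n \<ominus> Y n) < e / 3"
  using order_tendstoD(2)[OF asymD(3)[OF assms(2)] e3] unfolding eventually_sequentially by blast
 have "nu (Y m \<ominus> Y n) < e" if "m >= max M L" "n >= max M L" for m n
 proof -
  have "nu (Y m \<ominus> Y n) <= nu (Y m \<ominus> X m) + (nu (X m \<ominus> X n) + nu (X n \<ominus> Y n))"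
  using nu_triangle[of "Y m" "X m" "Y n"] nu_triangle[of "X m" "X n" "Y n"] c by fastforce
  then show ?thesis
  using M[of m n] L[of m] L[of n] that nu_diff_commute[OF c(1)[of m] c(2)[of m]] by simp
 qed
 then show "EX M. ALL m>=M. ALL n>=M. nu (Y m \<ominus> Y n) < e" by blast
qed (use asymD[OF assms(2)] in auto)

lemma cauchy_const: "x : car A ==> (%_. x) : cauchy_seqs A nu"
 by (auto simp: cauchy_seqs_def a_minus_def r_neg)

lemma cauchy_conv: "conv X x ==> X : cauchy_seqs A nu"
 using cauchy_asym[OF cauchy_const asym_sym] asymD(2) by blast

lemma conv_bounded:
 assumes "conv X x" obtains B where "!!n. nu (X n) <= B"
 using cauchy_bounded[OF cauchy_conv[OF assms]] by blast

lemma conv_mult: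
 assumes "conv X x" "conv Y y" shows "conv (%n. X n \<otimes> Y n) (x \<otimes> y)"
proof -
 obtain B where "!!n. nu (X n) <= B" using conv_bounded[OF assms(1)] by blast
 from asym_mult[OF assms this, of "nu y"] show ?thesis by simp
qed

lemma cauchy_geometric:
 assumes c: "!!n. X n : car A" and step: "!!n. nu (X (Suc n) \<ominus> X n) <= C * \<rho> ^ n"
  and r: "0 <= \<rho>" "\<rho> < 1"
 shows "X : cauchy_seqs A nu"
proof -
 have "0 <= nu (X (Suc 0) \<ominus> X 0)" using c by simp
 with step[of 0] have C: "0 <= C" by simp
 have *: "nu (X (n + k) \<ominus> X n) <= C * \<rho> ^ n / (1 - \<rho>)" for n k
 proof -
  have "nu (X (n + k) \<ominus> X n) <= C * \<rho> ^ n * ((1 - \<rho> ^ k) / (1 - \<rho>))"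
  proof (induction k)
  case 0 then show ?case using c by (simp add: a_minus_def r_neg)
  next
  case (Suc k)
  have "nu (X (n + Suc k) \<ominus> X n) \<le>
  nu (X (Suc (n + k)) \<ominus> X (n + k)) + nu (X (n + k) \<ominus> X n)"
  using nu_triangle[of "X (n + Suc k)" "X (n + k)" "X n"] c by simp
  also have "... <= C * \<rho> ^ (n + k) + C * \<rho> ^ n * ((1 - \<rho> ^ k) / (1 - \<rho>))"
  by (intro add_mono step Suc)
  also have "... = C * \<rho> ^ n * ((1 - \<rho> ^ Suc k) / (1 - \<rho>))"
  using r by (simp add: field_simps power_add)
  finally show ?case .
  qed
  also have "... <= C * \<rho> ^ n * (1 / (1 - \<rho>))"
  using C r by (intro mult_left_mono divide_right_mono) auto
  finally show ?thesis by simp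
 qed
 have lim: "(%n. C * \<rho> ^ n / (1 - \<rho>)) \<longlonglongrightarrow> 0"
  using r by (intro tendsto_divide_zero tendsto_mult_right_zero LIMSEQ_power_zero) auto
 show ?thesis unfolding cauchy_seqs_def
 proof safe
  fix e :: real assume "0 < e"
  then obtain M where M: "!!n. n >= M ==> C * \<rho> ^ n / (1 - \<rho>) < e"
  using order_tendstoD(2)[OF lim, of e] unfolding eventually_sequentially by blast
  have "nu (X m \<ominus> X n) < e" if "m >= M" "n >= M" for m n
  proof (cases "n <= m")
  case True
  then show ?thesis using *[of n "m - n"] M[OF that(2)] by simp
  next
  case False
  then show ?thesis using *[of m "n - m"] M[OF that(1)] nu_diff_commute[of "X m" "X n"] c by simp
  qed
  then show "EX M. ALL m>=M. ALL n>=M. nu (X m \<ominus> X n) < e" by blast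
 qed (rule c)
qed

end

locale cstar_alg =
 fixes A :: "('a, 'm) cstar_algebra_scheme" (structure)
 assumes cstar_algebra: "is_cstar_algebra A"

sublocale cstar_alg \<subseteq> cstar_semi A "cnorm A"
 using cstar_algebra
 by unfold_locales (auto simp: is_cstar_algebra_def)

context cstar_alg
begin

lemma cnorm_zeroD: "x : car A ==> cnorm A x = 0 ==> x = \<zero>"
 using cstar_algebra by (auto simp: is_cstar_algebra_def)

lemma eq_if_cnorm_diff_zero:
 assumes "x : car A" "y : car A" "cnorm A (x \<ominus> y) = 0"
 shows "x = y"
proof -
 have "x \<ominus> y = \<zero>" using cnorm_zeroD[of "x \<ominus> y"] assms by simp
 moreover have "x = (x \<ominus> y) \<oplus> y" using assms(1,2) by (simp add: a_minus_def a_assoc l_neg)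
 ultimately show ?thesis using assms by simp
qed

lemma complete:
 assumes "X : cauchy_seqs A (cnorm A)" obtains x where "conv X x"
 using assms cstar_algebra unfolding is_cstar_algebra_def asym_def cauchy_seqs_def by blast

lemma conv_unique: "conv X x ==> conv X y ==> x = y"
 using asym_trans[OF asym_sym, of X "%_. x" "%_. y"] asym_const_iff[of x y] asymD(2)
 by (metis eq_if_cnorm_diff_zero)

lemma exact_sqrt:
 assumes y: "y : sa" and ny: "cnorm A y < 1"
 obtains c where "c : sa" "c \<otimes> c = \<one> \<ominus> y"
proof -
 note yc = saD(1)[OF y]
 interpret P: real_cstar_poly "%p. cnorm A (ev y p)" by (rule real_cstar_poly_ev[OF y])
 define r where "r = cnorm A y"
 have r: "0 <= r" "r < 1" using ny yc by (auto simp: r_def)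
 obtain s where s: "!!n. cnorm A (ev y (s (Suc n) - s n)) <= r ^ Suc n"
  "!!n. cnorm A (ev y ((1 - [:0,1:]) - s n * s n)) <= 2 * r ^ Suc n"
  using P.sqrt_sequence[of "[:0,1:]" r] yc r by (auto simp: r_def)
 define X where "X n = ev y (s n)" for n
 have Xc: "X n : car A" for n using yc by (simp add: X_def)
 have "X : cauchy_seqs A (cnorm A)"
  by (rule cauchy_geometric[of X r r]) (use s(1) yc r in "auto simp: X_def ev_diff")
 then obtain c where c: "conv X c" by (rule complete)
 have "star (X n) = X n" for n using star_ev[OF y] by (simp add: X_def)
 then have "conv X (star c)" using asym_star[OF c] by simp
 then have "star c = c" using c conv_unique by blast
 then have "c : sa" using asymD(2)[OF c] by (simp add: sa_def)
 have "conv (%n. X n \<otimes> X n) (c \<otimes> c)" by (rule conv_mult[OF c c])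
 moreover have "conv (%n. X n \<otimes> X n) (\<one> \<ominus> y)"
 proof (rule asymI[where f = "%n. 2 * r ^ Suc n"])
  fix n
  have "ev y ((1 - [:0,1:]) - s n * s n) = (\<one> \<ominus> y) \<ominus> X n \<otimes> X n"
  using yc by (simp only: ev_diff ev_mult ev_one ev_X X_def)
  then show "cnorm A (X n \<otimes> X n \<ominus> (\<one> \<ominus> y)) <= 2 * r ^ Suc n"
  using s(2)[of n] nu_diff_commute[of "X n \<otimes> X n" "\<one> \<ominus> y"] Xc yc by simp
  show "(%n. 2 * r ^ Suc n) \<longlonglongrightarrow> 0"
  using r by (intro tendsto_mult_right_zero LIMSEQ_Suc LIMSEQ_power_zero) auto
 qed (use Xc yc in auto)
 ultimately have "c \<otimes> c = \<one> \<ominus> y" by (rule conv_unique)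
 with \<open>c : sa\<close> show ?thesis by (rule that)
qed

end

subsection \<open>Star-subalgebras\<close>

lemma star_subalgebraD:
 assumes "star_subalgebra A S"
 shows "S <= car A" "\<one>\<^bsub>A\<^esub> : S" "x : S ==> y : S ==> x \<oplus>\<^bsub>A\<^esub> y : S"
  "x : S ==> y : S ==> x \<otimes>\<^bsub>A\<^esub> y : S" "x : S ==> c \<odot>\<^bsub>A\<^esub> x : S" "x : S ==> adj A x : S"
  "x : S ==> x : car A"
 using assms by (auto simp: star_subalgebra_def)

locale star_sub = star_alg A for A :: "('a, 'm) star_algebra_scheme" (structure) +
 fixes S :: "'a set"
 assumes sub: "star_subalgebra A S"
begin

lemmas subD [simp] = star_subalgebraD(2-)[OF sub]

abbreviation B where "B == A(|carrier := S|)"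

lemma zero_in [simp]: "\<zero> : S"
 using subD(4)[of \<one> 0] by simp

lemma minus_in [simp]: "x : S ==> \<ominus> x : S"
 using subD(4)[of x "-1"] by (simp add: smult_minus_one)

lemma diff_in [simp]: "x : S ==> y : S ==> x \<ominus> y : S"
 by (simp add: a_minus_def)

lemma sub_abelian: "abelian_group B"
proof (rule abelian_groupI)
 fix x assume "x : car B"
 then show "EX y:car B. y \<oplus>\<^bsub>B\<^esub> x = \<zero>\<^bsub>B\<^esub>" by (intro bexI[of _ "\<ominus> x"]) (auto simp: l_neg)
qed (auto simp: a_assoc intro: a_comm)

lemma sub_star_algebra: "is_star_algebra B"
proof -
 have "ring B"
  by (rule ringI[OF sub_abelian])
  (auto intro!: monoidI simp: m_assoc l_distr r_distr)
 moreover have "module complex_ring B"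
  using star_algebra sub_abelian unfolding is_star_algebra_def module_def
  by (auto simp: module_axioms_def smult_l_distr smult_r_distr smult_smult complex_ring_def)
 ultimately show ?thesis
  by (auto simp: is_star_algebra_def smult_mult_left smult_mult_right star_add star_mult star_smult)
qed

sublocale B: star_alg B by unfold_locales (rule sub_star_algebra)

lemma sub_minus: "x : S ==> \<ominus>\<^bsub>B\<^esub> x = \<ominus> x"
 by (rule B.minus_equality) (auto simp: l_neg)

lemma sub_diff: "x : S ==> y : S ==> x \<ominus>\<^bsub>B\<^esub> y = x \<ominus> y"
 by (simp add: a_minus_def sub_minus)

lemma sub_finsum:
 assumes "f : I \<rightarrow> S" shows "finsum B f I = finsum A f I"
proof (cases "finite I")
 case True
 then show ?thesis using assms
 proof (induction I)
  case (insert i I)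
  then have "f : I \<rightarrow> S" "f i : S" by auto
  moreover from this have "f : I \<rightarrow> car A" using subD(6) by blast
  ultimately show ?case using insert by simp
 qed simp
qed (simp add: finsum_infinite B.finsum_infinite)

lemma finsum_in:
 assumes "f : I \<rightarrow> S" shows "finsum A f I : S"
 using B.finsum_closed[of f I] assms sub_finsum[OF assms] by simp

lemma sub_seminorm: "cstar_seminorm A nu ==> cstar_seminorm B nu"
 by (auto simp: cstar_seminorm_def)

lemma sub_cauchy_seqs: "cauchy_seqs B nu = {X : cauchy_seqs A nu. ALL n. X n : S}"
 by (auto simp: cauchy_seqs_def sub_diff)

end

locale cstar_sub = cstar_alg A for A :: "('a, 'm) cstar_algebra_scheme" (structure) +
 fixes S :: "'a set"
 assumes sub: "star_subalgebra A S" and closed: "norm_closed A S"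

sublocale cstar_sub \<subseteq> star_sub A S
 by unfold_locales (rule sub)

context cstar_sub
begin

lemma sub_cstar_algebra: "is_cstar_algebra B"
 unfolding is_cstar_algebra_def
proof (intro conjI ballI impI)
 show "cstar_seminorm B (cnorm B)" using sub_seminorm[OF cstar_seminorm] by simp
 fix X assume "X : cauchy_seqs B (cnorm B)"
 then have X: "X : cauchy_seqs A (cnorm A)" "!!n. X n : S" by (auto simp: sub_cauchy_seqs)
 obtain x where x: "conv X x" using complete[OF X(1)] .
 then have "x : S" using closed X(2) unfolding norm_closed_def asym_def by blast
 then show "EX x:car B. (%n. cnorm B (X n \<ominus>\<^bsub>B\<^esub> x)) \<longlonglongrightarrow> 0"
  using x X(2) by (auto simp: sub_diff asym_def)
qed (use sub_star_algebra cnorm_zeroD in auto)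

sublocale B: cstar_alg B by unfold_locales (rule sub_cstar_algebra)

end

section \<open>Positive functionals\<close>

locale pos_fun = star_alg A for A :: "('a, 'm) star_algebra_scheme" (structure) +
 fixes Ph :: "'a => complex"
 assumes Phi_add: "x : car A ==> y : car A ==> Ph (x \<oplus> y) = Ph x + Ph y"
  and Phi_smult: "x : car A ==> Ph (c \<odot> x) = c * Ph x"
  and Phi_pos: "x : car A ==> Ph (star x \<otimes> x) : \<real>\<^sub>\<ge>\<^sub>0"
begin

lemma Phi_zero [simp]: "Ph \<zero> = 0"
 using Phi_smult[of \<zero> 0] by simp

lemma Phi_minus: "x : car A ==> Ph (\<ominus> x) = - Ph x"
 using Phi_smult[of x "-1"] by (simp add: smult_minus_one)

lemma Phi_diff: "x : car A ==> y : car A ==> Ph (x \<ominus> y) = Ph x - Ph y"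
 by (simp add: a_minus_def Phi_add Phi_minus)

lemma Phi_pos': "x : car A ==> Im (Ph (star x \<otimes> x)) = 0 & Re (Ph (star x \<otimes> x)) >= 0"
 using Phi_pos[of x] by (auto simp: complex_nonneg_Reals_iff)

lemma Phi_expand:
 assumes "x : car A" "y : car A"
 shows "Ph (star (x \<oplus> c \<odot> y) \<otimes> (x \<oplus> c \<odot> y)) =
  Ph (star x \<otimes> x) + c * Ph (star x \<otimes> y) + cnj c * Ph (star y \<otimes> x) + (cnj c * c) * Ph (star y \<otimes> y)"
 using assms
 by (simp add: star_add star_smult l_distr r_distr smult_mult_left smult_mult_right smult_smult
  Phi_add Phi_smult smult_r_distr)

lemma Phi_hermitian:
 assumes "x : car A" "y : car A"
 shows "Ph (star y \<otimes> x) = cnj (Ph (star x \<otimes> y))"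
proof -
 have "Im (Ph (star (x \<oplus> c \<odot> y) \<otimes> (x \<oplus> c \<odot> y))) = 0" for c using Phi_pos' assms by simp
 from this[of 1] this[of \<i>] show ?thesis
  unfolding Phi_expand[OF assms] using Phi_pos'[OF assms(1)] Phi_pos'[OF assms(2)]
  by (auto simp: complex_eq_iff)
qed

lemma Phi_star: "x : car A ==> Ph (star x) = cnj (Ph x)"
 using Phi_hermitian[of \<one> x] by simp

lemma Phi_sa: "x : sa ==> Im (Ph x) = 0"
 using Phi_star[of x] by (simp add: sa_def complex_eq_iff)

definition q :: "'a => real" where
 "q x = Re (Ph (star x \<otimes> x))"

lemma q_nonneg: "x : car A ==> 0 <= q x"
 using Phi_pos' by (simp add: q_def)

lemma Phi_q: "x : car A ==> Ph (star x \<otimes> x) = complex_of_real (q x)"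
 using Phi_pos' by (simp add: q_def complex_eq_iff)

lemma cauchy_schwarz:
 assumes "x : car A" "y : car A"
 shows "(cmod (Ph (star x \<otimes> y)))\<^sup>2 <= q x * q y"
proof -
 define c where "c = Ph (star x \<otimes> y)"
 have main: "0 <= q x - 2 * t * (cmod c)\<^sup>2 + t\<^sup>2 * (cmod c)\<^sup>2 * q y" for t :: real
 proof -
  define d where "d = - complex_of_real t * cnj c"
  have cc: "c * cnj c = complex_of_real ((cmod c)\<^sup>2)" by (rule complex_norm_square[symmetric])
  have dc: "d * c = - complex_of_real (t * (cmod c)\<^sup>2)" "cnj d * cnj c = - complex_of_real (t * (cmod c)\<^sup>2)"
  "cnj d * d = complex_of_real (t\<^sup>2 * (cmod c)\<^sup>2)"
  using cc by (simp_all add: d_def power2_eq_square algebra_simps)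
  have "Ph (star (x \<oplus> d \<odot> y) \<otimes> (x \<oplus> d \<odot> y)) =
  Ph (star x \<otimes> x) + d * c + cnj d * cnj c + (cnj d * d) * Ph (star y \<otimes> y)"
  unfolding Phi_expand[OF assms] by (simp add: c_def Phi_hermitian[OF assms])
  also have "... = complex_of_real (q x - 2 * t * (cmod c)\<^sup>2 + t\<^sup>2 * (cmod c)\<^sup>2 * q y)"
  unfolding dc Phi_q[OF assms(1)] Phi_q[OF assms(2)] by simp
  finally show ?thesis using Phi_pos'[of "x \<oplus> d \<odot> y"] assms by simp
 qed
 show ?thesis
 proof (cases "q y = 0")
  case True
  have "(cmod c)\<^sup>2 = 0"
  proof (rule ccontr)
  assume "(cmod c)\<^sup>2 ~= 0"
  then have p: "(cmod c)\<^sup>2 > 0" by simp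
  have "0 <= q x - 2 * ((q x + 1) / (2 * (cmod c)\<^sup>2)) * (cmod c)\<^sup>2"
  using main[of "(q x + 1) / (2 * (cmod c)\<^sup>2)"] True by simp
  moreover have "2 * ((q x + 1) / (2 * (cmod c)\<^sup>2)) * (cmod c)\<^sup>2 = q x + 1"
  using p by (simp add: field_simps)
  ultimately show False by linarith
  qed
  then show ?thesis using True c_def by simp
 next
  case False
  then have p: "q y > 0" using q_nonneg[OF assms(2)] by simp
  have "0 <= q x - (cmod c)\<^sup>2 / q y"
  using main[of "1 / q y"] p by (simp add: power2_eq_square)
  then show ?thesis using p unfolding c_def by (simp add: field_simps)
 qed
qed

lemma sqrt_q_triangle:
 assumes "x : car A" "y : car A"
 shows "sqrt (q (x \<oplus> y)) <= sqrt (q x) + sqrt (q y)"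
proof (rule real_le_lsqrt)
 have "Ph (star (x \<oplus> y) \<otimes> (x \<oplus> y)) =
  Ph (star x \<otimes> x) + Ph (star x \<otimes> y) + cnj (Ph (star x \<otimes> y)) + Ph (star y \<otimes> y)"
  using Phi_expand[OF assms, of 1] assms Phi_hermitian[OF assms] by simp
 then have "q (x \<oplus> y) = q x + 2 * Re (Ph (star x \<otimes> y)) + q y"
  by (simp add: q_def)
 also have "... <= q x + 2 * (sqrt (q x) * sqrt (q y)) + q y"
 proof -
  have "cmod (Ph (star x \<otimes> y)) <= sqrt (q x * q y)"
  by (rule real_le_rsqrt[OF cauchy_schwarz[OF assms]])
  then show ?thesis using complex_Re_le_cmod[of "Ph (star x \<otimes> y)"] by (simp add: real_sqrt_mult)
 qed
 also have "... = (sqrt (q x) + sqrt (q y))\<^sup>2"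
  using q_nonneg assms by (simp add: power2_sum)
 finally show "q (x \<oplus> y) <= (sqrt (q x) + sqrt (q y))\<^sup>2" .
qed (use q_nonneg assms in auto)

lemma q_smult: "x : car A ==> q (c \<odot> x) = (cmod c)\<^sup>2 * q x"
proof -
 assume x: "x : car A"
 have "Ph (star (c \<odot> x) \<otimes> (c \<odot> x)) = (c * cnj c) * Ph (star x \<otimes> x)"
  using x by (simp add: star_smult smult_mult_left smult_mult_right smult_smult Phi_smult)
 also have "... = complex_of_real ((cmod c)\<^sup>2 * q x)"
  unfolding complex_norm_square[symmetric] Phi_q[OF x] by simp
 finally show ?thesis unfolding q_def by (simp only: Re_complex_of_real)
qed

end

lemma (in star_alg) pos_fun_state: "is_state A ph ==> pos_fun A ph"
 by unfold_locales (auto simp: is_state_def)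

text \<open>For \<open>M > \<parallel>y\<parallel>\<close> the element \<open>M - y\<close> is approximated by squares of self-adjoint elements.\<close>

lemma (in cstar_alg) pos_fun_bound:
 assumes "pos_fun A Ph" and y: "y : sa"
 shows "Re (Ph y) <= cnorm A y * Re (Ph \<one>)"
proof -
 interpret pos_fun A Ph by fact
 note yc = saD(1)[OF y]
 have p1: "0 <= Re (Ph \<one>)" using Phi_pos'[of \<one>] by simp
 have *: "Re (Ph y) <= M * Re (Ph \<one>)" if M: "M > cnorm A y" for M
 proof -
  have M0: "M > 0" using M nu_nonneg[OF yc] by linarith
  define z where "z = complex_of_real (1 / M) \<odot> y"
  have "z : sa" using y by (simp add: z_def sa_def star_smult)
  moreover have "cnorm A z < 1" using M M0 yc by (simp add: z_def nu_smult norm_divide)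
  ultimately obtain c where c: "c : sa" "c \<otimes> c = \<one> \<ominus> z" by (rule exact_sqrt)
  have "0 <= Re (Ph (\<one> \<ominus> z))" using Phi_pos'[of c] c saD[OF c(1)] by simp
  then have "Re (Ph z) <= Re (Ph \<one>)" using \<open>z : sa\<close> saD(1) by (simp add: Phi_diff)
  then show ?thesis using M0 yc by (simp add: z_def Phi_smult field_simps)
 qed
 show ?thesis
 proof (rule field_le_epsilon)
  fix e :: real assume e: "0 < e"
  have "Re (Ph y) <= (cnorm A y + e / (Re (Ph \<one>) + 1)) * Re (Ph \<one>)"
  using e p1 by (intro *) auto
  also have "... <= cnorm A y * Re (Ph \<one>) + e"
  using e p1 by (simp add: field_simps)
  finally show "Re (Ph y) <= cnorm A y * Re (Ph \<one>) + e" .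
 qed
qed

section \<open>Extension of states from C*-subalgebras\<close>

context star_alg
begin

abbreviation rscale :: "real => 'a => 'a" where "rscale t x == complex_of_real t \<odot> x"

lemma sa_closed [simp]:
 "x : sa ==> y : sa ==> x \<oplus> y : sa" "x : sa ==> rscale t x : sa" "\<zero> : sa" "\<one> : sa"
 "x : sa ==> \<ominus> x : sa" "x : sa ==> y : sa ==> x \<ominus> y : sa" "x : sa ==> x : car A"
 by (auto simp: sa_def star_add star_smult star_minus star_diff)

definition sublinear :: "('a => real) => bool" where
 "sublinear q \<longleftrightarrow> (ALL x:sa. ALL y:sa. q (x \<oplus> y) <= q x + q y) &
  (ALL x:sa. ALL t>=0. q (rscale t x) = t * q x) & (ALL x. x ~: sa --> q x = 0)"

lemma sublinearD:
 assumes "sublinear q"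
 shows "x : sa ==> y : sa ==> q (x \<oplus> y) <= q x + q y" "x : sa ==> t >= 0 ==> q (rscale t x) = t * q x"
  "x ~: sa ==> q x = 0"
 using assms by (auto simp: sublinear_def)

lemma sublinear_zero: "sublinear q ==> q \<zero> = 0"
 using sublinearD(2)[of q \<zero> 0] by simp

lemma sublinear_minus:
 assumes "sublinear q" "x : sa" shows "- q (\<ominus> x) <= q x"
 using sublinearD(1)[OF assms(1), of x "\<ominus> x"] assms sublinear_zero[OF assms(1)] by (simp add: r_neg)

text \<open>The construction that makes minimal functionals linear and that forces a minimal functional below it to attain the
prescribed values \<open>r\<close> at the vectors \<open>v\<close>.\<close>

lemma sublinear_shift:
 assumes q: "sublinear q" and W: "!!v r. (v, r) : W ==> v : sa & r <= q v"
  and W0: "(\<zero>, 0) : W"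
  and Wadd: "!!v r v' r'. (v, r) : W ==> (v', r') : W ==> (v \<oplus> v', r + r') : W"
  and Wscale: "!!v r t. (v, r) : W ==> t > 0 ==> (rscale t v, t * r) : W"
 obtains q' where "sublinear q'" "!!v r x. (v, r) : W ==> x : sa ==> q' x <= q (x \<oplus> v) - r"
proof -
 define F where "F x = (%(v, r). q (x \<oplus> v) - r) ` W" for x
 define q' where "q' x = (if x : sa then Inf (F x) else 0)" for x
 have ne: "F x ~= {}" for x using W0 by (auto simp: F_def)
 have lower: "- q (\<ominus> x) <= z" if x: "x : sa" and z: "z : F x" for x z
 proof -
  obtain v r where vr: "(v, r) : W" "z = q (x \<oplus> v) - r" using z by (auto simp: F_def)
  have v: "v : sa" "r <= q v" using W[OF vr(1)] by auto
  have "v = (x \<oplus> v) \<oplus> \<ominus> x" using x v by (simp add: a_comm[of x v] a_assoc r_neg)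
  then have "q v <= q (x \<oplus> v) + q (\<ominus> x)" using sublinearD(1)[OF q, of "x \<oplus> v" "\<ominus> x"] x v by simp
  then show ?thesis using v vr by simp
 qed
 have bdd: "bdd_below (F x)" if "x : sa" for x using lower[OF that] by (rule bdd_belowI)
 have le: "q' x <= q (x \<oplus> v) - r" if "(v, r) : W" "x : sa" for x v r
  using that by (auto simp: q'_def F_def intro!: cInf_lower bdd[unfolded F_def])
 have greatest: "b <= q' x" if "x : sa" "!!v r. (v, r) : W ==> b <= q (x \<oplus> v) - r" for x b
  using that ne[of x] by (auto simp: q'_def F_def intro!: cInf_greatest)
 have "sublinear q'" unfolding sublinear_def
 proof (intro conjI ballI allI impI)
  fix x y assume x: "x : sa" and y: "y : sa"
  have "q' (x \<oplus> y) - q' y <= q' x"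
  proof (rule greatest[OF x])
  fix v r assume vr: "(v, r) : W"
  have "q' (x \<oplus> y) - (q (x \<oplus> v) - r) <= q' y"
  proof (rule greatest[OF y])
  fix v' r' assume vr': "(v', r') : W"
  have v: "v : sa" "v' : sa" using W vr vr' by auto
  have "q' (x \<oplus> y) <= q ((x \<oplus> y) \<oplus> (v \<oplus> v')) - (r + r')"
  using Wadd[OF vr vr'] x y by (intro le) auto
  also have "(x \<oplus> y) \<oplus> (v \<oplus> v') = (x \<oplus> v) \<oplus> (y \<oplus> v')" using x y v by (simp add: a_ac)
  also have "q ... <= q (x \<oplus> v) + q (y \<oplus> v')" using x y v by (intro sublinearD(1)[OF q]) auto
  finally show "q' (x \<oplus> y) - (q (x \<oplus> v) - r) <= q (y \<oplus> v') - r'" by simp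
  qed
  then show "q' (x \<oplus> y) - q' y <= q (x \<oplus> v) - r" by simp
  qed
  then show "q' (x \<oplus> y) <= q' x + q' y" by simp
 next
  fix x and t :: real assume x: "x : sa" and t: "0 <= t"
  have half: "q' (rscale t x) <= t * q' x" if x: "x : sa" and t: "t > 0" for x t
  proof -
  have "q' (rscale t x) / t <= q' x"
  proof (rule greatest[OF x])
  fix v r assume vr: "(v, r) : W"
  have v: "v : sa" using W vr by auto
  have "q' (rscale t x) <= q (rscale t x \<oplus> rscale t v) - t * r"
  using Wscale[OF vr t] x by (intro le) auto
  also have "rscale t x \<oplus> rscale t v = rscale t (x \<oplus> v)" using x v by (simp add: smult_r_distr)
  also have "q ... = t * q (x \<oplus> v)" using x v t by (intro sublinearD(2)[OF q]) auto
  finally show "q' (rscale t x) / t <= q (x \<oplus> v) - r" using t by (simp add: field_simps)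
  qed
  then show ?thesis using t by (simp add: field_simps)
  qed
  show "q' (rscale t x) = t * q' x"
  proof (cases "t = 0")
  case True
  have "q' \<zero> <= 0" using le[OF W0, of \<zero>] sublinear_zero[OF q] by simp
  moreover have "0 <= q' \<zero>" using W by (intro greatest) auto
  ultimately show ?thesis using True x by simp
  next
  case False
  then have t: "t > 0" using t by simp
  have "rscale (1 / t) (rscale t x) = x" using t x by (simp add: smult_smult)
  then have "q' x <= 1 / t * q' (rscale t x)" using half[of "rscale t x" "1 / t"] x t by simp
  then have "t * q' x <= q' (rscale t x)" using t by (simp add: field_simps)
  then show ?thesis using half[OF x t] by simp
  qed
 qed (simp add: q'_def)
 then show ?thesis using le by (rule that)
qed

text \<open>Zorn's lemma; the pointwise infimum of a chain is finite because \<open>q x \<ge> - q (- x) \<ge> - q0 (- x)\<close>.\<close>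

lemma minimal_sublinear:
 assumes q0: "sublinear q0"
 obtains m where "sublinear m" "!!x. x : sa ==> m x <= q0 x"
  "!!m' x. sublinear m' ==> (!!x. x : sa ==> m' x <= m x) ==> x : sa ==> m' x = m x"
proof -
 define Q where "Q = {q. sublinear q & (ALL x:sa. q x <= q0 x)}"
 define r where "r = {(p, q). p : Q & q : Q & (ALL x:sa. q x <= p x)}"
 have F: "Field r = Q" by (auto simp: r_def Field_def)
 have po: "Partial_order r"
  unfolding partial_order_on_def preorder_on_def F
 proof (intro conjI)
  show "antisym r"
  proof (rule antisymI)
  fix p q assume *: "(p, q) : r" "(q, p) : r"
  show "p = q"
  proof
  fix x
  show "p x = q x" using * by (cases "x : sa") (auto simp: r_def Q_def sublinear_def intro: antisym)
  qed
  qed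
 qed (fastforce simp: r_def refl_on_def trans_def intro: order_trans)+
 have chain: "EX u:Field r. ALL a:C. (a, u) : r" if C: "C : Chains r" for C
 proof (cases "C = {}")
  case True
  then show ?thesis unfolding F Q_def using q0 by auto
 next
  case False
  have CQ: "C <= Q" using C by (auto simp: Chains_def r_def)
  have tot: "(ALL x:sa. p x <= q x) | (ALL x:sa. q x <= p x)" if "p : C" "q : C" for p q
  using C that by (fastforce simp: Chains_def r_def)
  define u where "u x = (if x : sa then INF q\<in>C. q x else 0)" for x
  have low: "- q0 (\<ominus> x) <= q x" if "x : sa" "q : C" for x q
  proof -
  have "sublinear q" "q (\<ominus> x) <= q0 (\<ominus> x)" using CQ that by (auto simp: Q_def)
  then show ?thesis using sublinear_minus[of q x] that by simp
  qed
  have bdd: "bdd_below ((%q. q x) ` C)" if "x : sa" for x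
  using low[OF that] by (intro bdd_belowI2) auto
  have ule: "u x <= q x" if "x : sa" "q : C" for x q
  using that bdd by (auto simp: u_def intro: cINF_lower)
  have ugr: "b <= u x" if "x : sa" "!!q. q : C ==> b <= q x" for b x
  using that False by (auto simp: u_def intro: cINF_greatest)
  have "sublinear u" unfolding sublinear_def
  proof (intro conjI ballI allI impI)
  fix x y assume x: "x : sa" and y: "y : sa"
  have "u (x \<oplus> y) - u y <= u x"
  proof (rule ugr[OF x])
  fix p assume p: "p : C"
  have "u (x \<oplus> y) - p x <= u y"
  proof (rule ugr[OF y])
  fix p' assume p': "p' : C"
  obtain s where s: "s : C" "s x <= p x" "s y <= p' y"
  using tot[OF p p'] p p' x y by (meson order_refl)
  have "u (x \<oplus> y) <= s (x \<oplus> y)" using s x y by (intro ule) auto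
  also have "... <= s x + s y" using s CQ x y by (intro sublinearD) (auto simp: Q_def)
  finally show "u (x \<oplus> y) - p x <= p' y" using s by linarith
  qed
  then show "u (x \<oplus> y) - u y <= p x" by simp
  qed
  then show "u (x \<oplus> y) <= u x + u y" by simp
  next
  fix x and t :: real assume x: "x : sa" and t: "0 <= t"
  have hom: "q (rscale t x) = t * q x" if "q : C" for q
  using CQ that x t by (auto simp: Q_def sublinear_def)
  show "u (rscale t x) = t * u x"
  proof (cases "t = 0")
  case True
  obtain q where "q : C" using False by blast
  have q0: "q \<zero> = 0" if "q : C" for q using CQ that sublinear_zero by (auto simp: Q_def)
  have "u \<zero> <= 0" using ule[of \<zero> q] q0[OF \<open>q : C\<close>] \<open>q : C\<close> by simp
  moreover have "0 <= u \<zero>" by (rule ugr) (simp_all add: q0)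
  ultimately have "u \<zero> = 0" by simp
  then show ?thesis using True x by simp
  next
  case False
  then have tp: "t > 0" using t by simp
  show ?thesis
  proof (rule antisym)
  have "u (rscale t x) / t <= q x" if "q : C" for q
  using ule[of "rscale t x" q] x hom[OF that] tp that by (simp add: field_simps)
  then have "u (rscale t x) / t <= u x" by (rule ugr[OF x])
  then show "u (rscale t x) <= t * u x" using tp by (simp add: field_simps)
  have "t * u x <= q (rscale t x)" if "q : C" for q
  unfolding hom[OF that] using ule[OF x that] tp by simp
  then show "t * u x <= u (rscale t x)"
  using ugr[OF sa_closed(2)[OF x], of "t * u x" t] by blast
  qed
  qed
  qed (simp add: u_def)
  moreover have "u x <= q0 x" if "x : sa" for x
  proof -
  obtain q where "q : C" using False by blast
  then have "u x <= q x" "q x <= q0 x" using ule that CQ by (auto simp: Q_def)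
  then show ?thesis by simp
  qed
  ultimately have "u : Q" by (simp add: Q_def)
  moreover have "(a, u) : r" if "a : C" for a
  using that CQ ule[OF _ that] \<open>u : Q\<close> unfolding r_def by blast
  ultimately show ?thesis unfolding F by blast
 qed
 have "EX m:Field r. ALL a:Field r. (m, a) : r --> a = m"
  by (rule Zorns_po_lemma[OF po chain])
 then obtain m where m: "m : Q" "!!a. a : Q ==> (m, a) : r ==> a = m"
  unfolding F by blast
 show ?thesis
 proof (rule that[of m])
  fix m' x assume m': "sublinear m'" "!!x. x : sa ==> m' x <= m x"
  then have "m' : Q" using m(1) unfolding Q_def by (blast intro: order_trans)
  moreover from this have "(m, m') : r" using m(1) m'(2) unfolding r_def by blast
  ultimately show "m' x = m x" using m(2) by blast
 qed (use m in "auto simp: Q_def")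
qed

lemma minimal_sublinear_additive:
 assumes m: "sublinear m"
  and min: "!!m' x. sublinear m' ==> (!!x. x : sa ==> m' x <= m x) ==> x : sa ==> m' x = m x"
  and x: "x : sa" and y: "y : sa"
 shows "m (x \<oplus> y) = m x + m y"
proof -
 define W where "W = {(rscale t y, t * m y) | t::real. t >= 0}"
 obtain q where q: "sublinear q" "!!v r x. (v, r) : W ==> x : sa ==> q x <= m (x \<oplus> v) - r"
 proof (rule sublinear_shift[OF m, of W])
  fix v r v' r' assume "(v, r) : W" "(v', r') : W"
  then obtain t t' where t: "t >= 0" "t' >= 0" "v = rscale t y" "r = t * m y" "v' = rscale t' y" "r' = t' * m y"
  by (auto simp: W_def)
  then show "(v \<oplus> v', r + r') : W" unfolding W_def
  using y smult_l_distr[of y "complex_of_real t" "complex_of_real t'"]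
  by (auto intro!: exI[of _ "t + t'"] simp: distrib_right)
 next
  fix v r and s :: real assume "(v, r) : W" "s > 0"
  then obtain t where t: "t >= 0" "v = rscale t y" "r = t * m y" by (auto simp: W_def)
  then show "(rscale s v, s * r) : W" unfolding W_def
  using y \<open>s > 0\<close> by (auto intro!: exI[of _ "s * t"] simp: smult_smult)
 qed (use y sublinearD(2)[OF m y] in "auto simp: W_def intro!: exI[of _ 0]")
 have "(\<zero>, 0) : W" using y by (auto simp: W_def intro!: exI[of _ 0])
 from q(2)[OF this] have "q x <= m x" if "x : sa" for x using that by fastforce
 then have "q x = m x" by (rule min[OF q(1) _ x])
 moreover have "(y, m y) : W" using y by (auto simp: W_def intro!: exI[of _ 1])
 ultimately have "m x <= m (x \<oplus> y) - m y" using q(2) x by fastforce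
 then show ?thesis using sublinearD(1)[OF m x y] by simp
qed

text \<open>A minimal sublinear functional is linear; minimal ones exist by Zorn's lemma.\<close>

theorem hahn_banach:
 assumes q: "sublinear q0" and S: "S <= sa" "\<zero> : S" "!!x y. x : S ==> y : S ==> x \<oplus> y : S"
  "!!x t. x : S ==> rscale t x : S"
  and g: "!!x y. x : S ==> y : S ==> g (x \<oplus> y) = g x + g y" "!!x t. x : S ==> g (rscale t x) = t * g x"
  and le: "!!x. x : S ==> g x <= q0 x"
 obtains m :: "'a => real" where "!!x y. x : sa ==> y : sa ==> m (x \<oplus> y) = m x + m y"
  "!!x t. x : sa ==> m (rscale t x) = t * m x" "!!x. x : sa ==> m x <= q0 x" "!!x. x : S ==> m x = g x"
proof -
 have g0: "g \<zero> = 0" using g(2)[OF S(2), of 0] by simp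
 define W where "W = {(v, g v) | v. v : S}"
 obtain q where q1: "sublinear q"
  and q2: "!!v r x. (v, r) : W ==> x : sa ==> q x <= q0 (x \<oplus> v) - r"
 proof (rule sublinear_shift[OF q, of W])
  show "v : sa & r <= q0 v" if "(v, r) : W" for v r using that S(1) le by (auto simp: W_def)
  show "(\<zero>, 0) : W" using S(2) g0 by (force simp: W_def)
  show "(v \<oplus> v', r + r') : W" if "(v, r) : W" "(v', r') : W" for v r v' r'
  using that S(3)[of v v'] g(1)[of v v'] by (auto simp: W_def)
  show "(rscale t v, t * r) : W" if "(v, r) : W" "t > 0" for v r t
  using that S(4)[of v t] g(2)[of v t] by (auto simp: W_def)
 qed blast
 have q': "q x <= q0 (x \<oplus> v) - g v" if "v : S" "x : sa" for v x
  using q2[of v "g v" x] that by (auto simp: W_def)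
 obtain m where m: "sublinear m" "!!x. x : sa ==> m x <= q x"
  and min: "!!m' x. sublinear m' ==> (!!x. x : sa ==> m' x <= m x) ==> x : sa ==> m' x = m x"
  using minimal_sublinear[OF q1] by blast
 have add: "m (x \<oplus> y) = m x + m y" if "x : sa" "y : sa" for x y
  by (rule minimal_sublinear_additive[OF m(1) _ that]) (rule min)
 have neg: "m (\<ominus> x) = - m x" if "x : sa" for x
  using add[OF that, of "\<ominus> x"] that sublinear_zero[OF m(1)] by (simp add: r_neg)
 have hom: "m (rscale t x) = t * m x" if x: "x : sa" for x t
 proof (cases "t >= 0")
  case False
  then have "m (rscale (- t) x) = - t * m x" using sublinearD(2)[OF m(1) x, of "- t"] by simp
  then show ?thesis using neg[of "rscale t x"] x by (simp add: smult_minus_left)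
 qed (use sublinearD(2)[OF m(1) x] in simp)
 have mq0: "m x <= q0 x" if "x : sa" for x
  using q'[OF S(2) that] m(2)[OF that] that g0 by simp
 have mg: "m x <= g x" if x: "x : S" for x
 proof -
  have xs: "x : sa" "x : car A" using x S(1) by auto
  have "\<ominus> x : S" "g (\<ominus> x) = - g x"
  using S(4)[OF x, of "-1"] g(2)[OF x, of "-1"] xs by (simp_all add: smult_minus_one)
  then have "q x <= q0 (x \<oplus> \<ominus> x) + g x" using q'[of "\<ominus> x" x] xs by simp
  then show ?thesis using m(2)[of x] xs sublinear_zero[OF q] by (simp add: r_neg)
 qed
 have mx: "m x = g x" if x: "x : S" for x
 proof -
  have xs: "x : sa" "x : car A" using x S(1) by auto
  have "\<ominus> x : S" "g (\<ominus> x) = - g x"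
  using S(4)[OF x, of "-1"] g(2)[OF x, of "-1"] xs by (simp_all add: smult_minus_one)
  then show ?thesis using mg[OF x] mg[of "\<ominus> x"] neg[OF xs(1)] by simp
 qed
 show ?thesis by (rule that[OF add hom mq0 mx])
qed

definition re :: "'a => 'a" where "re x = (1/2) \<odot> (x \<oplus> star x)"
definition im :: "'a => 'a" where "im x = (- \<i>/2) \<odot> (x \<ominus> star x)"

lemma re_sa [simp]: "x : car A ==> re x : sa"
 by (simp add: re_def sa_def star_smult star_add a_comm del: sa_closed)

lemma im_sa [simp]: "x : car A ==> im x : sa"
proof -
 assume x: "x : car A"
 have "star x \<ominus> x = \<ominus> (x \<ominus> star x)" using x by (simp add: a_minus_def minus_add a_comm)
 then show ?thesis
  using x smult_minus_left[of "x \<ominus> star x" "\<i>/2"]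
  by (simp add: im_def sa_def star_minus star_smult star_diff smult_minus_right smult_minus_left minus_minus del: sa_closed)
qed

lemma re_im: 
 assumes "x : car A" shows "x = re x \<oplus> \<i> \<odot> im x"
proof -
 have "re x \<oplus> \<i> \<odot> im x = (1/2) \<odot> ((x \<oplus> star x) \<oplus> (x \<ominus> star x))"
  using assms by (simp add: re_def im_def smult_smult smult_r_distr)
 also have "(x \<oplus> star x) \<oplus> (x \<ominus> star x) = 2 \<odot> x"
  using assms a_lcomm[of "star x" x "\<ominus> star x"]
  by (simp add: smult_two a_minus_def a_assoc r_neg)
 finally show ?thesis using assms by (simp add: smult_smult)
qed

lemma re_add: "x : car A ==> y : car A ==> re (x \<oplus> y) = re x \<oplus> re y"
 by (simp add: re_def star_add smult_r_distr a_ac)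

lemma im_add: "x : car A ==> y : car A ==> im (x \<oplus> y) = im x \<oplus> im y"
 by (simp add: im_def star_add smult_r_distr a_minus_def minus_add a_ac)

lemma smult_combine:
 "x : car A ==> y : car A ==>
  (a \<odot> x \<oplus> b \<odot> y) \<oplus> (c \<odot> x \<oplus> d \<odot> y) = (a + c) \<odot> x \<oplus> (b + d) \<odot> y"
 by (simp add: smult_l_distr a_ac)

lemma re_alt: "x : car A ==> re x = (1/2) \<odot> x \<oplus> (1/2) \<odot> star x"
 by (simp add: re_def smult_r_distr)

lemma im_alt:
 assumes "x : car A" shows "im x = (- \<i>/2) \<odot> x \<oplus> (\<i>/2) \<odot> star x"
proof -
 have "im x = (- \<i>/2) \<odot> x \<oplus> (- \<i>/2) \<odot> ((- 1) \<odot> star x)"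
  using assms by (simp add: im_def a_minus_def smult_r_distr smult_minus_one)
 then show ?thesis using assms by (simp only: smult_smult star_closed) simp
qed

lemma re_smult:
 "x : car A ==> re (c \<odot> x) = rscale (Re c) (re x) \<oplus> rscale (- Im c) (im x)"
proof -
 assume x: "x : car A"
 have c: "complex_of_real (Re c) * (1/2) + complex_of_real (- Im c) * (- \<i>/2) = 1/2 * c"
  "complex_of_real (Re c) * (1/2) + complex_of_real (- Im c) * (\<i>/2) = 1/2 * cnj c"
  by (simp_all add: complex_eq_iff)
 show ?thesis
  unfolding re_alt[OF x] im_alt[OF x] re_alt[OF smult_closed[OF x]] star_smult[OF x]
  using x by (simp only: smult_r_distr smult_smult smult_closed star_closed smult_combine c)
qed

lemma im_smult:
 assumes x: "x : car A"
 shows "im (c \<odot> x) = rscale (Re c) (im x) \<oplus> rscale (Im c) (re x)"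
proof -
 have im_re: "im y = re ((- \<i>) \<odot> y)" if "y : car A" for y
  using that by (simp add: im_alt re_alt star_smult smult_smult)
 show ?thesis
  using x re_smult[OF x, of "- \<i> * c"] by (simp add: im_re[of "c \<odot> x"] smult_smult a_comm)
qed

lemma re_im_of_sa:
 assumes "x : sa" shows "re x = x" "im x = \<zero>"
proof -
 have x: "x : car A" "star x = x" using saD[OF assms] by auto
 show "re x = x" using x by (simp add: re_def smult_two[symmetric] smult_smult)
 show "im x = \<zero>" using x by (simp add: im_def a_minus_def r_neg)
qed

end

text \<open>A state is dominated by the norm, a Hahn--Banach extension is again dominated, and a functional whose
norm is its value at the unit is positive.\<close>

lemma (in cstar_sub) state_extension:
 assumes st: "is_state B ph"
 obtains ps where "is_state A ps" "!!x. x : S ==> ps x = ph x"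
proof -
 interpret f: pos_fun B ph by (rule B.pos_fun_state[OF st])
 define q0 where "q0 x = (if x : sa then cnorm A x else 0)" for x
 have q0: "sublinear q0"
  unfolding sublinear_def q0_def by (auto intro!: nu_add simp: nu_smult)
 have Bsa: "B.sa = S Int sa" by (auto simp: B.sa_def sa_def simp del: sa_closed B.sa_closed)
 have re_in: "re x : S" if "x : S" for x using that by (simp add: re_def)
 have im_in: "im x : S" if "x : S" for x using that by (simp add: im_def)
 have add: "ph (x \<oplus> y) = ph x + ph y" if "x : S" "y : S" for x y using f.Phi_add that by simp
 have smult: "ph (c \<odot> x) = c * ph x" if "x : S" for c x using f.Phi_smult that by simp
 have one: "ph \<one> = 1" using st by (simp add: is_state_def)
 obtain m where m: "!!x y. x : sa ==> y : sa ==> m (x \<oplus> y) = m x + m y"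
  "!!x t. x : sa ==> m (rscale t x) = t * m x" "!!x. x : sa ==> m x <= q0 x"
  "!!x. x : S Int sa ==> m x = Re (ph x)"
 proof (rule hahn_banach[OF q0, of "S Int sa" "%x. Re (ph x)"])
  fix x assume x: "x : S Int sa"
  then have "Re (ph x) <= cnorm B x * Re (ph \<one>\<^bsub>B\<^esub>)"
  using B.pos_fun_bound[OF f.pos_fun_axioms, of x] Bsa by simp
  then show "Re (ph x) <= q0 x" using x one by (simp add: q0_def)
 qed (auto simp: add smult)
 define ps where "ps x = Complex (m (re x)) (m (im x))" for x
 have pos: "0 <= m (star x \<otimes> x)" if x: "x : car A" for x
 proof -
  define M where "M = cnorm A x"
  have h: "star x \<otimes> x : sa" using sa_square x by simp
  have neg: "m (\<ominus> y) = - m y" if "y : sa" for y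
  using m(2)[OF that, of "-1"] that by (simp add: smult_minus_one)
  have m1: "m \<one> = 1" using m(4)[of \<one>] one by simp
  show ?thesis
  proof (cases "M = 0")
  case True
  then have "cnorm A (\<ominus> (star x \<otimes> x)) = 0" using nu_cstar[OF x] x by (simp add: M_def)
  then show ?thesis using m(3)[of "\<ominus> (star x \<otimes> x)"] h neg by (simp add: q0_def)
  next
  case False
  then have M: "M > 0" using x by (simp add: M_def less_le)
  define z where "z = rscale (1 / M) x"
  have z: "z : car A" "cnorm A z <= 1" using x M by (auto simp: z_def nu_smult M_def norm_divide)
  have zz: "star z \<otimes> z = rscale (1 / M ^ 2) (star x \<otimes> x)"
  using x by (simp add: z_def star_smult smult_mult_left smult_mult_right smult_smult power2_eq_square)
  have s: "star z \<otimes> z : sa" using sa_square z by simp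
  have "m (\<one> \<ominus> star z \<otimes> z) <= 1"
  using nu_one_minus_star_mult[OF z] m(3)[of "\<one> \<ominus> star z \<otimes> z"] s by (simp add: q0_def)
  then have "0 <= m (star z \<otimes> z)" using s m1 neg m(1)[of \<one> "\<ominus> (star z \<otimes> z)"] by (simp add: a_minus_def)
  then show ?thesis using M m(2)[OF h, of "1 / M ^ 2"] unfolding zz by (simp add: zero_le_divide_iff)
  qed
 qed
 have "is_state A ps" unfolding is_state_def
 proof (intro conjI ballI allI)
  fix x y c assume x: "x : car A"
  show "ps (c \<odot> x) = c * ps x" using x
  by (simp add: ps_def re_smult im_smult m(1,2) complex_eq_iff del: of_real_minus)
  have "star x \<otimes> x : sa" using sa_square x by simp
  moreover have "m \<zero> = 0" using m(2)[of \<zero> 0] by simp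
  ultimately show "ps (star x \<otimes> x) : \<real>\<^sub>\<ge>\<^sub>0"
  using pos[OF x] by (simp add: ps_def re_im_of_sa complex_nonneg_Reals_iff)
  assume y: "y : car A"
  show "ps (x \<oplus> y) = ps x + ps y" using x y
  by (simp add: ps_def re_add im_add m(1) complex_eq_iff)
 next
  show "ps \<one> = 1" using m(4)[of \<one>] m(2)[of \<zero> 0] one by (simp add: ps_def re_im_of_sa complex_eq_iff)
 qed
 moreover have "ps x = ph x" if x: "x : S" for x
 proof -
  have xc: "x : car A" using x by simp
  have "ph x = ph (re x \<oplus> \<i> \<odot> im x)" using re_im[OF xc] by simp
  also have "... = ph (re x) + \<i> * ph (im x)" using re_in[OF x] im_in[OF x] by (simp add: add smult)
  also have "... = ps x"
  using f.Phi_sa[of "re x"] f.Phi_sa[of "im x"] re_in[OF x] im_in[OF x] xc m(4)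
  by (simp add: Bsa ps_def complex_eq_iff)
  finally show ?thesis by simp
 qed
 ultimately show ?thesis by (rule that)
qed

section \<open>Monoid algebras\<close>

definition lin :: "('a => complex) => ('a => complex) => complex" where
 "lin f h = (SUM x | f x ~= 0. f x * h x)"

lemma lin_superset: "finite F ==> {x. f x ~= 0} <= F ==> lin f h = (SUM x:F. f x * h x)"
 unfolding lin_def by (rule sum.mono_neutral_left) auto

lemma lin_eqI:
 assumes "finite {x. f x ~= 0}" "finite {x. g x ~= 0}" "!!h. lin f h = lin g h"
 shows "f = g"
proof
 fix z
 have "f z = lin f (bv z)" if "finite {x. f x ~= 0}" for f :: "'a => complex"
  using that unfolding lin_superset[OF finite.insertI[OF that, of z] subset_insertI]
  by (simp add: basis_vec_def if_distrib cong: if_cong)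
 then show "f z = g z" using assms by metis
qed

lemma lin_cong: "(!!x. f x ~= 0 ==> h x = h' x) ==> lin f h = lin f h'"
 unfolding lin_def by (rule sum.cong) auto

lemma lin_add:
 assumes "finite {x. f x ~= 0}" "finite {x. g x ~= 0}"
 shows "lin (%x. f x + g x) h = lin f h + lin g h"
proof -
 let ?F = "{x. f x ~= 0} Un {x. g x ~= 0}"
 have fin: "finite ?F" using assms by simp
 have "lin (%x. f x + g x) h = (SUM x:?F. (f x + g x) * h x)" by (rule lin_superset[OF fin]) auto
 also have "... = lin f h + lin g h"
  by (subst (1 2) lin_superset[OF fin]) (auto simp: distrib_right sum.distrib)
 finally show ?thesis .
qed

lemma lin_smult: "finite {x. f x ~= 0} ==> lin (%x. c * f x) h = c * lin f h"
 by (subst (1 2) lin_superset[of "{x. f x ~= 0}"]) (auto simp: sum_distrib_left mult.assoc)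

lemma lin_basis [simp]: "lin (bv x) h = h x"
 using lin_superset[of "{x}" "bv x" h] by (auto simp: basis_vec_def)

lemma lin_zero [simp]: "lin (%_. 0) h = 0"
 by (simp add: lin_def)

lemma lin_add_right: "lin f (%x. h x + k x) = lin f h + lin f k"
 by (simp add: lin_def distrib_left sum.distrib)

lemma lin_smult_right: "lin f (%x. c * h x) = c * lin f h"
 by (simp add: lin_def sum_distrib_left mult.left_commute)

lemma lin_swap: "lin f (%x. lin g (%y. h x y)) = lin g (%y. lin f (%x. h x y))"
 unfolding lin_def sum_distrib_left by (subst sum.swap) (simp add: mult.left_commute)

locale star_monoid = monoid M for M :: "('a, 'm) monoid_scheme" (structure) +
 fixes \<sigma> :: "'a => 'a"
 assumes sigma_closed [simp]: "x : car M ==> \<sigma> x : car M"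
  and sigma_sigma [simp]: "x : car M ==> \<sigma> (\<sigma> x) = x"
  and sigma_mult: "x : car M ==> y : car M ==> \<sigma> (x \<otimes> y) = \<sigma> y \<otimes> \<sigma> x"
begin

abbreviation X where "X == monoid_algebra M \<sigma>"

lemma carrierD: "f : car X ==> finite {x. f x ~= 0}" "f : car X ==> f x ~= 0 ==> x : car M"
 by (auto simp: monoid_algebra_def)

lemma X_simps:
 "\<one>\<^bsub>X\<^esub> = bv \<one>" "\<zero>\<^bsub>X\<^esub> = (%_. 0)" "f \<oplus>\<^bsub>X\<^esub> g = (%x. f x + g x)" "c \<odot>\<^bsub>X\<^esub> f = (%x. c * f x)"
 "f \<otimes>\<^bsub>X\<^esub> g = (%z. SUM x | f x ~= 0. SUM y | g y ~= 0. if x \<otimes> y = z then f x * g y else 0)"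
 "adj X f = (%x. if x : car M then cnj (f (\<sigma> x)) else 0)"
 by (auto simp: monoid_algebra_def)

lemma basis_closed [simp]: "x : car M ==> bv x : car X"
 by (auto simp: monoid_algebra_def basis_vec_def)

lemma X_zero_closed: "\<zero>\<^bsub>X\<^esub> : car X"
 by (simp add: monoid_algebra_def)

lemma X_add_closed: "f : car X ==> g : car X ==> f \<oplus>\<^bsub>X\<^esub> g : car X"
proof -
 assume *: "f : car X" "g : car X"
 have "{x. f x + g x ~= 0} <= {x. f x ~= 0} Un {x. g x ~= 0}" by auto
 then show ?thesis using * by (auto simp: monoid_algebra_def intro: finite_subset)
qed

lemma X_smult_closed: "f : car X ==> c \<odot>\<^bsub>X\<^esub> f : car X"
 by (cases "c = 0") (auto simp: monoid_algebra_def)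

lemma X_mult_supp:
 assumes "f : car X" "g : car X"
 shows "{z. (f \<otimes>\<^bsub>X\<^esub> g) z ~= 0} <= (%(x, y). x \<otimes> y) ` ({x. f x ~= 0} \<times> {y. g y ~= 0})"
proof
 fix z assume "z : {z. (f \<otimes>\<^bsub>X\<^esub> g) z ~= 0}"
 then have "(SUM x | f x ~= 0. SUM y | g y ~= 0. if x \<otimes> y = z then f x * g y else 0) ~= 0"
  by (simp add: X_simps)
 then obtain x where "f x ~= 0" "(SUM y | g y ~= 0. if x \<otimes> y = z then f x * g y else 0) ~= 0"
  by (auto elim: sum.not_neutral_contains_not_neutral)
 moreover from this(2) obtain y where "g y ~= 0" "(if x \<otimes> y = z then f x * g y else 0) ~= 0"
  by (auto elim: sum.not_neutral_contains_not_neutral)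
 ultimately show "z : (%(x, y). x \<otimes> y) ` ({x. f x ~= 0} \<times> {y. g y ~= 0})"
  by (force split: if_splits)
qed

lemma X_mult_closed:
 assumes "f : car X" "g : car X" shows "f \<otimes>\<^bsub>X\<^esub> g : car X"
proof -
 have "finite {z. (f \<otimes>\<^bsub>X\<^esub> g) z ~= 0}"
  by (rule finite_subset[OF X_mult_supp[OF assms]]) (use carrierD assms in auto)
 moreover have "{z. (f \<otimes>\<^bsub>X\<^esub> g) z ~= 0} <= car M"
  using X_mult_supp[OF assms] carrierD(2)[OF assms(1)] carrierD(2)[OF assms(2)] by fastforce
 ultimately show ?thesis unfolding monoid_algebra_def by simp
qed

lemma X_adj_supp: "f : car X ==> {x. adj X f x ~= 0} = \<sigma> ` {x. f x ~= 0}"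
proof safe
 fix x assume "f : car X" "adj X f x ~= 0"
 then have "x : car M" "f (\<sigma> x) ~= 0" by (auto simp: X_simps split: if_splits)
 then show "x : \<sigma> ` {x. f x ~= 0}" by (intro image_eqI[of _ _ "\<sigma> x"]) auto
qed (auto simp: X_simps dest: carrierD(2))

lemma carrierI: "finite {x. f x ~= 0} ==> (!!x. f x ~= 0 ==> x : car M) ==> f : car X"
 by (auto simp: monoid_algebra_def)

lemma X_adj_closed:
 assumes f: "f : car X" shows "adj X f : car X"
proof (rule carrierI)
 show "finite {x. adj X f x ~= 0}" unfolding X_adj_supp[OF f] using carrierD(1)[OF f] by simp
 fix x assume "adj X f x ~= 0"
 then show "x : car M" by (simp add: X_simps split: if_splits)
qed

lemma lin_mult:
 assumes f: "f : car X" and g: "g : car X"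
 shows "lin (f \<otimes>\<^bsub>X\<^esub> g) h = lin f (%x. lin g (%y. h (x \<otimes> y)))"
proof -
 let ?F = "{x. f x ~= 0}" and ?G = "{y. g y ~= 0}"
 let ?Z = "(%(x, y). x \<otimes> y) ` (?F \<times> ?G)"
 have fin: "finite ?F" "finite ?G" "finite ?Z" using carrierD f g by auto
 have "lin (f \<otimes>\<^bsub>X\<^esub> g) h = (SUM z:?Z. (f \<otimes>\<^bsub>X\<^esub> g) z * h z)"
  by (rule lin_superset[OF fin(3) X_mult_supp[OF f g]])
 also have "... = (SUM z:?Z. SUM x:?F. SUM y:?G. if x \<otimes> y = z then f x * g y * h z else 0)"
  unfolding X_simps sum_distrib_right by (intro sum.cong refl) auto
 also have "... = (SUM x:?F. SUM y:?G. SUM z:?Z. if x \<otimes> y = z then f x * g y * h z else 0)"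
  by (subst sum.swap, rule sum.cong[OF refl], rule sum.swap)
 also have "... = (SUM x:?F. SUM y:?G. f x * g y * h (x \<otimes> y))"
  using fin by (intro sum.cong refl) (subst sum.delta', auto)
 also have "... = lin f (%x. lin g (%y. h (x \<otimes> y)))"
  by (simp add: lin_def sum_distrib_left mult.assoc)
 finally show ?thesis .
qed

lemma lin_adj:
 assumes f: "f : car X"
 shows "lin (adj X f) h = cnj (lin f (%x. cnj (h (\<sigma> x))))"
proof -
 have inj: "inj_on \<sigma> {x. f x ~= 0}"
  by (rule inj_on_inverseI[of _ \<sigma>]) (use carrierD(2)[OF f] in auto)
 have "lin (adj X f) h = (SUM x:\<sigma> ` {x. f x ~= 0}. adj X f x * h x)"
  unfolding lin_def X_adj_supp[OF f] ..
 also have "... = (SUM x | f x ~= 0. adj X f (\<sigma> x) * h (\<sigma> x))"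
  using inj by (simp add: sum.reindex)
 also have "... = (SUM x | f x ~= 0. cnj (f x) * h (\<sigma> x))"
  by (intro sum.cong refl) (use carrierD(2)[OF f] in "auto simp: X_simps")
 finally show ?thesis by (simp add: lin_def)
qed

lemma X_eqI:
 assumes "f : car X" "g : car X" "!!h. lin f h = lin g h"
 shows "f = g"
 by (rule lin_eqI) (use assms carrierD in auto)

lemma lin_X:
 assumes "f : car X" "g : car X"
 shows "lin (f \<oplus>\<^bsub>X\<^esub> g) h = lin f h + lin g h" "lin (c \<odot>\<^bsub>X\<^esub> f) h = c * lin f h"
 using lin_add[of f g h] lin_smult[of f c h] carrierD(1) assms by (auto simp: X_simps)

lemma lin_cong_X: "f : car X ==> (!!x. x : car M ==> h x = h' x) ==> lin f h = lin f h'"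
 by (rule lin_cong) (use carrierD(2) in blast)

lemma star_algebra_X: "is_star_algebra X"
proof -
 note c = X_zero_closed X_add_closed X_smult_closed X_mult_closed X_adj_closed basis_closed[OF one_closed]
 note l = lin_X lin_mult lin_adj lin_add_right lin_smult_right
 have one: "\<one>\<^bsub>X\<^esub> : car X" by (simp add: X_simps)
 have ag: "abelian_group X"
 proof (rule abelian_groupI)
  fix f assume f: "f : car X"
  show "EX g:car X. g \<oplus>\<^bsub>X\<^esub> f = \<zero>\<^bsub>X\<^esub>"
  by (intro bexI[of _ "(-1) \<odot>\<^bsub>X\<^esub> f"] X_smult_closed f) (simp add: X_simps)
 qed (use c in "auto simp: X_simps(2-4) algebra_simps")
 have mon: "monoid X"
 proof (rule monoidI)
  fix f g k assume fgk: "f : car X" "g : car X" "k : car X"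
  show "f \<otimes>\<^bsub>X\<^esub> g \<otimes>\<^bsub>X\<^esub> k = f \<otimes>\<^bsub>X\<^esub> (g \<otimes>\<^bsub>X\<^esub> k)"
  proof (rule X_eqI)
  fix h
  have "lin f (%x. lin g (%y. lin k (%z. h (x \<otimes> y \<otimes> z)))) =
  lin f (%x. lin g (%y. lin k (%z. h (x \<otimes> (y \<otimes> z)))))"
  by (intro lin_cong_X fgk) (simp add: m_assoc)
  then show "lin (f \<otimes>\<^bsub>X\<^esub> g \<otimes>\<^bsub>X\<^esub> k) h = lin (f \<otimes>\<^bsub>X\<^esub> (g \<otimes>\<^bsub>X\<^esub> k)) h"
  using fgk c by (simp add: l)
  qed (use fgk c in auto)
  show "\<one>\<^bsub>X\<^esub> \<otimes>\<^bsub>X\<^esub> f = f"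
  proof (rule X_eqI)
  fix h
  have "lin f (%y. h (\<one> \<otimes> y)) = lin f h" by (intro lin_cong_X fgk) simp
  then show "lin (\<one>\<^bsub>X\<^esub> \<otimes>\<^bsub>X\<^esub> f) h = lin f h"
  unfolding lin_mult[OF one fgk(1)] by (simp add: X_simps(1))
  qed (use fgk c one in auto)
  show "f \<otimes>\<^bsub>X\<^esub> \<one>\<^bsub>X\<^esub> = f"
  proof (rule X_eqI)
  fix h
  have "lin f (%y. h (y \<otimes> \<one>)) = lin f h" by (intro lin_cong_X fgk) simp
  then show "lin (f \<otimes>\<^bsub>X\<^esub> \<one>\<^bsub>X\<^esub>) h = lin f h"
  unfolding lin_mult[OF fgk(1) one] by (simp add: X_simps(1))
  qed (use fgk c one in auto)
 qed (use c one in auto)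
 have ring: "ring X"
 proof (rule ringI[OF ag mon])
  fix f g k assume fgk: "f : car X" "g : car X" "k : car X"
  show "(f \<oplus>\<^bsub>X\<^esub> g) \<otimes>\<^bsub>X\<^esub> k = f \<otimes>\<^bsub>X\<^esub> k \<oplus>\<^bsub>X\<^esub> g \<otimes>\<^bsub>X\<^esub> k"
  by (rule X_eqI) (use fgk c in "auto simp: l")
  show "k \<otimes>\<^bsub>X\<^esub> (f \<oplus>\<^bsub>X\<^esub> g) = k \<otimes>\<^bsub>X\<^esub> f \<oplus>\<^bsub>X\<^esub> k \<otimes>\<^bsub>X\<^esub> g"
  by (rule X_eqI) (use fgk c in "auto simp: l")
 qed
 have cr: "cring complex_ring"
  by (rule cringI, rule abelian_groupI)
  (auto simp: complex_ring_def algebra_simps monoid.defs intro!: comm_monoidI exI[of _ "- _"])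
 have mod: "module complex_ring X"
  unfolding module_def module_axioms_def using cr ag c
  by (auto simp: complex_ring_def X_simps(3,4) algebra_simps)
 show ?thesis
  unfolding is_star_algebra_def
 proof (intro conjI ring mod ballI allI)
  fix c' f g assume fg: "f : car X"  "g : car X"
  show "c' \<odot>\<^bsub>X\<^esub> f \<otimes>\<^bsub>X\<^esub> g = c' \<odot>\<^bsub>X\<^esub> (f \<otimes>\<^bsub>X\<^esub> g)" "f \<otimes>\<^bsub>X\<^esub> (c' \<odot>\<^bsub>X\<^esub> g) = c' \<odot>\<^bsub>X\<^esub> (f \<otimes>\<^bsub>X\<^esub> g)"
  by (rule X_eqI; use fg c in "auto simp: l")+
  show "adj X (f \<oplus>\<^bsub>X\<^esub> g) = adj X f \<oplus>\<^bsub>X\<^esub> adj X g" by (auto simp: X_simps)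
  show "adj X (f \<otimes>\<^bsub>X\<^esub> g) = adj X g \<otimes>\<^bsub>X\<^esub> adj X f"
  proof (rule X_eqI)
  fix h
  have "lin f (%x. lin g (%y. cnj (h (\<sigma> (x \<otimes> y))))) = lin f (%x. lin g (%y. cnj (h (\<sigma> y \<otimes> \<sigma> x))))"
  by (intro lin_cong_X fg) (simp add: sigma_mult)
  then show "lin (adj X (f \<otimes>\<^bsub>X\<^esub> g)) h = lin (adj X g \<otimes>\<^bsub>X\<^esub> adj X f) h"
  using fg c by (simp add: l lin_swap[of g f])
  qed (use fg c in auto)
 next
  fix c' f assume f: "f : car X"
  show "adj X f : car X" by (rule X_adj_closed[OF f])
  show "adj X (adj X f) = f"
  proof
  fix x show "adj X (adj X f) x = f x"
  using carrierD(2)[OF f, of x] by (cases "x : car M") (auto simp: X_simps)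
  qed
  show "adj X (c' \<odot>\<^bsub>X\<^esub> f) = cnj c' \<odot>\<^bsub>X\<^esub> adj X f" by (auto simp: X_simps)
 qed
qed

sublocale X: star_alg X by unfold_locales (rule star_algebra_X)

lemma X_induct [consumes 1, case_names zero add]:
 assumes f: "f : car X" and zero: "P \<zero>\<^bsub>X\<^esub>"
  and add: "!!f c x. f : car X ==> P f ==> x : car M ==> P (f \<oplus>\<^bsub>X\<^esub> c \<odot>\<^bsub>X\<^esub> bv x)"
 shows "P f"
proof -
 have "ALL f : car X. {x. f x ~= 0} <= F --> P f" if "finite F" for F
  using that
 proof (induction F)
  case empty
  show ?case
  proof safe
  fix f :: "'a => complex" assume "{x. f x ~= 0} <= {}"
  then have "f = \<zero>\<^bsub>X\<^esub>" by (auto simp: X_simps)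
  then show "P f" using zero by simp
  qed
 next
  case (insert y F)
  show ?case
  proof safe
  fix f :: "'a => complex" assume f: "f : car X" and s: "{x. f x ~= 0} <= insert y F"
  show "P f"
  proof (cases "f y = 0")
  case True
  then have "{x. f x ~= 0} <= F" using s by auto
  then show ?thesis using insert f by blast
  next
  case False
  define g where "g = f(y := 0)"
  have y: "y : car M" using carrierD(2)[OF f False] .
  have gf: "{x. g x ~= 0} <= {x. f x ~= 0}" by (auto simp: g_def)
  have g: "g : car X"
  by (rule carrierI[OF finite_subset[OF gf]]) (use gf carrierD[OF f] in auto)
  have "{x. g x ~= 0} <= F" using s by (auto simp: g_def)
  then have "P g" using insert g by blast
  moreover have "f = g \<oplus>\<^bsub>X\<^esub> f y \<odot>\<^bsub>X\<^esub> bv y" by (auto simp: X_simps g_def basis_vec_def)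
  ultimately show ?thesis using add[OF g _ y] by metis
  qed
  qed
 qed
 then show ?thesis using f carrierD(1)[OF f] by blast
qed

lemma X_basis_mult [simp]:
 assumes "x : car M" "y : car M"
 shows "bv x \<otimes>\<^bsub>X\<^esub> bv y = bv (x \<otimes> y)"
 by (rule X_eqI) (use assms in "auto simp: lin_mult")

lemma X_basis_adj [simp]:
 assumes "x : car M" shows "adj X (bv x) = bv (\<sigma> x)"
 by (rule X_eqI) (use assms in "auto simp: lin_adj")

end

section \<open>C*-seminorms from positive functionals\<close>

locale pos_family = star_alg A for A :: "('a, 'm) star_algebra_scheme" (structure) +
 fixes \<F> :: "('a => complex) set"
 assumes pos_fun: "Ph : \<F> ==> pos_fun A Ph"
  and bounded: "t : car A ==> EX C>=0. ALL Ph:\<F>. ALL s:car A.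
  sqrt (Re (Ph (adj A (t \<otimes> s) \<otimes> (t \<otimes> s)))) <= C * sqrt (Re (Ph (adj A s \<otimes> s)))"
begin

abbreviation n2 :: "('a => complex) => 'a => real" where
 "n2 Ph s == sqrt (Re (Ph (star s \<otimes> s)))"

definition mu :: "'a => real" where
 "mu t = Sup (insert 0 {sqrt (Re (Ph (star (t \<otimes> s) \<otimes> (t \<otimes> s))) / Re (Ph (star s \<otimes> s))) | Ph s.
  Ph : \<F> & s : car A & Ph (star s \<otimes> s) ~= 0})"

lemma ratio_le:
 assumes "Ph : \<F>" "s : car A" "t : car A" "Ph (star s \<otimes> s) ~= 0" "n2 Ph (t \<otimes> s) <= C * n2 Ph s"
 shows "sqrt (Re (Ph (star (t \<otimes> s) \<otimes> (t \<otimes> s))) / Re (Ph (star s \<otimes> s))) <= C"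
proof -
 have "Re (Ph (star s \<otimes> s)) > 0"
  using pos_fun.Phi_pos'[OF pos_fun[OF assms(1)] assms(2)] assms(4) by (auto simp: complex_eq_iff less_le)
 then show ?thesis using assms(5) by (simp add: real_sqrt_divide field_simps)
qed

lemma mu_bdd:
 assumes t: "t : car A"
 shows "bdd_above (insert 0 {sqrt (Re (Ph (star (t \<otimes> s) \<otimes> (t \<otimes> s))) / Re (Ph (star s \<otimes> s))) | Ph s.
  Ph : \<F> & s : car A & Ph (star s \<otimes> s) ~= 0})"
proof -
 obtain C where C: "C >= 0" "!!Ph s. Ph : \<F> ==> s : car A ==> n2 Ph (t \<otimes> s) <= C * n2 Ph s"
  using bounded[OF t] by blast
 show ?thesis
 proof (rule bdd_aboveI[of _ C], goal_cases)
  case (1 x) then show ?case using C ratio_le[OF _ _ t] by auto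
 qed
qed

lemma mu_nonneg [simp]: "t : car A ==> 0 <= mu t"
 unfolding mu_def by (intro cSup_upper mu_bdd) auto

lemma mu_least:
 assumes "t : car A" "0 <= C" "!!Ph s. Ph : \<F> ==> s : car A ==> n2 Ph (t \<otimes> s) <= C * n2 Ph s"
 shows "mu t <= C"
 unfolding mu_def
proof (rule cSup_least, goal_cases)
 case (2 x) then show ?case using assms ratio_le[OF _ _ assms(1)] by auto
qed simp

lemma mu_bound:
 assumes F: "Ph : \<F>" and s: "s : car A" and t: "t : car A"
 shows "n2 Ph (t \<otimes> s) <= mu t * n2 Ph s"
proof (cases "Ph (star s \<otimes> s) = 0")
 case True
 then show ?thesis using bounded[OF t] F s by fastforce
next
 case False
 have p: "Re (Ph (star s \<otimes> s)) > 0"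
  using pos_fun.Phi_pos'[OF pos_fun[OF F] s] False by (auto simp: complex_eq_iff less_le)
 have "sqrt (Re (Ph (star (t \<otimes> s) \<otimes> (t \<otimes> s))) / Re (Ph (star s \<otimes> s))) <= mu t"
  unfolding mu_def by (rule cSup_upper[OF _ mu_bdd[OF t]]) (use F s False in blast)
 then show ?thesis using p by (simp add: real_sqrt_divide field_simps)
qed

lemma mu_mult:
 assumes t: "t : car A" "u : car A" shows "mu (t \<otimes> u) <= mu t * mu u"
proof (rule mu_least)
 fix Ph s assume F: "Ph : \<F>" and s: "s : car A"
 have "n2 Ph (t \<otimes> (u \<otimes> s)) <= mu t * n2 Ph (u \<otimes> s)" using F s t by (intro mu_bound) auto
 also have "... <= mu t * (mu u * n2 Ph s)" using F s t by (intro mult_left_mono mu_bound) auto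
 finally show "n2 Ph (t \<otimes> u \<otimes> s) <= mu t * mu u * n2 Ph s" using t s by (simp add: m_assoc)
qed (use t in auto)

lemma mu_square_le:
 assumes t: "t : car A" shows "(mu t)\<^sup>2 <= mu (star t \<otimes> t)"
proof -
 have m: "0 <= mu (star t \<otimes> t)" using t by simp
 have "mu t <= sqrt (mu (star t \<otimes> t))"
 proof (rule mu_least)
  fix Ph s assume F: "Ph : \<F>" and s: "s : car A"
  interpret pos_fun A Ph by (rule pos_fun[OF F])
  have q: "n2 Ph x = sqrt (q x)" for x by (simp add: q_def)
  let ?y = "star t \<otimes> t \<otimes> s"
  have y: "?y : car A" using s t by simp
  have "star (t \<otimes> s) \<otimes> (t \<otimes> s) = star s \<otimes> ?y" using s t by (simp add: star_mult m_assoc)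
  then have "q (t \<otimes> s) <= cmod (Ph (star s \<otimes> ?y))" by (simp add: q_def complex_Re_le_cmod)
  also have "... <= sqrt (q s * q ?y)" by (rule real_le_rsqrt[OF cauchy_schwarz[OF s y]])
  also have "... = sqrt (q s) * sqrt (q ?y)" by (rule real_sqrt_mult)
  also have "... <= sqrt (q s) * (mu (star t \<otimes> t) * sqrt (q s))"
  using mu_bound[OF F s, of "star t \<otimes> t"] q_nonneg[OF s] t by (intro mult_left_mono) (auto simp: q)
  also have "... = mu (star t \<otimes> t) * q s" using q_nonneg[OF s] by simp
  finally have "sqrt (q (t \<otimes> s)) <= sqrt (mu (star t \<otimes> t) * q s)" by simp
  then show "n2 Ph (t \<otimes> s) <= sqrt (mu (star t \<otimes> t)) * n2 Ph s" by (simp add: q real_sqrt_mult)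
 qed (use t m in auto)
 then have "(mu t)\<^sup>2 <= (sqrt (mu (star t \<otimes> t)))\<^sup>2" using t by (intro power_mono) auto
 then show ?thesis using m by simp
qed

lemma mu_star_le:
 assumes t: "t : car A" shows "mu (star t) <= mu t"
proof (cases "mu (star t) = 0")
 case False
 then have p: "mu (star t) > 0" using t by (simp add: less_le)
 have "(mu (star t))\<^sup>2 <= mu (t \<otimes> star t)" using mu_square_le[of "star t"] t by simp
 also have "... <= mu t * mu (star t)" using t by (intro mu_mult) auto
 finally show ?thesis using p by (simp add: power2_eq_square)
qed (use t in simp)

lemma mu_seminorm: "cstar_seminorm A mu"
proof -
 have add: "mu (x \<oplus> y) <= mu x + mu y" if c: "x : car A" "y : car A" for x y
 proof (rule mu_least)
  fix Ph s assume F: "Ph : \<F>" and s: "s : car A"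
  interpret pos_fun A Ph by (rule pos_fun[OF F])
  have "n2 Ph ((x \<oplus> y) \<otimes> s) <= n2 Ph (x \<otimes> s) + n2 Ph (y \<otimes> s)"
  using sqrt_q_triangle[of "x \<otimes> s" "y \<otimes> s"] c s by (simp add: q_def l_distr)
  also have "... <= mu x * n2 Ph s + mu y * n2 Ph s" using c F s by (intro add_mono mu_bound)
  finally show "n2 Ph ((x \<oplus> y) \<otimes> s) <= (mu x + mu y) * n2 Ph s" by (simp add: distrib_right)
 qed (use c in auto)
 have sc: "mu (c \<odot> x) <= cmod c * mu x" if x: "x : car A" for c x
 proof (rule mu_least)
  fix Ph s assume F: "Ph : \<F>" and s: "s : car A"
  interpret pos_fun A Ph by (rule pos_fun[OF F])
  have "n2 Ph (c \<odot> x \<otimes> s) = cmod c * n2 Ph (x \<otimes> s)"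
  using q_smult[of "x \<otimes> s" c] x s by (simp add: q_def smult_mult_left real_sqrt_mult)
  also have "... <= cmod c * (mu x * n2 Ph s)" using x F s by (intro mult_left_mono mu_bound) auto
  finally show "n2 Ph (c \<odot> x \<otimes> s) <= cmod c * mu x * n2 Ph s" by simp
 qed (use x in auto)
 have sm: "mu (c \<odot> x) = cmod c * mu x" if x: "x : car A" for c x
 proof (cases "c = 0")
  case True
  have "mu (0 \<odot> x) <= 0" using sc[OF x, of 0] by (simp del: smult_zero_left)
  moreover have "0 <= mu (0 \<odot> x)" by (rule mu_nonneg) (rule smult_closed[OF x])
  ultimately have "mu (0 \<odot> x) = 0" by (rule antisym)
  then show ?thesis using True by (simp del: smult_zero_left)
 next
  case False
  have "mu x <= cmod (1 / c) * mu (c \<odot> x)" using sc[of "c \<odot> x" "1/c"] x False by (simp add: smult_smult)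
  then have "cmod c * mu x <= mu (c \<odot> x)" using False by (simp add: norm_divide field_simps)
  then show ?thesis using sc[OF x, of c] by simp
 qed
 have cs: "mu (star x \<otimes> x) = (mu x)\<^sup>2" if x: "x : car A" for x
 proof (rule antisym)
  have "mu (star x \<otimes> x) <= mu (star x) * mu x" using x by (intro mu_mult) auto
  also have "... <= mu x * mu x" using x mu_star_le by (intro mult_right_mono) auto
  finally show "mu (star x \<otimes> x) <= (mu x)\<^sup>2" by (simp add: power2_eq_square)
 qed (rule mu_square_le[OF x])
 show ?thesis unfolding cstar_seminorm_def using add sm mu_mult cs by blast
qed

end

section \<open>The minimal C*-seminorm\<close>

subsection \<open>Schur products of positive semidefinite matrices\<close>

definition qform :: "'i set => ('i => 'i => complex) => ('i => complex) => complex" where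
 "qform I P c = (SUM i:I. SUM j:I. cnj (c i) * c j * P i j)"

definition psd :: "'i set => ('i => 'i => complex) => bool" where
 "psd I P \<longleftrightarrow> (ALL c. qform I P c : \<real>\<^sub>\<ge>\<^sub>0)"

lemma qform_mono:
 assumes "finite I" "J <= I" shows "qform I P (%i. if i : J then c i else 0) = qform J P c"
proof -
 have "qform I P (%i. if i : J then c i else 0) =
  (SUM i:I. if i : J then (SUM j:I. if j : J then cnj (c i) * c j * P i j else 0) else 0)"
  unfolding qform_def by (intro sum.cong refl) (auto intro!: sum.cong sum.neutral)
 also have "... = qform J P c"
  unfolding qform_def using assms by (simp add: sum.inter_restrict[symmetric] Int_absorb1)
 finally show ?thesis .
qed

lemma psd_subset: "finite I ==> psd I P ==> J <= I ==> psd J P"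
 unfolding psd_def using qform_mono by metis

lemma qform_insert:
 assumes "finite I" "a ~: I"
 shows "qform (insert a I) P c = cnj (c a) * c a * P a a + cnj (c a) * (SUM j:I. c j * P a j)
  + c a * (SUM i:I. cnj (c i) * P i a) + qform I P c"
 using assms unfolding qform_def
 by (simp add: sum.distrib sum_distrib_left algebra_simps)

lemma psd_diag: "finite I ==> psd I P ==> i : I ==> P i i : \<real>\<^sub>\<ge>\<^sub>0"
 using psd_subset[of I P "{i}"] unfolding psd_def qform_def by (auto dest: spec[of _ "%_. 1"])

lemma psd_pair:
 assumes "finite I" "psd I P" "i : I" "j : I" "i ~= j"
 shows "cnj x * x * P i i + cnj x * y * P i j + x * cnj y * P j i + cnj y * y * P j j : \<real>\<^sub>\<ge>\<^sub>0"
proof -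
 have "psd {i, j} P" using assms by (intro psd_subset[OF assms(1,2)]) auto
 then have "qform {i, j} P (%k. if k = i then x else y) : \<real>\<^sub>\<ge>\<^sub>0" by (auto simp: psd_def)
 then show ?thesis using assms(5) by (simp add: qform_def algebra_simps)
qed

lemma psd_hermitian:
 assumes "finite I" "psd I P" "i : I" "j : I" shows "P j i = cnj (P i j)"
proof (cases "i = j")
 case True
 then show ?thesis using psd_diag[OF assms(1,2,3)] by (auto simp: complex_nonneg_Reals_iff complex_eq_iff)
next
 case False
 note * = psd_pair[OF assms False] psd_diag[OF assms(1,2,3)] psd_diag[OF assms(1,2,4)]
 show ?thesis using *(1)[of 1 1] *(1)[of 1 \<i>] *(2,3)
  by (auto simp: complex_nonneg_Reals_iff complex_eq_iff)
qed

lemma psd_zero: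
 assumes "finite I" "psd I P" "i : I" "j : I" "P i i = 0" shows "P i j = 0"
proof (cases "i = j")
 case False
 define r where "r = (cmod (P i j))\<^sup>2"
 have pp: "P i j * cnj (P i j) = complex_of_real r" unfolding r_def by (rule complex_norm_square[symmetric])
 have "0 <= Re (P j j) - 2 * t * r" for t
 proof -
  have "cnj (- complex_of_real t * P i j) * P i j = complex_of_real (- t * r)"
  "- complex_of_real t * P i j * cnj (P i j) = complex_of_real (- t * r)"
  using pp by (simp_all add: mult.commute mult.left_commute mult.assoc[symmetric])
  then have "complex_of_real (- t * r) + complex_of_real (- t * r) + P j j : \<real>\<^sub>\<ge>\<^sub>0"
  using psd_pair[OF assms(1-4) False, of "- complex_of_real t * P i j" 1]
  unfolding assms(5) psd_hermitian[OF assms(1-4)]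
  by (simp only: mult_zero_right add_0 complex_cnj_one mult_1_right mult_1_left)
  then show ?thesis by (simp add: complex_nonneg_Reals_iff mult.commute mult.left_commute)
 qed
 from this[of "(Re (P j j) + 1) / (2 * r)"] have "r = 0" by (cases "r = 0") auto
 then show ?thesis by (simp add: r_def)
qed (use assms in simp)

text \<open>Entrywise products of positive semidefinite matrices are positive semidefinite; this makes product functionals
positive.\<close>

lemma schur_product:
 assumes "finite I" "psd I P" "psd I Q"
 shows "psd I (%i j. P i j * Q i j)"
 using assms
proof (induction I arbitrary: P rule: finite_induct)
 case empty
 then show ?case by (simp add: psd_def qform_def)
next
 case (insert a I)
 let ?J = "insert a I"
 have fin: "finite ?J" using insert by simp
 note P = insert.prems(1) and Q = insert.prems(2)
 have psdQ: "psd I Q" by (rule psd_subset[OF fin Q]) auto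
 show ?case
 proof (cases "P a a = 0")
  case True
  have z: "P a j = 0" "P j a = 0" if "j : ?J" for j
  using psd_zero[OF fin P _ that True] psd_hermitian[OF fin P _ that] by auto
  have "psd I (%i j. P i j * Q i j)"
  by (rule insert.IH[OF _ psdQ]) (rule psd_subset[OF fin P], auto)
  moreover have "qform ?J (%i j. P i j * Q i j) c = qform I (%i j. P i j * Q i j) c" for c
  unfolding qform_insert[OF insert.hyps] using z by simp
  ultimately show ?thesis by (simp add: psd_def)
 next
  case False
  define d where "d = Re (P a a)"
  have d: "d > 0" "P a a = complex_of_real d"
  using psd_diag[OF fin P, of a] False by (auto simp: d_def complex_nonneg_Reals_iff complex_eq_iff less_le)
  define P' where "P' i j = P i j - P i a * P a j / P a a" for i j
  have herm: "P i a = cnj (P a i)" if "i : ?J" for i using psd_hermitian[OF fin P, of a i] that by simp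
  have "psd I P'" unfolding psd_def
  proof
  fix c
  define S where "S = (SUM j:I. c j * P a j)"
  have S': "(SUM i:I. cnj (c i) * P i a) = cnj S"
  unfolding S_def cnj_sum by (intro sum.cong refl) (simp add: herm)
  define c' where "c' = c(a := - S / P a a)"
  have *: "(SUM j:I. c' j * P a j) = S" "(SUM i:I. cnj (c' i) * P i a) = cnj S"
  "qform I P c' = qform I P c"
  unfolding S'[symmetric] unfolding S_def qform_def c'_def using insert.hyps
  by (auto intro!: sum.cong)
  have "qform I (%i j. P i a * P a j / P a a) c =
  (SUM i:I. cnj (c i) * P i a) * (SUM j:I. c j * P a j) / P a a"
  unfolding qform_def sum_product sum_divide_distrib by (intro sum.cong refl) (simp add: algebra_simps)
  then have q': "qform I P' c = qform I P c - cnj S * S / P a a"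
  unfolding S' S_def[symmetric] P'_def qform_def
  by (simp add: right_diff_distrib sum_subtractf)
  have "qform ?J P c' = qform I P' c"
  unfolding qform_insert[OF insert.hyps] * q' using d by (simp add: c'_def field_simps)
  moreover have "qform ?J P c' : \<real>\<^sub>\<ge>\<^sub>0" using P by (simp add: psd_def)
  ultimately show "qform I P' c : \<real>\<^sub>\<ge>\<^sub>0" by simp
  qed
  from insert.IH[OF this psdQ] have IH: "psd I (%i j. P' i j * Q i j)" .
  show ?thesis unfolding psd_def
  proof
  fix c
  define e where "e i = c i * P a i / complex_of_real (sqrt d)" for i
  have ee: "cnj (e i) * e j = cnj (c i) * c j * (P i a * P a j / P a a)" if "i : ?J" for i j
  using d herm[OF that]
  by (simp add: e_def d(2) of_real_mult[symmetric] del: of_real_mult)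
  have P'0: "P' i a = 0" "P' a i = 0" for i using d by (simp_all add: P'_def)
  have "qform ?J (%i j. P i j * Q i j) c =
  qform ?J (%i j. P' i j * Q i j) c + qform ?J Q e"
  unfolding qform_def sum.distrib[symmetric]
  by (intro sum.cong refl) (simp add: ee P'_def right_diff_distrib left_diff_distrib mult.assoc)
  also have "qform ?J (%i j. P' i j * Q i j) c = qform I (%i j. P' i j * Q i j) c"
  unfolding qform_insert[OF insert.hyps] by (simp add: P'0)
  finally show "qform ?J (%i j. P i j * Q i j) c : \<real>\<^sub>\<ge>\<^sub>0"
  using IH Q by (auto simp: psd_def intro: nonneg_Reals_add_I)
  qed
 qed
qed

lemma (in pos_fun) psd_gram:
 assumes "finite I" "!!i. i : I ==> a i : car A"
 shows "psd I (%i j. Ph (star (a i) \<otimes> a j))"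
 unfolding psd_def
proof
 fix c
 have "EX w:car A. (ALL y:car A. Ph (star w \<otimes> y) = (SUM i:I. cnj (c i) * Ph (star (a i) \<otimes> y))) &
  (ALL y:car A. Ph (y \<otimes> w) = (SUM i:I. c i * Ph (y \<otimes> a i)))"
  using assms
 proof (induction I)
  case empty
  show ?case by (intro bexI[of _ \<zero>]) auto
 next
  case (insert i I)
  then obtain w where w: "w : car A"
  "!!y. y : car A ==> Ph (star w \<otimes> y) = (SUM i:I. cnj (c i) * Ph (star (a i) \<otimes> y))"
  "!!y. y : car A ==> Ph (y \<otimes> w) = (SUM i:I. c i * Ph (y \<otimes> a i))" by auto
  have ai: "a i : car A" using insert by simp
  show ?case
  using w ai insert.hyps
  by (intro bexI[of _ "w \<oplus> c i \<odot> a i"])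
  (auto simp: star_add star_smult l_distr r_distr smult_mult_left smult_mult_right Phi_add Phi_smult)
 qed
 then obtain w where w: "w : car A"
  "!!y. y : car A ==> Ph (star w \<otimes> y) = (SUM i:I. cnj (c i) * Ph (star (a i) \<otimes> y))"
  "!!y. y : car A ==> Ph (y \<otimes> w) = (SUM i:I. c i * Ph (y \<otimes> a i))" by blast
 have "qform I (%i j. Ph (star (a i) \<otimes> a j)) c = Ph (star w \<otimes> w)"
  unfolding w(2)[OF w(1)] qform_def using assms w
  by (simp add: sum_distrib_left mult.assoc)
 then show "qform I (%i j. Ph (star (a i) \<otimes> a j)) c : \<real>\<^sub>\<ge>\<^sub>0" using Phi_pos[OF w(1)] by simp
qed

subsection \<open>Product functionals\<close>

definition linear_on :: "('a, 'm) star_algebra_scheme => ('a => complex) => bool" where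
 "linear_on A f \<longleftrightarrow> (ALL x:car A. ALL y:car A. f (x \<oplus>\<^bsub>A\<^esub> y) = f x + f y) &
  (ALL c. ALL x:car A. f (c \<odot>\<^bsub>A\<^esub> x) = c * f x)"

locale tensor_pair = A: cstar_alg A + B: cstar_alg B
 for A :: "('a, 'm) cstar_algebra_scheme" and B :: "('b, 'n) cstar_algebra_scheme"
begin

abbreviation MM where "MM == A \<times>\<times> B"
abbreviation X where "X == formal_tensors A B"

lemma star_monoid_pair: "star_monoid MM (map_prod (adj A) (adj B))"
proof -
 interpret monoid MM by (rule DirProd_monoid) unfold_locales
 show ?thesis by unfold_locales (auto simp: A.star_mult B.star_mult)
qed

sublocale F: star_monoid MM "map_prod (adj A) (adj B)"
 rewrites "monoid_algebra MM (map_prod (adj A) (adj B)) = formal_tensors A B"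
 by (rule star_monoid_pair) (simp add: formal_tensors_def)

definition pf :: "('a => complex) => ('b => complex) => ('a \<times> 'b => complex) => complex" where
 "pf ph ps t = lin t (%(a, b). ph a * ps b)"

lemma product_functional_pf: "product_functional ph ps = pf ph ps"
 by (rule ext) (auto simp: product_functional_def pf_def lin_def mult.assoc intro!: sum.cong)

text \<open>The form \<open>s\<^sup>*(y \<otimes> z)s\<close> evaluated at a product functional.\<close>

definition sform :: "('a => complex) => ('b => complex) => ('a \<times> 'b => complex) => 'a => 'b => complex" where
 "sform ph ps s y z = (SUM p | s p ~= 0. SUM r | s r ~= 0. cnj (s p) * s r *
  (ph (adj A (fst p) \<otimes>\<^bsub>A\<^esub> (y \<otimes>\<^bsub>A\<^esub> fst r)) * ps (adj B (snd p) \<otimes>\<^bsub>B\<^esub> (z \<otimes>\<^bsub>B\<^esub> snd r))))"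

lemma pf_sform:
 assumes s: "s : car X" shows "pf ph ps (adj X s \<otimes>\<^bsub>X\<^esub> s) = sform ph ps s \<one>\<^bsub>A\<^esub> \<one>\<^bsub>B\<^esub>"
proof -
 have c: "fst p : car A" "snd p : car B" if "s p ~= 0" for p
  using F.carrierD(2)[OF s that] by (auto simp: mem_Times_iff)
 have "pf ph ps (adj X s \<otimes>\<^bsub>X\<^esub> s) = (SUM p | s p ~= 0. cnj (s p) * (SUM r | s r ~= 0. s r *
  (case map_prod (adj A) (adj B) p \<otimes>\<^bsub>MM\<^esub> r of (a, b) => ph a * ps b)))"
  unfolding pf_def F.lin_mult[OF F.X_adj_closed[OF s] s] F.lin_adj[OF s] by (simp add: lin_def)
 also have "... = sform ph ps s \<one>\<^bsub>A\<^esub> \<one>\<^bsub>B\<^esub>"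
  unfolding sform_def sum_distrib_left
  by (intro sum.cong refl) (use c in "auto simp: DirProd_def split_beta")
 finally show ?thesis .
qed

lemma sform_pos:
 assumes p: "pos_fun A ph" "pos_fun B ps" and s: "s : car X" and yz: "y : car A" "z : car B"
 shows "sform ph ps s (adj A y \<otimes>\<^bsub>A\<^esub> y) (adj B z \<otimes>\<^bsub>B\<^esub> z) : \<real>\<^sub>\<ge>\<^sub>0"
proof -
 interpret f: pos_fun A ph by fact
 interpret g: pos_fun B ps by fact
 let ?S = "{p. s p ~= 0}"
 have c: "fst p : car A" "snd p : car B" if "s p ~= 0" for p
  using F.carrierD(2)[OF s that] by (auto simp: mem_Times_iff)
 have fin: "finite ?S" using F.carrierD(1)[OF s] .
 have "psd ?S (%p r. ph (adj A (y \<otimes>\<^bsub>A\<^esub> fst p) \<otimes>\<^bsub>A\<^esub> (y \<otimes>\<^bsub>A\<^esub> fst r)) *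
  ps (adj B (z \<otimes>\<^bsub>B\<^esub> snd p) \<otimes>\<^bsub>B\<^esub> (z \<otimes>\<^bsub>B\<^esub> snd r)))"
  by (rule schur_product[OF fin]) (use c yz fin in "auto intro!: f.psd_gram g.psd_gram")
 then have "qform ?S (%p r. ph (adj A (y \<otimes>\<^bsub>A\<^esub> fst p) \<otimes>\<^bsub>A\<^esub> (y \<otimes>\<^bsub>A\<^esub> fst r)) *
  ps (adj B (z \<otimes>\<^bsub>B\<^esub> snd p) \<otimes>\<^bsub>B\<^esub> (z \<otimes>\<^bsub>B\<^esub> snd r))) s : \<real>\<^sub>\<ge>\<^sub>0" by (simp add: psd_def)
 also have "qform ?S (%p r. ph (adj A (y \<otimes>\<^bsub>A\<^esub> fst p) \<otimes>\<^bsub>A\<^esub> (y \<otimes>\<^bsub>A\<^esub> fst r)) *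
  ps (adj B (z \<otimes>\<^bsub>B\<^esub> snd p) \<otimes>\<^bsub>B\<^esub> (z \<otimes>\<^bsub>B\<^esub> snd r))) s =
  sform ph ps s (adj A y \<otimes>\<^bsub>A\<^esub> y) (adj B z \<otimes>\<^bsub>B\<^esub> z)"
  unfolding qform_def sform_def
  by (intro sum.cong refl) (use c yz in "auto simp: A.star_mult B.star_mult A.m_assoc B.m_assoc")
 finally show ?thesis .
qed

lemma pos_fun_pf:
 assumes p: "pos_fun A ph" "pos_fun B ps" shows "pos_fun X (pf ph ps)"
proof
 fix s t c assume s: "s : car X"
 show "pf ph ps (c \<odot>\<^bsub>X\<^esub> s) = c * pf ph ps s" using F.lin_X(2)[OF s s] by (simp add: pf_def)
 show "pf ph ps (adj X s \<otimes>\<^bsub>X\<^esub> s) : \<real>\<^sub>\<ge>\<^sub>0"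
  using sform_pos[OF p s, of "\<one>\<^bsub>A\<^esub>" "\<one>\<^bsub>B\<^esub>"] unfolding pf_sform[OF s] by simp
 assume t: "t : car X"
 show "pf ph ps (s \<oplus>\<^bsub>X\<^esub> t) = pf ph ps s + pf ph ps t" using F.lin_X(1)[OF s t] by (simp add: pf_def)
qed

lemma sform_linear_left:
 assumes p: "pos_fun A ph" "pos_fun B ps" and s: "s : car X" and z: "z : car B"
 shows "pos_fun A (%y. sform ph ps s y (adj B z \<otimes>\<^bsub>B\<^esub> z))"
proof
 interpret f: pos_fun A ph by fact
 have c: "fst p : car A" if "s p ~= 0" for p
  using F.carrierD(2)[OF s that] by (auto simp: mem_Times_iff)
 fix x y c' assume x: "x : car A"
 show "sform ph ps s (c' \<odot>\<^bsub>A\<^esub> x) (adj B z \<otimes>\<^bsub>B\<^esub> z) = c' * sform ph ps s x (adj B z \<otimes>\<^bsub>B\<^esub> z)"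
  unfolding sform_def sum_distrib_left
  by (intro sum.cong refl) (use c x in "auto simp: A.smult_mult_left A.smult_mult_right f.Phi_smult")
 show "sform ph ps s (adj A x \<otimes>\<^bsub>A\<^esub> x) (adj B z \<otimes>\<^bsub>B\<^esub> z) : \<real>\<^sub>\<ge>\<^sub>0" by (rule sform_pos[OF p s x z])
 assume y: "y : car A"
 show "sform ph ps s (x \<oplus>\<^bsub>A\<^esub> y) (adj B z \<otimes>\<^bsub>B\<^esub> z) =
  sform ph ps s x (adj B z \<otimes>\<^bsub>B\<^esub> z) + sform ph ps s y (adj B z \<otimes>\<^bsub>B\<^esub> z)"
  unfolding sform_def sum.distrib[symmetric]
  by (intro sum.cong refl) (use c x y in "auto simp: A.l_distr A.r_distr f.Phi_add algebra_simps")
qed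

lemma sform_linear_right:
 assumes p: "pos_fun A ph" "pos_fun B ps" and s: "s : car X" and z: "z : car A"
 shows "pos_fun B (%y. sform ph ps s (adj A z \<otimes>\<^bsub>A\<^esub> z) y)"
proof
 interpret g: pos_fun B ps by fact
 have c: "snd p : car B" if "s p ~= 0" for p
  using F.carrierD(2)[OF s that] by (auto simp: mem_Times_iff)
 fix x y c' assume x: "x : car B"
 show "sform ph ps s (adj A z \<otimes>\<^bsub>A\<^esub> z) (c' \<odot>\<^bsub>B\<^esub> x) = c' * sform ph ps s (adj A z \<otimes>\<^bsub>A\<^esub> z) x"
  unfolding sform_def sum_distrib_left
  by (intro sum.cong refl) (use c x in "auto simp: B.smult_mult_left B.smult_mult_right g.Phi_smult")
 show "sform ph ps s (adj A z \<otimes>\<^bsub>A\<^esub> z) (adj B x \<otimes>\<^bsub>B\<^esub> x) : \<real>\<^sub>\<ge>\<^sub>0" by (rule sform_pos[OF p s z x])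
 assume y: "y : car B"
 show "sform ph ps s (adj A z \<otimes>\<^bsub>A\<^esub> z) (x \<oplus>\<^bsub>B\<^esub> y) =
  sform ph ps s (adj A z \<otimes>\<^bsub>A\<^esub> z) x + sform ph ps s (adj A z \<otimes>\<^bsub>A\<^esub> z) y"
  unfolding sform_def sum.distrib[symmetric]
  by (intro sum.cong refl) (use c x y in "auto simp: B.l_distr B.r_distr g.Phi_add algebra_simps")
qed

lemma pf_basis_bound:
 assumes p: "pos_fun A ph" "pos_fun B ps" and s: "s : car X" and ab: "a : car A" "b : car B"
 defines "u == bv (a, b) \<otimes>\<^bsub>X\<^esub> s"
 shows "Re (pf ph ps (adj X u \<otimes>\<^bsub>X\<^esub> u)) <= (cnorm A a * cnorm B b)\<^sup>2 * Re (pf ph ps (adj X s \<otimes>\<^bsub>X\<^esub> s))"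
proof -
 interpret f: pos_fun A ph by fact
 interpret g: pos_fun B ps by fact
 have ab': "(a, b) : car MM" using ab by simp
 have u: "u : car X" unfolding u_def by (intro F.X_mult_closed F.basis_closed ab' s)
 have c: "fst p : car A" "snd p : car B" if "s p ~= 0" for p
  using F.carrierD(2)[OF s that] by (auto simp: mem_Times_iff)
 have lu: "lin u h = lin s (%r. h ((a, b) \<otimes>\<^bsub>MM\<^esub> r))" for h
  unfolding u_def F.lin_mult[OF F.basis_closed[OF ab'] s] by simp
 have "pf ph ps (adj X u \<otimes>\<^bsub>X\<^esub> u) = (SUM p | s p ~= 0. cnj (s p) * (SUM r | s r ~= 0. s r *
  (case map_prod (adj A) (adj B) ((a, b) \<otimes>\<^bsub>MM\<^esub> p) \<otimes>\<^bsub>MM\<^esub> ((a, b) \<otimes>\<^bsub>MM\<^esub> r) of (a, b) => ph a * ps b)))"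
  unfolding pf_def F.lin_mult[OF F.X_adj_closed[OF u] u] F.lin_adj[OF u] lu by (simp add: lin_def)
 also have "... = sform ph ps s (adj A a \<otimes>\<^bsub>A\<^esub> a) (adj B b \<otimes>\<^bsub>B\<^esub> b)"
  unfolding sform_def sum_distrib_left
  by (intro sum.cong refl)
  (use c ab in "auto simp: DirProd_def split_beta A.star_mult B.star_mult A.m_assoc B.m_assoc")
 finally have e: "pf ph ps (adj X u \<otimes>\<^bsub>X\<^esub> u) = sform ph ps s (adj A a \<otimes>\<^bsub>A\<^esub> a) (adj B b \<otimes>\<^bsub>B\<^esub> b)" .
 have "Re (sform ph ps s (adj A a \<otimes>\<^bsub>A\<^esub> a) (adj B b \<otimes>\<^bsub>B\<^esub> b)) \<le>
  cnorm A (adj A a \<otimes>\<^bsub>A\<^esub> a) * Re (sform ph ps s \<one>\<^bsub>A\<^esub> (adj B b \<otimes>\<^bsub>B\<^esub> b))"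
  by (rule A.pos_fun_bound[OF sform_linear_left[OF p s ab(2)]]) (rule A.sa_square[OF ab(1)])
 also have "... <= cnorm A (adj A a \<otimes>\<^bsub>A\<^esub> a) * (cnorm B (adj B b \<otimes>\<^bsub>B\<^esub> b) * Re (sform ph ps s \<one>\<^bsub>A\<^esub> \<one>\<^bsub>B\<^esub>))"
  using B.pos_fun_bound[OF sform_linear_right[OF p s A.one_closed] B.sa_square(1)[OF ab(2)]] ab
  by (intro mult_left_mono) auto
 also have "... = (cnorm A a * cnorm B b)\<^sup>2 * Re (pf ph ps (adj X s \<otimes>\<^bsub>X\<^esub> s))"
  using ab by (simp add: A.nu_cstar B.nu_cstar pf_sform[OF s] power_mult_distrib)
 finally show ?thesis unfolding e .
qed

definition FF where "FF = {pf ph ps | ph ps. is_state A ph & is_state B ps}"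

lemma pos_family_FF: "pos_family X FF"
proof (intro pos_family.intro pos_family_axioms.intro)
 show "star_alg X" by (rule F.X.star_alg_axioms)
next
 fix Ph assume "Ph : FF"
 then show "pos_fun X Ph" using pos_fun_pf A.pos_fun_state B.pos_fun_state by (auto simp: FF_def)
next
 have pf: "pos_fun X Ph" if "Ph : FF" for Ph
  using that pos_fun_pf A.pos_fun_state B.pos_fun_state by (auto simp: FF_def)
 fix t assume "t : car X"
 then show "EX C>=0. ALL Ph:FF. ALL s:car X.
  sqrt (Re (Ph (adj X (t \<otimes>\<^bsub>X\<^esub> s) \<otimes>\<^bsub>X\<^esub> (t \<otimes>\<^bsub>X\<^esub> s)))) <= C * sqrt (Re (Ph (adj X s \<otimes>\<^bsub>X\<^esub> s)))"
 proof (induction t rule: F.X_induct)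
  case zero
  have "sqrt (Re (Ph (adj X (\<zero>\<^bsub>X\<^esub> \<otimes>\<^bsub>X\<^esub> s) \<otimes>\<^bsub>X\<^esub> (\<zero>\<^bsub>X\<^esub> \<otimes>\<^bsub>X\<^esub> s)))) = 0"
  if "Ph : FF" "s : car X" for Ph s
  proof -
  interpret pos_fun X Ph by (rule pf[OF that(1)])
  show ?thesis using that(2) by simp
  qed
  then show ?case by (intro exI[of _ 0]) simp
 next
  case (add t c x)
  obtain C where C: "C >= 0" "!!Ph s. Ph : FF ==> s : car X ==>
  sqrt (Re (Ph (adj X (t \<otimes>\<^bsub>X\<^esub> s) \<otimes>\<^bsub>X\<^esub> (t \<otimes>\<^bsub>X\<^esub> s)))) <= C * sqrt (Re (Ph (adj X s \<otimes>\<^bsub>X\<^esub> s)))"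
  using add.IH by blast
  obtain a b where x1: "x = (a, b)" by (cases x)
  have "x : car A \<times> car B" using add.hyps(2) by simp
  then have x: "x = (a, b)" "a : car A" "b : car B" using x1 by auto
  define D where "D = C + cmod c * (cnorm A a * cnorm B b)"
  have "D >= 0" using C x by (simp add: D_def)
  moreover have "sqrt (Re (Ph (adj X ((t \<oplus>\<^bsub>X\<^esub> c \<odot>\<^bsub>X\<^esub> bv x) \<otimes>\<^bsub>X\<^esub> s) \<otimes>\<^bsub>X\<^esub>
  ((t \<oplus>\<^bsub>X\<^esub> c \<odot>\<^bsub>X\<^esub> bv x) \<otimes>\<^bsub>X\<^esub> s)))) <= D * sqrt (Re (Ph (adj X s \<otimes>\<^bsub>X\<^esub> s)))"
  if F: "Ph : FF" and s: "s : car X" for Ph s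
  proof -
  interpret pos_fun X Ph by (rule pf[OF F])
  have b: "bv x : car X" by (rule F.basis_closed[OF add.hyps(2)])
  obtain ph ps where st: "Ph = pf ph ps" "is_state A ph" "is_state B ps" using F by (auto simp: FF_def)
  have "sqrt (q (bv x \<otimes>\<^bsub>X\<^esub> s)) <= sqrt ((cnorm A a * cnorm B b)\<^sup>2 * q s)"
  unfolding q_def unfolding x(1) st(1)
  by (intro real_sqrt_le_mono pf_basis_bound A.pos_fun_state B.pos_fun_state st s x)
  also have "... = cnorm A a * cnorm B b * sqrt (q s)" using x by (simp add: real_sqrt_mult)
  finally have 1: "sqrt (q (bv x \<otimes>\<^bsub>X\<^esub> s)) <= cnorm A a * cnorm B b * sqrt (q s)" .
  have "(t \<oplus>\<^bsub>X\<^esub> c \<odot>\<^bsub>X\<^esub> bv x) \<otimes>\<^bsub>X\<^esub> s = t \<otimes>\<^bsub>X\<^esub> s \<oplus>\<^bsub>X\<^esub> c \<odot>\<^bsub>X\<^esub> (bv x \<otimes>\<^bsub>X\<^esub> s)"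
  using add.hyps(1) b s by (simp add: F.X.l_distr F.X.smult_mult_left)
  then have "sqrt (q ((t \<oplus>\<^bsub>X\<^esub> c \<odot>\<^bsub>X\<^esub> bv x) \<otimes>\<^bsub>X\<^esub> s)) \<le>
  sqrt (q (t \<otimes>\<^bsub>X\<^esub> s)) + sqrt (q (c \<odot>\<^bsub>X\<^esub> (bv x \<otimes>\<^bsub>X\<^esub> s)))"
  using sqrt_q_triangle[of "t \<otimes>\<^bsub>X\<^esub> s" "c \<odot>\<^bsub>X\<^esub> (bv x \<otimes>\<^bsub>X\<^esub> s)"] add.hyps(1) b s by simp
  also have "sqrt (q (c \<odot>\<^bsub>X\<^esub> (bv x \<otimes>\<^bsub>X\<^esub> s))) = cmod c * sqrt (q (bv x \<otimes>\<^bsub>X\<^esub> s))"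
  using q_smult[of "bv x \<otimes>\<^bsub>X\<^esub> s" c] b s by (simp add: real_sqrt_mult)
  also have "sqrt (q (t \<otimes>\<^bsub>X\<^esub> s)) + ... \<le>
  C * sqrt (q s) + cmod c * (cnorm A a * cnorm B b * sqrt (q s))"
  using C(2)[OF F s] 1 by (intro add_mono mult_left_mono) (auto simp: q_def)
  also have "... = D * sqrt (q s)" by (simp add: D_def algebra_simps)
  finally show ?thesis by (simp add: q_def)
  qed
  ultimately show ?case by blast
 qed
qed

sublocale P: pos_family X FF by (rule pos_family_FF)

lemma min_seminorm_mu: "min_seminorm A B = P.mu"
proof
 fix t
 have "{sqrt (Re (product_functional ph ps (adj X (t \<otimes>\<^bsub>X\<^esub> s) \<otimes>\<^bsub>X\<^esub> (t \<otimes>\<^bsub>X\<^esub> s)))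
  / Re (product_functional ph ps (adj X s \<otimes>\<^bsub>X\<^esub> s))) | ph ps s.
  is_state A ph & is_state B ps & s : car X &
  product_functional ph ps (adj X s \<otimes>\<^bsub>X\<^esub> s) ~= 0} =
  {sqrt (Re (Ph (adj X (t \<otimes>\<^bsub>X\<^esub> s) \<otimes>\<^bsub>X\<^esub> (t \<otimes>\<^bsub>X\<^esub> s))) / Re (Ph (adj X s \<otimes>\<^bsub>X\<^esub> s))) | Ph s.
  Ph : FF & s : car X & Ph (adj X s \<otimes>\<^bsub>X\<^esub> s) ~= 0}"
  unfolding FF_def product_functional_pf by blast
 then show "min_seminorm A B t = P.mu t" unfolding min_seminorm_def P.mu_def Let_def by simp
qed

sublocale S: cstar_semi X "min_seminorm A B"
 by unfold_locales (simp add: min_seminorm_mu P.mu_seminorm)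

text \<open>Elements on which all products of linear functionals vanish have seminorm zero; in particular
 elementary tensors are bilinear up to such elements.\<close>

lemma seminorm_zeroI:
 assumes t: "t : car X"
  and z: "!!f g. linear_on A f ==> linear_on B g ==> lin t (%(c, d). f c * g d) = 0"
 shows "min_seminorm A B t = 0"
proof -
 have "P.mu t <= 0"
 proof (rule P.mu_least[OF t order_refl])
  fix Ph s assume F: "Ph : FF" and s: "s : car X"
  obtain ph ps where st: "Ph = pf ph ps" "is_state A ph" "is_state B ps" using F by (auto simp: FF_def)
  interpret f: pos_fun A ph by (rule A.pos_fun_state[OF st(2)])
  interpret g: pos_fun B ps by (rule B.pos_fun_state[OF st(3)])
  define w where "w = adj X (t \<otimes>\<^bsub>X\<^esub> s)"
  have w: "w : car X" unfolding w_def by (intro F.X_adj_closed F.X_mult_closed t s)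
  have c: "lin t (%y. case p \<otimes>\<^bsub>MM\<^esub> (y \<otimes>\<^bsub>MM\<^esub> r) of (a, b) => ph a * ps b) = 0"
  if "p : car MM" "r : car MM" for p r
  proof -
  have 1: "linear_on A (%c. ph (fst p \<otimes>\<^bsub>A\<^esub> (c \<otimes>\<^bsub>A\<^esub> fst r)))"
  using that unfolding linear_on_def
  by (auto simp: A.l_distr A.r_distr A.smult_mult_left A.smult_mult_right f.Phi_add f.Phi_smult)
  have 2: "linear_on B (%c. ps (snd p \<otimes>\<^bsub>B\<^esub> (c \<otimes>\<^bsub>B\<^esub> snd r)))"
  using that unfolding linear_on_def
  by (auto simp: B.l_distr B.r_distr B.smult_mult_left B.smult_mult_right g.Phi_add g.Phi_smult)
  show ?thesis using z[OF 1 2] by (simp add: DirProd_def case_prod_beta')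
  qed
  have "pf ph ps (w \<otimes>\<^bsub>X\<^esub> (t \<otimes>\<^bsub>X\<^esub> s)) =
  lin w (%p. lin s (%r. lin t (%y. case p \<otimes>\<^bsub>MM\<^esub> (y \<otimes>\<^bsub>MM\<^esub> r) of (a, b) => ph a * ps b)))"
  unfolding pf_def F.lin_mult[OF w F.X_mult_closed[OF t s]] F.lin_mult[OF t s] by (subst lin_swap) (rule refl)
  also have "... = lin w (%p. lin s (%r. 0))"
  by (intro F.lin_cong_X w s c)
  also have "... = 0" by (simp add: lin_def)
  finally show "P.n2 Ph (t \<otimes>\<^bsub>X\<^esub> s) <= 0 * P.n2 Ph s" by (simp add: st(1) w_def)
 qed
 then show ?thesis using P.mu_nonneg[OF t] unfolding min_seminorm_mu by simp
qed

end

lemma formal_tensors_sub: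
 assumes "cstar_sub A S"
 defines "B == A(|carrier := S|)"
 defines "X == formal_tensors A A" and "Y == formal_tensors B B"
 shows "car Y <= car X" "monoid.mult Y = monoid.mult X" "ring.add Y = ring.add X" "monoid.one Y = monoid.one X" "ring.zero Y = ring.zero X"
  "module.smult Y = module.smult X" "x : car Y ==> adj Y x = adj X x"
proof -
 interpret S: cstar_sub A S by fact
 interpret BB: tensor_pair B B unfolding B_def by unfold_locales
 show "car Y <= car X"
  by (auto simp: X_def Y_def formal_tensors_def monoid_algebra_def B_def)
 show "monoid.mult Y = monoid.mult X" "ring.add Y = ring.add X" "monoid.one Y = monoid.one X" "ring.zero Y = ring.zero X" "module.smult Y = module.smult X"
  by (simp_all add: X_def Y_def formal_tensors_def monoid_algebra_def B_def DirProd_def)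
 assume x: "x : car Y"
 show "adj Y x = adj X x"
 proof
  fix p :: "'a \<times> 'a"
  have "x (map_prod (adj A) (adj A) p) = 0" if "p : car (A \<times>\<times> A)" "p ~: car (B \<times>\<times> B)"
  proof (rule ccontr)
  assume "x (map_prod (adj A) (adj A) p) ~= 0"
  then have "map_prod (adj A) (adj A) p : car (B \<times>\<times> B)" using BB.F.carrierD(2) x by (auto simp: Y_def)
  then have "map_prod (adj A) (adj A) (map_prod (adj A) (adj A) p) : car (B \<times>\<times> B)"
  by (cases p) (auto simp: B_def)
  then show False using that by (cases p) auto
  qed
  moreover have "p : car (A \<times>\<times> A)" if "p : car (B \<times>\<times> B)" using that by (cases p) (auto simp: B_def)
  ultimately show "adj Y x p = adj X x p"
  by (auto simp: X_def Y_def formal_tensors_def monoid_algebra_def B_def)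
 qed
qed

text \<open>Every pair of states on the subalgebra extends, so the supremum over the larger algebra dominates.\<close>

lemma min_seminorm_subalgebra:
 assumes "cstar_sub A S"
 defines "B == A(|carrier := S|)"
 assumes t: "t : car (formal_tensors B B)"
 shows "min_seminorm B B t <= min_seminorm A A t"
proof -
 interpret S: cstar_sub A S by fact
 interpret BB: tensor_pair B B unfolding B_def by unfold_locales
 interpret AA: tensor_pair A A by unfold_locales
 note sub = formal_tensors_sub(1)[OF assms(1), folded B_def]
  and mult = formal_tensors_sub(2)[OF assms(1), folded B_def]
  and adj = formal_tensors_sub(7)[OF assms(1), folded B_def]
 have "BB.P.mu t <= AA.P.mu t"
 proof (rule BB.P.mu_least[OF t])
  have tA: "t : car AA.X" using t sub by blast
  show "0 <= AA.P.mu t" using tA by simp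
  fix Ph s assume F: "Ph : BB.FF" and s: "s : car BB.X"
  obtain ph ps where st: "Ph = BB.pf ph ps" "is_state B ph" "is_state B ps" using F by (auto simp: BB.FF_def)
  obtain ph' where p': "is_state A ph'" "!!x. x : S ==> ph' x = ph x"
  using S.state_extension st(2) unfolding B_def by blast
  obtain ps' where q': "is_state A ps'" "!!x. x : S ==> ps' x = ps x"
  using S.state_extension st(3) unfolding B_def by blast
  have eq: "AA.pf ph' ps' y = BB.pf ph ps y" if "y : car BB.X" for y
  unfolding AA.pf_def BB.pf_def by (rule BB.F.lin_cong_X[OF that]) (auto simp: B_def p' q')
  have n2: "AA.P.n2 (AA.pf ph' ps') y = BB.P.n2 (BB.pf ph ps) y" if y: "y : car BB.X" for y
  using eq[of "adj BB.X y \<otimes>\<^bsub>BB.X\<^esub> y"] BB.F.X_mult_closed[OF BB.F.X_adj_closed[OF y] y]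
  by (simp add: mult adj[OF y])
  have "AA.P.n2 (AA.pf ph' ps') (t \<otimes>\<^bsub>AA.X\<^esub> s) <= AA.P.mu t * AA.P.n2 (AA.pf ph' ps') s"
  using p'(1) q'(1) s sub tA by (intro AA.P.mu_bound) (auto simp: AA.FF_def)
  then show "BB.P.n2 Ph (t \<otimes>\<^bsub>BB.X\<^esub> s) <= AA.P.mu t * BB.P.n2 Ph s"
  using n2[OF s] n2[OF BB.F.X_mult_closed[OF t s]] unfolding st(1) by (simp add: mult)
 qed
 then show ?thesis unfolding BB.min_seminorm_mu AA.min_seminorm_mu .
qed

section \<open>Completions\<close>

context cstar_semi
begin

abbreviation cls :: "(nat => 'a) => (nat => 'a) set" where "cls X == cauchy_class A nu X"
abbreviation C where "C == completion A nu"
abbreviation cs where "cs == cauchy_seqs A nu"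

lemma csD: "X : cs ==> X n : car A"
 by (auto simp: cauchy_seqs_def)

lemma mem_cls: "X : cs ==> Y : cls X \<longleftrightarrow> asym X Y"
 using cauchy_asym[of X Y] by (auto simp: cauchy_class_def asym_def dest: csD)

lemma cls_self: "X : cs ==> X : cls X"
 by (simp add: mem_cls asym_refl csD)

lemma cls_eq_iff:
 assumes X: "X : cs" and Y: "Y : cs" shows "cls X = cls Y \<longleftrightarrow> asym X Y"
proof
 assume "cls X = cls Y"
 then have "Y : cls X" using cls_self[OF Y] by simp
 then show "asym X Y" by (simp add: mem_cls[OF X])
next
 assume XY: "asym X Y"
 have "asym X Z \<longleftrightarrow> asym Y Z" for Z
  using asym_trans[OF XY, of Z] asym_trans[OF asym_sym[OF XY], of Z] by blast
 then show "cls X = cls Y" by (simp add: set_eq_iff mem_cls[OF X] mem_cls[OF Y])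
qed

lemma asym_rep:
 assumes X: "X : cs" shows "asym X (rep (cls X))"
proof -
 have "rep (cls X) : cls X" unfolding rep_def by (rule someI[of "%Y. Y : cls X", OF cls_self[OF X]])
 then show ?thesis by (simp add: mem_cls[OF X])
qed

lemma rep_cs: "X : cs ==> rep (cls X) : cs"
 using cauchy_asym asym_rep by blast

lemma carrier_C: "car C = cls ` cs"
 by (simp add: completion_def)

lemma cls_closed [simp]: "X : cs ==> cls X : car C"
 by (simp add: carrier_C)

lemma cs_add:
 assumes X: "X : cs" and Y: "Y : cs" shows "(%n. X n \<oplus> Y n) : cs"
 unfolding cauchy_seqs_def
proof safe
 note c = csD[OF X] csD[OF Y]
 fix e :: real assume "0 < e"
 then have e: "0 < e / 2" by simp
 obtain M where M: "!!m n. m >= M ==> n >= M ==> nu (X m \<ominus> X n) < e / 2" using cauchyD[OF X e] by metis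
 obtain L where L: "!!m n. m >= L ==> n >= L ==> nu (Y m \<ominus> Y n) < e / 2" using cauchyD[OF Y e] by metis
 have "nu ((X m \<oplus> Y m) \<ominus> (X n \<oplus> Y n)) < e" if "m >= max M L" "n >= max M L" for m n
 proof -
  have "(X m \<oplus> Y m) \<ominus> (X n \<oplus> Y n) = (X m \<ominus> X n) \<oplus> (Y m \<ominus> Y n)"
  using c by (simp add: a_minus_def minus_add a_ac)
  then show ?thesis using nu_add[of "X m \<ominus> X n" "Y m \<ominus> Y n"] M[of m n] L[of m n] that c by simp
 qed
 then show "EX M. ALL m>=M. ALL n>=M. nu ((X m \<oplus> Y m) \<ominus> (X n \<oplus> Y n)) < e" by blast
qed (auto simp: csD[OF X] csD[OF Y])

lemma cs_smult:
 assumes X: "X : cs" shows "(%n. c \<odot> X n) : cs"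
 unfolding cauchy_seqs_def
proof safe
 fix e :: real assume e: "0 < e"
 have e': "0 < e / (cmod c + 1)" using e by (simp add: add_nonneg_pos)
 obtain M where M: "!!m n. m >= M ==> n >= M ==> nu (X m \<ominus> X n) < e / (cmod c + 1)"
  using cauchyD[OF X e'] by metis
 have "nu (c \<odot> X m \<ominus> c \<odot> X n) < e" if "m >= M" "n >= M" for m n
 proof -
  have "nu (c \<odot> X m \<ominus> c \<odot> X n) = cmod c * nu (X m \<ominus> X n)"
  using csD[OF X] by (simp add: smult_diff[symmetric] nu_smult)
  also have "... <= (cmod c + 1) * nu (X m \<ominus> X n)" using csD[OF X] by (intro mult_right_mono) auto
  also have "... < e"
  using M[OF that] pos_less_divide_eq[of "cmod c + 1" "nu (X m \<ominus> X n)" e]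
  by (simp add: add_nonneg_pos mult.commute)
  finally show ?thesis .
 qed
 then show "EX M. ALL m>=M. ALL n>=M. nu (c \<odot> X m \<ominus> c \<odot> X n) < e" by blast
qed (auto simp: csD[OF X])

lemma cs_star:
 assumes X: "X : cs" shows "(%n. star (X n)) : cs"
proof -
 have c: "X n : car A" for n using csD[OF X] .
 have "nu (star (X m) \<ominus> star (X n)) = nu (X m \<ominus> X n)" for m n
  using c by (simp add: star_diff[symmetric])
 then show ?thesis using X unfolding cauchy_seqs_def by simp
qed

lemma cs_mult:
 assumes X: "X : cs" and Y: "Y : cs" shows "(%n. X n \<otimes> Y n) : cs"
 unfolding cauchy_seqs_def
proof safe
 note c = csD[OF X] csD[OF Y]
 obtain B where B: "!!n. nu (X n) <= B" using cauchy_bounded[OF X] by blast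
 obtain D where D: "!!n. nu (Y n) <= D" using cauchy_bounded[OF Y] by blast
 have BD: "0 <= B" "0 <= D" using B[of 0] D[of 0] nu_nonneg c by (meson order_trans)+
 fix e :: real assume e: "0 < e"
 define d where "d = e / (B + D + 1)"
 have d: "0 < d" "(B + D) * d < e" using e BD by (auto simp: d_def field_simps)
 obtain M where M: "!!m n. m >= M ==> n >= M ==> nu (X m \<ominus> X n) < d" using cauchyD[OF X d(1)] by metis
 obtain L where L: "!!m n. m >= L ==> n >= L ==> nu (Y m \<ominus> Y n) < d" using cauchyD[OF Y d(1)] by metis
 have "nu (X m \<otimes> Y m \<ominus> X n \<otimes> Y n) < e" if "m >= max M L" "n >= max M L" for m n
 proof -
  have "X m \<otimes> Y m \<ominus> X n \<otimes> Y n = X m \<otimes> (Y m \<ominus> Y n) \<oplus> (X m \<ominus> X n) \<otimes> Y n"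
  using c[of n] c[of m] by (simp add: a_minus_def r_distr l_distr l_minus r_minus a_assoc r_neg1)
  then have "nu (X m \<otimes> Y m \<ominus> X n \<otimes> Y n) <= nu (X m \<otimes> (Y m \<ominus> Y n)) + nu ((X m \<ominus> X n) \<otimes> Y n)"
  using nu_add c by simp
  also have "... <= nu (X m) * nu (Y m \<ominus> Y n) + nu (X m \<ominus> X n) * nu (Y n)"
  using c by (intro add_mono nu_mult) auto
  also have "... <= B * d + d * D"
  using M[of m n] L[of m n] that B D BD c d by (intro add_mono mult_mono) auto
  also have "... = (B + D) * d" by (simp add: algebra_simps)
  finally show ?thesis using d by simp
 qed
 then show "EX M. ALL m>=M. ALL n>=M. nu (X m \<otimes> Y m \<ominus> X n \<otimes> Y n) < e" by blast
qed (auto simp: csD[OF X] csD[OF Y])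

lemma cls_add: "X : cs ==> Y : cs ==> cls X \<oplus>\<^bsub>C\<^esub> cls Y = cls (%n. X n \<oplus> Y n)"
 by (simp add: completion_def cls_eq_iff cs_add rep_cs asym_add asym_rep asym_sym)

lemma cls_smult: "X : cs ==> c \<odot>\<^bsub>C\<^esub> cls X = cls (%n. c \<odot> X n)"
 by (simp add: completion_def cls_eq_iff cs_smult rep_cs asym_smult asym_rep asym_sym)

lemma cls_star: "X : cs ==> adj C (cls X) = cls (%n. star (X n))"
 by (simp add: completion_def cls_eq_iff cs_star rep_cs asym_star asym_rep asym_sym)

lemma cs_asym_mult:
 assumes "X : cs" "Y' : cs" "asym X X'" "asym Y Y'"
 shows "asym (%n. X n \<otimes> Y n) (%n. X' n \<otimes> Y' n)"
proof -
 obtain B where B: "!!n. nu (X n) <= B" using cauchy_bounded[OF assms(1)] by blast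
 obtain D where D: "!!n. nu (Y' n) <= D" using cauchy_bounded[OF assms(2)] by blast
 show ?thesis by (rule asym_mult[OF assms(3,4) B D])
qed

lemma cls_mult: "X : cs ==> Y : cs ==> cls X \<otimes>\<^bsub>C\<^esub> cls Y = cls (%n. X n \<otimes> Y n)"
 by (simp add: completion_def cls_eq_iff cs_mult rep_cs cs_asym_mult asym_rep asym_sym)

lemma C_one: "\<one>\<^bsub>C\<^esub> = cls (%_. \<one>)" and C_zero: "\<zero>\<^bsub>C\<^esub> = cls (%_. \<zero>)"
 by (simp_all add: completion_def)

lemma C_abelian_monoid: "abelian_monoid C"
proof (rule abelian_monoidI)
 fix P Q R assume "P : car C" "Q : car C"
 then obtain X Y where XY: "X : cs" "P = cls X" "Y : cs" "Q = cls Y" by (auto simp: carrier_C)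
 show "P \<oplus>\<^bsub>C\<^esub> Q : car C" using XY by (simp add: cls_add cs_add)
 have "(%n. X n \<oplus> Y n) = (%n. Y n \<oplus> X n)" using XY csD a_comm by blast
 then show "P \<oplus>\<^bsub>C\<^esub> Q = Q \<oplus>\<^bsub>C\<^esub> P" using XY by (simp add: cls_add)
 assume "R : car C"
 then obtain Z where Z: "Z : cs" "R = cls Z" by (auto simp: carrier_C)
 have "(%n. X n \<oplus> Y n \<oplus> Z n) = (%n. X n \<oplus> (Y n \<oplus> Z n))" using XY Z csD a_assoc by blast
 then show "P \<oplus>\<^bsub>C\<^esub> Q \<oplus>\<^bsub>C\<^esub> R = P \<oplus>\<^bsub>C\<^esub> (Q \<oplus>\<^bsub>C\<^esub> R)" using XY Z by (simp add: cls_add cs_add)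
next
 fix P assume "P : car C"
 then obtain X where X: "X : cs" "P = cls X" by (auto simp: carrier_C)
 have "(%n. \<zero> \<oplus> X n) = X" using X csD by auto
 then show "\<zero>\<^bsub>C\<^esub> \<oplus>\<^bsub>C\<^esub> P = P" using X by (simp add: C_zero cls_add cauchy_const)
qed (simp add: C_zero cauchy_const)

lemma nu_cauchy_conv:
 assumes "X : cs" shows "(%n. nu (X n)) \<longlonglongrightarrow> cnorm C (cls X)"
proof -
 define R where "R = rep (cls X)"
 have R: "R : cs" "asym X R" using rep_cs asym_rep assms by (auto simp: R_def)
 have "Cauchy (%n. nu (R n))"
 proof (rule metric_CauchyI)
  fix e :: real assume e: "0 < e"
  obtain M where M: "!!m n. m >= M ==> n >= M ==> nu (R m \<ominus> R n) < e" using cauchyD[OF R(1) e] by metis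
  have "dist (nu (R m)) (nu (R n)) < e" if "m >= M" "n >= M" for m n
  using nu_abs_diff[of "R m" "R n"] csD[OF R(1)] M[OF that] by (simp add: dist_real_def)
  then show "EX M. ALL m>=M. ALL n>=M. dist (nu (R m)) (nu (R n)) < e" by blast
 qed
 then have "(%n. nu (R n)) \<longlonglongrightarrow> lim (%n. nu (R n))" by (simp add: Cauchy_convergent_iff convergent_LIMSEQ_iff)
 moreover have "(%n. nu (X n) - nu (R n)) \<longlonglongrightarrow> 0"
  by (rule tendsto_rabs_zero_cancel, rule tendsto_sandwich[OF _ _ tendsto_const asymD(3)[OF R(2)]])
  (use nu_abs_diff asymD(1,2)[OF R(2)] in auto)
 ultimately have "(%n. (nu (X n) - nu (R n)) + nu (R n)) \<longlonglongrightarrow> 0 + lim (%n. nu (R n))"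
  by (intro tendsto_add)
 then show ?thesis by (simp add: completion_def R_def)
qed

lemma C_seminorm: "cstar_seminorm C (cnorm C)"
 unfolding cstar_seminorm_def
proof (intro conjI ballI allI)
 fix P Q c assume P: "P : car C"
 then obtain X where X: "X : cs" "P = cls X" by (auto simp: carrier_C)
 note c = csD[OF X(1)]
 show "cnorm C (c \<odot>\<^bsub>C\<^esub> P) = cmod c * cnorm C P"
 proof (rule LIMSEQ_unique)
  show "(%n. nu (c \<odot> X n)) \<longlonglongrightarrow> cnorm C (c \<odot>\<^bsub>C\<^esub> P)"
  using nu_cauchy_conv[OF cs_smult[OF X(1)]] X by (simp add: cls_smult)
  show "(%n. nu (c \<odot> X n)) \<longlonglongrightarrow> cmod c * cnorm C P"
  using tendsto_mult[OF tendsto_const nu_cauchy_conv[OF X(1)], of "cmod c"] X c by (simp add: nu_smult)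
 qed
 show "cnorm C (adj C P \<otimes>\<^bsub>C\<^esub> P) = (cnorm C P)\<^sup>2"
 proof (rule LIMSEQ_unique)
  show "(%n. nu (star (X n) \<otimes> X n)) \<longlonglongrightarrow> cnorm C (adj C P \<otimes>\<^bsub>C\<^esub> P)"
  using nu_cauchy_conv[OF cs_mult[OF cs_star[OF X(1)] X(1)]] X by (simp add: cls_mult cls_star cs_star)
  show "(%n. nu (star (X n) \<otimes> X n)) \<longlonglongrightarrow> (cnorm C P)\<^sup>2"
  using tendsto_power[OF nu_cauchy_conv[OF X(1)], of 2] X c by (simp add: nu_cstar)
 qed
 assume "Q : car C"
 then obtain Y where Y: "Y : cs" "Q = cls Y" by (auto simp: carrier_C)
 show "cnorm C (P \<oplus>\<^bsub>C\<^esub> Q) <= cnorm C P + cnorm C Q"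
 proof (rule LIMSEQ_le)
  show "(%n. nu (X n \<oplus> Y n)) \<longlonglongrightarrow> cnorm C (P \<oplus>\<^bsub>C\<^esub> Q)"
  using nu_cauchy_conv[OF cs_add[OF X(1) Y(1)]] X Y by (simp add: cls_add)
  show "(%n. nu (X n) + nu (Y n)) \<longlonglongrightarrow> cnorm C P + cnorm C Q"
  using tendsto_add[OF nu_cauchy_conv[OF X(1)] nu_cauchy_conv[OF Y(1)]] X Y by simp
  show "EX N. ALL n>=N. nu (X n \<oplus> Y n) <= nu (X n) + nu (Y n)" using c csD[OF Y(1)] nu_add by blast
 qed
 show "cnorm C (P \<otimes>\<^bsub>C\<^esub> Q) <= cnorm C P * cnorm C Q"
 proof (rule LIMSEQ_le)
  show "(%n. nu (X n \<otimes> Y n)) \<longlonglongrightarrow> cnorm C (P \<otimes>\<^bsub>C\<^esub> Q)"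
  using nu_cauchy_conv[OF cs_mult[OF X(1) Y(1)]] X Y by (simp add: cls_mult)
  show "(%n. nu (X n) * nu (Y n)) \<longlonglongrightarrow> cnorm C P * cnorm C Q"
  using tendsto_mult[OF nu_cauchy_conv[OF X(1)] nu_cauchy_conv[OF Y(1)]] X Y by simp
  show "EX N. ALL n>=N. nu (X n \<otimes> Y n) <= nu (X n) * nu (Y n)" using c csD[OF Y(1)] nu_mult by blast
 qed
qed

abbreviation \<iota> :: "'a => (nat => 'a) set" where "\<iota> x == cls (%_. x)"

lemma iota_eq_iff: "x : car A ==> y : car A ==> \<iota> x = \<iota> y \<longleftrightarrow> nu (x \<ominus> y) = 0"
 by (simp add: cls_eq_iff cauchy_const asym_const_iff)

lemma iota_closed: "x : car A ==> \<iota> x : car C"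
 by (simp add: cauchy_const)

lemma iota_add: "x : car A ==> y : car A ==> \<iota> x \<oplus>\<^bsub>C\<^esub> \<iota> y = \<iota> (x \<oplus> y)"
 by (simp add: cls_add cauchy_const)

lemma iota_mult: "x : car A ==> y : car A ==> \<iota> x \<otimes>\<^bsub>C\<^esub> \<iota> y = \<iota> (x \<otimes> y)"
 by (simp add: cls_mult cauchy_const)

lemma iota_smult: "x : car A ==> c \<odot>\<^bsub>C\<^esub> \<iota> x = \<iota> (c \<odot> x)"
 by (simp add: cls_smult cauchy_const)

lemma iota_star: "x : car A ==> adj C (\<iota> x) = \<iota> (star x)"
 by (simp add: cls_star cauchy_const)

lemma cnorm_iota: "x : car A ==> cnorm C (\<iota> x) = nu x"
 by (rule LIMSEQ_unique[OF nu_cauchy_conv[OF cauchy_const] tendsto_const])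

lemma iota_finsum:
 assumes "finite I" "f : I \<rightarrow> car A"
 shows "finsum C (%i. \<iota> (f i)) I = \<iota> (finsum A f I)"
proof -
 interpret CM: abelian_monoid C by (rule C_abelian_monoid)
 show ?thesis using assms
 proof (induction I)
  case (insert i I)
  then have f: "f : I \<rightarrow> car A" "f i : car A" by auto
  have g: "(%i. \<iota> (f i)) : I \<rightarrow> car C" by (intro Pi_I iota_closed) (use f(1) in auto)
  show ?case
  using insert.hyps insert.IH[OF f(1)] f g
  by (simp add: CM.finsum_insert[OF insert.hyps(1,2) g] cauchy_const iota_add)
 qed (simp add: C_zero)
qed

end

section \<open>Star-homomorphisms\<close>

locale star_homo = A: star_alg A + B: star_alg B
 for A :: "('a, 'm) star_algebra_scheme" and B :: "('b, 'n) star_algebra_scheme" +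
 fixes th :: "'a => 'b"
 assumes star_hom: "star_hom A B th"
begin

lemma hom_closed [simp]: "x : car A ==> th x : car B"
 using star_hom by (auto simp: star_hom_def ring_hom_def)

lemma hom_add: "x : car A ==> y : car A ==> th (x \<oplus>\<^bsub>A\<^esub> y) = th x \<oplus>\<^bsub>B\<^esub> th y"
 using star_hom by (auto simp: star_hom_def ring_hom_def)

lemma hom_mult: "x : car A ==> y : car A ==> th (x \<otimes>\<^bsub>A\<^esub> y) = th x \<otimes>\<^bsub>B\<^esub> th y"
 using star_hom by (auto simp: star_hom_def ring_hom_def)

lemma hom_one [simp]: "th \<one>\<^bsub>A\<^esub> = \<one>\<^bsub>B\<^esub>"
 using star_hom by (auto simp: star_hom_def ring_hom_def)

lemma hom_smult: "x : car A ==> th (c \<odot>\<^bsub>A\<^esub> x) = c \<odot>\<^bsub>B\<^esub> th x"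
 using star_hom by (auto simp: star_hom_def)

lemma hom_star: "x : car A ==> th (adj A x) = adj B (th x)"
 using star_hom by (auto simp: star_hom_def)

lemma hom_zero [simp]: "th \<zero>\<^bsub>A\<^esub> = \<zero>\<^bsub>B\<^esub>"
 using hom_smult[of "\<zero>\<^bsub>A\<^esub>" 0] by simp

lemma hom_minus: "x : car A ==> th (\<ominus>\<^bsub>A\<^esub> x) = \<ominus>\<^bsub>B\<^esub> th x"
 using hom_smult[of x "-1"] by (simp add: A.smult_minus_one B.smult_minus_one)

lemma hom_diff: "x : car A ==> y : car A ==> th (x \<ominus>\<^bsub>A\<^esub> y) = th x \<ominus>\<^bsub>B\<^esub> th y"
 by (simp add: a_minus_def hom_add hom_minus)

lemma hom_finsum:
 assumes "f : I \<rightarrow> car A" shows "th (finsum A f I) = finsum B (%i. th (f i)) I"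
proof (cases "finite I")
 case True
 then show ?thesis using assms by (induction I) (auto simp: hom_add Pi_def)
qed (simp add: A.finsum_infinite B.finsum_infinite)

lemma hom_ev: "h : car A ==> th (A.ev h p) = B.ev (th h) p"
 by (induction p) (simp_all add: A.ev_pCons B.ev_pCons hom_add hom_mult hom_smult)

lemma hom_sa: "x : A.sa ==> th x : B.sa"
 using hom_star[of x] by (auto simp: A.sa_def B.sa_def simp del: A.sa_closed B.sa_closed)

lemma hom_re: "x : car A ==> th (A.re x) = B.re (th x)"
 by (simp add: A.re_def B.re_def hom_smult hom_add hom_star)

lemma hom_im: "x : car A ==> th (A.im x) = B.im (th x)"
 by (simp add: A.im_def B.im_def hom_smult hom_diff hom_star)

lemma pull_seminorm: "cstar_seminorm B my ==> cstar_seminorm A (%x. my (th x))"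
 by (auto simp: cstar_seminorm_def hom_add hom_mult hom_smult hom_star)

end

lemma (in cstar_semi) nu_re_im:
 assumes x: "x : car A" shows "nu (re x) <= nu x" "nu (im x) <= nu x"
proof -
 show "nu (re x) <= nu x" using nu_add[of x "star x"] x by (simp add: re_def nu_smult)
 show "nu (im x) <= nu x" using nu_diff[of x "star x"] x by (simp add: im_def nu_smult norm_divide)
qed

text \<open>A contractive homomorphism from a seminormed star-algebra to a C*-algebra extends to the
 completion, and the image of the extension is closed.\<close>

locale contractive = star_homo A B th + A: cstar_semi A nu + B: cstar_alg B
 for A :: "('a, 'm) star_algebra_scheme" and B :: "('b, 'n) cstar_algebra_scheme" and th nu +
 assumes contractive: "x : car A ==> cnorm B (th x) <= nu x"
begin

lemma hom_asym: "A.asym X Y ==> B.asym (%n. th (X n)) (%n. th (Y n))"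
 by (rule B.asymI[where f = "%n. nu (X n \<ominus>\<^bsub>A\<^esub> Y n)"])
  (use contractive in "auto simp: A.asym_def hom_diff[symmetric]")

lemma hom_cauchy:
 assumes X: "X : A.cs" shows "(%n. th (X n)) : B.cs"
 unfolding cauchy_seqs_def
proof safe
 note c = A.csD[OF X]
 fix e :: real assume e: "0 < e"
 obtain M where M: "!!m n. m >= M ==> n >= M ==> nu (X m \<ominus>\<^bsub>A\<^esub> X n) < e" using A.cauchyD[OF X e] by metis
 have "cnorm B (th (X m) \<ominus>\<^bsub>B\<^esub> th (X n)) < e" if "m >= M" "n >= M" for m n
  using contractive[of "X m \<ominus>\<^bsub>A\<^esub> X n"] c M[OF that] by (simp add: hom_diff)
 then show "EX M. ALL m>=M. ALL n>=M. cnorm B (th (X m) \<ominus>\<^bsub>B\<^esub> th (X n)) < e" by blast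
qed (auto simp: A.csD[OF X])

definition ext :: "(nat => 'a) set => 'b" where
 "ext P = (SOME y. B.conv (%n. th (rep P n)) y)"

lemma ext_cls:
 assumes X: "X : A.cs" shows "B.conv (%n. th (X n)) (ext (A.cls X))"
proof -
 let ?R = "rep (A.cls X)"
 obtain y where "B.conv (%n. th (?R n)) y" using B.complete[OF hom_cauchy[OF A.rep_cs[OF X]]] .
 then have "B.conv (%n. th (?R n)) (ext (A.cls X))" unfolding ext_def by (rule someI)
 then show ?thesis using B.asym_trans[OF hom_asym[OF A.asym_rep[OF X]]] by blast
qed

lemma ext_eqI: "X : A.cs ==> B.conv (%n. th (X n)) y ==> ext (A.cls X) = y"
 using ext_cls B.conv_unique by blast

lemma ext_iota: "x : car A ==> ext (A.\<iota> x) = th x"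
 by (intro ext_eqI A.cauchy_const B.asym_refl) auto

lemma ext_star_hom: "star_hom A.C B ext"
 unfolding star_hom_def
proof (intro conjI ballI allI ring_hom_memI)
 fix P Q c assume P: "P : car A.C"
 then obtain X where X: "X : A.cs" "P = A.cls X" by (auto simp: A.carrier_C)
 note cX = ext_cls[OF X(1)] and c = A.csD[OF X(1)]
 show "ext P : car B" using B.asymD(2)[OF cX] X by simp
 show "ext (c \<odot>\<^bsub>A.C\<^esub> P) = c \<odot>\<^bsub>B\<^esub> ext P"
  unfolding X A.cls_smult[OF X(1)]
  by (rule ext_eqI[OF A.cs_smult[OF X(1)]]) (use B.asym_smult[OF cX] c in "simp add: hom_smult")
 show "ext (adj A.C P) = adj B (ext P)"
  unfolding X A.cls_star[OF X(1)]
  by (rule ext_eqI[OF A.cs_star[OF X(1)]]) (use B.asym_star[OF cX] c in "simp add: hom_star")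
 assume "Q : car A.C"
 then obtain Y where Y: "Y : A.cs" "Q = A.cls Y" by (auto simp: A.carrier_C)
 note cY = ext_cls[OF Y(1)] and c' = A.csD[OF Y(1)]
 show "ext (P \<otimes>\<^bsub>A.C\<^esub> Q) = ext P \<otimes>\<^bsub>B\<^esub> ext Q"
  unfolding X Y A.cls_mult[OF X(1) Y(1)]
  by (rule ext_eqI[OF A.cs_mult[OF X(1) Y(1)]]) (use B.conv_mult[OF cX cY] c c' in "simp add: hom_mult")
 show "ext (P \<oplus>\<^bsub>A.C\<^esub> Q) = ext P \<oplus>\<^bsub>B\<^esub> ext Q"
  unfolding X Y A.cls_add[OF X(1) Y(1)]
  by (rule ext_eqI[OF A.cs_add[OF X(1) Y(1)]]) (use B.asym_add[OF cX cY] c c' in "simp add: hom_add")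
next
 show "ext \<one>\<^bsub>A.C\<^esub> = \<one>\<^bsub>B\<^esub>" unfolding A.C_one by (simp add: ext_iota)
qed

lemma approx_lift_sa:
 assumes f: "f : A.sa" and le: "cnorm B (th f) <= 1"
 obtains g where "g : car A" "nu g <= 2" "cnorm B (th f \<ominus>\<^bsub>B\<^esub> th g) <= 1 / 24"
proof -
 note fc = A.saD(1)[OF f]
 obtain k where "nu f < 3 ^ k" using real_arch_pow[of 3 "nu f"] by auto
 then have k: "nu f <= 2 * 3 ^ k" using zero_le_power[of "3::real" k] by linarith
 obtain q where q: "nu (A.ev f q) <= 2" "cnorm B (B.ev (th f) ([:0,1:] - q)) <= (1 - 1 / 9 ^ k) / 24"
  using truncation[OF A.real_cstar_poly_ev[OF f] B.real_cstar_poly_ev[OF hom_sa[OF f]], of "[:0,1:]" k]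
  k le fc by auto
 have eq: "B.ev (th f) ([:0,1:] - q) = th f \<ominus>\<^bsub>B\<^esub> th (A.ev f q)"
  using fc by (simp only: B.ev_diff B.ev_X hom_closed hom_ev)
 note q(2)
 also have "(1 - 1 / 9 ^ k) / 24 <= (1::real) / 24" by (intro divide_right_mono) auto
 finally have "cnorm B (th f \<ominus>\<^bsub>B\<^esub> th (A.ev f q)) <= 1 / 24" unfolding eq .
 then show ?thesis by (intro that[of "A.ev f q"] A.ev_closed fc q(1))
qed

lemma approx_lift_one:
 assumes f: "f : car A" and le: "cnorm B (th f) <= 1"
 obtains g where "g : car A" "nu g <= 4" "cnorm B (th f \<ominus>\<^bsub>B\<^esub> th g) <= 1 / 2"
proof -
 have "cnorm B (th (A.re f)) <= 1" "cnorm B (th (A.im f)) <= 1"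
  using B.nu_re_im[of "th f"] f le by (auto simp: hom_re hom_im)
 then obtain g h where g: "g : car A" "nu g <= 2" "cnorm B (th (A.re f) \<ominus>\<^bsub>B\<^esub> th g) <= 1 / 24"
  and h: "h : car A" "nu h <= 2" "cnorm B (th (A.im f) \<ominus>\<^bsub>B\<^esub> th h) <= 1 / 24"
  using approx_lift_sa f A.re_sa A.im_sa by metis
 define k where "k = g \<oplus>\<^bsub>A\<^esub> \<i> \<odot>\<^bsub>A\<^esub> h"
 have k: "k : car A" using g h by (simp add: k_def)
 have "nu k <= 4" using A.nu_add[of g "\<i> \<odot>\<^bsub>A\<^esub> h"] g h by (simp add: k_def A.nu_smult)
 moreover have "cnorm B (th f \<ominus>\<^bsub>B\<^esub> th k) <= 1 / 2"
 proof -
  have "th f \<ominus>\<^bsub>B\<^esub> th k = (th (A.re f) \<ominus>\<^bsub>B\<^esub> th g) \<oplus>\<^bsub>B\<^esub> \<i> \<odot>\<^bsub>B\<^esub> (th (A.im f) \<ominus>\<^bsub>B\<^esub> th h)"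
  using g h f
  by (subst A.re_im[OF f]) (simp add: k_def hom_add hom_smult a_minus_def B.smult_r_distr
  B.smult_minus_right B.minus_add B.a_ac)
  then show ?thesis
  using B.nu_add[of "th (A.re f) \<ominus>\<^bsub>B\<^esub> th g" "\<i> \<odot>\<^bsub>B\<^esub> (th (A.im f) \<ominus>\<^bsub>B\<^esub> th h)"] g h f by (simp add: B.nu_smult)
 qed
 ultimately show ?thesis using k that by blast
qed

lemma approx_lift:
 assumes f: "f : car A" and e: "0 < e" and le: "cnorm B (th f) <= e"
 obtains g where "g : car A" "nu g <= 4 * e" "cnorm B (th f \<ominus>\<^bsub>B\<^esub> th g) <= e / 2"
proof -
 define h where "h = complex_of_real (1 / e) \<odot>\<^bsub>A\<^esub> f"
 have h: "h : car A" "cnorm B (th h) <= 1"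
  using f e le by (auto simp: h_def hom_smult B.nu_smult norm_divide)
 obtain g where g: "g : car A" "nu g <= 4" "cnorm B (th h \<ominus>\<^bsub>B\<^esub> th g) <= 1 / 2"
  using approx_lift_one[OF h] .
 define k where "k = complex_of_real e \<odot>\<^bsub>A\<^esub> g"
 have "th f \<ominus>\<^bsub>B\<^esub> th k = complex_of_real e \<odot>\<^bsub>B\<^esub> (th h \<ominus>\<^bsub>B\<^esub> th g)"
  using f g e by (simp add: k_def h_def hom_smult B.smult_diff B.smult_smult)
 then have "cnorm B (th f \<ominus>\<^bsub>B\<^esub> th k) <= e / 2" using g h e by (simp add: B.nu_smult)
 moreover have "nu k <= 4 * e" using g e by (simp add: k_def A.nu_smult)
 moreover have "k : car A" using g by (simp add: k_def)
 ultimately show ?thesis using that by blast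
qed

text \<open>Successive approximation: truncation lifts the error that is left in the range to an element of the domain with a bound
proportional to this error, so that the partial sums of the lifts form a Cauchy sequence.\<close>

lemma closed_range:
 assumes y: "y : car B" and dense: "!!e. 0 < e ==> EX f:car A. cnorm B (y \<ominus>\<^bsub>B\<^esub> th f) < e"
 shows "y : ext ` car A.C"
proof -
 define K where "K = cnorm B y + 1"
 have K: "K > 0" using y by (simp add: K_def add_nonneg_pos)
 define P where "P n z \<longleftrightarrow> z : car A & cnorm B (y \<ominus>\<^bsub>B\<^esub> th z) <= K * (3/4) ^ n" for n z
 define Q where "Q n z z' \<longleftrightarrow> nu (z' \<ominus>\<^bsub>A\<^esub> z) <= 5 * K * (3/4) ^ n" for n :: nat and z z'
 have step: "EX z'. P (Suc n) z' & Q n z z'" if Pz: "P n z" for n z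
 proof -
  define e where "e = K * (3/4) ^ n"
  have e: "e > 0" using K by (simp add: e_def)
  have z: "z : car A" "cnorm B (y \<ominus>\<^bsub>B\<^esub> th z) <= e" using Pz by (auto simp: P_def e_def)
  obtain f where f: "f : car A" "cnorm B (y \<ominus>\<^bsub>B\<^esub> th f) < e / 10" using dense[of "e / 10"] e by auto
  have "cnorm B (th f \<ominus>\<^bsub>B\<^esub> th z) <= cnorm B (th f \<ominus>\<^bsub>B\<^esub> y) + cnorm B (y \<ominus>\<^bsub>B\<^esub> th z)"
  using f z y by (intro B.nu_triangle) auto
  then have "cnorm B (th (f \<ominus>\<^bsub>A\<^esub> z)) <= 11/10 * e"
  using f z B.nu_diff_commute[of y "th f"] y by (simp add: hom_diff)
  then obtain g where g: "g : car A" "nu g <= 4 * (11/10 * e)"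
  "cnorm B (th (f \<ominus>\<^bsub>A\<^esub> z) \<ominus>\<^bsub>B\<^esub> th g) <= (11/10 * e) / 2"
  using approx_lift[of "f \<ominus>\<^bsub>A\<^esub> z" "11/10 * e"] f z e by auto
  have "y \<ominus>\<^bsub>B\<^esub> th (z \<oplus>\<^bsub>A\<^esub> g) = (y \<ominus>\<^bsub>B\<^esub> th f) \<oplus>\<^bsub>B\<^esub> (th (f \<ominus>\<^bsub>A\<^esub> z) \<ominus>\<^bsub>B\<^esub> th g)"
  using y z f g by (simp add: hom_add hom_minus a_minus_def B.minus_add B.a_assoc B.r_neg1)
  then have "cnorm B (y \<ominus>\<^bsub>B\<^esub> th (z \<oplus>\<^bsub>A\<^esub> g)) <= e / 10 + (11/10 * e) / 2"
  using B.nu_add[of "y \<ominus>\<^bsub>B\<^esub> th f" "th (f \<ominus>\<^bsub>A\<^esub> z) \<ominus>\<^bsub>B\<^esub> th g"] f g z y by simp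
  also have "... <= 3/4 * e" using e by simp
  finally have "P (Suc n) (z \<oplus>\<^bsub>A\<^esub> g)" using z g by (simp add: P_def e_def)
  moreover have "(z \<oplus>\<^bsub>A\<^esub> g) \<ominus>\<^bsub>A\<^esub> z = g"
  using z g by (simp add: a_minus_def A.a_comm[of z g] A.a_assoc A.r_neg)
  then have "Q n z (z \<oplus>\<^bsub>A\<^esub> g)" using g(2) e by (simp add: Q_def e_def)
  ultimately show ?thesis by blast
 qed
 have "P 0 \<zero>\<^bsub>A\<^esub>" using y by (simp add: P_def K_def a_minus_def)
 then obtain X where X: "!!n. P n (X n)" "!!n. Q n (X n) (X (Suc n))"
  using dependent_nat_choice[of P Q] step by blast
 have c: "X n : car A" for n using X(1)[of n] by (simp add: P_def)
 have "X : A.cs"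
  by (rule A.cauchy_geometric[of X "5 * K" "3/4"]) (use c X(2) in "auto simp: Q_def")
 moreover have "B.conv (%n. th (X n)) y"
 proof (rule B.asymI[where f = "%n. K * (3/4) ^ n"])
  show "cnorm B (th (X n) \<ominus>\<^bsub>B\<^esub> y) <= K * (3/4) ^ n" for n
  using X(1)[of n] B.nu_diff_commute[of "th (X n)" y] y by (simp add: P_def)
  show "(%n. K * (3/4) ^ n) \<longlonglongrightarrow> 0" by (intro tendsto_mult_right_zero LIMSEQ_power_zero) auto
 qed (use c y in auto)
 ultimately have "y = ext (A.cls X)" "A.cls X : car A.C" using ext_eqI by auto
 then show ?thesis by blast
qed

end

section \<open>Generated subalgebras\<close>

context star_alg
begin

lemma star_subalgebra_carrier: "star_subalgebra A (car A)"
 by (auto simp: star_subalgebra_def)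

lemma star_subalgebra_Inter:
 assumes "\<T> ~= {}" "!!T. T : \<T> ==> star_subalgebra A T"
 shows "star_subalgebra A (\<Inter>\<T>)"
proof -
 note D = star_subalgebraD[OF assms(2)]
 show ?thesis
  unfolding star_subalgebra_def
 proof (intro conjI ballI allI)
  show "\<Inter>\<T> <= car A" using assms(1) D(1) by blast
  show "\<one> : \<Inter>\<T>" using D(2) by blast
  fix x y c assume x: "x : \<Inter>\<T>"
  show "c \<odot> x : \<Inter>\<T>" "star x : \<Inter>\<T>" using D(5,6) x by blast+
  assume y: "y : \<Inter>\<T>"
  show "x \<oplus> y : \<Inter>\<T>" "x \<otimes> y : \<Inter>\<T>" using D(3,4) x y by blast+
 qed
qed

lemma star_generated_sub: "S <= car A ==> star_subalgebra A (star_generated A S)"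
 unfolding star_generated_def by (rule star_subalgebra_Inter) (use star_subalgebra_carrier in auto)

lemma star_generated_incl: "S <= star_generated A S"
 by (auto simp: star_generated_def)

lemma star_generated_least: "star_subalgebra A T ==> S <= T ==> star_generated A S <= T"
 by (auto simp: star_generated_def)

end

context cstar_alg
begin

lemma cstar_generated_sub: "S <= car A ==> star_subalgebra A (cstar_generated A S)"
 and cstar_generated_closed: "S <= car A ==> norm_closed A (cstar_generated A S)"
proof -
 assume S: "S <= car A"
 have c: "norm_closed A (car A)" by (simp add: norm_closed_def)
 show "star_subalgebra A (cstar_generated A S)"
  unfolding cstar_generated_def by (rule star_subalgebra_Inter) (use star_subalgebra_carrier S c in auto)
 show "norm_closed A (cstar_generated A S)"
  unfolding norm_closed_def
 proof (intro allI impI, elim conjE)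
  fix X x assume *: "ALL n. X n : cstar_generated A S" "x : car A"
  "(%n. cnorm A (X n \<ominus> x)) \<longlonglongrightarrow> 0"
  show "x : cstar_generated A S" unfolding cstar_generated_def
  proof (rule InterI)
  fix T assume T: "T : {T. star_subalgebra A T & norm_closed A T & S <= T}"
  then have "ALL n. X n : T" using *(1) by (auto simp: cstar_generated_def)
  then show "x : T" using T *(2,3) unfolding norm_closed_def by blast
  qed
 qed
qed

lemma cstar_generated_incl: "S <= cstar_generated A S"
 by (auto simp: cstar_generated_def)

lemma cstar_generated_least:
 "star_subalgebra A T ==> norm_closed A T ==> S <= T ==> cstar_generated A S <= T"
 by (auto simp: cstar_generated_def)

lemma closure_sub:
 assumes P: "star_subalgebra A P"
 defines "T == {x. EX X. (ALL n. X n : P) & conv X x}"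
 shows "star_subalgebra A T" "norm_closed A T" "P <= T"
proof -
 note D = star_subalgebraD[OF P]
 have T: "x : T" if "!!n. X n : P" "conv X x" for X x using that by (auto simp: T_def)
 show PT: "P <= T"
 proof
  fix x assume "x : P"
  then show "x : T" by (intro T[of "%_. x"] asym_refl D(7)) auto
 qed
 show "star_subalgebra A T" unfolding star_subalgebra_def
 proof (intro conjI ballI allI)
  show "T <= car A" by (auto simp: T_def dest: asymD(2))
  show "\<one> : T" using PT D(2) by blast
  fix x y c assume "x : T"
  then obtain X where X: "!!n. X n : P" "conv X x" by (auto simp: T_def)
  show "c \<odot> x : T" by (rule T[of "%n. c \<odot> X n", OF D(5)[OF X(1)] asym_smult[OF X(2)]])
  show "star x : T" by (rule T[of "%n. star (X n)", OF D(6)[OF X(1)] asym_star[OF X(2)]])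
  assume "y : T"
  then obtain Y where Y: "!!n. Y n : P" "conv Y y" by (auto simp: T_def)
  show "x \<oplus> y : T"
  by (rule T[of "%n. X n \<oplus> Y n", OF D(3)[OF X(1) Y(1)] asym_add[OF X(2) Y(2)]])
  show "x \<otimes> y : T"
  by (rule T[of "%n. X n \<otimes> Y n", OF D(4)[OF X(1) Y(1)] conv_mult[OF X(2) Y(2)]])
 qed
 show "norm_closed A T" unfolding norm_closed_def
 proof (intro allI impI, elim conjE)
  fix X x assume X: "ALL n. X n : T" and x: "x : car A" and lim: "(%n. cnorm A (X n \<ominus> x)) \<longlonglongrightarrow> 0"
  have "EX p. p : P & cnorm A (p \<ominus> X n) < inverse (real (Suc n))" for n
  proof -
  obtain Y where Y: "!!m. Y m : P" "conv Y (X n)" using X by (auto simp: T_def)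
  have "eventually (%m. cnorm A (Y m \<ominus> X n) < inverse (real (Suc n))) sequentially"
  by (rule order_tendstoD(2)[OF asymD(3)[OF Y(2)]]) simp
  then show ?thesis using Y(1) by (auto simp: eventually_sequentially)
  qed
  then obtain p where p: "!!n. p n : P" "!!n. cnorm A (p n \<ominus> X n) < inverse (real (Suc n))" by metis
  have Xc: "X n : car A" for n using X by (auto simp: T_def dest: asymD(2))
  have "conv p x"
  proof (rule asymI[where f = "%n. inverse (real (Suc n)) + cnorm A (X n \<ominus> x)"])
  fix n
  show "cnorm A (p n \<ominus> x) <= inverse (real (Suc n)) + cnorm A (X n \<ominus> x)"
  using nu_triangle[of "p n" "X n" x] p[of n] D(7)[OF p(1)] Xc x by fastforce
  qed (use p D(7) x lim LIMSEQ_inverse_real_of_nat in "auto intro!: tendsto_add_zero")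
  then show "x : T" by (rule T[of p, OF p(1)])
 qed
qed

lemma cstar_generated_approx:
 assumes S: "S <= car A" and x: "x : cstar_generated A S"
 obtains X where "!!n. X n : star_generated A S" "conv X x"
proof -
 let ?T = "{x. EX X. (ALL n. X n : star_generated A S) & conv X x}"
 note c = closure_sub[OF star_generated_sub[OF S]]
 have "cstar_generated A S <= ?T"
  using c star_generated_incl[of S] by (intro cstar_generated_least) auto
 then show ?thesis using x that by blast
qed

lemma cstar_generated_in_sub:
 assumes S: "S <= car A"
 defines "B == A(|carrier := cstar_generated A S|)"
 shows "cstar_generated B S = car B"
proof
 interpret G: cstar_sub A "cstar_generated A S"
  by unfold_locales (use cstar_generated_sub cstar_generated_closed S in auto)
 have S': "S <= car B" using cstar_generated_incl by (simp add: B_def)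
 show "cstar_generated B S <= car B"
  using G.B.cstar_generated_sub[folded B_def, OF S'] by (auto simp: star_subalgebra_def)
 have "car B <= T" if T: "star_subalgebra B T" "norm_closed B T" "S <= T" for T
 proof -
  have sub: "T <= cstar_generated A S" using T(1) by (auto simp: star_subalgebra_def B_def)
  have "star_subalgebra A T"
  using T(1) sub star_subalgebraD(1)[OF G.sub] by (auto simp: star_subalgebra_def B_def)
  moreover have "norm_closed A T" unfolding norm_closed_def
  proof (intro allI impI, elim conjE)
  fix X x assume *: "ALL n. X n : T" "x : car A" "(%n. cnorm A (X n \<ominus> x)) \<longlonglongrightarrow> 0"
  then have x: "x : cstar_generated A S" using G.closed sub unfolding norm_closed_def by blast
  have "X n \<ominus>\<^bsub>B\<^esub> x = X n \<ominus> x" for n using G.sub_diff[of "X n" x] *(1) sub x by (auto simp: B_def)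
  then have "(%n. cnorm B (X n \<ominus>\<^bsub>B\<^esub> x)) \<longlonglongrightarrow> 0" using *(3) by (simp add: B_def)
  then show "x : T" using T(2) *(1) x unfolding norm_closed_def by (auto simp: B_def)
  qed
  ultimately show ?thesis using T(3) cstar_generated_least by (simp add: B_def)
 qed
 then show "car B <= cstar_generated B S" unfolding cstar_generated_def by blast
qed

end

section \<open>Matrices over a star-algebra\<close>

lemma multi_indices_0 [simp]: "mi n 0 = {[]}"
 by (auto simp: multi_indices_def)

lemma multi_indices_Suc: "mi n (Suc k) = (%(i, is). i # is) ` ({..<n} \<times> mi n k)"
proof safe
 fix xs assume "xs : mi n (Suc k)"
 then obtain y ys where "xs = y # ys" "y < n" "ys : mi n k"
  by (cases xs) (auto simp: multi_indices_def)
 then show "xs : (%(i, is). i # is) ` ({..<n} \<times> mi n k)" by force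
qed (auto simp: multi_indices_def)

lemma finite_multi_indices [simp]: "finite (mi n k)"
 by (induction k) (auto simp: multi_indices_Suc)

lemma inj_Cons_pair: "inj_on (%(i, is). i # is) X"
 by (auto simp: inj_on_def)

lemma sum_multi_indices_Suc:
 "(SUM xs:mi n (Suc k). f xs) = (SUM i<n. SUM xs:mi n k. f (i # xs))"
 unfolding multi_indices_Suc
 by (subst sum.reindex[OF inj_Cons_pair]) (simp add: sum.cartesian_product split_beta)

definition cmm :: "'i set => ('r => 'i => complex) => ('i => 'c => complex) => 'r => 'c => complex" where
 "cmm I M M' = (%i j. SUM k:I. M i k * M' k j)"

fun ctp :: "(nat => nat => complex) => nat list => nat list => complex" where
 "ctp M [] [] = 1"
| "ctp M (i # is) (j # js) = M i j * ctp M is js"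
| "ctp M _ _ = 0"

definition ctpk :: "(nat => nat => complex) => nat => nat list => nat list => complex" where
 "ctpk M k = (%is js. if length is = k then ctp M is js else 0)"

lemma cmm_assoc: "cmm J (cmm I M M') M'' = cmm I M (cmm J M' M'')"
 unfolding cmm_def sum_distrib_left sum_distrib_right
 by (intro ext) (subst sum.swap, simp add: mult.assoc)

lemma ctp_length: "length is ~= length js ==> ctp M is js = 0"
 by (induction M "is" js rule: ctp.induct) auto

lemma ctp_cmm:
 "length is = k ==> length js = k ==>
  ctp (cmm {..<n} M M') is js = (SUM ks:mi n k. ctp M is ks * ctp M' ks js)"
proof (induction k arbitrary: "is" js)
 case (Suc k)
 then obtain i is' j js' where *: "is = i # is'" "js = j # js'" "length is' = k" "length js' = k"
  by (auto simp: length_Suc_conv)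
 show ?case
  using Suc.IH[OF *(3,4)] unfolding *(1,2)
  by (simp add: sum_multi_indices_Suc cmm_def sum_product algebra_simps)
qed simp

lemma ctpk_cmm: "ctpk (cmm {..<n} M M') k = cmm (mi n k) (ctpk M k) (ctpk M' k)"
proof (intro ext)
 fix "is" js
 show "ctpk (cmm {..<n} M M') k is js = cmm (mi n k) (ctpk M k) (ctpk M' k) is js"
 proof (cases "length is = k & length js = k")
  case True
  then show ?thesis using ctp_cmm[of "is" k js]
  by (simp add: ctpk_def cmm_def) (auto intro!: sum.cong simp: multi_indices_def)
 next
  case False
  then show ?thesis by (auto simp: ctpk_def cmm_def multi_indices_def ctp_length intro!: sum.neutral[symmetric])
 qed
qed

lemma ctp_support:
 assumes "!!i j. M i j ~= 0 ==> i < m & j < n"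
 shows "ctpk M k is js ~= 0 ==> is : mi m k & js : mi n k"
proof -
 have "ctp M is js ~= 0 ==> length js = length is & set is <= {..<m} & set js <= {..<n}"
  using assms by (induction M "is" js rule: ctp.induct) auto
 then show "ctpk M k is js ~= 0 ==> is : mi m k & js : mi n k"
  by (auto simp: ctpk_def multi_indices_def split: if_splits)
qed

definition cid :: "'i set => 'i => 'i => complex" where
 "cid I i j = (if i = j & i : I then 1 else 0)"

lemma ctpk_cid: "ctpk (cid {..<n}) k = cid (mi n k)"
proof -
 have *: "ctp (cid {..<n}) is js = (if is = js & set is <= {..<n} then 1 else 0)" for "is" js
  by (induction "cid {..<n}" "is" js rule: ctp.induct) (auto simp: cid_def)
 show ?thesis by (intro ext) (auto simp: ctpk_def * cid_def multi_indices_def)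
qed

lemma cmm_cid_left:
 assumes "finite I" "!!i j. M i j ~= 0 ==> i : I" shows "cmm I (cid I) M = M"
proof (intro ext)
 fix i j
 have "cmm I (cid I) M i j = (SUM k:I. if i = k then M k j else 0)"
  unfolding cmm_def by (intro sum.cong) (auto simp: cid_def)
 also have "... = M i j" using assms by auto
 finally show "cmm I (cid I) M i j = M i j" .
qed

lemma cmm_cid_right:
 assumes "finite I" "!!i j. M i j ~= 0 ==> j : I" shows "cmm I M (cid I) = M"
proof (intro ext)
 fix i j
 have "cmm I M (cid I) i j = (SUM k:I. if k = j then M i k else 0)"
  unfolding cmm_def by (intro sum.cong) (auto simp: cid_def)
 also have "... = M i j" using assms by auto
 finally show "cmm I M (cid I) i j = M i j" .
qed

context star_alg
begin

lemma finsum_smult: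
 assumes "f : I \<rightarrow> car A" shows "c \<odot> finsum A f I = finsum A (%i. c \<odot> f i) I"
proof (cases "finite I")
 case True
 then show ?thesis using assms by (induction I) (auto simp: smult_r_distr Pi_def)
qed (simp add: finsum_infinite)

lemma finsum_star:
 assumes "f : I \<rightarrow> car A" shows "star (finsum A f I) = finsum A (%i. star (f i)) I"
proof (cases "finite I")
 case True
 then show ?thesis using assms by (induction I) (auto simp: star_add Pi_def)
qed (simp add: finsum_infinite)

lemma finsum_scalar: "finsum A (%i. c i \<odot> x) I = (SUM i:I. c i) \<odot> x" if "x : car A"
proof (cases "finite I")
 case True
 then show ?thesis by (induction I) (auto simp: smult_l_distr that Pi_def)
qed (simp add: finsum_infinite that)

lemma finsum_Times:
 assumes "finite I" "finite J" "!!i j. i : I ==> j : J ==> f i j : car A"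
 shows "finsum A (%i. finsum A (f i) J) I = finsum A (%(i, j). f i j) (I \<times> J)"
 using assms
proof (induction I)
 case (insert a I)
 have eq: "insert a I \<times> J = (%j. (a, j)) ` J Un I \<times> J" by auto
 have d: "(%j. (a, j)) ` J Int I \<times> J = {}" using insert.hyps by auto
 have 1: "(%(i, j). f i j) : (%j. (a, j)) ` J \<rightarrow> car A" using insert.prems by auto
 have 2: "(%(i, j). f i j) : I \<times> J \<rightarrow> car A" using insert.prems by auto
 have 3: "(%i. finsum A (f i) J) : I \<rightarrow> car A" using insert.prems by (auto intro!: finsum_closed)
 have 4: "finsum A (f a) J : car A" using insert.prems by (auto intro!: finsum_closed)
 have 5: "finsum A (%(i, j). f i j) ((%j. (a, j)) ` J) = finsum A (f a) J"
  by (subst finsum_reindex) (use 1 in "auto simp: inj_on_def")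
 show ?case
  unfolding eq finsum_Un_disjoint[OF finite_imageI[OF insert.prems(1)]
  finite_cartesian_product[OF insert.hyps(1) insert.prems(1)] d 1 2]
  finsum_insert[OF insert.hyps(1,2) 3 4] 5
  using insert by simp
qed simp

lemma finsum_swap:
 assumes "finite I" "finite J" "!!i j. i : I ==> j : J ==> f i j : car A"
 shows "finsum A (%i. finsum A (f i) J) I = finsum A (%j. finsum A (%i. f i j) I) J"
proof -
 have "finsum A (%(i, j). f i j) (I \<times> J) = finsum A (%(i, j). f i j) ((%(j, i). (i, j)) ` (J \<times> I))"
  by (intro arg_cong[of _ _ "finsum A _"]) auto
 also have "... = finsum A (%(j, i). f i j) (J \<times> I)"
  by (subst finsum_reindex) (use assms(3) in "auto simp: inj_on_def case_prod_beta'")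
 finally show ?thesis using assms by (simp add: finsum_Times)
qed

definition mm :: "'i set => ('r => 'i => 'a) => ('i => 'c => 'a) => 'r => 'c => 'a" where
 "mm I X Y = (%i j. \<Oplus>k\<in>I. X i k \<otimes> Y k j)"

definition mat :: "('r => 'c => 'a) => bool" where
 "mat X \<longleftrightarrow> (ALL i j. X i j : car A)"

definition sc :: "('r => 'c => complex) => 'r => 'c => 'a" where
 "sc M = (%i j. M i j \<odot> \<one>)"

lemma matD [simp]: "mat X ==> X i j : car A"
 by (simp add: mat_def)

lemma mat_sc [simp]: "mat (sc M)"
 by (simp add: mat_def sc_def)

lemma mat_mm [simp]: "mat X ==> mat Y ==> mat (mm I X Y)"
 by (auto simp: mat_def mm_def intro!: finsum_closed)

lemma mm_assoc:
 assumes "mat X" "mat Y" "mat Z" "finite I" "finite J"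
 shows "mm J (mm I X Y) Z = mm I X (mm J Y Z)"
proof (intro ext)
 fix i j
 have "mm J (mm I X Y) Z i j = (\<Oplus>l\<in>J. \<Oplus>k\<in>I. X i k \<otimes> Y k l \<otimes> Z l j)"
  unfolding mm_def using assms by (intro finsum_cong') (auto simp: finsum_ldistr intro!: finsum_closed)
 also have "... = (\<Oplus>k\<in>I. \<Oplus>l\<in>J. X i k \<otimes> Y k l \<otimes> Z l j)"
  by (rule finsum_swap) (use assms in auto)
 also have "... = mm I X (mm J Y Z) i j"
  unfolding mm_def using assms
  by (intro finsum_cong') (auto simp: finsum_rdistr m_assoc intro!: finsum_closed)
 finally show "mm J (mm I X Y) Z i j = mm I X (mm J Y Z) i j" .
qed

lemma sc_mult_left: "x : car A ==> sc M i j \<otimes> x = M i j \<odot> x"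
 by (simp add: sc_def smult_mult_left)

lemma sc_mult_right: "x : car A ==> x \<otimes> sc M i j = M i j \<odot> x"
 by (simp add: sc_def smult_mult_right)

lemma mm_sc_left: "mat X ==> mm I (sc M) X i j = (\<Oplus>k\<in>I. M i k \<odot> X k j)"
 unfolding mm_def by (simp add: sc_mult_left)

lemma mm_sc_right: "mat X ==> mm I X (sc M) i j = (\<Oplus>k\<in>I. M k j \<odot> X i k)"
 unfolding mm_def by (simp add: sc_mult_right)

lemma mm_sc_sc: "mm I (sc M) (sc M') = sc (cmm I M M')"
proof (intro ext)
 fix i j
 have "mm I (sc M) (sc M') i j = (\<Oplus>k\<in>I. (M i k * M' k j) \<odot> \<one>)"
  unfolding mm_sc_left[OF mat_sc] by (simp add: sc_def smult_smult)
 also have "... = sc (cmm I M M') i j" by (simp add: finsum_scalar sc_def cmm_def)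
 finally show "mm I (sc M) (sc M') i j = sc (cmm I M M') i j" .
qed

lemma finsum_delta:
 assumes "finite I" "i : I" "!!k. k : I ==> k ~= i ==> f k = \<zero>" "f i : car A"
 shows "finsum A f I = f i"
proof -
 have "finsum A f I = finsum A (%j. if i = j then f j else \<zero>) I"
  by (rule finsum_cong') (use assms in auto)
 also have "... = f i" using assms(1,2,4) add.finprod_singleton[of i I f] assms(3)
  by (metis (no_types, lifting) \<open>finsum A f I = finsum A (%j. if i = j then f j else \<zero>) I\<close> Pi_I' add.finprod_cong' add.finprod_singleton zero_closed)
 finally show ?thesis .
qed

lemma mm_cid_left:
 assumes "finite I" "mat X" "!!i j. i ~: I ==> X i j = \<zero>" shows "mm I (sc (cid I)) X = X"
proof (intro ext)
 fix i j
 show "mm I (sc (cid I)) X i j = X i j"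
 proof (cases "i : I")
  case True
  then have "finsum A (%k. cid I i k \<odot> X k j) I = cid I i i \<odot> X i j"
  using assms by (intro finsum_delta) (auto simp: cid_def)
  then show ?thesis using True assms by (simp add: mm_sc_left cid_def)
 next
  case False
  then have "finsum A (%k. cid I i k \<odot> X k j) I = finsum A (%k. \<zero>) I"
  using assms by (intro finsum_cong') (auto simp: cid_def)
  then show ?thesis using False assms by (simp add: mm_sc_left)
 qed
qed

lemma mm_cid_right:
 assumes "finite I" "mat X" "!!i j. j ~: I ==> X i j = \<zero>" shows "mm I X (sc (cid I)) = X"
proof (intro ext)
 fix i j
 show "mm I X (sc (cid I)) i j = X i j"
 proof (cases "j : I")
  case True
  then have "finsum A (%k. cid I k j \<odot> X i k) I = cid I j j \<odot> X i j"
  using assms by (intro finsum_delta) (auto simp: cid_def)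
  then show ?thesis using True assms by (simp add: mm_sc_right cid_def)
 next
  case False
  then have "finsum A (%k. cid I k j \<odot> X i k) I = finsum A (%k. \<zero>) I"
  using assms by (intro finsum_cong') (auto simp: cid_def)
  then show ?thesis using False assms by (simp add: mm_sc_right)
 qed
qed

fun tp :: "(nat => nat => 'a) => nat list => nat list => 'a" where
 "tp X [] [] = \<one>"
| "tp X (i # is) (j # js) = X i j \<otimes> tp X is js"
| "tp X _ _ = \<zero>"

definition tpk :: "(nat => nat => 'a) => nat => nat list => nat list => 'a" where
 "tpk X k = (%is js. if length is = k then tp X is js else \<zero>)"

lemma tp_closed [simp]: "mat X ==> tp X is js : car A"
 by (induction X "is" js rule: tp.induct) auto

lemma mat_tpk [simp]: "mat X ==> mat (tpk X k)"
 unfolding mat_def[of "tpk X k"] by (simp add: tpk_def)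

lemma tp_length: "length is ~= length js ==> mat X ==> tp X is js = \<zero>"
 by (induction X "is" js rule: tp.induct) auto

lemma tp_sc: "tp (sc M) is js = ctp M is js \<odot> \<one>"
 by (induction M "is" js rule: ctp.induct) (auto simp: sc_mult_left smult_smult)

lemma tpk_sc: "tpk (sc M) k = sc (ctpk M k)"
 unfolding sc_def[of "ctpk M k"] by (intro ext) (simp add: tpk_def tp_sc ctpk_def)

lemma finsum_multi_indices_Suc:
 assumes "!!xs. f xs : car A"
 shows "finsum A f (mi n (Suc k)) = finsum A (%(i, xs). f (i # xs)) ({..<n} \<times> mi n k)"
 unfolding multi_indices_Suc
 by (subst finsum_reindex[OF _ inj_Cons_pair]) (use assms in "auto simp: case_prod_beta'")

lemma finsum_product:
 assumes "finite I" "finite J" "f : I \<rightarrow> car A" "g : J \<rightarrow> car A"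
 shows "finsum A f I \<otimes> finsum A g J = finsum A (%(i, j). f i \<otimes> g j) (I \<times> J)"
proof -
 have c: "i : I ==> f i : car A" "j : J ==> g j : car A" for i j using assms by auto
 have "finsum A f I \<otimes> finsum A g J = (\<Oplus>i\<in>I. f i \<otimes> finsum A g J)"
  using assms by (intro finsum_ldistr finsum_closed)
 also have "... = (\<Oplus>i\<in>I. \<Oplus>j\<in>J. f i \<otimes> g j)"
  using assms c by (intro finsum_cong') (auto simp: finsum_rdistr intro!: finsum_closed)
 also have "... = finsum A (%(i, j). f i \<otimes> g j) (I \<times> J)"
  by (rule finsum_Times) (use assms c in auto)
 finally show ?thesis .
qed

lemma tp_commute:
 assumes "mat X" "y : car A" "!!k l. y \<otimes> X k l = X k l \<otimes> y"
 shows "y \<otimes> tp X is js = tp X is js \<otimes> y"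
 using assms
proof (induction X "is" js rule: tp.induct)
 case (2 X i "is" j js)
 note m = "2.prems"(1,2) and c = matD[OF "2.prems"(1), of i j] tp_closed[OF "2.prems"(1), of "is" js]
 have "y \<otimes> tp X (i # is) (j # js) = (y \<otimes> X i j) \<otimes> tp X is js"
  using m_assoc[OF m(2) c] by simp
 also have "... = (X i j \<otimes> y) \<otimes> tp X is js" by (simp only: "2.prems"(3))
 also have "... = X i j \<otimes> (y \<otimes> tp X is js)" by (rule m_assoc[OF c(1) m(2) c(2)])
 also have "... = X i j \<otimes> (tp X is js \<otimes> y)" by (simp only: "2.IH"[OF "2.prems"])
 also have "... = tp X (i # is) (j # js) \<otimes> y" using m_assoc[OF c m(2)] by simp
 finally show ?case .
qed auto

lemma tp_mm:
 assumes XY: "mat X" "mat Y" and comm: "!!i j k l. Y i j \<otimes> X k l = X k l \<otimes> Y i j"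
 shows "length is = k ==> length js = k ==>
  tp (mm {..<n} X Y) is js = (\<Oplus>ks\<in>mi n k. tp X is ks \<otimes> tp Y ks js)"
proof (induction k arbitrary: "is" js)
 case (Suc k)
 then obtain i is' j js' where *: "is = i # is'" "js = j # js'" "length is' = k" "length js' = k"
  by (auto simp: length_Suc_conv)
 have "tp (mm {..<n} X Y) is js =
  (\<Oplus>k\<in>{..<n}. X i k \<otimes> Y k j) \<otimes> (\<Oplus>ks\<in>mi n k. tp X is' ks \<otimes> tp Y ks js')"
  using Suc.IH[OF *(3,4)] by (simp add: *(1,2) mm_def)
 also have "... = finsum A (%(k, ks). (X i k \<otimes> Y k j) \<otimes> (tp X is' ks \<otimes> tp Y ks js')) ({..<n} \<times> mi n k)"
  by (rule finsum_product) (use XY in auto)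
 also have "... = finsum A (%(k, ks). tp X is (k # ks) \<otimes> tp Y (k # ks) js) ({..<n} \<times> mi n k)"
 proof (rule finsum_cong', rule refl, goal_cases)
  case (2 p)
  obtain a as where p: "p = (a, as)" by (cases p)
  have "Y a j \<otimes> tp X is' as = tp X is' as \<otimes> Y a j" by (rule tp_commute) (use XY comm in auto)
  then have "Y a j \<otimes> (tp X is' as \<otimes> tp Y as js') = tp X is' as \<otimes> (Y a j \<otimes> tp Y as js')"
  using XY by (simp add: m_assoc[symmetric])
  then show ?case using XY by (simp add: p *(1,2) m_assoc)
 qed (use XY in auto)
 also have "... = (\<Oplus>ks\<in>mi n (Suc k). tp X is ks \<otimes> tp Y ks js)"
  by (rule finsum_multi_indices_Suc[symmetric]) (use XY in auto)
 finally show ?case .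
qed simp

lemma tpk_mm:
 assumes XY: "mat X" "mat Y" and comm: "!!i j k l. Y i j \<otimes> X k l = X k l \<otimes> Y i j"
 shows "tpk (mm {..<n} X Y) k = mm (mi n k) (tpk X k) (tpk Y k)"
proof (intro ext)
 fix "is" js
 show "tpk (mm {..<n} X Y) k is js = mm (mi n k) (tpk X k) (tpk Y k) is js"
 proof (cases "length is = k & length js = k")
  case True
  then have "tpk (mm {..<n} X Y) k is js = (\<Oplus>ks\<in>mi n k. tp X is ks \<otimes> tp Y ks js)"
  using tp_mm[OF assms, of "is" k js n] by (simp add: tpk_def)
  also have "... = mm (mi n k) (tpk X k) (tpk Y k) is js"
  unfolding mm_def using True XY by (intro finsum_cong') (auto simp: tpk_def multi_indices_def)
  finally show ?thesis .
 next
  case False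
  have "mm (mi n k) (tpk X k) (tpk Y k) is js = (\<Oplus>ks\<in>mi n k. \<zero>)"
  unfolding mm_def using False XY
  by (intro finsum_cong') (auto simp: tpk_def tp_length multi_indices_def)
  moreover have "tpk (mm {..<n} X Y) k is js = \<zero>"
  using False tp_length[of "is" js "mm {..<n} X Y"] XY by (auto simp: tpk_def)
  ultimately show ?thesis by simp
 qed
qed

lemma tpk_zero:
 assumes "mat X" "!!i j. i ~: {..<m} | j ~: {..<n} ==> X i j = \<zero>"
  and "is ~: mi m k | js ~: mi n k"
 shows "tpk X k is js = \<zero>"
proof (rule ccontr)
 have "tp X is js ~= \<zero> ==> length js = length is & set is <= {..<m} & set js <= {..<n}"
  using assms(1,2)
 proof (induction X "is" js rule: tp.induct)
  case (2 X i "is" j js)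
  then have "X i j ~= \<zero>" "tp X is js ~= \<zero>" by auto
  then show ?case using 2 by fastforce
 qed auto
 moreover assume "tpk X k is js ~= \<zero>"
 ultimately show False using assms(3) by (auto simp: tpk_def multi_indices_def split: if_splits)
qed

end

section \<open>Universal C*-seminorms and the free orthogonal quantum group\<close>

locale star_monoid_hom = star_monoid M \<sigma> + A: star_alg A
 for M :: "('b, 'n) monoid_scheme" and \<sigma> and A :: "('a, 'm) star_algebra_scheme" +
 fixes H :: "'b => 'a"
 assumes H_closed [simp]: "x : car M ==> H x : car A"
  and H_mult: "x : car M ==> y : car M ==> H (x \<otimes>\<^bsub>M\<^esub> y) = H x \<otimes>\<^bsub>A\<^esub> H y"
  and H_one: "H \<one>\<^bsub>M\<^esub> = \<one>\<^bsub>A\<^esub>"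
  and H_star: "x : car M ==> H (\<sigma> x) = adj A (H x)"
begin

definition linA :: "('b => complex) => 'a" where
 "linA f = finsum A (%w. f w \<odot>\<^bsub>A\<^esub> H w) {w. f w ~= 0}"

lemma linA_superset:
 assumes "finite F" "{w. f w ~= 0} <= F" "F <= car M"
 shows "linA f = finsum A (%w. f w \<odot>\<^bsub>A\<^esub> H w) F"
 unfolding linA_def
 by (rule A.add.finprod_mono_neutral_cong_left) (use assms in auto)

lemma linA_closed [simp]: "f : car X ==> linA f : car A"
 unfolding linA_def by (rule A.finsum_closed) (use carrierD(2) in auto)

lemma linA_add:
 assumes f: "f : car X" and g: "g : car X"
 shows "linA (f \<oplus>\<^bsub>X\<^esub> g) = linA f \<oplus>\<^bsub>A\<^esub> linA g"
proof -
 let ?F = "{w. f w ~= 0} Un {w. g w ~= 0}"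
 have F: "finite ?F" "?F <= car M" using carrierD[OF f] carrierD[OF g] by auto
 have c: "w : ?F ==> H w : car A" for w using F(2) H_closed by blast
 have "linA (f \<oplus>\<^bsub>X\<^esub> g) = finsum A (%w. (f \<oplus>\<^bsub>X\<^esub> g) w \<odot>\<^bsub>A\<^esub> H w) ?F"
  by (rule linA_superset[OF F(1) _ F(2)]) (auto simp: X_simps)
 also have "... = finsum A (%w. f w \<odot>\<^bsub>A\<^esub> H w \<oplus>\<^bsub>A\<^esub> g w \<odot>\<^bsub>A\<^esub> H w) ?F"
  by (rule A.finsum_cong') (use c in "auto simp: X_simps A.smult_l_distr")
 also have "... = finsum A (%w. f w \<odot>\<^bsub>A\<^esub> H w) ?F \<oplus>\<^bsub>A\<^esub> finsum A (%w. g w \<odot>\<^bsub>A\<^esub> H w) ?F"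
  by (rule A.finsum_addf) (use c in auto)
 also have "... = linA f \<oplus>\<^bsub>A\<^esub> linA g"
  using linA_superset[OF F(1) _ F(2)] by simp
 finally show ?thesis .
qed

lemma linA_smult:
 assumes f: "f : car X" shows "linA (c \<odot>\<^bsub>X\<^esub> f) = c \<odot>\<^bsub>A\<^esub> linA f"
proof -
 let ?F = "{w. f w ~= 0}"
 have F: "finite ?F" "?F <= car M" using carrierD[OF f] by auto
 have cl: "w : ?F ==> H w : car A" for w using F(2) H_closed by blast
 have "linA (c \<odot>\<^bsub>X\<^esub> f) = finsum A (%w. (c \<odot>\<^bsub>X\<^esub> f) w \<odot>\<^bsub>A\<^esub> H w) ?F"
  by (rule linA_superset[OF F(1) _ F(2)]) (auto simp: X_simps)
 also have "... = finsum A (%w. c \<odot>\<^bsub>A\<^esub> (f w \<odot>\<^bsub>A\<^esub> H w)) ?F"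
  by (rule A.finsum_cong') (use cl in "auto simp: X_simps A.smult_smult")
 also have "... = c \<odot>\<^bsub>A\<^esub> linA f"
  unfolding linA_def by (rule A.finsum_smult[symmetric]) (use cl in auto)
 finally show ?thesis .
qed

lemma linA_basis [simp]: "x : car M ==> linA (bv x) = H x"
 using linA_superset[of "{x}" "bv x"] by (auto simp: basis_vec_def)

lemma linA_zero: "linA \<zero>\<^bsub>X\<^esub> = \<zero>\<^bsub>A\<^esub>"
 by (simp add: linA_def X_simps)

lemma linA_mult_basis:
 assumes x: "x : car M" and g: "g : car X"
 shows "linA (bv x \<otimes>\<^bsub>X\<^esub> g) = H x \<otimes>\<^bsub>A\<^esub> linA g"
 using g
proof (induction g rule: X_induct)
 case zero
 then show ?case using x by (simp add: linA_zero)
next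
 case (add g c y)
 note b = basis_closed[OF x] basis_closed[OF add.hyps(2)]
 show ?case
  using add b x
  by (simp add: X.r_distr X.smult_mult_right linA_add linA_smult H_mult A.r_distr A.smult_mult_right)
qed

lemma linA_mult:
 assumes f: "f : car X" and g: "g : car X"
 shows "linA (f \<otimes>\<^bsub>X\<^esub> g) = linA f \<otimes>\<^bsub>A\<^esub> linA g"
 using f
proof (induction f rule: X_induct)
 case zero
 then show ?case using g by (simp add: linA_zero)
next
 case (add f c x)
 note b = basis_closed[OF add.hyps(2)]
 show ?case
  using add b g
  by (simp add: X.l_distr X.smult_mult_left linA_add linA_smult linA_mult_basis A.l_distr A.smult_mult_left)
qed

lemma linA_star:
 assumes f: "f : car X" shows "linA (adj X f) = adj A (linA f)"
 using f
proof (induction f rule: X_induct)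
 case zero
 then show ?case by (simp add: linA_zero)
next
 case (add f c x)
 note b = basis_closed[OF add.hyps(2)]
 show ?case
  using add b by (simp add: X.star_add X.star_smult linA_add linA_smult A.star_add A.star_smult H_star)
qed

lemma linA_star_hom: "star_hom X A linA"
 unfolding star_hom_def
 by (intro conjI ballI allI ring_hom_memI)
  (auto simp: linA_mult linA_add linA_smult linA_star, simp add: X_simps(1) H_one)

end

context star_alg
begin

abbreviation ok_seminorm :: "'a set => ('a => real) => bool" where
 "ok_seminorm R my == cstar_seminorm A my & (ALL r:R. my r = 0)"

context
 fixes R :: "'a set"
 assumes bounded: "!!x. x : car A ==> EX C. ALL my. ok_seminorm R my --> my x <= C"
begin

abbreviation U :: "'a => real" where "U == universal_seminorm A R"

lemma zero_seminorm: "ok_seminorm R (%_. 0)"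
 by (simp add: cstar_seminorm_def)

lemma U_upper:
 assumes x: "x : car A" and ok: "ok_seminorm R my" shows "my x <= U x"
proof -
 obtain C where "!!my. ok_seminorm R my ==> my x <= C" using bounded[OF x] by blast
 then have "bdd_above {my x | my. ok_seminorm R my}" by (intro bdd_aboveI[of _ C]) auto
 then show ?thesis unfolding universal_seminorm_def by (rule cSup_upper[rotated]) (use ok in auto)
qed

lemma U_least: "(!!my. ok_seminorm R my ==> my x <= C) ==> U x <= C"
 unfolding universal_seminorm_def by (rule cSup_least) (use zero_seminorm in auto)

lemma U_nonneg: "x : car A ==> 0 <= U x"
 using U_upper[OF _ zero_seminorm] by simp

lemma U_zero: "r : R ==> r : car A ==> U r = 0"
 using U_least[of r 0] U_nonneg[of r] by force

lemma U_seminorm: "cstar_seminorm A U"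
proof -
 have sc: "U (c \<odot> x) <= cmod c * U x" if x: "x : car A" for c x
 proof (rule U_least)
  fix my assume ok: "ok_seminorm R my"
  then have "my (c \<odot> x) = cmod c * my x" using x by (simp add: cstar_seminorm_def)
  also have "... <= cmod c * U x" by (intro mult_left_mono U_upper x ok) simp
  finally show "my (c \<odot> x) <= cmod c * U x" .
 qed
 show ?thesis unfolding cstar_seminorm_def
 proof (intro conjI ballI allI)
  fix x y c assume x: "x : car A"
  show "U (c \<odot> x) = cmod c * U x"
  proof (cases "c = 0")
  case True
  have "U (0 \<odot> x) <= 0" using sc[OF x, of 0] by (simp del: smult_zero_left)
  moreover have "0 <= U (0 \<odot> x)" by (rule U_nonneg) (rule smult_closed[OF x])
  ultimately have "U (0 \<odot> x) = 0" by (rule antisym)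
  then show ?thesis using True by (simp del: smult_zero_left)
  next
  case False
  have "U x <= cmod (1 / c) * U (c \<odot> x)" using sc[of "c \<odot> x" "1/c"] x False by (simp add: smult_smult)
  then have "cmod c * U x <= U (c \<odot> x)" using False by (simp add: norm_divide field_simps)
  then show ?thesis using sc[OF x, of c] by simp
  qed
  have xx: "star x \<otimes> x : car A" using x by simp
  have sq: "my (star x \<otimes> x) = (my x)\<^sup>2" "0 <= my x" if ok: "ok_seminorm R my" for my
  proof -
  interpret cstar_semi A my by unfold_locales (use ok in simp)
  show "my (star x \<otimes> x) = (my x)\<^sup>2" "0 <= my x" using x nu_cstar by auto
  qed
  show "U (star x \<otimes> x) = (U x)\<^sup>2"
  proof (rule antisym)
  show "U (star x \<otimes> x) <= (U x)\<^sup>2"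
  proof (rule U_least)
  fix my assume ok: "ok_seminorm R my"
  show "my (star x \<otimes> x) <= (U x)\<^sup>2" unfolding sq(1)[OF ok]
  by (rule power_mono[OF U_upper[OF x ok] sq(2)[OF ok]])
  qed
  have "U x <= sqrt (U (star x \<otimes> x))"
  proof (rule U_least)
  fix my assume ok: "ok_seminorm R my"
  show "my x <= sqrt (U (star x \<otimes> x))"
  using U_upper[OF xx ok] unfolding sq(1)[OF ok] by (rule real_le_rsqrt)
  qed
  then have "(U x)\<^sup>2 <= (sqrt (U (star x \<otimes> x)))\<^sup>2" by (intro power_mono U_nonneg x)
  then show "(U x)\<^sup>2 <= U (star x \<otimes> x)" using U_nonneg[OF xx] by simp
  qed
  assume y: "y : car A"
  show "U (x \<oplus> y) <= U x + U y"
  proof (rule U_least)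
  fix my assume ok: "ok_seminorm R my"
  then have "my (x \<oplus> y) <= my x + my y" using x y by (simp add: cstar_seminorm_def)
  also have "... <= U x + U y" by (intro add_mono U_upper x y ok)
  finally show "my (x \<oplus> y) <= U x + U y" .
  qed
  show "U (x \<otimes> y) <= U x * U y"
  proof (rule U_least)
  fix my assume ok: "ok_seminorm R my"
  interpret cstar_semi A my by unfold_locales (use ok in simp)
  have "my (x \<otimes> y) <= my x * my y" using x y by (rule nu_mult)
  also have "... <= U x * U y" by (intro mult_mono U_upper x y ok U_nonneg nu_nonneg)
  finally show "my (x \<otimes> y) <= U x * U y" .
  qed
 qed
qed

end

end

text \<open>Each square is dominated by the sum of the squares. This bounds the generators of the free orthogonal quantum group in every
C*-seminorm, so that the universal seminorm is finite.\<close>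

lemma (in cstar_semi) nu_le_one_if_sum_squares:
 assumes I: "finite I" and x: "!!i. i : I ==> x i : car A"
  and sa: "!!i. i : I ==> nu (x i \<ominus> star (x i)) = 0"
  and sum: "nu ((\<Oplus>i\<in>I. x i \<otimes> x i) \<ominus> \<one>) = 0" and k: "k : I"
 shows "nu (x k) <= 1"
proof -
 define E where "E y z \<longleftrightarrow> asym (%_. y) (%_. z)" for y z
 have E: "E y z \<longleftrightarrow> nu (y \<ominus> z) = 0" if "y : car A" "z : car A" for y z
  using asym_const_iff that by (simp add: E_def)
 have Emult: "E (y \<otimes> y) (z \<otimes> z)" if "E y z" for y z
  unfolding E_def by (rule asym_mult[of _ _ _ _ "nu y" "nu z"]) (use that in "auto simp: E_def")
 have Eadd: "E (y \<oplus> y') (z \<oplus> z')" if "E y z" "E y' z'" for y z y' z'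
  using that asym_add unfolding E_def by blast
 define a where "a i = re (x i)" for i
 have a: "a i : sa" "a i : car A" if "i : I" for i using x[OF that] by (simp_all add: a_def)
 have Ea: "E (x i) (a i)" if i: "i : I" for i
 proof -
  have "x i \<ominus> a i = (1/2) \<odot> (x i \<ominus> star (x i))"
  proof -
  have "x i = (1/2) \<odot> x i \<oplus> (1/2) \<odot> x i" using smult_l_distr[OF x[OF i], of "1/2" "1/2"] x[OF i] by simp
  then have "x i \<ominus> a i = ((1/2) \<odot> x i \<oplus> (1/2) \<odot> x i) \<ominus> ((1/2) \<odot> x i \<oplus> (1/2) \<odot> star (x i))"
  using x[OF i] by (simp add: a_def re_alt)
  also have "... = (1/2) \<odot> x i \<ominus> (1/2) \<odot> star (x i)"
  using x[OF i] by (simp add: a_minus_def minus_add a_assoc r_neg1 r_neg2)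
  finally show ?thesis using x[OF i] by (simp add: smult_diff)
  qed
  then show ?thesis using sa[OF i] x[OF i] a[OF i] by (simp add: E nu_smult)
 qed
 have Esum: "E (\<Oplus>i\<in>J. x i \<otimes> x i) (\<Oplus>i\<in>J. a i \<otimes> a i)" if "J <= I" for J
  using finite_subset[OF that I] that
 proof (induction J)
  case empty then show ?case by (simp add: E a_minus_def)
 next
  case (insert j J)
  then have "(%i. x i \<otimes> x i) : J \<rightarrow> car A" "(%i. a i \<otimes> a i) : J \<rightarrow> car A" "j : I"
  using x a by (auto simp: subset_iff)
  then show ?case using insert Ea Emult Eadd x a by (simp add: Pi_def)
 qed
 have pos: "npos (\<Oplus>i\<in>J. a i \<otimes> a i)" if "J <= I" for J
  using finite_subset[OF that I] that
 proof (induction J)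
  case empty then show ?case by (auto simp: npos_def a_minus_def intro!: exI[of _ 0])
 next
  case (insert j J)
  then have "(%i. a i \<otimes> a i) : J \<rightarrow> car A" "j : I" using a by (auto simp: subset_iff)
  then show ?case using insert a by (auto intro!: npos_add npos_square)
 qed
 let ?r = "\<Oplus>i\<in>I - {k}. a i \<otimes> a i"
 have r: "?r : car A" by (rule finsum_closed) (use a in auto)
 have ak: "a k : car A" "a k : sa" using a k by auto
 have split: "(\<Oplus>i\<in>I. a i \<otimes> a i) = a k \<otimes> a k \<oplus> ?r"
 proof -
  have "I = insert k (I - {k})" using k by auto
  then have "(\<Oplus>i\<in>I. a i \<otimes> a i) = (\<Oplus>i\<in>insert k (I - {k}). a i \<otimes> a i)" by simp
  also have "... = a k \<otimes> a k \<oplus> ?r" by (rule finsum_insert) (use I a k in auto)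
  finally show ?thesis .
 qed
 have sc: "(\<Oplus>i\<in>I. x i \<otimes> x i) : car A" by (rule finsum_closed) (use x in auto)
 have "E (\<Oplus>i\<in>I. x i \<otimes> x i) \<one>" using sum sc by (simp add: E)
 then have "E (a k \<otimes> a k \<oplus> ?r) \<one>"
  using Esum[of I] asym_trans[OF asym_sym] unfolding E_def split by blast
 then have z: "nu ((a k \<otimes> a k \<oplus> ?r) \<ominus> \<one>) = 0" using E ak r by simp
 obtain t :: real where t: "nu (complex_of_real t \<odot> \<one> \<ominus> ?r) <= t"
  using pos[of "I - {k}"] by (auto simp: npos_def)
 have eq: "complex_of_real t \<odot> \<one> \<ominus> (\<one> \<ominus> a k \<otimes> a k) =
  (complex_of_real t \<odot> \<one> \<ominus> ?r) \<oplus> ((a k \<otimes> a k \<oplus> ?r) \<ominus> \<one>)" (is "?T \<ominus> (\<one> \<ominus> ?q) = _")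
 proof -
  have "T \<ominus> (\<one> \<ominus> q) = (T \<ominus> p) \<oplus> ((q \<oplus> p) \<ominus> \<one>)"
  if "T : car A" "q : car A" "p : car A" for T q p
  proof -
  have "(T \<ominus> p) \<oplus> ((q \<oplus> p) \<ominus> \<one>) = T \<oplus> (\<ominus> p \<oplus> (p \<oplus> (q \<oplus> \<ominus> \<one>)))"
  using that by (simp add: a_minus_def a_assoc a_comm[of q p])
  then show ?thesis using that by (simp add: r_neg1 a_minus_def minus_add minus_minus a_comm)
  qed
  then show ?thesis using ak r by simp
 qed
 have "nu (complex_of_real t \<odot> \<one> \<ominus> (\<one> \<ominus> a k \<otimes> a k)) <= t"
  unfolding eq
  using nu_add[of "complex_of_real t \<odot> \<one> \<ominus> ?r" "(a k \<otimes> a k \<oplus> ?r) \<ominus> \<one>"] t z ak r by simp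
 then have "npos (\<one> \<ominus> a k \<otimes> a k)" using ak unfolding npos_def by blast
 then have "nu (a k) <= 1" using nu_le_one_if_npos ak by blast
 moreover have "nu (x k \<ominus> a k) = 0" using Ea[OF k] E x[OF k] ak by simp
 ultimately show ?thesis using nu_le_add_diff[of "x k" "a k"] x[OF k] ak by simp
qed

locale free_orth =
 fixes n :: nat
begin

abbreviation S where "S == {..<n} \<times> {..<n}"
definition W :: "((nat \<times> nat) \<times> bool) list monoid" where "W = (|carrier = lists (S \<times> UNIV), mult = (@), one = []|)"
definition ws :: "((nat \<times> nat) \<times> bool) list => ((nat \<times> nat) \<times> bool) list" where
 "ws = (%w. rev (map (%(g, b). (g, ~ b)) w))"

lemma W_simps: "car W = lists (S \<times> UNIV)" "v \<otimes>\<^bsub>W\<^esub> w = v @ w" "\<one>\<^bsub>W\<^esub> = []"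
 by (simp_all add: W_def)

lemma star_monoid_W: "star_monoid W ws"
proof -
 have "monoid W" by (rule monoidI) (auto simp: W_simps)
 then interpret monoid W .
 show ?thesis
 proof
  show "ws (ws x) = x" for x by (simp add: ws_def rev_map[symmetric] split_beta comp_def)
  show "ws x : car W" if "x : car W" for x
  using that by (force simp: W_simps ws_def in_lists_conv_set)
 qed (simp add: W_simps ws_def)
qed

abbreviation F where "F == free_star_algebra S"

lemma F_def: "F = monoid_algebra W ws"
 by (simp add: free_star_algebra_def W_def ws_def)

sublocale M: star_monoid W ws
 rewrites "monoid_algebra W ws = F"
 by (rule star_monoid_W) (simp add: F_def)

abbreviation x where "x i j == free_gen (i, j) :: ((nat \<times> nat) \<times> bool) list => complex"
abbreviation R where "R == orthogonal_relations n"

lemma x_closed [simp]: "i < n ==> j < n ==> x i j : car F"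
 unfolding free_gen_def by (rule M.basis_closed) (simp add: W_simps)

lemma R_cases:
 assumes "r : R"
 obtains (sa) i j where "i < n" "j < n" "r = x i j \<ominus>\<^bsub>F\<^esub> adj F (x i j)"
 | (row) i j where "i < n" "j < n" "r = (\<Oplus>\<^bsub>F\<^esub>k\<in>{..<n}. x i k \<otimes>\<^bsub>F\<^esub> x j k) \<ominus>\<^bsub>F\<^esub> (if i = j then \<one>\<^bsub>F\<^esub> else \<zero>\<^bsub>F\<^esub>)"
 | (col) i j where "i < n" "j < n" "r = (\<Oplus>\<^bsub>F\<^esub>k\<in>{..<n}. x k i \<otimes>\<^bsub>F\<^esub> x k j) \<ominus>\<^bsub>F\<^esub> (if i = j then \<one>\<^bsub>F\<^esub> else \<zero>\<^bsub>F\<^esub>)"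
 using assms unfolding orthogonal_relations_def Let_def by blast

lemma R_intros:
 assumes "i < n" "j < n"
 shows "x i j \<ominus>\<^bsub>F\<^esub> adj F (x i j) : R"
  "(\<Oplus>\<^bsub>F\<^esub>k\<in>{..<n}. x i k \<otimes>\<^bsub>F\<^esub> x j k) \<ominus>\<^bsub>F\<^esub> (if i = j then \<one>\<^bsub>F\<^esub> else \<zero>\<^bsub>F\<^esub>) : R"
  "(\<Oplus>\<^bsub>F\<^esub>k\<in>{..<n}. x k i \<otimes>\<^bsub>F\<^esub> x k j) \<ominus>\<^bsub>F\<^esub> (if i = j then \<one>\<^bsub>F\<^esub> else \<zero>\<^bsub>F\<^esub>) : R"
 using assms unfolding orthogonal_relations_def Let_def by blast+

lemma R_closed: "r : R ==> r : car F"
 by (erule R_cases) (auto intro!: M.X.minus_closed M.X.finsum_closed)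

lemma gen_bound:
 assumes ok: "M.X.ok_seminorm R my" and ij: "i < n" "j < n" shows "my (x i j) <= 1"
proof -
 interpret cstar_semi F my by unfold_locales (use ok in simp)
 show ?thesis
 proof (rule nu_le_one_if_sum_squares[of "{..<n}" "%k. x i k" j])
  show "my (x i k \<ominus>\<^bsub>F\<^esub> adj F (x i k)) = 0" if "k : {..<n}" for k
  using ok R_intros(1)[of i k] ij that by simp
  show "my ((\<Oplus>\<^bsub>F\<^esub>k\<in>{..<n}. x i k \<otimes>\<^bsub>F\<^esub> x i k) \<ominus>\<^bsub>F\<^esub> \<one>\<^bsub>F\<^esub>) = 0"
  using ok R_intros(2)[of i i] ij by simp
 qed (use ij in auto)
qed

lemma word_bound:
 assumes ok: "M.X.ok_seminorm R my" shows "w : car W ==> my (bv w) <= 1"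
proof (induction w)
 interpret cstar_semi F my by unfold_locales (use ok in simp)
 case Nil
 then show ?case using nu_one by (simp add: M.X_simps(1) W_simps)
next
 interpret cstar_semi F my by unfold_locales (use ok in simp)
 case (Cons a w)
 obtain i j b where a: "a = ((i, j), b)" by (metis surj_pair)
 have ij: "i < n" "j < n" and w: "w : car W" and aW: "[a] : car W"
  using Cons.prems a by (auto simp: W_simps)
 have "my (bv [a]) <= 1"
 proof (cases b)
  case True
  have "bv [a] = adj F (x i j)"
  using M.X_basis_adj[of "[((i, j), False)]"] ij True by (simp add: free_gen_def W_simps ws_def a)
  then show ?thesis using gen_bound[OF ok ij] ij by simp
 next
  case False
  then show ?thesis using gen_bound[OF ok ij] by (simp add: free_gen_def a)
 qed
 moreover have "bv (a # w) = bv [a] \<otimes>\<^bsub>F\<^esub> bv w"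
  using M.X_basis_mult[OF aW w] by (simp add: W_simps)
 moreover have "my (bv [a] \<otimes>\<^bsub>F\<^esub> bv w) <= my (bv [a]) * my (bv w)"
  by (intro nu_mult M.basis_closed aW w)
 moreover have "my (bv [a]) * my (bv w) <= 1"
  using Cons.IH[OF w] calculation(1) by (intro mult_le_one nu_nonneg M.basis_closed w)
 ultimately show ?case by simp
qed

lemma F_bounded: "f : car F ==> EX C. ALL my. M.X.ok_seminorm R my --> my f <= C"
proof (induction f rule: M.X_induct)
 case zero
 have "my \<zero>\<^bsub>F\<^esub> <= 0" if "M.X.ok_seminorm R my" for my
 proof -
  interpret cstar_semi F my by unfold_locales (use that in simp)
  show ?thesis by simp
 qed
 then show ?case by blast
next
 case (add f c w)
 obtain C where C: "!!my. M.X.ok_seminorm R my ==> my f <= C" using add.IH by blast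
 have "my (f \<oplus>\<^bsub>F\<^esub> c \<odot>\<^bsub>F\<^esub> bv w) <= C + cmod c" if ok: "M.X.ok_seminorm R my" for my
 proof -
  interpret cstar_semi F my by unfold_locales (use ok in simp)
  note b = M.basis_closed[OF add.hyps(2)]
  have "my (f \<oplus>\<^bsub>F\<^esub> c \<odot>\<^bsub>F\<^esub> bv w) <= my f + my (c \<odot>\<^bsub>F\<^esub> bv w)"
  by (rule nu_add) (use add.hyps b in auto)
  also have "my (c \<odot>\<^bsub>F\<^esub> bv w) = cmod c * my (bv w)" by (rule nu_smult[OF b])
  also have "my f + ... <= C + cmod c * 1"
  using C[OF ok] word_bound[OF ok add.hyps(2)] by (intro add_mono mult_left_mono) auto
  finally show ?thesis by simp
 qed
 then show ?case by blast
qed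

abbreviation nuU where "nuU == universal_seminorm F R"

sublocale U: cstar_semi F nuU
 by unfold_locales (rule M.X.U_seminorm[OF F_bounded])

lemma nuU_zero: "r : R ==> nuU r = 0"
 by (rule M.X.U_zero[OF F_bounded]) (auto intro: R_closed)

lemma free_orthogonal_qgroup_simps:
 "qdim (free_orthogonal_qgroup n) = n" "qalg (free_orthogonal_qgroup n) = U.C"
 "qfund (free_orthogonal_qgroup n) i j = U.\<iota> (x i j)"
 by (simp_all add: free_orthogonal_qgroup_def Let_def)

end

definition orthogonal_entries :: "('a, 'm) star_algebra_scheme => nat => (nat => nat => 'a) => bool" where
 "orthogonal_entries A n u \<longleftrightarrow> (ALL i<n. ALL j<n. u i j : car A & adj A (u i j) = u i j &
  (\<Oplus>\<^bsub>A\<^esub>k\<in>{..<n}. u i k \<otimes>\<^bsub>A\<^esub> u j k) = (if i = j then \<one>\<^bsub>A\<^esub> else \<zero>\<^bsub>A\<^esub>) &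
  (\<Oplus>\<^bsub>A\<^esub>k\<in>{..<n}. u k i \<otimes>\<^bsub>A\<^esub> u k j) = (if i = j then \<one>\<^bsub>A\<^esub> else \<zero>\<^bsub>A\<^esub>))"

lemma (in star_alg) diff_zeroD: "x : car A ==> y : car A ==> x \<ominus> y = \<zero> ==> x = y"
 by (metis a_minus_def a_inv_closed add.inv_equality minus_minus)

lemma orthogonal_entries_hom:
 assumes A: "is_star_algebra A"
  and ph: "star_hom (qalg (free_orthogonal_qgroup n)) A ph"
  "!!i j. i < n ==> j < n ==> ph (qfund (free_orthogonal_qgroup n) i j) = u i j"
 shows "orthogonal_entries A n u"
proof -
 interpret free_orth n .
 interpret A: star_alg A by unfold_locales (rule A)
 define th where "th f = ph (U.\<iota> f)" for f
 have h: "star_hom U.C A ph" using ph(1) by (simp add: free_orthogonal_qgroup_simps)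
 have "star_hom F A th"
  unfolding star_hom_def th_def
 proof (intro conjI ballI allI ring_hom_memI)
  fix f g c assume f: "f : car F"
  show "ph (U.\<iota> f) : car A" using h U.iota_closed[OF f] by (auto simp: star_hom_def ring_hom_def)
  show "ph (U.\<iota> (c \<odot>\<^bsub>F\<^esub> f)) = c \<odot>\<^bsub>A\<^esub> ph (U.\<iota> f)"
  using h U.iota_closed[OF f] unfolding U.iota_smult[OF f, symmetric] by (auto simp: star_hom_def)
  show "ph (U.\<iota> (adj F f)) = adj A (ph (U.\<iota> f))"
  using h U.iota_closed[OF f] unfolding U.iota_star[OF f, symmetric] by (auto simp: star_hom_def)
  assume g: "g : car F"
  show "ph (U.\<iota> (f \<otimes>\<^bsub>F\<^esub> g)) = ph (U.\<iota> f) \<otimes>\<^bsub>A\<^esub> ph (U.\<iota> g)"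
  using h U.iota_closed[OF f] U.iota_closed[OF g] unfolding U.iota_mult[OF f g, symmetric]
  by (auto simp: star_hom_def ring_hom_def)
  show "ph (U.\<iota> (f \<oplus>\<^bsub>F\<^esub> g)) = ph (U.\<iota> f) \<oplus>\<^bsub>A\<^esub> ph (U.\<iota> g)"
  using h U.iota_closed[OF f] U.iota_closed[OF g] unfolding U.iota_add[OF f g, symmetric]
  by (auto simp: star_hom_def ring_hom_def)
 next
  show "ph (U.\<iota> \<one>\<^bsub>F\<^esub>) = \<one>\<^bsub>A\<^esub>"
  using h unfolding U.C_one[symmetric] by (auto simp: star_hom_def ring_hom_def)
 qed
 then interpret T: star_homo F A th by unfold_locales
 have kill: "th r = \<zero>\<^bsub>A\<^esub>" if r: "r : R" for r
 proof -
  have "U.\<iota> r = U.\<iota> \<zero>\<^bsub>F\<^esub>"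
  using nuU_zero[OF r] R_closed[OF r] by (subst U.iota_eq_iff) (auto simp: a_minus_def)
  then have "th r = th \<zero>\<^bsub>F\<^esub>" by (simp add: th_def)
  then show ?thesis by simp
 qed
 have u: "th (x i j) = u i j" if "i < n" "j < n" for i j
  using ph(2)[OF that] by (simp add: th_def free_orthogonal_qgroup_simps)
 have uc: "u i j : car A" if "i < n" "j < n" for i j using T.hom_closed[OF x_closed[OF that]] u[OF that] by simp
 have sums: "th (\<Oplus>\<^bsub>F\<^esub>k\<in>{..<n}. x i k \<otimes>\<^bsub>F\<^esub> x j k) = (\<Oplus>\<^bsub>A\<^esub>k\<in>{..<n}. u i k \<otimes>\<^bsub>A\<^esub> u j k)"
  "th (\<Oplus>\<^bsub>F\<^esub>k\<in>{..<n}. x k i \<otimes>\<^bsub>F\<^esub> x k j) = (\<Oplus>\<^bsub>A\<^esub>k\<in>{..<n}. u k i \<otimes>\<^bsub>A\<^esub> u k j)"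
  if "i < n" "j < n" for i j
  using that uc
  by (auto simp: T.hom_finsum Pi_def T.hom_mult u intro!: A.finsum_cong')
 have \<delta>: "th (if i = j then \<one>\<^bsub>F\<^esub> else \<zero>\<^bsub>F\<^esub>) = (if i = j then \<one>\<^bsub>A\<^esub> else \<zero>\<^bsub>A\<^esub>)" for i j :: nat by simp
 have fc: "(\<Oplus>\<^bsub>F\<^esub>k\<in>{..<n}. x i k \<otimes>\<^bsub>F\<^esub> x j k) : car F" "(\<Oplus>\<^bsub>F\<^esub>k\<in>{..<n}. x k i \<otimes>\<^bsub>F\<^esub> x k j) : car F"
  if "i < n" "j < n" for i j using that by (auto intro!: M.X.finsum_closed)
 show ?thesis unfolding orthogonal_entries_def
 proof (intro allI impI conjI)
  fix i j assume ij: "i < n" "j < n"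
  show "u i j : car A" by (rule uc[OF ij])
  have "th (x i j) \<ominus>\<^bsub>A\<^esub> th (adj F (x i j)) = \<zero>\<^bsub>A\<^esub>"
  using kill[OF R_intros(1)[OF ij]] T.hom_diff[of "x i j" "adj F (x i j)"] ij by simp
  then show "adj A (u i j) = u i j"
  using A.diff_zeroD[of "u i j" "adj A (u i j)"] uc[OF ij] ij by (simp add: T.hom_star u)
  show "(\<Oplus>\<^bsub>A\<^esub>k\<in>{..<n}. u i k \<otimes>\<^bsub>A\<^esub> u j k) = (if i = j then \<one>\<^bsub>A\<^esub> else \<zero>\<^bsub>A\<^esub>)"
  proof (rule A.diff_zeroD)
  show "(\<Oplus>\<^bsub>A\<^esub>k\<in>{..<n}. u i k \<otimes>\<^bsub>A\<^esub> u j k) \<ominus>\<^bsub>A\<^esub> (if i = j then \<one>\<^bsub>A\<^esub> else \<zero>\<^bsub>A\<^esub>) = \<zero>\<^bsub>A\<^esub>"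
  using kill[OF R_intros(2)[OF ij]] unfolding sums(1)[OF ij, symmetric] \<delta>[symmetric]
  by (subst T.hom_diff[symmetric]) (use fc[OF ij] in auto)
  qed (use uc ij in "auto intro!: A.finsum_closed")
  show "(\<Oplus>\<^bsub>A\<^esub>k\<in>{..<n}. u k i \<otimes>\<^bsub>A\<^esub> u k j) = (if i = j then \<one>\<^bsub>A\<^esub> else \<zero>\<^bsub>A\<^esub>)"
  proof (rule A.diff_zeroD)
  show "(\<Oplus>\<^bsub>A\<^esub>k\<in>{..<n}. u k i \<otimes>\<^bsub>A\<^esub> u k j) \<ominus>\<^bsub>A\<^esub> (if i = j then \<one>\<^bsub>A\<^esub> else \<zero>\<^bsub>A\<^esub>) = \<zero>\<^bsub>A\<^esub>"
  using kill[OF R_intros(3)[OF ij]] unfolding sums(2)[OF ij, symmetric] \<delta>[symmetric]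
  by (subst T.hom_diff[symmetric]) (use fc[OF ij] in auto)
  qed (use uc ij in "auto intro!: A.finsum_closed")
 qed
qed

text \<open>Conversely, C*-algebras generated by an orthogonal matrix are quotients.\<close>

lemma qsubgroup_free_orthogonal:
 assumes A: "is_cstar_algebra (qalg G)" and orth: "orthogonal_entries (qalg G) (qdim G) (qfund G)"
  and gen: "cstar_generated (qalg G) (entries G) = car (qalg G)"
 shows "qsubgroup G (free_orthogonal_qgroup (qdim G))"
proof -
 define n where "n = qdim G"
 define A where "A = qalg G"
 define u where "u = qfund G"
 interpret free_orth n .
 interpret A: cstar_alg A by unfold_locales (use A in "simp add: A_def")
 have o: "u i j : car A" "adj A (u i j) = u i j"
  "(\<Oplus>\<^bsub>A\<^esub>k\<in>{..<n}. u i k \<otimes>\<^bsub>A\<^esub> u j k) = (if i = j then \<one>\<^bsub>A\<^esub> else \<zero>\<^bsub>A\<^esub>)"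
  "(\<Oplus>\<^bsub>A\<^esub>k\<in>{..<n}. u k i \<otimes>\<^bsub>A\<^esub> u k j) = (if i = j then \<one>\<^bsub>A\<^esub> else \<zero>\<^bsub>A\<^esub>)" if "i < n" "j < n" for i j
  using orth that unfolding orthogonal_entries_def n_def A_def u_def by blast+
 define H where "H = (%w :: ((nat \<times> nat) \<times> bool) list. foldr (%((i, j), b) y. u i j \<otimes>\<^bsub>A\<^esub> y) w \<one>\<^bsub>A\<^esub>)"
 have H_simps: "H [] = \<one>\<^bsub>A\<^esub>" "H (((i, j), b) # w) = u i j \<otimes>\<^bsub>A\<^esub> H w" for i j b w by (simp_all add: H_def)
 have Hc: "H w : car A" if "w : car W" for w
  using that by (induction w) (auto simp: W_simps H_simps o)
 have Hm: "H (v @ w) = H v \<otimes>\<^bsub>A\<^esub> H w" if "v : car W" "w : car W" for v w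
  using that(1)
 proof (induction v)
  case (Cons a v)
  then show ?case using Hc[of v] Hc[OF that(2)] by (auto simp: W_simps H_simps o A.m_assoc)
 qed (use Hc[OF that(2)] in "simp add: H_simps")
 have Hs: "H (ws w) = adj A (H w)" if "w : car W" for w
  using that
 proof (induction w)
  case (Cons a w)
  obtain i j b where a: "a = ((i, j), b)" by (metis surj_pair)
  have ij: "i < n" "j < n" "w : car W" using Cons.prems a by (auto simp: W_simps)
  have "ws (a # w) = ws w @ [((i, j), ~ b)]" by (simp add: ws_def a)
  moreover have "[((i, j), ~ b)] : car W" using ij by (simp add: W_simps)
  moreover have "ws w : car W" using M.sigma_closed[OF ij(3)] .
  ultimately have "H (ws (a # w)) = adj A (H w) \<otimes>\<^bsub>A\<^esub> u i j"
  using Hm Cons.IH[OF ij(3)] ij o by (simp add: H_simps)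
  then show ?case using ij o Hc[OF ij(3)] by (simp add: a H_simps A.star_mult)
 qed (simp add: H_simps ws_def)
 interpret L: star_monoid_hom W ws A H
  by unfold_locales (use Hc Hm Hs in "auto simp: W_simps H_simps")
 have "L.linA (x i j) = u i j" if "i < n" "j < n" for i j
  using that o unfolding free_gen_def by (subst L.linA_basis) (auto simp: W_simps H_simps)
 note lx = this
 interpret T: star_homo F A L.linA
  by unfold_locales (use L.linA_star_hom in "simp add: F_def")
 have ok: "M.X.ok_seminorm R (%f. cnorm A (L.linA f))"
 proof (intro conjI ballI)
  show "cstar_seminorm F (%f. cnorm A (L.linA f))" by (rule T.pull_seminorm[OF A.cstar_seminorm])
  have z: "cnorm A (L.linA (f \<ominus>\<^bsub>F\<^esub> g)) = 0"
  if "f : car F" "g : car F" "L.linA f = L.linA g" for f g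
  unfolding T.hom_diff[OF that(1,2)] that(3) using that(2) by (simp add: a_minus_def A.r_neg)
  fix r assume "r : R"
  then show "cnorm A (L.linA r) = 0"
  proof (cases r rule: R_cases)
  case (sa i j)
  show ?thesis unfolding sa(3) by (rule z) (use sa o lx in "auto simp: T.hom_star")
  next
  case (row i j)
  have e: "L.linA (\<Oplus>\<^bsub>F\<^esub>k\<in>{..<n}. x i k \<otimes>\<^bsub>F\<^esub> x j k) = (\<Oplus>\<^bsub>A\<^esub>k\<in>{..<n}. u i k \<otimes>\<^bsub>A\<^esub> u j k)"
  proof -
  have "L.linA (\<Oplus>\<^bsub>F\<^esub>k\<in>{..<n}. x i k \<otimes>\<^bsub>F\<^esub> x j k) =
  (\<Oplus>\<^bsub>A\<^esub>k\<in>{..<n}. L.linA (x i k \<otimes>\<^bsub>F\<^esub> x j k))"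
  by (rule T.hom_finsum) (use row in auto)
  also have "... = (\<Oplus>\<^bsub>A\<^esub>k\<in>{..<n}. u i k \<otimes>\<^bsub>A\<^esub> u j k)"
  by (rule A.finsum_cong') (use row o(1) lx in "auto simp: T.hom_mult")
  finally show ?thesis .
  qed
  have c: "(\<Oplus>\<^bsub>F\<^esub>k\<in>{..<n}. x i k \<otimes>\<^bsub>F\<^esub> x j k) : car F" using row by (auto intro!: M.X.finsum_closed)
  show ?thesis unfolding row(3) by (rule z[OF c]) (use row o in "auto simp only: e T.hom_one T.hom_zero M.X.one_closed M.X.zero_closed split: if_splits")
  next
  case (col i j)
  have e: "L.linA (\<Oplus>\<^bsub>F\<^esub>k\<in>{..<n}. x k i \<otimes>\<^bsub>F\<^esub> x k j) = (\<Oplus>\<^bsub>A\<^esub>k\<in>{..<n}. u k i \<otimes>\<^bsub>A\<^esub> u k j)"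
  proof -
  have "L.linA (\<Oplus>\<^bsub>F\<^esub>k\<in>{..<n}. x k i \<otimes>\<^bsub>F\<^esub> x k j) =
  (\<Oplus>\<^bsub>A\<^esub>k\<in>{..<n}. L.linA (x k i \<otimes>\<^bsub>F\<^esub> x k j))"
  by (rule T.hom_finsum) (use col in auto)
  also have "... = (\<Oplus>\<^bsub>A\<^esub>k\<in>{..<n}. u k i \<otimes>\<^bsub>A\<^esub> u k j)"
  by (rule A.finsum_cong') (use col o(1) lx in "auto simp: T.hom_mult")
  finally show ?thesis .
  qed
  have c: "(\<Oplus>\<^bsub>F\<^esub>k\<in>{..<n}. x k i \<otimes>\<^bsub>F\<^esub> x k j) : car F" using col by (auto intro!: M.X.finsum_closed)
  show ?thesis unfolding col(3) by (rule z[OF c]) (use col o in "auto simp only: e T.hom_one T.hom_zero M.X.one_closed M.X.zero_closed split: if_splits")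
  qed
 qed
 interpret T: contractive F A L.linA nuU
  by unfold_locales (rule M.X.U_upper[OF F_bounded _ ok])
 have im: "star_subalgebra A (L.linA ` car F)" unfolding star_subalgebra_def
 proof (intro conjI ballI allI)
  show "L.linA ` car F <= car A" by auto
  show "\<one>\<^bsub>A\<^esub> : L.linA ` car F" by (rule image_eqI[of _ _ "\<one>\<^bsub>F\<^esub>"]) auto
  fix y z c assume "y : L.linA ` car F"
  then obtain f where f: "f : car F" "y = L.linA f" by blast
  show "c \<odot>\<^bsub>A\<^esub> y : L.linA ` car F" using f by (intro image_eqI[of _ _ "c \<odot>\<^bsub>F\<^esub> f"]) (auto simp: T.hom_smult)
  show "adj A y : L.linA ` car F" using f by (intro image_eqI[of _ _ "adj F f"]) (auto simp: T.hom_star)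
  assume "z : L.linA ` car F"
  then obtain g where g: "g : car F" "z = L.linA g" by blast
  show "y \<oplus>\<^bsub>A\<^esub> z : L.linA ` car F" using f g by (intro image_eqI[of _ _ "f \<oplus>\<^bsub>F\<^esub> g"]) (auto simp: T.hom_add)
  show "y \<otimes>\<^bsub>A\<^esub> z : L.linA ` car F" using f g by (intro image_eqI[of _ _ "f \<otimes>\<^bsub>F\<^esub> g"]) (auto simp: T.hom_mult)
 qed
 have ent: "entries G <= L.linA ` car F"
 proof
  fix y assume "y : entries G"
  then obtain i j where "i < n" "j < n" "y = u i j" by (auto simp: entries_def n_def u_def)
  then show "y : L.linA ` car F" by (intro image_eqI[of _ _ "x i j"]) (simp_all add: lx)
 qed
 have entc: "entries G <= car A" using o(1) unfolding entries_def n_def u_def by blast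
 have surj: "y : T.ext ` car U.C" if y: "y : car A" for y
 proof (rule T.closed_range[OF y])
  fix e :: real assume e: "0 < e"
  have "y : cstar_generated A (entries G)" using y gen by (simp add: A_def)
  then obtain Y where Y: "!!m. Y m : star_generated A (entries G)" "A.conv Y y"
  using A.cstar_generated_approx[OF entc] by blast
  obtain m where "cnorm A (Y m \<ominus>\<^bsub>A\<^esub> y) < e"
  using order_tendstoD(2)[OF A.asymD(3)[OF Y(2)] e] by (auto simp: eventually_sequentially)
  moreover obtain f where "f : car F" "Y m = L.linA f"
  using Y(1)[of m] A.star_generated_least[OF im ent] by blast
  ultimately show "EX f:car F. cnorm A (y \<ominus>\<^bsub>A\<^esub> L.linA f) < e"
  using A.nu_diff_commute[of "Y m" y] y by auto
 qed
 have "T.ext ` car U.C = car A"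
 proof
  show "T.ext ` car U.C <= car A" using T.ext_star_hom by (auto simp: star_hom_def ring_hom_def)
 qed (use surj in blast)
 then show ?thesis
  unfolding qsubgroup_def n_def[symmetric] A_def[symmetric] u_def[symmetric] free_orthogonal_qgroup_simps
  using T.ext_star_hom T.ext_iota[OF x_closed] lx by auto
qed

section \<open>Intertwiners as matrix identities\<close>

locale qg_sub = cstar_sub A S for A :: "'a cstar_algebra" (structure) and S +
 fixes H :: "'a qgroup" and n :: nat
 assumes qalg_H: "qalg H = A(|carrier := S|)" and qdim_H: "qdim H = n"
  and qfund_in: "i < n ==> j < n ==> qfund H i j : S"
begin

definition w :: "nat => nat => 'a" where
 "w i j = (if i < n & j < n then qfund H i j else \<zero>)"

lemma mat_w [simp]: "mat w"
 using qfund_in by (auto simp: mat_def w_def)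

lemma w_in: "w i j : S"
 using qfund_in by (auto simp: w_def)

lemma fund_power_tp:
 "is : mi n k ==> js : mi n k ==> fund_power H is js = tp w is js"
proof (induction k arbitrary: "is" js)
 case 0
 then show ?case by (simp add: fund_power_def qalg_H)
next
 case (Suc k)
 then obtain i is' j js' where *: "is = i # is'" "js = j # js'" "i < n" "j < n"
  "is' : mi n k" "js' : mi n k" by (auto simp: multi_indices_Suc)
 then show ?case using Suc.IH[of is' js'] by (simp add: fund_power_def qalg_H w_def)
qed

lemma tp_in: "tp w is js : S"
 by (induction w "is" js rule: tp.induct) (auto simp: w_in)

lemma tpk_eq: "is : mi n k ==> tpk w k is js = tp w is js"
 by (simp add: tpk_def multi_indices_def)

lemma tpk_w_zero: "is ~: mi n k | js ~: mi n k ==> tpk w k is js = \<zero>"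
 by (rule tpk_zero[of w n n]) (auto simp: w_def)

text \<open>Rewriting intertwiners as a matrix identity over the algebra makes associativity available.\<close>

lemma Mor_iff:
 "T : Mor H k l \<longleftrightarrow> (ALL j i. j ~: mi n l | i ~: mi n k --> T j i = 0) &
  mm (mi n k) (sc T) (tpk w k) = mm (mi n l) (tpk w l) (sc T)"
proof -
 let ?I = "mi n k" and ?J = "mi n l"
 have lhs: "(\<Oplus>\<^bsub>B\<^esub>i'\<in>?I. T j i' \<odot> fund_power H i' i) = mm ?I (sc T) (tpk w k) j i"
  if "i : ?I" for i j
 proof -
  have "(\<Oplus>\<^bsub>B\<^esub>i'\<in>?I. T j i' \<odot> fund_power H i' i) = (\<Oplus>i'\<in>?I. T j i' \<odot> fund_power H i' i)"
  by (rule sub_finsum) (use that in "auto simp: fund_power_tp tp_in")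
  also have "... = mm ?I (sc T) (tpk w k) j i"
  unfolding mm_sc_left[OF mat_tpk[OF mat_w]]
  by (rule finsum_cong') (use that in "auto simp: fund_power_tp tpk_eq")
  finally show ?thesis .
 qed
 have rhs: "(\<Oplus>\<^bsub>B\<^esub>j'\<in>?J. T j' i \<odot> fund_power H j j') = mm ?J (tpk w l) (sc T) j i"
  if "j : ?J" for i j
 proof -
  have "(\<Oplus>\<^bsub>B\<^esub>j'\<in>?J. T j' i \<odot> fund_power H j j') = (\<Oplus>j'\<in>?J. T j' i \<odot> fund_power H j j')"
  by (rule sub_finsum) (use that in "auto simp: fund_power_tp tp_in")
  also have "... = mm ?J (tpk w l) (sc T) j i"
  unfolding mm_sc_right[OF mat_tpk[OF mat_w]]
  by (rule finsum_cong') (use that in "auto simp: fund_power_tp tpk_eq")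
  finally show ?thesis .
 qed
 have out: "mm ?I (sc T) (tpk w k) j i = mm ?J (tpk w l) (sc T) j i"
  if supp: "ALL j i. j ~: ?J | i ~: ?I --> T j i = 0" and ij: "j ~: ?J | i ~: ?I" for i j
 proof -
  have "mm ?I (sc T) (tpk w k) j i = (\<Oplus>i'\<in>?I. \<zero>)"
  unfolding mm_sc_left[OF mat_tpk[OF mat_w]]
  by (rule finsum_cong') (use supp ij tpk_w_zero in "auto")
  moreover have "mm ?J (tpk w l) (sc T) j i = (\<Oplus>i'\<in>?J. \<zero>)"
  unfolding mm_sc_right[OF mat_tpk[OF mat_w]]
  by (rule finsum_cong') (use supp ij tpk_w_zero in "auto")
  ultimately show ?thesis by simp
 qed
 have "T : Mor H k l \<longleftrightarrow> (ALL j i. j ~: ?J | i ~: ?I --> T j i = 0) &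
  (ALL j:?J. ALL i:?I. mm ?I (sc T) (tpk w k) j i = mm ?J (tpk w l) (sc T) j i)"
  unfolding Mor_def Let_def qdim_H qalg_H using lhs rhs by simp
 also have "... \<longleftrightarrow> (ALL j i. j ~: ?J | i ~: ?I --> T j i = 0) &
  mm ?I (sc T) (tpk w k) = mm ?J (tpk w l) (sc T)"
  unfolding fun_eq_iff using out by blast
 finally show ?thesis .
qed

end

section \<open>The matrices \<open>V\<close>\<close>

definition Vm :: "nat => real => nat => nat => complex" where
 "Vm N s i a = (if i < N - 1 & a < N then U_matrix N s i a else 0)"

definition Vt :: "nat => real => nat => nat => complex" where
 "Vt N s a i = Vm N s i a"

definition Pm :: "nat => nat => nat => complex" where
 "Pm N a b = (if a < N & b < N then (if a = b then 1 else 0) - 1 / of_nat N else 0)"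

lemma sum_delta_shift:
 fixes \<alpha> :: complex
 assumes "i < m" "j < m"
 shows "(SUM a<m. ((if i = a then 1 else 0) - \<alpha>) * ((if j = a then 1 else 0) - \<alpha>)) =
  (if i = j then 1 else 0) - 2 * \<alpha> + of_nat m * \<alpha>\<^sup>2"
proof -
 have "(SUM a<m. ((if i = a then 1 else 0) - \<alpha>) * ((if j = a then 1 else 0) - \<alpha>)) =
  (SUM a<m. (if a = i then (if i = j then 1 else 0) else 0) - (if a = i then \<alpha> else 0) -
  (if a = j then \<alpha> else 0) + \<alpha>\<^sup>2)"
  by (intro sum.cong) (auto simp: power2_eq_square algebra_simps)
 also have "... = (if i = j then 1 else 0) - 2 * \<alpha> + of_nat m * \<alpha>\<^sup>2"
  using assms by (simp add: sum.distrib sum_subtractf)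
 finally show ?thesis .
qed

context
 fixes N :: nat and s :: real
 assumes N: "N >= 2" and s: "s : {1, -1}"
begin

definition vbeta :: complex where "vbeta = complex_of_real (s / sqrt (real N))"
definition valpha :: complex where "valpha = complex_of_real (1 / (real N - 1) * (1 + s / sqrt (real N)))"

lemma vbeta_square: "vbeta\<^sup>2 = 1 / of_nat N"
proof -
 have "(s / sqrt (real N))\<^sup>2 = 1 / real N" using s by (auto simp: power_divide)
 then have "complex_of_real ((s / sqrt (real N))\<^sup>2) = complex_of_real (1 / real N)" by (rule arg_cong)
 then show ?thesis by (simp add: vbeta_def)
qed

lemma valpha_eq: "of_nat (N - 1) * valpha = 1 + vbeta"
proof -
 have "real (N - 1) * (1 / (real N - 1) * (1 + s / sqrt (real N))) = 1 + s / sqrt (real N)"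
  using N by (simp add: of_nat_diff)
 then have "complex_of_real (real (N - 1) * (1 / (real N - 1) * (1 + s / sqrt (real N)))) =
  complex_of_real (1 + s / sqrt (real N))" by (rule arg_cong)
 then show ?thesis by (simp add: vbeta_def valpha_def)
qed

lemma valpha_rel: "of_nat (N - 1) * valpha\<^sup>2 - 2 * valpha = - (vbeta\<^sup>2)"
proof -
 have n0: "(of_nat (N - 1) :: complex) ~= 0" using N by simp
 have nn: "(of_nat N :: complex) = of_nat (N - 1) + 1" using N by (simp add: of_nat_diff)
 have "of_nat (N - 1) * (of_nat (N - 1) * valpha\<^sup>2 - 2 * valpha) =
  (of_nat (N - 1) * valpha)\<^sup>2 - 2 * (of_nat (N - 1) * valpha)"
  by (simp add: power2_eq_square algebra_simps)
 also have "... = vbeta\<^sup>2 - 1" unfolding valpha_eq by (simp add: power2_eq_square algebra_simps)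
 also have "... = of_nat (N - 1) * (- (vbeta\<^sup>2))"
  unfolding vbeta_square nn using n0 nn[symmetric] N by (simp add: field_simps)
 finally show ?thesis by (rule mult_left_cancel[OF n0, THEN iffD1])
qed

lemma Vm_cases:
 assumes "i < N - 1"
 shows "a < N - 1 ==> Vm N s i a = (if i = a then 1 else 0) - valpha" "Vm N s i (N - 1) = vbeta"
 using assms by (auto simp: Vm_def U_matrix_def vbeta_def valpha_def)

lemma sum_split_last: "(SUM a<N. f a) = (SUM a<N - 1. f a) + f (N - 1)" for f :: "nat => complex"
 using sum.lessThan_Suc[of f "N - 1"] N by simp

lemma V_Vt: "cmm {..<N} (Vm N s) (Vt N s) = cid {..<N - 1}"
proof (intro ext)
 fix i j
 have ring: "(d - 2 * a + n * a\<^sup>2) + b * b = d + (n * a\<^sup>2 - 2 * a) + b\<^sup>2" for d a n b :: complex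
  by (simp add: power2_eq_square)
 show "cmm {..<N} (Vm N s) (Vt N s) i j = cid {..<N - 1} i j"
 proof (cases "i < N - 1 & j < N - 1")
  case True
  have "cmm {..<N} (Vm N s) (Vt N s) i j =
  (SUM a<N - 1. ((if i = a then 1 else 0) - valpha) * ((if j = a then 1 else 0) - valpha)) + vbeta * vbeta"
  unfolding cmm_def Vt_def sum_split_last using True Vm_cases by simp
  also have "... = (if i = j then 1 else 0) + (of_nat (N - 1) * valpha\<^sup>2 - 2 * valpha) + vbeta\<^sup>2"
  unfolding sum_delta_shift[OF conjunct1[OF True] conjunct2[OF True]] by (rule ring)
  also have "... = cid {..<N - 1} i j" unfolding valpha_rel using True by (simp add: cid_def)
  finally show ?thesis .
 next
  case False
  then show ?thesis by (auto simp: cmm_def Vt_def Vm_def cid_def)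
 qed
qed

lemma Vt_V: "cmm {..<N - 1} (Vt N s) (Vm N s) = Pm N"
proof (intro ext)
 fix a b
 have ring: "d - 2 * a + n * a\<^sup>2 = d + (n * a\<^sup>2 - 2 * a)" for d a n :: complex by simp
 have n0: "(of_nat (N - 1) :: complex) = of_nat N - 1" using N by (simp add: of_nat_diff)
 have one: "(SUM i<N - 1. ((if i = a then 1 else 0) - valpha) * vbeta) = - (vbeta\<^sup>2)" if "a < N - 1" for a
 proof -
  have "(SUM i<N - 1. ((if i = a then 1 else 0) - valpha) * vbeta) = (1 - of_nat (N - 1) * valpha) * vbeta"
  using that by (simp add: sum_distrib_right[symmetric] sum_subtractf)
  then show ?thesis unfolding valpha_eq by (simp add: power2_eq_square)
 qed
 consider "a >= N | b >= N" | "a < N - 1" "b < N - 1" | "a < N - 1" "b = N - 1" | "a = N - 1" "b < N - 1"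
  | "a = N - 1" "b = N - 1" using N by linarith
 then show "cmm {..<N - 1} (Vt N s) (Vm N s) a b = Pm N a b"
 proof cases
  case 1
  then show ?thesis by (auto simp: cmm_def Vt_def Vm_def Pm_def)
 next
  case 2
  have "cmm {..<N - 1} (Vt N s) (Vm N s) a b =
  (SUM i<N - 1. ((if a = i then 1 else 0) - valpha) * ((if b = i then 1 else 0) - valpha))"
  unfolding cmm_def Vt_def using 2 Vm_cases by (intro sum.cong) auto
  also have "... = (if a = b then 1 else 0) + (of_nat (N - 1) * valpha\<^sup>2 - 2 * valpha)"
  unfolding sum_delta_shift[OF 2] by (rule ring)
  also have "... = Pm N a b" unfolding valpha_rel vbeta_square using 2 by (auto simp: Pm_def)
  finally show ?thesis .
 next
  case 3
  have "cmm {..<N - 1} (Vt N s) (Vm N s) a b = (SUM i<N - 1. ((if i = a then 1 else 0) - valpha) * vbeta)"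
  unfolding cmm_def Vt_def using 3 Vm_cases by (intro sum.cong) auto
  then show ?thesis unfolding one[OF 3(1)] vbeta_square using 3 N by (simp add: Pm_def)
 next
  case 4
  have "cmm {..<N - 1} (Vt N s) (Vm N s) a b = (SUM i<N - 1. ((if i = b then 1 else 0) - valpha) * vbeta)"
  unfolding cmm_def Vt_def using 4 Vm_cases by (intro sum.cong) auto
  then show ?thesis unfolding one[OF 4(2)] vbeta_square using 4 N by (simp add: Pm_def)
 next
  case 5
  have "cmm {..<N - 1} (Vt N s) (Vm N s) a b = of_nat (N - 1) * vbeta\<^sup>2"
  unfolding cmm_def Vt_def using 5 Vm_cases by (simp add: power2_eq_square)
  then show ?thesis unfolding vbeta_square n0 using 5 N by (simp add: Pm_def field_simps)
 qed
qed

end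

section \<open>The irreducible part\<close>

declare One_nat_def [simp del]

lemma (in cstar_alg) cstar_sub_carrier: "cstar_sub A (car A)"
 by unfold_locales (use star_subalgebra_carrier in "auto simp: norm_closed_def")

locale irr_setting = qg_sub A "car A" G N for A :: "'a cstar_algebra" (structure) and G N +
 fixes s :: real
 assumes N: "N >= 2" and s: "s : {1, -1}"
  and orth: "orthogonal_entries A N (qfund G)"
  and two: "(%j i. if j : mi N 2 & i = [] then 1 else 0) : Mor G 0 2"
begin

abbreviation u where "u == w"
abbreviation V where "V == Vm N s"
abbreviation V' where "V' == Vt N s"
abbreviation P where "P == Pm N"

lemma u_star: "star (u i j) = u i j"
 using orth by (auto simp: w_def orthogonal_entries_def)

lemma u_zero: "~ (i < N & j < N) ==> u i j = \<zero>"
 by (auto simp: w_def)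

definition ut where "ut i j = u j i"

lemma mat_ut [simp]: "mat ut"
 by (simp add: mat_def[of ut] ut_def)

lemma u_ut: "mm {..<N} u ut = sc (cid {..<N})" "mm {..<N} ut u = sc (cid {..<N})"
proof -
 have 1: "mm {..<N} u ut i j = sc (cid {..<N}) i j" for i j
 proof (cases "i < N & j < N")
  case True
  have "mm {..<N} u ut i j = (\<Oplus>k\<in>{..<N}. qfund G i k \<otimes> qfund G j k)"
  unfolding mm_def by (rule finsum_cong') (use True qfund_in in "auto simp: ut_def w_def")
  then show ?thesis using orth True by (simp add: orthogonal_entries_def sc_def cid_def)
 next
  case False
  then have "mm {..<N} u ut i j = (\<Oplus>k\<in>{..<N}. \<zero>)"
  unfolding mm_def by (intro finsum_cong') (auto simp: ut_def u_zero)
  then show ?thesis using False by (auto simp: sc_def cid_def)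
 qed
 have 2: "mm {..<N} ut u i j = sc (cid {..<N}) i j" for i j
 proof (cases "i < N & j < N")
  case True
  have "mm {..<N} ut u i j = (\<Oplus>k\<in>{..<N}. qfund G k i \<otimes> qfund G k j)"
  unfolding mm_def by (rule finsum_cong') (use True qfund_in in "auto simp: ut_def w_def")
  then show ?thesis using orth True by (simp add: orthogonal_entries_def sc_def cid_def)
 next
  case False
  then have "mm {..<N} ut u i j = (\<Oplus>k\<in>{..<N}. \<zero>)"
  unfolding mm_def by (intro finsum_cong') (auto simp: ut_def u_zero)
  then show ?thesis using False by (auto simp: sc_def cid_def)
 qed
 show "mm {..<N} u ut = sc (cid {..<N})" "mm {..<N} ut u = sc (cid {..<N})"
  using 1 2 by (auto intro!: ext)
qed

definition r where "r i = (\<Oplus>k\<in>{..<N}. u i k)"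
definition c where "c j = (\<Oplus>k\<in>{..<N}. u k j)"

lemma r_closed [simp]: "r i : car A" and c_closed [simp]: "c i : car A"
 by (auto simp: r_def c_def intro!: finsum_closed)

lemma r_mult:
 assumes "i < N" "j < N" shows "r i \<otimes> r j = \<one>"
proof -
 define T :: tensor_map where "T = (%j i. if j : mi N 2 & i = [] then 1 else 0)"
 define o1 where "o1 = (%(i::nat) (j::nat). 1 :: complex)"
 have ctp1: "length is = length js ==> ctp o1 is js = 1" for "is" js
  by (induction "is" js rule: list_induct2) (auto simp: o1_def)
 have ij: "[i, j] : mi N 2" using assms by (simp add: multi_indices_def)
 have r': "mm {..<N} u (sc o1) i 0 = r i" for i
  unfolding mm_sc_right[OF mat_w] r_def by (rule finsum_cong') (auto simp: o1_def)
 have "mm (mi N 0) (sc T) (tpk u 0) = mm (mi N 2) (tpk u 2) (sc T)"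
  using two unfolding Mor_iff T_def by blast
 then have "mm (mi N 0) (sc T) (tpk u 0) [i, j] [] = mm (mi N 2) (tpk u 2) (sc T) [i, j] []"
  by simp
 moreover have "mm (mi N 0) (sc T) (tpk u 0) [i, j] [] = \<one>"
  using ij unfolding mm_sc_left[OF mat_tpk[OF mat_w]] by (simp add: T_def tpk_def)
 moreover have "mm (mi N 2) (tpk u 2) (sc T) [i, j] [] =
  (\<Oplus>ks\<in>mi N 2. tp u [i, j] ks \<otimes> tp (sc o1) ks [0, 0])"
  unfolding mm_sc_right[OF mat_tpk[OF mat_w]]
 proof (rule finsum_cong', rule refl, goal_cases)
  case (2 ks)
  have "tp (sc o1) ks [0, 0] = \<one>" using 2 by (simp add: tp_sc ctp1 multi_indices_def)
  then show ?case using 2 by (simp add: T_def tpk_def)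
 qed auto
 moreover have "... = tp (mm {..<N} u (sc o1)) [i, j] [0, 0]"
  by (rule tp_mm[symmetric]) (auto simp: sc_mult_left sc_mult_right)
 ultimately show ?thesis by (simp add: r')
qed

lemma r_eq: assumes "i < N" "j < N" shows "r i = r j"
proof -
 have "r i = r i \<otimes> (r j \<otimes> r j)" using r_mult[OF assms(2,2)] by simp
 also have "... = (r i \<otimes> r j) \<otimes> r j" by (simp add: m_assoc)
 also have "... = r j" using r_mult[OF assms] by simp
 finally show ?thesis .
qed

lemma c_eq_r: assumes "i < N" "j < N" shows "c j = r i"
proof -
 have "c j \<otimes> r i = (\<Oplus>k\<in>{..<N}. u k j \<otimes> r i)"
  unfolding c_def by (rule finsum_ldistr) auto
 also have "... = (\<Oplus>k\<in>{..<N}. u k j \<otimes> r k)"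
  by (rule finsum_cong') (use r_eq[OF assms(1)] in auto)
 also have "... = (\<Oplus>k\<in>{..<N}. \<Oplus>l\<in>{..<N}. u k j \<otimes> u k l)"
  unfolding r_def by (rule finsum_cong') (auto simp: finsum_rdistr intro!: finsum_closed)
 also have "... = (\<Oplus>l\<in>{..<N}. \<Oplus>k\<in>{..<N}. u k j \<otimes> u k l)" by (rule finsum_swap) auto
 also have "... = (\<Oplus>l\<in>{..<N}. sc (cid {..<N}) j l)"
  unfolding u_ut(2)[symmetric] mm_def ut_def by simp
 also have "... = \<one>"
  unfolding sc_def finsum_scalar[OF one_closed] using assms by (simp add: cid_def)
 finally have *: "c j \<otimes> r i = \<one>" .
 have "c j = c j \<otimes> (r i \<otimes> r i)" using r_mult[OF assms(1,1)] by simp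
 also have "... = (c j \<otimes> r i) \<otimes> r i" by (simp add: m_assoc)
 also have "... = r i" using * by simp
 finally show ?thesis .
qed

text \<open>The intertwiner given by the two singletons forces all row sums and all column sums of \<open>u\<close> to be the same element.\<close>

lemma u_P: "mm {..<N} u (sc P) = mm {..<N} (sc P) u"
proof (intro ext)
 fix i j
 show "mm {..<N} u (sc P) i j = mm {..<N} (sc P) u i j"
 proof (cases "i < N & j < N")
  case True
  let ?d = "%a b. (if a = b then 1 else 0) :: complex"
  have P: "P a b = ?d a b + (- 1 / of_nat N)" if "a < N" "b < N" for a b using that by (simp add: Pm_def)
  have "mm {..<N} u (sc P) i j = (\<Oplus>k\<in>{..<N}. ?d k j \<odot> u i k \<oplus> (- 1 / of_nat N) \<odot> u i k)"
  unfolding mm_sc_right[OF mat_w] by (rule finsum_cong') (use True P in "auto simp: smult_l_distr[symmetric]")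
  also have "... = (\<Oplus>k\<in>{..<N}. ?d k j \<odot> u i k) \<oplus> (\<Oplus>k\<in>{..<N}. (- 1 / of_nat N) \<odot> u i k)"
  by (rule finsum_addf) auto
  also have "(\<Oplus>k\<in>{..<N}. ?d k j \<odot> u i k) = ?d j j \<odot> u i j"
  by (rule finsum_delta) (use True in auto)
  also have "(\<Oplus>k\<in>{..<N}. (- 1 / of_nat N) \<odot> u i k) = (- 1 / of_nat N) \<odot> r i"
  unfolding r_def by (rule finsum_smult[symmetric]) auto
  also have "r i = c j" using c_eq_r[of i j] True by simp
  also have "(- 1 / of_nat N) \<odot> c j = (\<Oplus>k\<in>{..<N}. (- 1 / of_nat N) \<odot> u k j)"
  unfolding c_def by (rule finsum_smult) auto
  also have "?d j j \<odot> u i j = ?d i i \<odot> u i j" by simp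
  also have "?d i i \<odot> u i j = (\<Oplus>k\<in>{..<N}. ?d i k \<odot> u k j)"
  by (rule finsum_delta[symmetric]) (use True in auto)
  also have "(\<Oplus>k\<in>{..<N}. ?d i k \<odot> u k j) \<oplus> (\<Oplus>k\<in>{..<N}. (- 1 / of_nat N) \<odot> u k j) =
  (\<Oplus>k\<in>{..<N}. ?d i k \<odot> u k j \<oplus> (- 1 / of_nat N) \<odot> u k j)"
  by (rule finsum_addf[symmetric]) auto
  also have "... = mm {..<N} (sc P) u i j"
  unfolding mm_sc_left[OF mat_w] by (rule finsum_cong') (use True P in "auto simp: smult_l_distr[symmetric]")
  finally show ?thesis .
 next
  case False
  have "mm {..<N} u (sc P) i j = (\<Oplus>k\<in>{..<N}. \<zero>)"
  unfolding mm_sc_right[OF mat_w] by (rule finsum_cong') (use False in "auto simp: u_zero Pm_def")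
  moreover have "mm {..<N} (sc P) u i j = (\<Oplus>k\<in>{..<N}. \<zero>)"
  unfolding mm_sc_left[OF mat_w] by (rule finsum_cong') (use False in "auto simp: u_zero Pm_def")
  ultimately show ?thesis by simp
 qed
qed

definition v where "v = mm {..<N} (mm {..<N} (sc V) u) (sc V')"
definition vt where "vt i j = v j i"

lemma mat_v [simp]: "mat v"
 by (simp add: v_def)

lemma v_double: "v i j = (\<Oplus>a\<in>{..<N}. \<Oplus>b\<in>{..<N}. (V i a * V j b) \<odot> u a b)"
proof -
 have "v i j = mm {..<N} (sc V) (mm {..<N} u (sc V')) i j"
  unfolding v_def by (subst mm_assoc) auto
 also have "... = (\<Oplus>a\<in>{..<N}. V i a \<odot> (\<Oplus>b\<in>{..<N}. V j b \<odot> u a b))"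
  by (simp add: mm_sc_left mm_sc_right Vt_def)
 also have "... = (\<Oplus>a\<in>{..<N}. \<Oplus>b\<in>{..<N}. (V i a * V j b) \<odot> u a b)"
  by (rule finsum_cong') (auto simp: finsum_smult smult_smult intro!: finsum_closed)
 finally show ?thesis .
qed

lemma V_real: "cnj (V i a) = V i a" "cnj (U_matrix N s i a) = U_matrix N s i a"
 by (simp_all add: Vm_def U_matrix_def)

lemma irr_fund_v:
 assumes "i < N - 1" "j < N - 1" shows "irr_fund s G i j = v i j"
proof -
 have "qalg G = A" by (simp add: qalg_H)
 then have "irr_fund s G i j = (\<Oplus>a\<in>{..<N}. \<Oplus>b\<in>{..<N}. (U_matrix N s i a * U_matrix N s j b) \<odot> qfund G a b)"
  by (simp add: irr_fund_def Let_def qdim_H V_real)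
 also have "... = v i j"
  unfolding v_double
  by (intro finsum_cong') (use assms qfund_in in "auto simp: Vm_def w_def intro!: finsum_closed finsum_cong'")
 finally show ?thesis .
qed

lemma v_star: "star (v i j) = v i j"
proof -
 have "star (v i j) = (\<Oplus>a\<in>{..<N}. \<Oplus>b\<in>{..<N}. star ((V i a * V j b) \<odot> u a b))"
  unfolding v_double by (subst finsum_star) (auto intro!: finsum_cong' finsum_closed simp: finsum_star)
 then show ?thesis unfolding v_double by (simp add: star_smult u_star V_real)
qed

lemma v_zero: "~ (i < N - 1 & j < N - 1) ==> v i j = \<zero>"
proof -
 assume "~ (i < N - 1 & j < N - 1)"
 then have "v i j = (\<Oplus>a\<in>{..<N}. \<Oplus>b\<in>{..<N}. \<zero>)"
  unfolding v_double by (intro finsum_cong') (auto simp: Vm_def intro!: finsum_cong')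
 then show ?thesis by simp
qed

lemma vt_eq: "vt = mm {..<N} (mm {..<N} (sc V) ut) (sc V')"
proof (intro ext)
 fix i j
 have "vt i j = mm {..<N} (sc V) (mm {..<N} u (sc V')) j i"
  unfolding vt_def v_def by (subst mm_assoc) auto
 also have "... = mm {..<N} (mm {..<N} (sc V) ut) (sc V') i j"
  by (simp add: mm_sc_left mm_sc_right Vt_def ut_def)
 finally show "vt i j = mm {..<N} (mm {..<N} (sc V) ut) (sc V') i j" .
qed

lemma P_square: "mm {..<N - 1} (sc V') (sc V) = sc P" "mm {..<N} (sc V) (sc V') = sc (cid {..<N - 1})"
 unfolding mm_sc_sc Vt_V[OF N s] V_Vt[OF N s] by (rule refl)+

lemma cid_V: "mm {..<N - 1} (sc (cid {..<N - 1})) (sc V) = sc V" "mm {..<N} (sc (cid {..<N})) (sc V') = sc V'"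
  "mm {..<N} (sc (cid {..<N})) u = u" "mm {..<N} u (sc (cid {..<N})) = u"
  "mm {..<N} (sc (cid {..<N})) (sc P) = sc P"
proof -
 show "mm {..<N - 1} (sc (cid {..<N - 1})) (sc V) = sc V"
  by (rule mm_cid_left[OF _ mat_sc]) (auto simp: sc_def Vm_def)
 show "mm {..<N} (sc (cid {..<N})) (sc V') = sc V'"
  by (rule mm_cid_left[OF _ mat_sc]) (auto simp: sc_def Vm_def Vt_def)
 show "mm {..<N} (sc (cid {..<N})) u = u" by (rule mm_cid_left[OF _ mat_w]) (auto simp: w_def)
 show "mm {..<N} u (sc (cid {..<N})) = u" by (rule mm_cid_right[OF _ mat_w]) (auto simp: w_def)
 show "mm {..<N} (sc (cid {..<N})) (sc P) = sc P"
  by (rule mm_cid_left[OF _ mat_sc]) (auto simp: sc_def Pm_def)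
qed

lemma V_P: "mm {..<N} (sc V) (sc P) = sc V"
proof -
 have "mm {..<N} (sc V) (sc P) = mm {..<N - 1} (mm {..<N} (sc V) (sc V')) (sc V)"
  unfolding P_square(1)[symmetric] by (subst mm_assoc) auto
 then show ?thesis by (simp add: P_square cid_V)
qed

lemma v_vt: "mm {..<N - 1} v vt = sc (cid {..<N - 1})"
proof -
 have "mm {..<N - 1} v vt = mm {..<N} (sc V) (mm {..<N} u (mm {..<N} (mm {..<N - 1} (sc V') (sc V)) (mm {..<N} ut (sc V'))))"
  unfolding v_def vt_eq by (simp add: mm_assoc)
 also have "... = mm {..<N} (sc V) (mm {..<N} (mm {..<N} u (sc P)) (mm {..<N} ut (sc V')))"
  unfolding P_square by (simp add: mm_assoc)
 also have "... = mm {..<N} (mm {..<N} (sc V) (sc P)) (mm {..<N} (mm {..<N} u ut) (sc V'))"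
  unfolding u_P by (simp add: mm_assoc)
 also have "... = sc (cid {..<N - 1})"
  unfolding u_ut V_P by (simp add: cid_V P_square)
 finally show ?thesis .
qed

lemma vt_v: "mm {..<N - 1} vt v = sc (cid {..<N - 1})"
proof -
 have "mm {..<N - 1} vt v = mm {..<N} (sc V) (mm {..<N} ut (mm {..<N} (mm {..<N - 1} (sc V') (sc V)) (mm {..<N} u (sc V'))))"
  unfolding v_def vt_eq by (simp add: mm_assoc)
 also have "... = mm {..<N} (sc V) (mm {..<N} ut (mm {..<N} (mm {..<N} (sc P) u) (sc V')))"
  unfolding P_square by (simp add: mm_assoc)
 also have "... = mm {..<N} (sc V) (mm {..<N} (mm {..<N} ut u) (mm {..<N} (sc P) (sc V')))"
  unfolding u_P[symmetric] by (simp add: mm_assoc)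
 also have "... = mm {..<N} (mm {..<N} (sc V) (sc P)) (sc V')"
  unfolding u_ut by (simp add: mm_assoc[symmetric] cid_V)
 also have "... = sc (cid {..<N - 1})" by (simp add: V_P P_square)
 finally show ?thesis .
qed

definition Vk where "Vk k = ctpk V k"
definition Vk' where "Vk' k = ctpk V' k"
definition Pk where "Pk k = ctpk P k"

lemma Vk_rel:
 "cmm (mi N k) (Vk k) (Vk' k) = cid (multi_indices (N - 1) k)"
 "cmm (multi_indices (N - 1) k) (Vk' k) (Vk k) = Pk k"
 unfolding Vk_def Vk'_def Pk_def ctpk_cmm[symmetric] V_Vt[OF N s] Vt_V[OF N s] by (simp_all add: ctpk_cid)

lemma Vk_support:
 "Vk k i j ~= 0 ==> i : multi_indices (N - 1) k & j : mi N k"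
 "Vk' k j i ~= 0 ==> i : multi_indices (N - 1) k & j : mi N k"
proof -
 show "Vk k i j ~= 0 ==> i : multi_indices (N - 1) k & j : mi N k"
  unfolding Vk_def by (rule ctp_support) (auto simp: Vm_def split: if_splits)
 have "Vk' k j i ~= 0 ==> j : mi N k & i : multi_indices (N - 1) k"
  unfolding Vk'_def by (rule ctp_support) (auto simp: Vt_def Vm_def split: if_splits)
 then show "Vk' k j i ~= 0 ==> i : multi_indices (N - 1) k & j : mi N k" by blast
qed

lemma tpk_v: "tpk v k = mm (mi N k) (mm (mi N k) (sc (Vk k)) (tpk u k)) (sc (Vk' k))"
 unfolding v_def Vk_def Vk'_def tpk_sc[symmetric]
 by (subst tpk_mm, simp, simp, simp add: sc_mult_left sc_mult_right,
  subst tpk_mm, simp, simp, simp add: sc_mult_left sc_mult_right, simp)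

lemma Pk_u: "mm (mi N k) (tpk u k) (sc (Pk k)) = mm (mi N k) (sc (Pk k)) (tpk u k)"
 unfolding Pk_def tpk_sc[symmetric]
 by (subst (1 2) tpk_mm[symmetric]) (simp_all add: sc_mult_left sc_mult_right u_P)

end

context irr_setting
begin

definition E where "E = {irr_fund s G i j | i j. i < N - 1 & j < N - 1}"
definition T where "T = cstar_generated A E"
abbreviation irr where "irr == irr_qgroup s G"

lemma qalg_G: "qalg G = A"
 by (simp add: qalg_H)

lemma E_closed: "E <= car A"
 by (auto simp: E_def irr_fund_v)

sublocale T: cstar_sub A T
 unfolding T_def by unfold_locales (rule cstar_generated_sub[OF E_closed], rule cstar_generated_closed[OF E_closed])

lemma irr_simps: "qdim irr = N - 1" "qalg irr = A(|carrier := T|)" "qfund irr = irr_fund s G"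
 by (simp_all add: irr_qgroup_def Let_def qdim_H qalg_G T_def E_def)

lemma irr_fund_in: "i < N - 1 ==> j < N - 1 ==> irr_fund s G i j : T"
proof -
 assume "i < N - 1" "j < N - 1"
 then have "irr_fund s G i j : E" unfolding E_def by blast
 then show ?thesis using cstar_generated_incl[of E] unfolding T_def by (rule rev_subsetD)
qed

lemma v_in: "v i j : T"
 using irr_fund_in[of i j] irr_fund_v[of i j] v_zero[of i j] by (cases "i < N - 1 & j < N - 1") auto

sublocale I: qg_sub A T irr "N - 1"
 by unfold_locales (auto simp: irr_simps irr_fund_in)

lemma I_w: "I.w = v"
 by (intro ext) (auto simp: I.w_def irr_simps irr_fund_v v_zero)

lemma irr_sums:
 assumes "i < N - 1" "j < N - 1"
 shows "(\<Oplus>\<^bsub>T.B\<^esub>k\<in>{..<N - 1}. irr_fund s G i k \<otimes> irr_fund s G j k) = (if i = j then \<one> else \<zero>)"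
  "(\<Oplus>\<^bsub>T.B\<^esub>k\<in>{..<N - 1}. irr_fund s G k i \<otimes> irr_fund s G k j) = (if i = j then \<one> else \<zero>)"
proof -
 have "(\<Oplus>\<^bsub>T.B\<^esub>k\<in>{..<N - 1}. irr_fund s G i k \<otimes> irr_fund s G j k) =
  (\<Oplus>k\<in>{..<N - 1}. irr_fund s G i k \<otimes> irr_fund s G j k)"
  by (rule T.sub_finsum) (use assms irr_fund_in in auto)
 also have "... = mm {..<N - 1} v vt i j"
  unfolding mm_def by (rule finsum_cong') (use assms in "auto simp: irr_fund_v vt_def")
 also have "... = (if i = j then \<one> else \<zero>)" unfolding v_vt using assms by (simp add: sc_def cid_def)
 finally show "(\<Oplus>\<^bsub>T.B\<^esub>k\<in>{..<N - 1}. irr_fund s G i k \<otimes> irr_fund s G j k) = (if i = j then \<one> else \<zero>)" .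
 have "(\<Oplus>\<^bsub>T.B\<^esub>k\<in>{..<N - 1}. irr_fund s G k i \<otimes> irr_fund s G k j) =
  (\<Oplus>k\<in>{..<N - 1}. irr_fund s G k i \<otimes> irr_fund s G k j)"
  by (rule T.sub_finsum) (use assms irr_fund_in in auto)
 also have "... = mm {..<N - 1} vt v i j"
  unfolding mm_def by (rule finsum_cong') (use assms in "auto simp: irr_fund_v vt_def")
 also have "... = (if i = j then \<one> else \<zero>)" unfolding vt_v using assms by (simp add: sc_def cid_def)
 finally show "(\<Oplus>\<^bsub>T.B\<^esub>k\<in>{..<N - 1}. irr_fund s G k i \<otimes> irr_fund s G k j) = (if i = j then \<one> else \<zero>)" .
qed

lemma irr_orthogonal: "orthogonal_entries (qalg irr) (qdim irr) (qfund irr)"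
 unfolding orthogonal_entries_def irr_simps
 using irr_sums irr_fund_in by (auto simp: irr_fund_v v_star)

lemma entries_irr: "entries irr = E"
 by (simp add: entries_def irr_simps E_def)

lemma irr_generated: "cstar_generated (qalg irr) (entries irr) = car (qalg irr)"
 unfolding entries_irr irr_simps T_def by (rule cstar_generated_in_sub[OF E_closed])

lemma irr_sub_free_orthogonal: "qsubgroup irr (free_orthogonal_qgroup (N - 1))"
 using qsubgroup_free_orthogonal[of irr] irr_orthogonal irr_generated T.sub_cstar_algebra
 by (simp add: irr_simps)

lemma irr_invertible:
 "matrix_invertible (qalg irr) (N - 1) (qfund irr)" "matrix_invertible (qalg irr) (N - 1) (%i j. qfund irr j i)"
 unfolding matrix_invertible_def irr_simps
 by (rule exI[of _ "%i j. irr_fund s G j i"], use irr_sums irr_fund_in in simp)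
  (rule exI[of _ "irr_fund s G"], use irr_sums irr_fund_in in simp)

subsection \<open>Intertwiners\<close>

definition conj_V where
 "conj_V k l S = cmm (mi N k) (cmm (mi N l) (Vk l) S) (Vk' k)"

lemma scVk_rel:
 "mm (mi N k) (sc (Vk k)) (sc (Vk' k)) = sc (cid (multi_indices (N - 1) k))"
 "mm (multi_indices (N - 1) k) (sc (Vk' k)) (sc (Vk k)) = sc (Pk k)"
 unfolding mm_sc_sc Vk_rel by (rule refl)+

lemma Vk_Pk: "mm (mi N k) (sc (Vk k)) (sc (Pk k)) = sc (Vk k)"
proof -
 have "mm (mi N k) (sc (Vk k)) (sc (Pk k)) =
  mm (multi_indices (N - 1) k) (mm (mi N k) (sc (Vk k)) (sc (Vk' k))) (sc (Vk k))"
  unfolding scVk_rel(2)[symmetric] by (simp add: mm_assoc)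
 also have "... = sc (Vk k)"
  unfolding scVk_rel unfolding mm_sc_sc by (subst cmm_cid_left) (use Vk_support(1) in auto)
 finally show ?thesis .
qed

lemma Pk_Vk': "mm (mi N k) (sc (Pk k)) (sc (Vk' k)) = sc (Vk' k)"
proof -
 have "mm (mi N k) (sc (Pk k)) (sc (Vk' k)) =
  mm (multi_indices (N - 1) k) (sc (Vk' k)) (mm (mi N k) (sc (Vk k)) (sc (Vk' k)))"
  unfolding scVk_rel(2)[symmetric] by (simp add: mm_assoc)
 also have "... = sc (Vk' k)"
  unfolding scVk_rel unfolding mm_sc_sc by (subst cmm_cid_right) (use Vk_support(2) in auto)
 finally show ?thesis .
qed

lemma Mor_conj_V:
 assumes S: "S : Mor G k l" shows "conj_V k l S : Mor irr k l"
proof -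
 let ?Nk = "mi N k" and ?Nl = "mi N l"
 let ?Mk = "multi_indices (N - 1) k" and ?Ml = "multi_indices (N - 1) l"
 have comm: "mm ?Nk (sc S) (tpk u k) = mm ?Nl (tpk u l) (sc S)" using S by (simp add: Mor_iff)
 have scT: "sc (conj_V k l S) = mm ?Nk (mm ?Nl (sc (Vk l)) (sc S)) (sc (Vk' k))"
  unfolding conj_V_def mm_sc_sc ..
 have "mm ?Mk (sc (conj_V k l S)) (tpk v k) =
  mm ?Nl (sc (Vk l)) (mm ?Nk (sc S) (mm ?Nk (mm ?Nk (mm ?Mk (sc (Vk' k)) (sc (Vk k))) (tpk u k)) (sc (Vk' k))))"
  unfolding scT tpk_v by (simp add: mm_assoc)
 also have "... = mm ?Nl (sc (Vk l)) (mm ?Nk (mm ?Nk (sc S) (tpk u k)) (mm ?Nk (sc (Pk k)) (sc (Vk' k))))"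
  unfolding scVk_rel Pk_u[symmetric] by (simp add: mm_assoc)
 also have "... = mm ?Nk (mm ?Nl (sc (Vk l)) (mm ?Nl (tpk u l) (sc S))) (sc (Vk' k))"
  unfolding Pk_Vk' comm by (simp add: mm_assoc)
 finally have L: "mm ?Mk (sc (conj_V k l S)) (tpk v k) =
  mm ?Nk (mm ?Nl (sc (Vk l)) (mm ?Nl (tpk u l) (sc S))) (sc (Vk' k))" .
 have "mm ?Ml (tpk v l) (sc (conj_V k l S)) =
  mm ?Nl (sc (Vk l)) (mm ?Nl (mm ?Nl (tpk u l) (mm ?Ml (sc (Vk' l)) (sc (Vk l)))) (mm ?Nk (sc S) (sc (Vk' k))))"
  unfolding scT tpk_v by (simp add: mm_assoc)
 also have "... = mm ?Nl (mm ?Nl (sc (Vk l)) (sc (Pk l))) (mm ?Nl (tpk u l) (mm ?Nk (sc S) (sc (Vk' k))))"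
  unfolding scVk_rel Pk_u by (simp add: mm_assoc)
 also have "... = mm ?Nk (mm ?Nl (sc (Vk l)) (mm ?Nl (tpk u l) (sc S))) (sc (Vk' k))"
  unfolding Vk_Pk by (simp add: mm_assoc)
 finally have "mm ?Mk (sc (conj_V k l S)) (tpk v k) = mm ?Ml (tpk v l) (sc (conj_V k l S))" using L by simp
 moreover have "conj_V k l S j i = 0" if "j ~: ?Ml | i ~: ?Mk" for i j
 proof -
  have "Vk l j b = 0 | Vk' k a i = 0" for a b using Vk_support[of l j b] Vk_support(2)[of k a i] that by blast
  then show ?thesis unfolding conj_V_def cmm_def sum_distrib_right by (intro sum.neutral ballI) auto
 qed
 ultimately show ?thesis unfolding I.Mor_iff I_w by blast
qed

text \<open>The inverse direction conjugates back; it hits intertwiners of \<open>u\<close> because \<open>P\<close> commutes with \<open>u\<close>.\<close>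

lemma Mor_irr: "Mor irr k l = conj_V k l ` Mor G k l"
proof
 show "conj_V k l ` Mor G k l <= Mor irr k l" using Mor_conj_V by blast
 show "Mor irr k l <= conj_V k l ` Mor G k l"
 proof
  let ?Nk = "mi N k" and ?Nl = "mi N l"
  let ?Mk = "multi_indices (N - 1) k" and ?Ml = "multi_indices (N - 1) l"
  fix R assume R: "R : Mor irr k l"
  have supp: "j ~: ?Ml | i ~: ?Mk ==> R j i = 0" for i j using R unfolding I.Mor_iff by blast
  have comm: "mm ?Mk (sc R) (tpk v k) = mm ?Ml (tpk v l) (sc R)" using R unfolding I.Mor_iff I_w by blast
  define S where "S = cmm ?Mk (cmm ?Ml (Vk' l) R) (Vk k)"
  have scS: "sc S = mm ?Mk (mm ?Ml (sc (Vk' l)) (sc R)) (sc (Vk k))"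
  unfolding S_def mm_sc_sc ..
  have "mm ?Nk (sc S) (tpk u k) = mm ?Ml (sc (Vk' l)) (mm ?Mk (sc R) (mm ?Nk (mm ?Nk (sc (Vk k)) (sc (Pk k))) (tpk u k)))"
  unfolding scS Vk_Pk by (simp add: mm_assoc)
  also have "... = mm ?Ml (sc (Vk' l)) (mm ?Mk (sc R) (mm ?Nk (mm ?Nk (sc (Vk k)) (tpk u k)) (mm ?Mk (sc (Vk' k)) (sc (Vk k)))))"
  unfolding scVk_rel by (simp add: mm_assoc Pk_u)
  also have "... = mm ?Mk (mm ?Ml (sc (Vk' l)) (mm ?Mk (sc R) (tpk v k))) (sc (Vk k))"
  unfolding tpk_v by (simp add: mm_assoc)
  also have "... = mm ?Nl (mm ?Nl (mm ?Ml (sc (Vk' l)) (sc (Vk l))) (tpk u l)) (mm ?Ml (sc (Vk' l)) (mm ?Mk (sc R) (sc (Vk k))))"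
  unfolding comm unfolding tpk_v by (simp add: mm_assoc)
  also have "... = mm ?Ml (mm ?Nl (tpk u l) (mm ?Nl (sc (Pk l)) (sc (Vk' l)))) (mm ?Mk (sc R) (sc (Vk k)))"
  unfolding scVk_rel Pk_u[symmetric] by (simp add: mm_assoc)
  also have "... = mm ?Nl (tpk u l) (sc S)" unfolding Pk_Vk' scS by (simp add: mm_assoc)
  finally have "mm ?Nk (sc S) (tpk u k) = mm ?Nl (tpk u l) (sc S)" .
  moreover have "S j i = 0" if "j ~: ?Nl | i ~: ?Nk" for i j
  proof -
  have "Vk' l j b = 0 | Vk k a i = 0" for a b using Vk_support(2)[of l j b] Vk_support(1)[of k a i] that by blast
  then show ?thesis unfolding S_def cmm_def sum_distrib_right by (intro sum.neutral ballI) auto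
  qed
  ultimately have "S : Mor G k l" unfolding Mor_iff by blast
  moreover have "conj_V k l S = R"
  proof -
  have "conj_V k l S = cmm ?Mk (cmm ?Ml (cmm ?Nl (Vk l) (Vk' l)) R) (cmm ?Nk (Vk k) (Vk' k))"
  unfolding conj_V_def S_def by (simp add: cmm_assoc)
  also have "... = R"
  unfolding Vk_rel by (subst cmm_cid_left, simp, metis supp, subst cmm_cid_right, simp, metis supp, rule refl)
  finally show ?thesis .
  qed
  ultimately show "R : conj_V k l ` Mor G k l" by (metis image_eqI)
 qed
qed

end

lemma linear_on_zero: "star_alg A ==> linear_on A f ==> f \<zero>\<^bsub>A\<^esub> = 0"
proof -
 assume "star_alg A" and f: "linear_on A f"
 then interpret star_alg A by simp
 have "f (0 \<odot>\<^bsub>A\<^esub> \<zero>\<^bsub>A\<^esub>) = 0 * f \<zero>\<^bsub>A\<^esub>" using f zero_closed unfolding linear_on_def by blast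
 then show ?thesis by simp
qed

lemma linear_on_finsum:
 assumes "star_alg A" "linear_on A f" "finite I" "g : I \<rightarrow> car A"
 shows "f (finsum A g I) = (SUM i:I. f (g i))"
proof -
 interpret star_alg A by fact
 show ?thesis using assms(3,4)
 proof (induction I)
  case (insert i I)
  then show ?case using assms(2) by (simp add: linear_on_def Pi_def)
 qed (simp add: linear_on_zero[OF assms(1,2)])
qed

context irr_setting
begin

lemma linear_on_v:
 assumes f: "linear_on A f"
 shows "f (v i j) = cmm {..<N} (cmm {..<N} V (%a b. f (u a b))) V' i j"
proof -
 have sm: "f (x \<odot> y) = x * f y" if "y : car A" for x y using f that by (simp add: linear_on_def)
 have "f (v i j) = (SUM a<N. SUM b<N. (V i a * V j b) * f (u a b))"
 proof -
  have 1: "(%b. (V i a * V j b) \<odot> u a b) : {..<N} \<rightarrow> car A" for a by auto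
  have 2: "(%a. \<Oplus>b\<in>{..<N}. (V i a * V j b) \<odot> u a b) : {..<N} \<rightarrow> car A"
  using finsum_closed[OF 1] by blast
  show ?thesis
  unfolding v_double linear_on_finsum[OF star_alg_axioms f finite_lessThan 2]
  linear_on_finsum[OF star_alg_axioms f finite_lessThan 1] by (simp add: sm)
 qed
 also have "... = (SUM b<N. SUM a<N. (V i a * V j b) * f (u a b))" by (rule sum.swap)
 also have "... = cmm {..<N} (cmm {..<N} V (%a b. f (u a b))) V' i j"
  unfolding cmm_def Vt_def sum_distrib_right by (intro sum.cong refl) (simp add: algebra_simps)
 finally show ?thesis .
qed

lemma linear_on_u_P:
 assumes f: "linear_on A f"
 shows "cmm {..<N} (%a b. f (u a b)) P = cmm {..<N} P (%a b. f (u a b))"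
proof (intro ext)
 fix i j
 have sm: "f (x \<odot> y) = x * f y" if "y : car A" for x y using f that by (simp add: linear_on_def)
 have "f (mm {..<N} u (sc P) i j) = (SUM k<N. P k j * f (u i k))"
  unfolding mm_sc_right[OF mat_w] by (subst linear_on_finsum[OF star_alg_axioms f]) (auto simp: sm)
 moreover have "f (mm {..<N} (sc P) u i j) = (SUM k<N. P i k * f (u k j))"
  unfolding mm_sc_left[OF mat_w] by (subst linear_on_finsum[OF star_alg_axioms f]) (auto simp: sm)
 ultimately show "cmm {..<N} (%a b. f (u a b)) P i j = cmm {..<N} P (%a b. f (u a b)) i j"
  unfolding u_P by (simp add: cmm_def mult.commute)
qed

lemma cmm_V_P: "cmm {..<N} V P = V"
proof -
 have "cmm {..<N} V P = cmm {..<N - 1} (cmm {..<N} V V') V"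
  unfolding Vt_V[OF N s, symmetric] by (simp only: cmm_assoc)
 also have "... = V" unfolding V_Vt[OF N s] by (rule cmm_cid_left) (auto simp: Vm_def split: if_splits)
 finally show ?thesis .
qed

lemma linear_on_v_mult:
 assumes f: "linear_on A f" and g: "linear_on A g"
 shows "(SUM k<N - 1. f (v i k) * g (v k j)) = (SUM a<N. SUM b<N. (V i a * V j b) * (SUM k<N. f (u a k) * g (u k b)))"
proof -
 let ?F = "%a b. f (u a b)" and ?G = "%a b. g (u a b)"
 have "(SUM k<N - 1. f (v i k) * g (v k j)) =
  cmm {..<N - 1} (cmm {..<N} (cmm {..<N} V ?F) V') (cmm {..<N} (cmm {..<N} V ?G) V') i j"
  unfolding cmm_def[of "{..<N - 1}"] by (simp add: linear_on_v[OF f] linear_on_v[OF g])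
 also have "... = cmm {..<N} V (cmm {..<N} ?F (cmm {..<N} (cmm {..<N - 1} V' V) (cmm {..<N} ?G V'))) i j"
  by (simp only: cmm_assoc)
 also have "... = cmm {..<N} V (cmm {..<N} (cmm {..<N} ?F P) (cmm {..<N} ?G V')) i j"
  unfolding Vt_V[OF N s] by (simp only: cmm_assoc)
 also have "... = cmm {..<N} (cmm {..<N} V P) (cmm {..<N} ?F (cmm {..<N} ?G V')) i j"
  unfolding linear_on_u_P[OF f] by (simp only: cmm_assoc)
 also have "... = cmm {..<N} (cmm {..<N} V (cmm {..<N} ?F ?G)) V' i j"
  unfolding cmm_V_P by (simp only: cmm_assoc)
 also have "... = (SUM b<N. SUM a<N. (V i a * V j b) * (SUM k<N. f (u a k) * g (u k b)))"
  unfolding cmm_def Vt_def sum_distrib_right[of _ _ "Vm N s j _"] by (intro sum.cong refl) (simp add: algebra_simps)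
 also have "... = (SUM a<N. SUM b<N. (V i a * V j b) * (SUM k<N. f (u a k) * g (u k b)))" by (rule sum.swap)
 finally show ?thesis .
qed

end

section \<open>The comultiplication of the irreducible part\<close>

lemma star_hom_pull_seminorm:
 assumes "star_alg A" "star_hom A C De" "cstar_seminorm C my" shows "cstar_seminorm A (%x. my (De x))"
proof -
 interpret star_alg A by fact
 have "adj A x : car A" if "x : car A" for x using that by simp
 then show ?thesis using assms(2,3) unfolding cstar_seminorm_def star_hom_def ring_hom_def by (auto simp: Pi_def)
qed

lemma (in star_monoid) lin_finsum:
 assumes "finite I" "F : I \<rightarrow> car X" shows "lin (finsum X F I) h = (SUM i:I. lin (F i) h)"
 using assms
proof (induction I)
 case (insert i I)
 then have c: "F : I \<rightarrow> car X" "F i : car X" by auto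
 then have "lin (finsum X F (insert i I)) h = lin (F i \<oplus>\<^bsub>X\<^esub> finsum X F I) h" using insert by simp
 also have "... = lin (F i) h + lin (finsum X F I) h" by (rule lin_X(1)) (use c in auto)
 finally show ?case using insert c by simp
qed (simp add: X_simps)

locale comult_setting = irr_setting A G N s for A :: "'a cstar_algebra" (structure) and G N s +
 fixes De
 assumes De_hom: "star_hom A (min_tensor A A) De"
  and De_u: "i < N ==> j < N ==> De (qfund G i j) =
  (\<Oplus>\<^bsub>min_tensor A A\<^esub>k\<in>{..<N}. pure_tensor A A (qfund G i k) (qfund G k j))"
  and full: "cstar_seminorm (A(|carrier := star_generated A (entries G)|)) nu ==>
  x : star_generated A (entries G) ==> nu x <= cnorm A x"
begin

sublocale AA: tensor_pair A A ..

sublocale BB: tensor_pair T.B T.B ..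

lemmas sub_ops = formal_tensors_sub[OF T.cstar_sub_axioms]

abbreviation CA where "CA == AA.S.C"
abbreviation CB where "CB == BB.S.C"

lemma De_hom': "star_hom A CA De"
 using De_hom by (simp add: min_tensor_def)

lemma De_ops:
 "x : car A ==> y : car A ==> De (x \<oplus> y) = De x \<oplus>\<^bsub>CA\<^esub> De y"
 "x : car A ==> y : car A ==> De (x \<otimes> y) = De x \<otimes>\<^bsub>CA\<^esub> De y"
 "x : car A ==> De (z \<odot> x) = z \<odot>\<^bsub>CA\<^esub> De x"
 "x : car A ==> De (star x) = adj CA (De x)"
 "De \<one> = \<one>\<^bsub>CA\<^esub>"
 using De_hom' by (auto simp: star_hom_def ring_hom_def)

text \<open>The pairs of elements \<open>x\<close> and formal tensors that represent \<open>De x\<close>.\<close>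

definition repr where "repr x t \<longleftrightarrow> x : car A & t : car AA.X & De x = AA.S.\<iota> t"

lemma repr_add: "repr x t ==> repr y t' ==> repr (x \<oplus> y) (t \<oplus>\<^bsub>AA.X\<^esub> t')"
 by (auto simp: repr_def De_ops AA.S.iota_add)

lemma repr_mult: "repr x t ==> repr y t' ==> repr (x \<otimes> y) (t \<otimes>\<^bsub>AA.X\<^esub> t')"
 by (auto simp: repr_def De_ops AA.S.iota_mult)

lemma repr_smult: "repr x t ==> repr (z \<odot> x) (z \<odot>\<^bsub>AA.X\<^esub> t)"
 by (auto simp: repr_def De_ops AA.S.iota_smult)

lemma repr_star: "repr x t ==> repr (star x) (adj AA.X t)"
 by (auto simp: repr_def De_ops AA.S.iota_star)

lemma repr_one: "repr \<one> \<one>\<^bsub>AA.X\<^esub>"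
 by (auto simp: repr_def De_ops AA.S.C_one)

lemma repr_zero: "repr \<zero> \<zero>\<^bsub>AA.X\<^esub>"
 using repr_smult[OF repr_one, of 0] by simp

lemma repr_diff: "repr x t ==> repr y t' ==> repr (x \<ominus> y) (t \<ominus>\<^bsub>AA.X\<^esub> t')"
 using repr_add[OF _ repr_smult[of y t' "-1"]]
 by (simp add: a_minus_def smult_minus_one AA.F.X.smult_minus_one repr_def)

lemma repr_finsum:
 assumes "finite I" "!!i. i : I ==> repr (x i) (t i)" shows "repr (finsum A x I) (finsum AA.X t I)"
 using assms
proof (induction I)
 case (insert i I)
 have c: "x : I \<rightarrow> car A" "t : I \<rightarrow> car AA.X" "x i : car A" "t i : car AA.X"
  using insert.prems by (auto simp: repr_def)
 then show ?case using repr_add[of "x i" "t i"] insert by simp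
qed (simp add: repr_zero)

lemma repr_u: "repr (u a b) (\<Oplus>\<^bsub>AA.X\<^esub>k\<in>{..<N}. bv (u a k, u k b))"
proof (cases "a < N & b < N")
 case True
 have b: "(%k. bv (u a k, u k b)) : {..<N} \<rightarrow> car AA.X"
  by (auto intro!: AA.F.basis_closed)
 interpret CM: abelian_monoid CA by (rule AA.S.C_abelian_monoid)
 have "De (u a b) = (\<Oplus>\<^bsub>CA\<^esub>k\<in>{..<N}. AA.S.\<iota> (bv (qfund G a k, qfund G k b)))"
  using True De_u[of a b] by (simp add: w_def min_tensor_def pure_tensor_def)
 also have "... = (\<Oplus>\<^bsub>CA\<^esub>k\<in>{..<N}. AA.S.\<iota> (bv (u a k, u k b)))"
  by (rule CM.finsum_cong') (use True b AA.S.iota_closed in "auto simp: w_def Pi_def")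
 also have "... = AA.S.\<iota> (\<Oplus>\<^bsub>AA.X\<^esub>k\<in>{..<N}. bv (u a k, u k b))"
  by (rule AA.S.iota_finsum[OF _ b]) simp
 finally show ?thesis using b by (auto simp: repr_def intro!: AA.F.X.finsum_closed)
next
 case False
 define t where "t = (\<Oplus>\<^bsub>AA.X\<^esub>k\<in>{..<N}. bv (u a k, u k b))"
 have b: "(%k. bv (u a k, u k b)) : {..<N} \<rightarrow> car AA.X"
  by (auto intro!: AA.F.basis_closed)
 have tc: "t : car AA.X" unfolding t_def by (rule AA.F.X.finsum_closed[OF b])
 have "min_seminorm A A t = 0"
 proof (rule AA.seminorm_zeroI[OF tc])
  fix f g assume fg: "linear_on A f" "linear_on A g"
  show "lin t (%(c, d). f c * g d) = 0"
  unfolding t_def AA.F.lin_finsum[OF finite_lessThan b]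
  using False linear_on_zero[OF star_alg_axioms] fg by (auto intro!: sum.neutral simp: u_zero)
 qed
 then have "AA.S.\<iota> t = AA.S.\<iota> \<zero>\<^bsub>AA.X\<^esub>"
  using tc by (subst AA.S.iota_eq_iff) (auto simp: a_minus_def)
 then show ?thesis using repr_zero False tc unfolding t_def[symmetric] by (auto simp: repr_def u_zero)
qed

definition tv where "tv i j = (\<Oplus>\<^bsub>BB.X\<^esub>k\<in>{..<N - 1}. bv (v i k, v k j))"

lemma tv_basis: "(%k. bv (v i k, v k j)) : K \<rightarrow> car BB.X"
 by (auto intro!: BB.F.basis_closed simp: v_in)

lemma tv_closed: "tv i j : car BB.X" "tv i j : car AA.X"
proof -
 show "tv i j : car BB.X" unfolding tv_def by (rule BB.F.X.finsum_closed[OF tv_basis])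
 then show "tv i j : car AA.X" using sub_ops(1) by blast
qed

text \<open>The two formal tensors are different but are identified by all products of linear functionals, hence have distance
zero in the minimal seminorm.\<close>

lemma repr_v: "repr (v i j) (tv i j)"
proof -
 define t where "t = (\<Oplus>\<^bsub>AA.X\<^esub>a\<in>{..<N}. \<Oplus>\<^bsub>AA.X\<^esub>b\<in>{..<N}. (V i a * V j b) \<odot>\<^bsub>AA.X\<^esub>
  (\<Oplus>\<^bsub>AA.X\<^esub>k\<in>{..<N}. bv (u a k, u k b)))"
 have 1: "repr (v i j) t"
  unfolding v_double t_def by (intro repr_finsum repr_smult repr_u finite_lessThan)
 have tc: "t : car AA.X" using 1 by (simp add: repr_def)
 have b: "(%k. bv (u a k, u k b)) : {..<N} \<rightarrow> car AA.X" for a b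
  by (auto intro!: AA.F.basis_closed)
 note b' = AA.F.X.finsum_closed[OF b]
 have c1: "(%b. (V i a * V j b) \<odot>\<^bsub>AA.X\<^esub> (\<Oplus>\<^bsub>AA.X\<^esub>k\<in>{..<N}. bv (u a k, u k b))) : {..<N} \<rightarrow> car AA.X" for a
  using b' by auto
 have c2: "(%a. \<Oplus>\<^bsub>AA.X\<^esub>b\<in>{..<N}. (V i a * V j b) \<odot>\<^bsub>AA.X\<^esub> (\<Oplus>\<^bsub>AA.X\<^esub>k\<in>{..<N}. bv (u a k, u k b)))
  : {..<N} \<rightarrow> car AA.X"
  using AA.F.X.finsum_closed[OF c1] by auto
 have "min_seminorm A A (t \<ominus>\<^bsub>AA.X\<^esub> tv i j) = 0"
 proof (rule AA.seminorm_zeroI)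
  show "t \<ominus>\<^bsub>AA.X\<^esub> tv i j : car AA.X" using tc tv_closed by simp
  fix f g assume f: "linear_on A f" and g: "linear_on A g"
  let ?h = "%(c, d). f c * g d"
  have "lin t ?h = (SUM a<N. SUM b<N. (V i a * V j b) * (SUM k<N. f (u a k) * g (u k b)))"
  unfolding t_def AA.F.lin_finsum[OF finite_lessThan c2]
  by (intro sum.cong refl)
  (simp add: AA.F.lin_finsum[OF finite_lessThan c1] AA.F.lin_X(2)[OF b' b'] AA.F.lin_finsum[OF finite_lessThan b])
  moreover have "lin (tv i j) ?h = (SUM k<N - 1. f (v i k) * g (v k j))"
  unfolding tv_def BB.F.lin_finsum[OF finite_lessThan tv_basis] by simp
  ultimately have "lin t ?h = lin (tv i j) ?h" using linear_on_v_mult[OF f g] by simp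
  moreover have "t \<ominus>\<^bsub>AA.X\<^esub> tv i j = t \<oplus>\<^bsub>AA.X\<^esub> (-1) \<odot>\<^bsub>AA.X\<^esub> tv i j"
  using tv_closed by (simp add: a_minus_def AA.F.X.smult_minus_one)
  ultimately show "lin (t \<ominus>\<^bsub>AA.X\<^esub> tv i j) ?h = 0"
  using tc tv_closed AA.F.lin_X[OF tv_closed(2) tv_closed(2)]
  by (simp add: AA.F.lin_X(1)[OF tc AA.F.X_smult_closed[OF tv_closed(2)]])
 qed
 then have "AA.S.\<iota> t = AA.S.\<iota> (tv i j)" using tc tv_closed by (subst AA.S.iota_eq_iff) auto
 then show ?thesis using 1 tv_closed by (simp add: repr_def)
qed

abbreviation T0 where "T0 == star_generated A E"

lemma T0_sub: "star_subalgebra A T0"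
 by (rule star_generated_sub[OF E_closed])

lemma repr_exists: "x : T0 ==> EX t:car BB.X. repr x t"
proof -
 let ?Q = "{x : car A. EX t:car BB.X. repr x t}"
 have "star_subalgebra A ?Q" unfolding star_subalgebra_def
 proof (intro conjI ballI allI)
  have "\<one>\<^bsub>AA.X\<^esub> : car BB.X" using BB.F.X.one_closed sub_ops(4) by simp
  then show "\<one> : ?Q" using repr_one by auto
  fix x y c assume "x : ?Q"
  then obtain t where t: "x : car A" "t : car BB.X" "repr x t" by blast
  have "c \<odot>\<^bsub>AA.X\<^esub> t : car BB.X" using BB.F.X.smult_closed[OF t(2), of c] sub_ops(6) by simp
  then show "c \<odot> x : ?Q" using repr_smult[OF t(3), of c] t by auto
  have "adj AA.X t : car BB.X" using BB.F.X.star_closed[OF t(2)] sub_ops(7)[OF t(2)] by simp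
  then show "star x : ?Q" using repr_star[OF t(3)] t by auto
  assume "y : ?Q"
  then obtain t' where t': "y : car A" "t' : car BB.X" "repr y t'" by blast
  have "t \<oplus>\<^bsub>AA.X\<^esub> t' : car BB.X" using BB.F.X.a_closed[OF t(2) t'(2)] sub_ops(3) by simp
  then show "x \<oplus> y : ?Q" using repr_add[OF t(3) t'(3)] t t' by auto
  have "t \<otimes>\<^bsub>AA.X\<^esub> t' : car BB.X" using BB.F.X.m_closed[OF t(2) t'(2)] sub_ops(2) by simp
  then show "x \<otimes> y : ?Q" using repr_mult[OF t(3) t'(3)] t t' by auto
 qed auto
 moreover have "E <= ?Q"
 proof
  fix e assume "e : E"
  then obtain i j where "i < N - 1" "j < N - 1" "e = irr_fund s G i j" unfolding E_def by blast
  then have "e = v i j" by (simp add: irr_fund_v)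
  then show "e : ?Q" using repr_v[of i j] tv_closed(1)[of i j] by (auto simp: repr_def)
 qed
 ultimately have "T0 <= ?Q" by (rule star_generated_least)
 then show "x : T0 ==> EX t:car BB.X. repr x t" by blast
qed

lemma T0_entries: "T0 <= star_generated A (entries G)"
proof (rule star_generated_least)
 have e: "entries G <= car A" using qfund_in by (auto simp: entries_def qdim_H)
 show s: "star_subalgebra A (star_generated A (entries G))" by (rule star_generated_sub[OF e])
 interpret Q: star_sub A "star_generated A (entries G)" by unfold_locales (rule s)
 have "qfund G i j : star_generated A (entries G)" if "i < N" "j < N" for i j
  using star_generated_incl[of "entries G"] that by (auto simp: entries_def qdim_H)
 then have "u i j : star_generated A (entries G)" for i j by (auto simp: w_def)
 then have "v i j : star_generated A (entries G)" for i j
  unfolding v_double by (intro Q.finsum_in Pi_I Q.subD)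
 then show "E <= star_generated A (entries G)" by (auto simp: E_def irr_fund_v)
qed

text \<open>Fullness enters here: pulling back the norm of the tensor product along the comultiplication gives a
C*-seminorm on the *-algebra generated by the entries, so it is dominated by the norm.\<close>

lemma repr_bound:
 assumes x: "x : T0" and t: "t : car BB.X" "repr x t"
 shows "min_seminorm T.B T.B t <= cnorm A x"
proof -
 have e: "entries G <= car A" using qfund_in by (auto simp: entries_def qdim_H)
 interpret Q: star_sub A "star_generated A (entries G)" by unfold_locales (rule star_generated_sub[OF e])
 have "min_seminorm T.B T.B t <= min_seminorm A A t"
  by (rule min_seminorm_subalgebra[OF T.cstar_sub_axioms t(1)])
 also have "... = cnorm CA (De x)" using t by (simp add: repr_def AA.S.cnorm_iota)
 also have "... <= cnorm A x"
  using full[OF Q.sub_seminorm[OF star_hom_pull_seminorm[OF star_alg_axioms De_hom' AA.S.C_seminorm]], of x] x T0_entries by blast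
 finally show ?thesis .
qed

lemma repr_diff_BB:
 assumes "t : car BB.X" "t' : car BB.X" shows "t \<ominus>\<^bsub>BB.X\<^esub> t' = t \<ominus>\<^bsub>AA.X\<^esub> t'"
proof -
 have "t' : car AA.X" using assms sub_ops(1) by blast
 then have "\<ominus>\<^bsub>BB.X\<^esub> t' = \<ominus>\<^bsub>AA.X\<^esub> t'"
  using assms BB.F.X.smult_minus_one[of t'] AA.F.X.smult_minus_one[of t'] sub_ops(6) by simp
 then show ?thesis by (simp add: a_minus_def sub_ops(3))
qed

lemma repr_asym_bound:
 assumes "x : T0" "y : T0" "t : car BB.X" "t' : car BB.X" "repr x t" "repr y t'"
 shows "min_seminorm T.B T.B (t \<ominus>\<^bsub>BB.X\<^esub> t') <= cnorm A (x \<ominus> y)"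
proof (rule repr_bound)
 interpret Q: star_sub A T0 by unfold_locales (rule T0_sub)
 show "x \<ominus> y : T0" using assms by simp
 show "t \<ominus>\<^bsub>BB.X\<^esub> t' : car BB.X" using assms by simp
 show "repr (x \<ominus> y) (t \<ominus>\<^bsub>BB.X\<^esub> t')" unfolding repr_diff_BB[OF assms(3,4)] by (rule repr_diff[OF assms(5,6)])
qed

definition approx where
 "approx x X t \<longleftrightarrow> (ALL n. X n : T0 & t n : car BB.X & repr (X n) (t n)) & conv X x"

lemma approx_exists: "x : T ==> EX X t. approx x X t"
proof -
 assume "x : T"
 then obtain X where X: "!!n. X n : T0" "conv X x"
  using cstar_generated_approx[OF E_closed] unfolding T_def by blast
 then have "ALL n. EX t. t : car BB.X & repr (X n) t" using repr_exists by blast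
 then obtain t where "!!n. t n : car BB.X & repr (X n) (t n)" by metis
 then show ?thesis using X unfolding approx_def by blast
qed

lemma approx_cs:
 assumes a: "approx x X t" shows "t : BB.S.cs"
proof -
 have X: "X : cs" using a cauchy_conv by (auto simp: approx_def)
 have t: "t n : car BB.X" for n using a by (auto simp: approx_def)
 show ?thesis unfolding cauchy_seqs_def
 proof safe
  fix e :: real assume e: "0 < e"
  obtain M where M: "!!m n. m >= M ==> n >= M ==> cnorm A (X m \<ominus> X n) < e" using cauchyD[OF X e] by metis
  have "min_seminorm T.B T.B (t m \<ominus>\<^bsub>BB.X\<^esub> t n) < e" if "m >= M" "n >= M" for m n
  using repr_asym_bound[of "X m" "X n" "t m" "t n"] M[OF that] a by (force simp: approx_def)
  then show "EX M. ALL m>=M. ALL n>=M. min_seminorm T.B T.B (t m \<ominus>\<^bsub>BB.X\<^esub> t n) < e" by blast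
 qed (rule t)
qed

lemma approx_unique:
 assumes a: "approx x X t" and b: "approx x Y t'" shows "BB.S.cls t = BB.S.cls t'"
proof -
 have "asym X Y" using a b asym_trans[OF _ asym_sym] unfolding approx_def by blast
 then have "BB.S.asym t t'"
 proof (intro BB.S.asymI[where f = "%n. cnorm A (X n \<ominus> Y n)"])
  fix n
  show "min_seminorm T.B T.B (t n \<ominus>\<^bsub>BB.X\<^esub> t' n) <= cnorm A (X n \<ominus> Y n)"
  using repr_asym_bound[of "X n" "Y n" "t n" "t' n"] a b by (auto simp: approx_def)
 qed (use a b in "auto simp: approx_def dest: asymD")
 then show ?thesis using BB.S.cls_eq_iff[OF approx_cs[OF a] approx_cs[OF b]] by blast
qed

definition De' where "De' x = (SOME P. EX X t. approx x X t & P = BB.S.cls t)"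

lemma De'_eq:
 assumes a: "approx x X t" shows "De' x = BB.S.cls t"
proof -
 have "EX P. EX X t. approx x X t & P = BB.S.cls t" using a by blast
 then have "EX X t. approx x X t & De' x = BB.S.cls t" unfolding De'_def by (rule someI_ex)
 then show ?thesis using approx_unique a by metis
qed

lemma approx_const: "x : T0 ==> t : car BB.X ==> repr x t ==> approx x (%_. x) (%_. t)"
 using asym_refl[of "%_. x"] by (auto simp: approx_def repr_def)

lemma De'_hom: "star_hom T.B CB De'"
 unfolding star_hom_def
proof (intro conjI ballI allI ring_hom_memI)
 interpret Q: star_sub A T0 by unfold_locales (rule T0_sub)
 fix x y c assume "x : car T.B"
 then obtain X t where a: "approx x X t" using approx_exists by (simp, blast)
 have a': "X n : T0" "t n : car BB.X" "repr (X n) (t n)" "conv X x" for n using a by (auto simp: approx_def)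
 note t = approx_cs[OF a]
 show "De' x : car CB" using De'_eq[OF a] t by simp
 have "approx (c \<odot> x) (%n. c \<odot> X n) (%n. c \<odot>\<^bsub>BB.X\<^esub> t n)"
  unfolding approx_def using a' repr_smult asym_smult[OF a'(4)] BB.F.X.smult_closed
  by (auto simp: sub_ops(6))
 then show "De' (c \<odot>\<^bsub>T.B\<^esub> x) = c \<odot>\<^bsub>CB\<^esub> De' x"
  using De'_eq a BB.S.cls_smult[OF t] by simp
 have "approx (star x) (%n. star (X n)) (%n. adj BB.X (t n))"
  unfolding approx_def using a' repr_star asym_star[OF a'(4)] BB.F.X.star_closed
  by (auto simp: sub_ops(7))
 then show "De' (adj T.B x) = adj CB (De' x)"
  using De'_eq a BB.S.cls_star[OF t] by simp
 assume "y : car T.B"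
 then obtain Y t' where b: "approx y Y t'" using approx_exists by (simp, blast)
 have b': "Y n : T0" "t' n : car BB.X" "repr (Y n) (t' n)" "conv Y y" for n using b by (auto simp: approx_def)
 note t' = approx_cs[OF b]
 have "approx (x \<otimes> y) (%n. X n \<otimes> Y n) (%n. t n \<otimes>\<^bsub>BB.X\<^esub> t' n)"
  unfolding approx_def using a' b' repr_mult conv_mult[OF a'(4) b'(4)] BB.F.X.m_closed
  by (auto simp: sub_ops(2))
 then show "De' (x \<otimes>\<^bsub>T.B\<^esub> y) = De' x \<otimes>\<^bsub>CB\<^esub> De' y"
  using De'_eq a b BB.S.cls_mult[OF t t'] by simp
 have "approx (x \<oplus> y) (%n. X n \<oplus> Y n) (%n. t n \<oplus>\<^bsub>BB.X\<^esub> t' n)"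
  unfolding approx_def using a' b' repr_add asym_add[OF a'(4) b'(4)] BB.F.X.a_closed
  by (auto simp: sub_ops(3))
 then show "De' (x \<oplus>\<^bsub>T.B\<^esub> y) = De' x \<oplus>\<^bsub>CB\<^esub> De' y"
  using De'_eq a b BB.S.cls_add[OF t t'] by simp
next
 interpret Q: star_sub A T0 by unfold_locales (rule T0_sub)
 have "\<one>\<^bsub>BB.X\<^esub> : car BB.X" by simp
 then have "approx \<one> (%_. \<one>) (%_. \<one>\<^bsub>BB.X\<^esub>)" using repr_one by (intro approx_const) (auto simp: sub_ops(4))
 then show "De' \<one>\<^bsub>T.B\<^esub> = \<one>\<^bsub>CB\<^esub>" using De'_eq BB.S.C_one by simp
qed

lemma De'_v:
 assumes "i < N - 1" "j < N - 1"
 shows "De' (irr_fund s G i j) =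
  (\<Oplus>\<^bsub>min_tensor T.B T.B\<^esub>k\<in>{..<N - 1}. pure_tensor T.B T.B (irr_fund s G i k) (irr_fund s G k j))"
proof -
 have "v i j : T0" using star_generated_incl[of E] assms irr_fund_v[OF assms] by (force simp: E_def)
 then have "De' (v i j) = BB.S.\<iota> (tv i j)" using De'_eq[OF approx_const[OF _ tv_closed(1) repr_v]] by simp
 also have "... = (\<Oplus>\<^bsub>CB\<^esub>k\<in>{..<N - 1}. BB.S.\<iota> (bv (v i k, v k j)))"
  unfolding tv_def by (rule BB.S.iota_finsum[symmetric, OF _ tv_basis]) simp
 also have "... = (\<Oplus>\<^bsub>CB\<^esub>k\<in>{..<N - 1}. BB.S.\<iota> (bv (irr_fund s G i k, irr_fund s G k j)))"
 proof -
  interpret CM: abelian_monoid CB by (rule BB.S.C_abelian_monoid)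
  show ?thesis
  by (rule CM.finsum_cong') (use assms irr_fund_v BB.S.iota_closed BB.F.basis_closed irr_fund_in in "auto simp: Pi_def")
 qed
 finally show ?thesis using assms by (simp add: irr_fund_v min_tensor_def pure_tensor_def)
qed

lemma irr_cmqg: "is_cmqg irr"
 unfolding is_cmqg_def Let_def
proof (intro conjI)
 show "is_cstar_algebra (qalg irr)" using T.sub_cstar_algebra by (simp add: irr_simps)
 show "entries irr <= car (qalg irr)" using irr_fund_in by (auto simp: entries_irr E_def irr_simps)
 show "EX De. star_hom (qalg irr) (min_tensor (qalg irr) (qalg irr)) De &
  (ALL i<qdim irr. ALL j<qdim irr. De (qfund irr i j) =
  (\<Oplus>\<^bsub>min_tensor (qalg irr) (qalg irr)\<^esub>k\<in>{..<qdim irr}. pure_tensor (qalg irr) (qalg irr) (qfund irr i k) (qfund irr k j)))"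
  unfolding irr_simps
  by (rule exI[of _ De'], intro conjI allI impI De'_v) (use De'_hom in "auto simp: min_tensor_def")
qed (use irr_generated irr_invertible in "auto simp: irr_simps(1)")

end

section \<open>The permutation group inside the irreducible part\<close>

definition perm_matrix :: "nat => (nat => nat) => nat => nat => complex" where
 "perm_matrix n \<pi> = (%i j. if i < n & j < n & i = \<pi> j then 1 else 0)"

lemma permutation_matrices_image: "permutation_matrices n = perm_matrix n ` {\<pi>. \<pi> permutes {..<n}}"
 by (auto simp: permutation_matrices_def perm_matrix_def image_def)

lemma finite_permutation_matrices: "finite (permutation_matrices n)"
 unfolding permutation_matrices_image by (intro finite_imageI finite_permutations) simp

lemma perm_matrix_eqI:
 assumes "\<pi> permutes {..<n}" "!!j. j < n ==> perm_matrix n \<rho> (\<pi> j) j ~= 0"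
 shows "perm_matrix n \<rho> = perm_matrix n \<pi>"
proof -
 have "\<pi> j = \<rho> j" if "j < n" for j using assms(2)[OF that] by (auto simp: perm_matrix_def split: if_splits)
 then show ?thesis by (auto simp: perm_matrix_def fun_eq_iff)
qed

text \<open>The functions on a finite group of permutation matrices are generated, even without closure,
 by the coordinate functions: the product of the coordinates along the graph of a permutation is
 the indicator of this permutation.\<close>

lemma sym_functions_generated:
 fixes n :: nat and S :: "((nat => nat => complex) => complex) set"
 defines "M == permutation_matrices n"
 assumes one: "(%Q. if Q : M then 1 else 0) : S"
  and add: "!!f g. f : S ==> g : S ==> (%Q. f Q + g Q) : S"
  and mult: "!!f g. f : S ==> g : S ==> (%Q. f Q * g Q) : S"
  and smult: "!!c f. f : S ==> (%Q. c * f Q) : S"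
  and coord: "!!i j. i < n ==> j < n ==> (%Q. if Q : M then Q i j else 0) : S"
  and f: "!!Q. Q ~: M ==> f Q = 0"
 shows "f : S"
proof -
 have ind: "(%Q. if Q = R then 1 else 0) : S" if R: "R : M" for R
 proof -
  obtain \<pi> where p: "\<pi> permutes {..<n}" "R = perm_matrix n \<pi>"
  using R by (auto simp: M_def permutation_matrices_image)
  have "(%Q. if Q : M then \<Prod>j<m. Q (\<pi> j) j else 0) : S" if "m <= n" for m
  using that
  proof (induction m)
  case 0
  then show ?case using one by (simp cong: if_cong)
  next
  case (Suc m)
  then have "\<pi> m < n" "m < n" using permutes_in_image[OF p(1), of m] by auto
  then have "(%Q. (if Q : M then \<Prod>j<m. Q (\<pi> j) j else 0) * (if Q : M then Q (\<pi> m) m else 0)) : S"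
  using Suc by (intro mult coord) auto
  also have "(%Q. (if Q : M then \<Prod>j<m. Q (\<pi> j) j else 0) * (if Q : M then Q (\<pi> m) m else 0)) =
  (%Q. if Q : M then \<Prod>j<Suc m. Q (\<pi> j) j else 0)" by auto
  finally show ?case .
  qed
  from this[of n] have "(%Q. if Q : M then \<Prod>j<n. Q (\<pi> j) j else 0) : S" by simp
  also have "(%Q. if Q : M then \<Prod>j<n. Q (\<pi> j) j else 0) = (%Q. if Q = R then 1 else 0)"
  proof
  fix Q
  show "(if Q : M then \<Prod>j<n. Q (\<pi> j) j else 0) = (if Q = R then 1 else 0)"
  proof (cases "Q = R")
  case True
  have "\<pi> j < n" if "j < n" for j using permutes_in_image[OF p(1), of j] that by auto
  then show ?thesis using True R by (simp add: p(2) perm_matrix_def)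
  next
  case False
  show ?thesis
  proof (cases "Q : M")
  case True
  then obtain \<rho> where "Q = perm_matrix n \<rho>" by (auto simp: M_def permutation_matrices_image)
  then have "EX j<n. Q (\<pi> j) j = 0" using perm_matrix_eqI[OF p(1), of \<rho>] False p(2) by blast
  then show ?thesis using False by auto
  qed (use False in simp)
  qed
  qed
  finally show ?thesis .
 qed
 have "(%Q. if Q : F then f Q else 0) : S" if "finite F" "F <= M" for F
  using that
 proof (induction F)
  case empty
  then show ?case using smult[OF one, of 0] by simp
 next
  case (insert R F)
  have "(%Q. f R * (if Q = R then 1 else 0) + (if Q : F then f Q else 0)) : S"
  using insert by (intro add smult ind) auto
  also have "(%Q. f R * (if Q = R then 1 else 0) + (if Q : F then f Q else 0)) =
  (%Q. if Q : insert R F then f Q else 0)" by (rule ext) (use insert.hyps in auto)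
  finally show ?case .
 qed
 from this[of M] have "(%Q. if Q : M then f Q else 0) : S"
  using finite_permutation_matrices by (simp add: M_def)
 also have "(%Q. if Q : M then f Q else 0) = f" using f by auto
 finally show ?thesis .
qed

text \<open>A permutation of the first \<open>N - 1\<close> basis vectors, extended by fixing the last one, commutes with
 the projection to the irreducible part in the following sense.\<close>

lemma V_perm_matrix:
 assumes N: "N >= 2" and s: "s : {1, -1 :: real}" and p: "\<pi> permutes {..<N - 1}"
 shows "cmm {..<N} (cmm {..<N} (Vm N s) (perm_matrix N \<pi>)) (Vt N s) = perm_matrix (N - 1) \<pi>"
proof -
 have "cmm {..<N} (Vm N s) (perm_matrix N \<pi>) = cmm {..<N - 1} (perm_matrix (N - 1) \<pi>) (Vm N s)"
 proof (intro ext)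
  fix i b
  have lt: "\<pi> b < N" if "b < N" using permutes_in_image[OF permutes_subset[OF p, of "{..<N}"], of b] that by auto
  have lt1: "\<pi> b < N - 1 \<longleftrightarrow> b < N - 1" for b using permutes_in_image[OF p, of b] by auto
  have "cmm {..<N} (Vm N s) (perm_matrix N \<pi>) i b = (SUM a<N. if a = \<pi> b then (if b < N then Vm N s i a else 0) else 0)"
  unfolding cmm_def by (intro sum.cong) (auto simp: perm_matrix_def)
  also have "... = (if b < N then Vm N s i (\<pi> b) else 0)" using lt by auto
  finally have L: "cmm {..<N} (Vm N s) (perm_matrix N \<pi>) i b = (if b < N then Vm N s i (\<pi> b) else 0)" .
  have iff: "i = \<pi> k \<longleftrightarrow> k = Hilbert_Choice.inv \<pi> i" for k using permutes_inverses[OF p] by metis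
  have "cmm {..<N - 1} (perm_matrix (N - 1) \<pi>) (Vm N s) i b =
  (SUM k<N - 1. if k = Hilbert_Choice.inv \<pi> i then (if i < N - 1 then Vm N s k b else 0) else 0)"
  unfolding cmm_def by (intro sum.cong) (auto simp: perm_matrix_def iff)
  also have "... = (if i < N - 1 then Vm N s (Hilbert_Choice.inv \<pi> i) b else 0)"
  using permutes_in_image[OF permutes_inv[OF p], of i] by auto
  finally have R: "cmm {..<N - 1} (perm_matrix (N - 1) \<pi>) (Vm N s) i b = (if i < N - 1 then Vm N s (Hilbert_Choice.inv \<pi> i) b else 0)" .
  have "Vm N s i (\<pi> b) = Vm N s (Hilbert_Choice.inv \<pi> i) b" if b: "b < N" and i: "i < N - 1"
  proof -
  have i': "Hilbert_Choice.inv \<pi> i < N - 1" using permutes_in_image[OF permutes_inv[OF p], of i] i by auto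
  show ?thesis
  using iff[of b] lt[OF b] lt1[of b] b i i' by (auto simp: Vm_def U_matrix_def)
  qed
  then show "cmm {..<N} (Vm N s) (perm_matrix N \<pi>) i b = cmm {..<N - 1} (perm_matrix (N - 1) \<pi>) (Vm N s) i b"
  unfolding L R by (auto simp: Vm_def)
 qed
 then have "cmm {..<N} (cmm {..<N} (Vm N s) (perm_matrix N \<pi>)) (Vt N s) =
  cmm {..<N - 1} (perm_matrix (N - 1) \<pi>) (cid {..<N - 1})"
  by (simp only: cmm_assoc V_Vt[OF N s])
 also have "... = perm_matrix (N - 1) \<pi>" by (rule cmm_cid_right) (auto simp: perm_matrix_def split: if_splits)
 finally show ?thesis .
qed

text \<open>Restriction of functions to the permutation matrices that fix the last basis vector.\<close>

lemma (in irr_setting) sym_sub_irr: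
 assumes "qsubgroup (sym_qgroup N) G"
 shows "qsubgroup (sym_qgroup (N - 1)) irr"
proof -
 let ?M = "permutation_matrices (N - 1)"
 obtain ph where h: "star_hom A (qalg (sym_qgroup N)) ph"
  and gen: "!!i j. i < N ==> j < N ==> ph (qfund G i j) = qfund (sym_qgroup N) i j"
  using assms unfolding qsubgroup_def qdim_H qalg_G by blast
 define ex :: "(nat => nat => complex) => nat => nat => complex"
  where "ex Q = (%i j. if i = N - 1 & j = N - 1 then 1 else Q i j)" for Q
 have ex_perm: "ex (perm_matrix (N - 1) \<pi>) = perm_matrix N \<pi>" if p: "\<pi> permutes {..<N - 1}" for \<pi>
 proof (intro ext)
  fix i j
  have "\<pi> (N - 1) = N - 1" using permutes_not_in[OF p, of "N - 1"] by simp
  moreover have "\<pi> j < N - 1 \<longleftrightarrow> j < N - 1" using permutes_in_image[OF p, of j] by auto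
  ultimately show "ex (perm_matrix (N - 1) \<pi>) i j = perm_matrix N \<pi> i j"
  using N by (cases "j = N - 1"; cases "i = N - 1") (auto simp: ex_def perm_matrix_def)
 qed
 have ex_in: "ex Q : permutation_matrices N" if Q: "Q : ?M" for Q
 proof -
  obtain \<pi> where p: "\<pi> permutes {..<N - 1}" "Q = perm_matrix (N - 1) \<pi>"
  using Q by (auto simp: permutation_matrices_image)
  then show ?thesis using permutes_subset[OF p(1), of "{..<N}"] ex_perm[OF p(1)]
  by (auto simp: permutation_matrices_image)
 qed
 have ops0: "ph (x \<oplus> y) R = ph x R + ph y R" "ph (x \<otimes> y) R = ph x R * ph y R"
  "ph (z \<odot> x) R = z * ph x R" "ph (star x) R = cnj (ph x R)" if "x : car A" "y : car A" for x y z R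
  using h that by (auto simp: star_hom_def ring_hom_def sym_qgroup_def)
 note ops = ops0(1,2) ops0(3,4)[OF _ zero_closed]
 have one: "ph \<one> R = (if R : permutation_matrices N then 1 else 0)" for R
  using h by (auto simp: star_hom_def ring_hom_def sym_qgroup_def)
 define \<Psi> where "\<Psi> x = (%Q. if Q : ?M then ph x (ex Q) else 0)" for x
 have u_val: "ph (u a b) (perm_matrix N \<pi>) = perm_matrix N \<pi> a b" if p: "\<pi> permutes {..<N}" for a b \<pi>
 proof (cases "a < N & b < N")
  case True
  then show ?thesis using gen[of a b] p by (auto simp: w_def sym_qgroup_def permutation_matrices_image)
 next
  case False
  have "ph \<zero> R = 0" for R using ops(3)[of \<zero> 0 R] by simp
  then show ?thesis using False by (auto simp: u_zero perm_matrix_def)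
 qed
 have v_val: "\<Psi> (v i j) Q = Q i j" if Q: "Q : ?M" for Q i j
 proof -
  obtain \<pi> where p: "\<pi> permutes {..<N - 1}" "Q = perm_matrix (N - 1) \<pi>"
  using Q by (auto simp: permutation_matrices_image)
  have pN: "\<pi> permutes {..<N}" by (rule permutes_subset[OF p(1)]) auto
  have lin: "linear_on A (%x. ph x (perm_matrix N \<pi>))" by (auto simp: linear_on_def ops)
  have "\<Psi> (v i j) Q = ph (v i j) (perm_matrix N \<pi>)" using Q p by (simp add: \<Psi>_def ex_perm)
  also have "... = cmm {..<N} (cmm {..<N} V (%a b. perm_matrix N \<pi> a b)) V' i j"
  using linear_on_v[OF lin] by (simp add: u_val[OF pN])
  also have "... = Q i j" using V_perm_matrix[OF N s p(1)] p(2) by simp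
  finally show ?thesis .
 qed
 have hom: "star_hom (qalg irr) (qalg (sym_qgroup (N - 1))) \<Psi>"
  unfolding star_hom_def ring_hom_def irr_simps
  using one ex_in by (auto simp: \<Psi>_def sym_qgroup_def ops fun_eq_iff)
 have coord: "\<Psi> (irr_fund s G i j) = qfund (sym_qgroup (N - 1)) i j" if "i < N - 1" "j < N - 1" for i j
  using that v_val by (auto simp: irr_fund_v sym_qgroup_def \<Psi>_def fun_eq_iff)
 have onto: "\<Psi> ` car (qalg irr) = car (qalg (sym_qgroup (N - 1)))"
 proof
  show "\<Psi> ` car (qalg irr) <= car (qalg (sym_qgroup (N - 1)))"
  by (auto simp: \<Psi>_def sym_qgroup_def)
  show "car (qalg (sym_qgroup (N - 1))) <= \<Psi> ` car (qalg irr)"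
  proof
  fix f assume f: "f : car (qalg (sym_qgroup (N - 1)))"
  have "f : \<Psi> ` T"
  proof (rule sym_functions_generated[of "N - 1"])
  show "(%Q. if Q : ?M then 1 else 0) : \<Psi> ` T"
  by (rule image_eqI[of _ _ \<one>]) (auto simp: \<Psi>_def one ex_in)
  fix i j assume ij: "i < N - 1" "j < N - 1"
  show "(%Q. if Q : ?M then Q i j else 0) : \<Psi> ` T"
  by (rule image_eqI[OF _ irr_fund_in[OF ij]]) (use coord[OF ij] in "simp add: sym_qgroup_def")
  next
  fix g c assume "g : \<Psi> ` T"
  then obtain x where x: "x : T" "g = \<Psi> x" by blast
  show "(%Q. c * g Q) : \<Psi> ` T"
  by (rule image_eqI[of _ _ "c \<odot> x"]) (use x in "auto simp: \<Psi>_def ops")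
  fix h assume "h : \<Psi> ` T"
  then obtain y where y: "y : T" "h = \<Psi> y" by blast
  show "(%Q. g Q + h Q) : \<Psi> ` T"
  by (rule image_eqI[of _ _ "x \<oplus> y"]) (use x y in "auto simp: \<Psi>_def ops")
  show "(%Q. g Q * h Q) : \<Psi> ` T"
  by (rule image_eqI[of _ _ "x \<otimes> y"]) (use x y in "auto simp: \<Psi>_def ops")
  qed (use f in "auto simp: sym_qgroup_def")
  then show "f : \<Psi> ` car (qalg irr)" by (simp add: irr_simps)
  qed
 qed
 show ?thesis
  unfolding qsubgroup_def
  using hom onto coord by (intro conjI exI[of _ \<Psi>]) (auto simp: irr_simps sym_qgroup_def)
qed

section \<open>Labellings of partitions\<close>

definition pdelta :: "'x set set => ('x => nat) => complex" where
 "pdelta p my = (if ALL B:p. ALL x:B. ALL y:B. my x = my y then 1 else 0)"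

lemma ptn_delta_pdelta: "ptn_delta p i j = pdelta p (label i j)"
 by (simp add: ptn_delta_def pdelta_def)

lemma pdelta_cong:
 assumes "!!x. x : \<Union>p ==> my x = nu x" shows "pdelta p my = pdelta p nu"
proof -
 have "(ALL B:p. ALL x:B. ALL y:B. my x = my y) \<longleftrightarrow> (ALL B:p. ALL x:B. ALL y:B. nu x = nu y)"
  using assms by (intro ball_cong refl) (metis UnionI)
 then show ?thesis by (simp only: pdelta_def)
qed

lemma if_times: "(if P then 1 else 0) * g = (if P then g else 0 :: complex)"
 by simp

lemma pdelta_mult: "pdelta p my * g = (if ALL B:p. ALL x:B. ALL y:B. my x = my y then g else 0)"
 unfolding pdelta_def by (rule if_times)

lemma pdelta_Un: "pdelta (p Un q) my = pdelta p my * pdelta q my"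
 by (auto simp: pdelta_def)

lemma pdelta_UN: "finite p ==> pdelta (\<Union>B\<in>p. f B) my = (\<Prod>B\<in>p. pdelta (f B) my)"
 by (induction p rule: finite_induct) (auto simp: pdelta_Un, auto simp: pdelta_def)

lemma pdelta_image: "pdelta ((`) h ` p) my = pdelta p (my \<circ> h)"
 by (auto simp: pdelta_def)

definition blk :: "'x set set => 'x => 'x set" where
 "blk p x = (THE B. B : p & x : B)"

lemma partition_blockD:
 assumes "partition_on X p" "B : p" shows "B ~= {}" "B <= X" "x : B ==> blk p x = B"
proof -
 show "B ~= {}" "B <= X" using assms by (auto simp: partition_on_def)
 show "blk p x = B" if "x : B"
  unfolding blk_def
 proof (rule the_equality)
  show "C = B" if "C : p & x : C" for C
  using assms \<open>x : B\<close> that by (auto simp: partition_on_def disjoint_def)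
 qed (use assms that in simp)
qed

lemma partition_blk:
 assumes "partition_on X p" "x : X" shows "blk p x : p" "x : blk p x"
proof -
 obtain B where "B : p" "x : B" using assms by (auto simp: partition_on_def)
 then show "blk p x : p" "x : blk p x" using partition_blockD(3)[OF assms(1)] by auto
qed

lemma sum_block_constant:
 assumes p: "partition_on X p" and X: "finite X" and Z: "finite Z"
 shows "(SUM my:X \<rightarrow>\<^sub>E Z. pdelta p my * G my) = (SUM F:p \<rightarrow>\<^sub>E Z. G (\<lambda>x\<in>X. F (blk p x)))"
proof -
 let ?S = "{my : X \<rightarrow>\<^sub>E Z. ALL B:p. ALL x:B. ALL y:B. my x = my y}"
 note blk = partition_blk[OF p] and bD = partition_blockD[OF p]
 have fin: "finite (X \<rightarrow>\<^sub>E Z)" using X Z by (intro finite_PiE) auto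
 have some: "(SOME x. x : B) : B" if "B : p" for B using bD(1)[OF that] by (simp add: some_in_eq)
 have "(SUM my:X \<rightarrow>\<^sub>E Z. pdelta p my * G my) = (SUM my:?S. G my)"
  unfolding sum.inter_filter[OF fin] pdelta_mult ..
 also have "... = (SUM F:p \<rightarrow>\<^sub>E Z. G (\<lambda>x\<in>X. F (blk p x)))"
 proof (rule sum.reindex_bij_witness[where i = "%F. \<lambda>x\<in>X. F (blk p x)" and j = "%my. \<lambda>B\<in>p. my (SOME x. x : B)"])
  fix my assume m: "my : ?S"
  have mP: "my : X \<rightarrow>\<^sub>E Z" using m by blast
  show *: "(\<lambda>x\<in>X. (\<lambda>B\<in>p. my (SOME x. x : B)) (blk p x)) = my"
  proof
  fix x
  show "(\<lambda>x\<in>X. (\<lambda>B\<in>p. my (SOME x. x : B)) (blk p x)) x = my x"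
  proof (cases "x : X")
  case True
  have "my (SOME y. y : blk p x) = my x"
  using m blk[OF True] some[OF blk(1)[OF True]] by blast
  then show ?thesis using True blk by simp
  next
  case False
  then show ?thesis using PiE_arb[OF mP False] by simp
  qed
  qed
  show "(\<lambda>B\<in>p. my (SOME x. x : B)) : p \<rightarrow>\<^sub>E Z"
  using mP some bD(2) by (auto simp: PiE_iff)
  show "G (\<lambda>x\<in>X. (\<lambda>B\<in>p. my (SOME x. x : B)) (blk p x)) = G my" unfolding * ..
 next
  fix F assume F: "F : p \<rightarrow>\<^sub>E Z"
  show "(\<lambda>B\<in>p. (\<lambda>x\<in>X. F (blk p x)) (SOME x. x : B)) = F"
  proof
  fix B
  show "(\<lambda>B\<in>p. (\<lambda>x\<in>X. F (blk p x)) (SOME x. x : B)) B = F B"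
  proof (cases "B : p")
  case True
  then have "(SOME x. x : B) : X" "blk p (SOME x. x : B) = B" using some[OF True] bD(2,3)[OF True] by auto
  then show ?thesis using True by simp
  next
  case False
  then show ?thesis using PiE_arb[OF F False] by simp
  qed
  qed
  have "(\<lambda>x\<in>X. F (blk p x)) x = (\<lambda>x\<in>X. F (blk p x)) y" if "B : p" "x : B" "y : B" for B x y
  proof -
  have "x : X" "y : X" using bD(2)[OF that(1)] that by auto
  then show ?thesis using bD(3)[OF that(1)] that by simp
  qed
  moreover have "(\<lambda>x\<in>X. F (blk p x)) : X \<rightarrow>\<^sub>E Z"
  by (simp add: restrict_PiE_iff PiE_mem[OF F blk(1)])
  ultimately show "(\<lambda>x\<in>X. F (blk p x)) : ?S" by blast
 qed
 finally show ?thesis .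
qed

text \<open>Summing a product weight over all labellings that are constant on the blocks factorises over
 the blocks.\<close>

lemma block_sum:
 assumes p: "partition_on X p" and X: "finite X" and Z: "finite Z"
 shows "(SUM my:X \<rightarrow>\<^sub>E Z. pdelta p my * (\<Prod>x\<in>X. h x (my x))) = (\<Prod>B\<in>p. SUM c:Z. \<Prod>x\<in>B. h x c :: complex)"
proof -
 have "(SUM my:X \<rightarrow>\<^sub>E Z. pdelta p my * (\<Prod>x\<in>X. h x (my x))) = (SUM F:p \<rightarrow>\<^sub>E Z. \<Prod>x\<in>X. h x (F (blk p x)))"
  unfolding sum_block_constant[OF assms] by (intro sum.cong prod.cong refl) simp
 also have "... = (SUM F:p \<rightarrow>\<^sub>E Z. \<Prod>B\<in>p. \<Prod>x\<in>B. h x (F B))"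
  unfolding prod.partition[OF X p] using partition_blockD(3)[OF p] by (intro sum.cong prod.cong refl) simp
 also have "... = (\<Prod>B\<in>p. SUM c:Z. \<Prod>x\<in>B. h x c)"
  using prod_sum_PiE[of p "%_. Z" "%B c. \<Prod>x\<in>B. h x c"] finite_elements[OF X p] Z by simp
 finally show ?thesis .
qed

subsection \<open>Multi-indices as labellings of the points\<close>

lemma finite_points [simp]: "finite (points k l)"
 by (simp add: points_def)

lemma finite_partitions [simp]: "finite (partitions k l)"
 unfolding partitions_def by (rule finitely_many_partition_on) simp

lemma partitionsD:
 assumes "p : partitions k l" shows "partition_on (points k l) p" "finite p" "\<Union>p = points k l"
 using assms finite_elements[of "points k l" p] partition_onD1[of "points k l" p] by (auto simp: partitions_def)

lemma label_lt:
 assumes "i : mi n k" "j : mi n l" "x : points k l"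
 shows "label i j x < n"
 using assms by (auto simp: multi_indices_def points_def label_def) (meson lessThan_iff nth_mem subsetD)+

lemma sum_labels:
 "(SUM j:mi n l. SUM i:mi n k. G (\<lambda>x\<in>points k l. label i j x)) =
  (SUM my:points k l \<rightarrow>\<^sub>E {..<n}. G my :: complex)"
proof -
 have "(SUM j:mi n l. SUM i:mi n k. G (\<lambda>x\<in>points k l. label i j x)) =
  (SUM z:mi n l \<times> mi n k. G (\<lambda>x\<in>points k l. label (snd z) (fst z) x))"
  by (simp add: sum.cartesian_product split_beta)
 also have "... = (SUM my:points k l \<rightarrow>\<^sub>E {..<n}. G my)"
 proof (rule sum.reindex_bij_witness[where j = "%z. \<lambda>x\<in>points k l. label (snd z) (fst z) x"
  and i = "%my. (map (%t. my (1, t)) [0..<l], map (%t. my (0, t)) [0..<k])"])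
  fix z assume z: "z : mi n l \<times> mi n k"
  show "(map (%t. (\<lambda>x\<in>points k l. label (snd z) (fst z) x) (1, t)) [0..<l],
  map (%t. (\<lambda>x\<in>points k l. label (snd z) (fst z) x) (0, t)) [0..<k]) = z"
  proof (rule prod_eqI)
  show "fst (map (%t. (\<lambda>x\<in>points k l. label (snd z) (fst z) x) (1, t)) [0..<l],
  map (%t. (\<lambda>x\<in>points k l. label (snd z) (fst z) x) (0, t)) [0..<k]) = fst z"
  unfolding fst_conv by (rule nth_equalityI) (use z in "auto simp: points_def label_def multi_indices_def")
  show "snd (map (%t. (\<lambda>x\<in>points k l. label (snd z) (fst z) x) (1, t)) [0..<l],
  map (%t. (\<lambda>x\<in>points k l. label (snd z) (fst z) x) (0, t)) [0..<k]) = snd z"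
  unfolding snd_conv by (rule nth_equalityI) (use z in "auto simp: points_def label_def multi_indices_def")
  qed
  show "(\<lambda>x\<in>points k l. label (snd z) (fst z) x) : points k l \<rightarrow>\<^sub>E {..<n}"
  using z label_lt[of "snd z" n k "fst z" l] by auto
 next
  fix my assume m: "my : points k l \<rightarrow>\<^sub>E {..<n}"
  show "(\<lambda>x\<in>points k l. label (snd (map (%t. my (1, t)) [0..<l], map (%t. my (0, t)) [0..<k]))
  (fst (map (%t. my (1, t)) [0..<l], map (%t. my (0, t)) [0..<k])) x) = my"
  proof
  fix x
  show "(\<lambda>x\<in>points k l. label (snd (map (%t. my (1, t)) [0..<l], map (%t. my (0, t)) [0..<k]))
  (fst (map (%t. my (1, t)) [0..<l], map (%t. my (0, t)) [0..<k])) x) x = my x"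
  proof (cases "x : points k l")
  case True
  then show ?thesis by (auto simp: points_def label_def)
  next
  case False
  then show ?thesis using PiE_arb[OF m False] by simp
  qed
  qed
  show "(map (%t. my (1, t)) [0..<l], map (%t. my (0, t)) [0..<k]) : mi n l \<times> mi n k"
  proof -
  have "my (1, t) < n" if "t < l" for t using PiE_mem[OF m, of "(1, t)"] that by (simp add: points_def)
  moreover have "my (0, t) < n" if "t < k" for t using PiE_mem[OF m, of "(0, t)"] that by (simp add: points_def)
  ultimately show ?thesis by (auto simp: multi_indices_def)
  qed
 qed simp
 finally show ?thesis .
qed

lemma prod_points: "(\<Prod>x\<in>points k l. h x) = (\<Prod>t<k. h (0, t)) * (\<Prod>t<l. h (1, t) :: complex)"
proof -
 have r: "{r} \<times> {..<m} = Pair r ` {..<m}" for r m :: nat by auto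
 have "(\<Prod>x\<in>points k l. h x) = (\<Prod>x\<in>Pair 0 ` {..<k}. h x) * (\<Prod>x\<in>Pair 1 ` {..<l}. h x)"
  unfolding points_def r by (rule prod.union_disjoint) auto
 then show ?thesis by (simp add: prod.reindex inj_on_def)
qed

lemma ctp_prod: "length is = length js ==> ctp M is js = (\<Prod>t<length is. M (is ! t) (js ! t))"
 by (induction "is" js rule: list_induct2) (simp_all add: prod.lessThan_Suc_shift del: prod.lessThan_Suc)

lemma ptn_map_eq:
 "j : mi n l ==> i : mi n k ==>
  ptn_map n k l f j i = (SUM p:partitions k l. f p * pdelta p (label i j))"
 by (simp add: ptn_map_def ptn_delta_pdelta)

lemma ptn_map_eqI:
 assumes "!!i j. j : mi n l ==> i : mi n k ==> ptn_map n k l f j i = T j i"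
  "!!i j. j ~: mi n l | i ~: mi n k ==> T j i = 0"
 shows "ptn_map n k l f = T"
proof (intro ext)
 fix j i
 show "ptn_map n k l f j i = T j i"
  using assms[of j i] assms(2)[of j i] by (cases "j : mi n l & i : mi n k") (auto simp: ptn_map_def)
qed

text \<open>Conjugating the map of a partition by tensor powers of a matrix gives a product over the blocks.\<close>

lemma conj_ptn_map:
 assumes i: "i : mi n k" and j: "j : mi n l"
 shows "cmm (mi N k) (cmm (mi N l) (ctpk W l) (ptn_map N k l f)) (ctpk (%a b. W b a) k) j i =
  (SUM p:partitions k l. f p * (\<Prod>B\<in>p. SUM c<N. \<Prod>x\<in>B. W (label i j x) c))"
proof -
 have len: "length i = k" "length j = l" using i j by (auto simp: multi_indices_def)
 have wt: "ctpk W l j b * ctpk (%a b. W b a) k a i = (\<Prod>x\<in>points k l. W (label i j x) ((\<lambda>x\<in>points k l. label a b x) x))"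
  if "a : mi N k" "b : mi N l" for a b
 proof -
  have "length a = k" "length b = l" using that by (auto simp: multi_indices_def)
  then have "ctpk W l j b = (\<Prod>t<l. W (j ! t) (b ! t))" "ctpk (%a b. W b a) k a i = (\<Prod>t<k. W (i ! t) (a ! t))"
  using len by (simp_all add: ctpk_def ctp_prod)
  moreover have "(\<Prod>x\<in>points k l. W (label i j x) ((\<lambda>x\<in>points k l. label a b x) x)) =
  (\<Prod>t<k. W (i ! t) (a ! t)) * (\<Prod>t<l. W (j ! t) (b ! t))"
  unfolding prod_points by (intro arg_cong2[of _ _ _ _ "(*)"] prod.cong refl) (auto simp: points_def label_def)
  ultimately show ?thesis by simp
 qed
 have "cmm (mi N k) (cmm (mi N l) (ctpk W l) (ptn_map N k l f)) (ctpk (%a b. W b a) k) j i =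
  (SUM b:mi N l. SUM a:mi N k. (ctpk W l j b * ctpk (%a b. W b a) k a i) * ptn_map N k l f b a)"
  unfolding cmm_def sum_distrib_right by (subst sum.swap) (simp add: algebra_simps)
 also have "... = (SUM b:mi N l. SUM a:mi N k. SUM p:partitions k l.
  f p * (pdelta p (\<lambda>x\<in>points k l. label a b x) * (\<Prod>x\<in>points k l. W (label i j x) ((\<lambda>x\<in>points k l. label a b x) x))))"
 proof (intro sum.cong refl)
  fix a b assume ab: "b : mi N l" "a : mi N k"
  have "pdelta p (label a b) = pdelta p (\<lambda>x\<in>points k l. label a b x)" if "p : partitions k l" for p
  by (rule pdelta_cong) (use partitionsD(3)[OF that] in auto)
  then show "(ctpk W l j b * ctpk (%a b. W b a) k a i) * ptn_map N k l f b a = (SUM p:partitions k l.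
  f p * (pdelta p (\<lambda>x\<in>points k l. label a b x) * (\<Prod>x\<in>points k l. W (label i j x) ((\<lambda>x\<in>points k l. label a b x) x))))"
  unfolding wt[OF ab(2,1)] ptn_map_eq[OF ab] sum_distrib_left by (intro sum.cong refl) (simp add: algebra_simps)
 qed
 also have "... = (SUM p:partitions k l. SUM b:mi N l. SUM a:mi N k.
  f p * (pdelta p (\<lambda>x\<in>points k l. label a b x) * (\<Prod>x\<in>points k l. W (label i j x) ((\<lambda>x\<in>points k l. label a b x) x))))"
  unfolding sum.swap[of _ "partitions k l" "mi N k"] sum.swap[of _ "partitions k l" "mi N l"] ..
 also have "... = (SUM p:partitions k l. f p * (\<Prod>B\<in>p. SUM c<N. \<Prod>x\<in>B. W (label i j x) c))"
 proof (intro sum.cong refl)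
  fix p assume p: "p : partitions k l"
  show "(SUM b:mi N l. SUM a:mi N k.
  f p * (pdelta p (\<lambda>x\<in>points k l. label a b x) * (\<Prod>x\<in>points k l. W (label i j x) ((\<lambda>x\<in>points k l. label a b x) x)))) =
  f p * (\<Prod>B\<in>p. SUM c<N. \<Prod>x\<in>B. W (label i j x) c)"
  by (rule trans[OF sum_labels[where G = "%my. f p * (pdelta p my * (\<Prod>x\<in>points k l. W (label i j x) (my x)))"]])
  (use block_sum[OF partitionsD(1)[OF p], of "{..<N}" "%x c. W (label i j x) c"] in
  \<open>simp add: sum_distrib_left[symmetric]\<close>)
 qed
 finally show ?thesis .
qed

section \<open>The map on partitions with a complex parameter\<close>

definition al :: "complex => complex" where "al x = - 1 / (x * (x - 1))"

definition Vb :: "complex => point set => lin_ptn" where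
 "Vb x B = (%Q. (SUM I | I \<subset> B. al x ^ card I * bv (insert (B - I) (singletons I)) Q)
  + (al x ^ card B * (x\<^sup>2 - 1) + (1 / x) ^ card B) * bv (singletons B) Q)"

definition Vp :: "complex => ptn => lin_ptn" where
 "Vp x p = (%r. SUM f:(\<Pi>\<^sub>E B\<in>p. {Q. partition_on B Q}).
  (\<Prod>B\<in>p. Vb x B (f B)) * bv (\<Union>B\<in>p. f B) r)"

definition Vl :: "complex => nat => nat => lin_ptn => lin_ptn" where
 "Vl x k l f = (%r. SUM p:partitions k l. f p * Vp x p r)"

definition xpar :: "nat => real => complex" where "xpar N s = of_real (s * sqrt (real N))"

context
 fixes N :: nat and s :: real
 assumes N: "N >= 2" and s: "s : {1, -1}"
begin

lemma xpar_square: "(xpar N s)\<^sup>2 = of_nat N"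
proof -
 have "(s * sqrt (real N))\<^sup>2 = real N" using s by (auto simp: power_mult_distrib)
 then have "complex_of_real ((s * sqrt (real N))\<^sup>2) = complex_of_real (real N)" by (rule arg_cong)
 then show ?thesis by (simp add: xpar_def)
qed

lemma xpar_neq: "xpar N s ~= 0" "xpar N s ~= 1"
 using xpar_square N by auto

lemma xpar_beta: "of_real (s / sqrt (real N)) = 1 / xpar N s"
proof -
 have "s / sqrt (real N) = 1 / (s * sqrt (real N))" using s by auto
 then show ?thesis unfolding xpar_def by simp
qed

lemma xpar_alpha: "of_real (- 1 / (real N - 1) * (1 + s / sqrt (real N))) = al (xpar N s)"
proof -
 define x where "x = xpar N s"
 have "x + 1 ~= 0"
 proof
  assume "x + 1 = 0"
  then have "x = - 1" by (simp add: add_eq_0_iff2)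
  then show False using xpar_square N by (simp add: x_def[symmetric])
 qed
 then have x: "x ~= 0" "x - 1 ~= 0" "x + 1 ~= 0" using xpar_neq by (auto simp: x_def)
 have n: "complex_of_real (real N - 1) = (x - 1) * (x + 1)"
  using xpar_square by (simp add: x_def power2_eq_square algebra_simps)
 have "complex_of_real (- 1 / (real N - 1) * (1 + s / sqrt (real N))) = - 1 / ((x - 1) * (x + 1)) * (1 + 1 / x)"
  using n xpar_beta by (simp add: x_def)
 also have "... = al x" using x by (simp add: al_def divide_simps)
 finally show ?thesis by (simp add: x_def)
qed

text \<open>The level sums are resolved into a sum over proper subsets; the top level only contributes to the singletons.\<close>

lemma V_block_Vb: assumes "finite B" shows "V_block N s B = Vb (xpar N s) B"
proof
 fix Q
 let ?a = "al (xpar N s)"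
 have "(SUM i=0..card B. ?a ^ i * block_level N B i Q) =
  (SUM i<card B. ?a ^ i * block_level N B i Q) + ?a ^ card B * block_level N B (card B) Q"
  by (simp add: atLeast0AtMost lessThan_Suc_atMost[symmetric])
 also have "(SUM i<card B. ?a ^ i * block_level N B i Q) =
  (SUM i<card B. SUM I | I : {I. I \<subset> B} & card I = i. ?a ^ card I * bv (insert (B - I) (singletons I)) Q)"
 proof (intro sum.cong refl)
  fix i assume i: "i : {..<card B}"
  have "{I. I <= B & card I = i} = {I. I : {I. I \<subset> B} & card I = i}" using i by auto
  then show "?a ^ i * block_level N B i Q =
  (SUM I | I : {I. I \<subset> B} & card I = i. ?a ^ card I * bv (insert (B - I) (singletons I)) Q)"
  using i by (simp add: block_level_def sum_distrib_left)
 qed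
 also have "... = (SUM I | I \<subset> B. ?a ^ card I * bv (insert (B - I) (singletons I)) Q)"
 proof (rule sum.group)
  show "finite {I. I \<subset> B}" by (rule finite_subset[of _ "Pow B"]) (use assms in auto)
  show "card ` {I. I \<subset> B} <= {..<card B}" using psubset_card_mono[OF assms] by auto
 qed simp
 finally have "(SUM i=0..card B. ?a ^ i * block_level N B i Q) =
  (SUM I | I \<subset> B. ?a ^ card I * bv (insert (B - I) (singletons I)) Q) +
  ?a ^ card B * ((of_nat N - 1) * bv (singletons B) Q)" by (simp add: block_level_def)
 then show "V_block N s B Q = Vb (xpar N s) B Q"
  unfolding V_block_def Vb_def xpar_alpha xpar_beta by (simp add: xpar_square algebra_simps)
qed

lemma V_ptn_Vp: "p : partitions k l ==> V_ptn N s p = Vp (xpar N s) p"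
proof -
 assume p: "p : partitions k l"
 have "V_block N s B = Vb (xpar N s) B" if "B : p" for B
  using partition_blockD(2)[OF partitionsD(1)[OF p] that] finite_subset[OF _ finite_points] by (intro V_block_Vb) auto
 then show ?thesis unfolding V_ptn_def Vp_def by (intro ext sum.cong arg_cong2[of _ _ _ _ "(*)"] prod.cong refl) simp
qed

lemma V_lin_Vl: "V_lin N s k l f = Vl (xpar N s) k l f"
 unfolding V_lin_def Vl_def by (intro ext sum.cong refl) (simp add: V_ptn_Vp)

end

lemma partition_refine_block:
 "I \<subset> B ==> partition_on B (insert (B - I) (singletons I))"
 by (auto simp: partition_on_def disjoint_def singletons_def)

lemma partition_singletons: "partition_on B (singletons B)"
 unfolding singletons_def by (rule partition_on_singletons)

lemma partition_UN:
 assumes p: "partition_on X p" and f: "!!B. B : p ==> partition_on B (f B)"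
 shows "partition_on X (\<Union>B\<in>p. f B)"
proof (rule partition_onI)
 have "\<Union> (\<Union>B\<in>p. f B) = (\<Union>B\<in>p. \<Union> (f B))" by blast
 also have "... = (\<Union>B\<in>p. B)" by (intro SUP_cong refl) (rule partition_onD1[OF f, symmetric])
 also have "... = X" using partition_onD1[OF p] by simp
 finally show "\<Union> (\<Union>B\<in>p. f B) = X" .
 show "{} ~: (\<Union>B\<in>p. f B)" using partition_onD3[OF f] by auto
 fix C D assume "C : (\<Union>B\<in>p. f B)" "D : (\<Union>B\<in>p. f B)" "C ~= D"
 then obtain B B' where b: "B : p" "B' : p" "C : f B" "D : f B'" by blast
 show "disjnt C D"
 proof (cases "B = B'")
  case True
  then show ?thesis using f[OF b(1)] b \<open>C ~= D\<close> by (auto simp: partition_on_def pairwise_def)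
 next
  case False
  then have "disjnt B B'" using p b by (auto simp: partition_on_def pairwise_def)
  moreover have "C <= B" "D <= B'" using partition_blockD(2)[OF f] b by auto
  ultimately show ?thesis by (auto simp: disjnt_def)
 qed
qed

lemma sum_basis_vec: "finite S ==> r : S ==> (SUM q:S. bv r q * h q) = h r"
 by (simp add: basis_vec_def if_distrib[of "%z. z * _"] cong: if_cong)

text \<open>Expanding the product over the block of \<open>\<alpha> + \<delta>\<close> over subsets: the points that contribute \<open>\<alpha>\<close> become singletons.
If all of them do, the free summation index gives the factor \<open>N - 1\<close>.\<close>

lemma Vb_weight:
 assumes N: "N >= 2" and s: "s : {1, -1 :: real}" and B: "finite B" "B ~= {}"
  and my: "!!y. y : B ==> my y < N - 1"
 shows "(SUM Q | partition_on B Q. Vb (xpar N s) B Q * pdelta Q my) = (SUM c<N. \<Prod>y\<in>B. Vm N s (my y) c)"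
proof -
 let ?x = "xpar N s" let ?a = "al ?x"
 have fin: "finite {Q. partition_on B Q}" by (rule finitely_many_partition_on[OF B(1)])
 have finI: "finite {I. I \<subset> B}" by (rule finite_subset[of _ "Pow B"]) (use B in auto)
 have "(SUM Q | partition_on B Q. Vb ?x B Q * pdelta Q my) =
  (SUM I | I \<subset> B. SUM Q | partition_on B Q. ?a ^ card I * (bv (insert (B - I) (singletons I)) Q * pdelta Q my))
  + (?a ^ card B * (?x\<^sup>2 - 1) + (1 / ?x) ^ card B) * (SUM Q | partition_on B Q. bv (singletons B) Q * pdelta Q my)"
  unfolding Vb_def distrib_right sum.distrib sum_distrib_right sum_distrib_left
  by (subst sum.swap) (simp add: mult.assoc)
 also have "(SUM I | I \<subset> B. SUM Q | partition_on B Q. ?a ^ card I * (bv (insert (B - I) (singletons I)) Q * pdelta Q my)) =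
  (SUM I | I \<subset> B. ?a ^ card I * pdelta (insert (B - I) (singletons I)) my)"
  unfolding sum_distrib_left[symmetric]
  by (intro sum.cong refl) (subst sum_basis_vec[OF fin], auto intro: partition_refine_block)
 also have "(SUM Q | partition_on B Q. bv (singletons B) Q * pdelta Q my) = 1"
  by (subst sum_basis_vec[OF fin]) (auto simp: partition_singletons, auto simp: pdelta_def singletons_def)
 finally have L: "(SUM Q | partition_on B Q. Vb ?x B Q * pdelta Q my) =
  (SUM I | I \<subset> B. ?a ^ card I * pdelta (insert (B - I) (singletons I)) my) + (?a ^ card B * (?x\<^sup>2 - 1) + (1 / ?x) ^ card B)"
  by simp
 have val: "- valpha N s = ?a" "vbeta N s = 1 / ?x"
  unfolding xpar_alpha[OF N s, symmetric] xpar_beta[OF N s, symmetric] valpha_def[OF N s] vbeta_def[OF N s] by simp_all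
 have "(SUM c<N. \<Prod>y\<in>B. Vm N s (my y) c) = (SUM c<N - 1. \<Prod>y\<in>B. Vm N s (my y) c) + (\<Prod>y\<in>B. Vm N s (my y) (N - 1))"
  by (rule sum_split_last[OF N s])
 also have "(\<Prod>y\<in>B. Vm N s (my y) (N - 1)) = (1 / ?x) ^ card B"
  using Vm_cases(2)[OF N s my] by (simp add: val)
 also have "(SUM c<N - 1. \<Prod>y\<in>B. Vm N s (my y) c) = (SUM c<N - 1. \<Prod>y\<in>B. ?a + (if my y = c then 1 else 0))"
  using Vm_cases(1)[OF N s my] by (intro sum.cong prod.cong refl) (simp add: val(1)[symmetric])
 also have "... = (SUM I:Pow B. ?a ^ card I * (SUM c<N - 1. \<Prod>y\<in>B - I. if my y = c then 1 else 0))"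
  unfolding prod_add[OF B(1)] sum_distrib_left by (subst sum.swap) simp
 also have "Pow B = insert B {I. I \<subset> B}" by auto
 also have "(SUM I:insert B {I. I \<subset> B}. ?a ^ card I * (SUM c<N - 1. \<Prod>y\<in>B - I. if my y = c then 1 else 0)) =
  ?a ^ card B * (?x\<^sup>2 - 1) + (SUM I | I \<subset> B. ?a ^ card I * (SUM c<N - 1. \<Prod>y\<in>B - I. if my y = c then 1 else 0))"
  using finI N by (simp add: xpar_square[OF N s] of_nat_diff)
 also have "(SUM I | I \<subset> B. ?a ^ card I * (SUM c<N - 1. \<Prod>y\<in>B - I. if my y = c then 1 else 0)) =
  (SUM I | I \<subset> B. ?a ^ card I * pdelta (insert (B - I) (singletons I)) my)"
 proof (intro sum.cong refl arg_cong2[of _ _ _ _ "(*)"])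
  fix I assume "I : {I. I \<subset> B}"
  then obtain y where y: "y : B - I" by blast
  have "(\<Prod>z\<in>B - I. if my z = c then 1 else 0 :: complex) = (if c = my y then pdelta (insert (B - I) (singletons I)) my else 0)" for c
  proof (cases "ALL z:B - I. my z = c")
  case True
  then show ?thesis using y by (auto simp: pdelta_def singletons_def intro!: prod.neutral)
  next
  case False
  then obtain z where z: "z : B - I" "my z ~= c" by blast
  then have "(\<Prod>z\<in>B - I. if my z = c then 1 else 0 :: complex) = 0" using B by (intro prod_zero) auto
  moreover have "c = my y ==> pdelta (insert (B - I) (singletons I)) my = 0" using z y by (auto simp: pdelta_def)
  ultimately show ?thesis by simp
  qed
  then show "(SUM c<N - 1. \<Prod>y\<in>B - I. if my y = c then 1 else 0) = pdelta (insert (B - I) (singletons I)) my"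
  using my[of y] y by simp
 qed
 finally show ?thesis unfolding L by (simp add: algebra_simps)
qed

lemma Vp_partitions:
 assumes p: "p : partitions k l" and f: "f : (\<Pi>\<^sub>E B\<in>p. {Q. partition_on B Q})"
 shows "(\<Union>B\<in>p. f B) : partitions k l"
 using partition_UN[OF partitionsD(1)[OF p], of f] f by (auto simp: partitions_def)

lemma Vl_in: "Vl x k l f : lin_partitions k l"
proof -
 have "Vp x p r = 0" if "p : partitions k l" "r ~: partitions k l" for p r
  unfolding Vp_def
  by (intro sum.neutral ballI) (use that Vp_partitions in "auto simp: basis_vec_def")
 then show ?thesis unfolding lin_partitions_def Vl_def by (auto intro!: sum.neutral)
qed

text \<open>The defining property of the map: it describes conjugation by tensor powers of \<open>V\<close>.\<close>

lemma ptn_map_Vl: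
 assumes N: "N >= 2" and s: "s : {1, -1 :: real}" and i: "i : multi_indices (N - 1) k" and j: "j : multi_indices (N - 1) l"
 shows "ptn_map (N - 1) k l (Vl (xpar N s) k l f) j i =
  (SUM p:partitions k l. f p * (\<Prod>B\<in>p. SUM c<N. \<Prod>x\<in>B. Vm N s (label i j x) c))"
proof -
 let ?x = "xpar N s" and ?my = "label i j"
 have "ptn_map (N - 1) k l (Vl ?x k l f) j i = (SUM p:partitions k l. f p * (SUM r:partitions k l. Vp ?x p r * pdelta r ?my))"
  unfolding ptn_map_eq[OF j i] Vl_def sum_distrib_right sum_distrib_left by (subst sum.swap) (simp add: mult.assoc)
 also have "... = (SUM p:partitions k l. f p * (\<Prod>B\<in>p. SUM c<N. \<Prod>x\<in>B. Vm N s (label i j x) c))"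
 proof (intro sum.cong refl arg_cong2[of _ _ _ _ "(*)"])
  fix p assume p: "p : partitions k l"
  let ?F = "\<Pi>\<^sub>E B\<in>p. {Q. partition_on B Q}"
  have finB: "finite B" "B ~= {}" "B <= points k l" if "B : p" for B
  using partition_blockD(1,2)[OF partitionsD(1)[OF p] that] finite_subset[OF _ finite_points] by auto
  have "(SUM r:partitions k l. Vp ?x p r * pdelta r ?my) =
  (SUM f:?F. (\<Prod>B\<in>p. Vb ?x B (f B)) * (SUM r:partitions k l. bv (\<Union>B\<in>p. f B) r * pdelta r ?my))"
  unfolding Vp_def sum_distrib_right sum_distrib_left by (subst sum.swap) (simp add: mult.assoc)
  also have "... = (SUM f:?F. \<Prod>B\<in>p. Vb ?x B (f B) * pdelta (f B) ?my)"
  proof (intro sum.cong refl)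
  fix f assume f: "f : ?F"
  show "(\<Prod>B\<in>p. Vb ?x B (f B)) * (SUM r:partitions k l. bv (\<Union>B\<in>p. f B) r * pdelta r ?my) =
  (\<Prod>B\<in>p. Vb ?x B (f B) * pdelta (f B) ?my)"
  unfolding sum_basis_vec[OF finite_partitions Vp_partitions[OF p f]] prod.distrib
  by (simp add: pdelta_UN[OF partitionsD(2)[OF p]])
  qed
  also have "... = (\<Prod>B\<in>p. SUM Q | partition_on B Q. Vb ?x B Q * pdelta Q ?my)"
  by (rule prod_sum_PiE[symmetric, OF partitionsD(2)[OF p] finitely_many_partition_on[OF finB(1)]])
  also have "... = (\<Prod>B\<in>p. SUM c<N. \<Prod>x\<in>B. Vm N s (label i j x) c)"
  by (intro prod.cong refl Vb_weight[OF N s]) (use finB label_lt[OF i j] in blast)+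
  finally show "(SUM r:partitions k l. Vp ?x p r * pdelta r ?my) = (\<Prod>B\<in>p. SUM c<N. \<Prod>x\<in>B. Vm N s (label i j x) c)" .
 qed
 finally show ?thesis .
qed

section \<open>Functoriality of the linear maps\<close>

lemma pdelta_cong_points:
 assumes "p : partitions k l" "!!x. x : points k l ==> my x = nu x" shows "pdelta p my = pdelta p nu"
 by (rule pdelta_cong) (unfold partitionsD(3)[OF assms(1)], rule assms(2))

lemma sum_swap3: "(SUM r:R. SUM p:P. SUM q:Q. F r p q) = (SUM p:P. SUM q:Q. SUM r:R. F r p q)"
proof -
 have "(SUM r:R. SUM p:P. SUM q:Q. F r p q) = (SUM p:P. SUM r:R. SUM q:Q. F r p q)" by (rule sum.swap)
 also have "... = (SUM p:P. SUM q:Q. SUM r:R. F r p q)" by (intro sum.cong refl) (rule sum.swap)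
 finally show ?thesis .
qed

lemma partition_on_Un:
 assumes "partition_on A P" "partition_on B Q" "A Int B = {}"
 shows "partition_on (A Un B) (P Un Q)"
proof (rule partition_onI)
 show "\<Union> (P Un Q) = A Un B" "{} ~: P Un Q"
  using assms(1,2)[THEN partition_onD1] assms(1,2)[THEN partition_onD3] by auto
 fix C D assume CD: "C : P Un Q" "D : P Un Q" "C ~= D"
 have sub: "C : P ==> C <= A" "C : Q ==> C <= B" for C
  using partition_blockD(2)[OF assms(1)] partition_blockD(2)[OF assms(2)] by auto
 have "C : P ==> D : P ==> disjnt C D" "C : Q ==> D : Q ==> disjnt C D"
  using assms(1,2)[THEN partition_onD2] CD(3) by (auto simp: pairwise_def)
 moreover have "C : P ==> D : Q ==> disjnt C D" "C : Q ==> D : P ==> disjnt C D"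
  using sub[of C] sub[of D] assms(3) unfolding disjnt_def by blast+
 ultimately show "disjnt C D" using CD by blast
qed

lemma partition_on_image:
 assumes "partition_on A P" "inj_on h A" shows "partition_on (h ` A) ((`) h ` P)"
proof -
 have "{} ~: (`) h ` P" using partition_onD3[OF assms(1)] by auto
 then show ?thesis using partition_on_inj_image[OF assms] by simp
qed

lemma prod_block_image:
 assumes "partition_on A P" "inj_on h A"
 shows "(\<Prod>B\<in>(`) h ` P. F B) = (\<Prod>B\<in>P. F (h ` B) :: complex)"
proof -
 have "inj_on ((`) h) P"
 proof (rule inj_onI)
  fix B C assume "B : P" "C : P" "h ` B = h ` C"
  then show "B = C" using inj_on_image_eq_iff[OF assms(2)] partition_blockD(2)[OF assms(1)] by metis
 qed
 then show ?thesis by (simp add: prod.reindex)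
qed

subsection \<open>Tensor products\<close>

definition shift :: "nat => nat => point => point" where
 "shift k l = (%(r, i). (r, (if r = 0 then k else l) + i))"

lemma inj_shift: "inj_on (shift k l) X"
 by (auto simp: inj_on_def shift_def)

lemma points_add: "points (k + k') (l + l') = points k l Un shift k l ` points k' l'"
proof -
 have "x : shift k l ` points k' l'" if "x : points (k + k') (l + l')" "x ~: points k l" for x
 proof (cases x)
  case (Pair r i)
  then have "x = shift k l (r, i - (if r = 0 then k else l))" "(r, i - (if r = 0 then k else l)) : points k' l'"
  using that by (auto simp: points_def shift_def)
  then show ?thesis by blast
 qed
 then show ?thesis by (auto simp: points_def shift_def)
qed

lemma points_shift_disjoint: "points k l Int shift k l ` points k' l' = {}"
 by (auto simp: points_def shift_def)

lemma tensor_ptn_shift: "tensor_ptn k l p q = p Un (`) (shift k l) ` q"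
 by (simp add: tensor_ptn_def shift_def)

lemma tensor_partition:
 assumes "p : partitions k l" "q : partitions k' l'"
 shows "tensor_ptn k l p q : partitions (k + k') (l + l')"
 using partition_on_Un[OF partitionsD(1)[OF assms(1)] partition_on_image[OF partitionsD(1)[OF assms(2)] inj_shift]
  points_shift_disjoint]
 by (simp add: partitions_def points_add tensor_ptn_shift)

lemma label_append:
 assumes "length i = k" "length j = l"
 shows "x : points k l ==> label (i @ i') (j @ j') x = label i j x"
  "label (i @ i') (j @ j') (shift k l x) = label i' j' x"
 using assms by (auto simp: label_def points_def shift_def nth_append split: prod.splits)

lemma tensor_lin_sum:
 "(SUM r:partitions (k + k') (l + l'). tensor_lin k l k' l' f g r * w r) =
  (SUM p:partitions k l. SUM q:partitions k' l'. f p * g q * w (tensor_ptn k l p q))"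
proof -
 have "(SUM r:partitions (k + k') (l + l'). tensor_lin k l k' l' f g r * w r) =
  (SUM p:partitions k l. SUM q:partitions k' l'. f p * g q *
  (SUM r:partitions (k + k') (l + l'). bv (tensor_ptn k l p q) r * w r))"
  unfolding tensor_lin_def sum_distrib_right sum_distrib_left
  by (rule trans[OF sum_swap3]) (simp add: mult.assoc)
 also have "... = (SUM p:partitions k l. SUM q:partitions k' l'. f p * g q * w (tensor_ptn k l p q))"
  by (intro sum.cong refl) (simp add: sum_basis_vec tensor_partition)
 finally show ?thesis .
qed

lemma tensor_lin_in: "tensor_lin k l k' l' f g : lin_partitions (k + k') (l + l')"
proof -
 have "tensor_lin k l k' l' f g r = 0" if "r ~: partitions (k + k') (l + l')" for r
  unfolding tensor_lin_def by (intro sum.neutral ballI) (use that tensor_partition in "auto simp: basis_vec_def")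
 then show ?thesis by (auto simp: lin_partitions_def)
qed

text \<open>The value at a labelling of the map obtained from a partition by conjugation with \<open>W\<close>.\<close>

definition wt :: "(nat => nat => complex) => nat => point set set => (point => nat) => complex" where
 "wt W N p my = (\<Prod>B\<in>p. SUM c<N. \<Prod>x\<in>B. W (my x) c)"

lemma wt_cong:
 assumes "!!x. x : \<Union>p ==> my x = nu x" shows "wt W N p my = wt W N p nu"
proof -
 have *: "W (my x) c = W (nu x) c" if "B : p" "x : B" for B x c using assms[of x] that by (metis UnionI)
 show ?thesis unfolding wt_def by (intro prod.cong sum.cong refl) (rule *)
qed

lemma wt_cong_points:
 assumes "p : partitions k l" "!!x. x : points k l ==> my x = nu x" shows "wt W N p my = wt W N p nu"
 by (rule wt_cong) (unfold partitionsD(3)[OF assms(1)], rule assms(2))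

lemma wt_image:
 assumes "partition_on A p" "inj_on h A" shows "wt W N ((`) h ` p) my = wt W N p (my \<circ> h)"
 unfolding wt_def prod_block_image[OF assms]
proof (rule prod.cong[OF refl], rule sum.cong[OF refl])
 fix B c assume "B : p"
 then have "inj_on h B" using assms inj_on_subset partition_blockD(2)[OF assms(1)] by blast
 then show "(\<Prod>x\<in>h ` B. W (my x) c) = (\<Prod>x\<in>B. W ((my \<circ> h) x) c)" by (simp add: prod.reindex)
qed

lemma tensor_weight:
 assumes p: "p : partitions k l" and q: "q : partitions k' l'" and len: "length i = k" "length j = l"
 shows "pdelta (tensor_ptn k l p q) (label (i @ i') (j @ j')) = pdelta p (label i j) * pdelta q (label i' j')"
  "wt W N (tensor_ptn k l p q) (label (i @ i') (j @ j')) = wt W N p (label i j) * wt W N q (label i' j')"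
proof -
 let ?my = "label (i @ i') (j @ j')"
 have comp: "?my \<circ> shift k l = label i' j'" using label_append(2)[OF len] by auto
 have eq: "pdelta p ?my = pdelta p (label i j)" "wt W N p ?my = wt W N p (label i j)"
  using label_append(1)[OF len] by (intro pdelta_cong_points[OF p] wt_cong_points[OF p]; simp)+
 show "pdelta (tensor_ptn k l p q) ?my = pdelta p (label i j) * pdelta q (label i' j')"
  unfolding tensor_ptn_shift pdelta_Un pdelta_image comp eq ..
 have disj: "p Int (`) (shift k l) ` q = {}"
 proof -
  have False if "B : p" "B : (`) (shift k l) ` q" for B
  proof -
  have "B ~= {}" "B <= points k l" using partition_blockD(1,2)[OF partitionsD(1)[OF p] that(1)] by auto
  moreover have "B <= shift k l ` points k' l'" using that(2) partition_blockD(2)[OF partitionsD(1)[OF q]] by blast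
  ultimately show False using points_shift_disjoint[of k l k' l'] by blast
  qed
  then show ?thesis by blast
 qed
 have "wt W N (tensor_ptn k l p q) ?my = wt W N p ?my * wt W N ((`) (shift k l) ` q) ?my"
  unfolding tensor_ptn_shift wt_def
  by (rule prod.union_disjoint) (use partitionsD(2)[OF p] partitionsD(2)[OF q] disj in auto)
 then show "wt W N (tensor_ptn k l p q) ?my = wt W N p (label i j) * wt W N q (label i' j')"
  unfolding wt_image[OF partitionsD(1)[OF q] inj_shift] comp eq .
qed

lemma append_multi: "i : mi n k ==> i' : mi n k' ==> i @ i' : mi n (k + k')"
 by (auto simp: multi_indices_def)

lemma split_multi:
 assumes "i : mi n (k + k')"
 obtains a b where "i = a @ b" "a : mi n k" "b : mi n k'"
 by (rule that[of "take k i" "drop k i"]) (use assms in "auto simp: multi_indices_def dest: in_set_takeD in_set_dropD")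

lemma length_multi: "i : mi n k ==> length i = k"
 by (simp add: multi_indices_def)

lemma ptn_map_tensor:
 assumes "i : mi n k" "j : mi n l" "i' : mi n k'" "j' : mi n l'"
 shows "ptn_map n (k + k') (l + l') (tensor_lin k l k' l' f g) (j @ j') (i @ i') =
  ptn_map n k l f j i * ptn_map n k' l' g j' i'"
 unfolding ptn_map_eq[OF append_multi[OF assms(2,4)] append_multi[OF assms(1,3)]] ptn_map_eq[OF assms(2,1)]
  ptn_map_eq[OF assms(4,3)] tensor_lin_sum sum_product
 by (intro sum.cong refl) (simp add: tensor_weight length_multi[OF assms(1)] length_multi[OF assms(2)])

subsection \<open>Reflections\<close>

definition flip :: "point => point" where "flip = (%(r, i). (1 - r, i))"

definition refl_lin :: "nat => nat => lin_ptn => lin_ptn" where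
 "refl_lin k l f = (%r. SUM p:partitions k l. f p * bv (involution_ptn p) r)"

lemma involution_refl: "involution_lin k l f = refl_lin k l (%p. cnj (f p))"
 by (simp add: involution_lin_def refl_lin_def)

lemma involution_ptn_flip: "involution_ptn p = (`) flip ` p"
 by (simp add: involution_ptn_def flip_def)

lemma flip_points: "flip ` points k l = points l k" "inj_on flip (points k l)"
proof -
 have "x : flip ` points k l" if "x : points l k" for x
 proof -
  have "x = flip (flip x)" "flip x : points k l" using that by (auto simp: flip_def points_def)
  then show ?thesis by blast
 qed
 then show "flip ` points k l = points l k" by (auto simp: flip_def points_def)
 show "inj_on flip (points k l)" by (auto simp: inj_on_def flip_def points_def)
qed

lemma involution_partition: "p : partitions k l ==> involution_ptn p : partitions l k"
 using partition_on_image[OF partitionsD(1) flip_points(2), of p k l]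
 by (simp add: partitions_def involution_ptn_flip flip_points)

lemma refl_lin_sum:
 "(SUM r:partitions l k. refl_lin k l f r * w r) = (SUM p:partitions k l. f p * w (involution_ptn p))"
proof -
 have "(SUM r:partitions l k. refl_lin k l f r * w r) =
  (SUM p:partitions k l. f p * (SUM r:partitions l k. bv (involution_ptn p) r * w r))"
  unfolding refl_lin_def sum_distrib_right sum_distrib_left by (subst sum.swap) (simp add: mult.assoc)
 also have "... = (SUM p:partitions k l. f p * w (involution_ptn p))"
  by (intro sum.cong refl) (simp add: sum_basis_vec involution_partition)
 finally show ?thesis .
qed

lemma refl_lin_in: "refl_lin k l f : lin_partitions l k"
proof -
 have "refl_lin k l f r = 0" if "r ~: partitions l k" for r
  unfolding refl_lin_def by (intro sum.neutral ballI) (use that involution_partition in "auto simp: basis_vec_def")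
 then show ?thesis by (auto simp: lin_partitions_def)
qed

lemma refl_weight:
 assumes p: "p : partitions k l"
 shows "pdelta (involution_ptn p) (label i j) = pdelta p (label j i)"
  "wt W N (involution_ptn p) (label i j) = wt W N p (label j i)"
proof -
 have eq: "x : points k l ==> (label i j \<circ> flip) x = label j i x" for x
  by (auto simp: label_def flip_def points_def)
 show "pdelta (involution_ptn p) (label i j) = pdelta p (label j i)"
  unfolding involution_ptn_flip pdelta_image by (rule pdelta_cong_points[OF p eq])
 show "wt W N (involution_ptn p) (label i j) = wt W N p (label j i)"
  unfolding involution_ptn_flip wt_image[OF partitionsD(1)[OF p] flip_points(2)] by (rule wt_cong_points[OF p eq])
qed

lemma ptn_map_refl:
 assumes "i : mi n l" "j : mi n k"
 shows "ptn_map n l k (refl_lin k l f) j i = ptn_map n k l f i j"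
 unfolding ptn_map_eq[OF assms(2,1)] ptn_map_eq[OF assms] refl_lin_sum
 by (intro sum.cong refl) (simp add: refl_weight)

subsection \<open>Compositions\<close>

definition points3 :: "nat => nat => nat => point set" where
 "points3 k l m = {0} \<times> {..<k} Un {1} \<times> {..<l} Un {2} \<times> {..<m}"

definition up :: "point => point" where "up = (%(r, i). (r + 1, i))"

definition squeeze :: "point => point" where "squeeze = (%(r, i). (if r = 2 then 1 else r, i))"

definition label3 :: "nat list => nat list => nat list => point => nat" where
 "label3 i a j = (%(r, t). if r = 0 then i ! t else if r = 1 then a ! t else j ! t)"

lemma multi_nth: "i : mi n k ==> t < k ==> i ! t < n"
 by (auto simp: multi_indices_def) (meson lessThan_iff nth_mem subsetD)

lemma finite_points3 [simp]: "finite (points3 k l m)"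
 by (simp add: points3_def)

lemma stacked_components_quotient:
 "stacked_components q p = \<Union>(p Un (`) up ` q) // (\<Union>B\<in>p Un (`) up ` q. B \<times> B)\<^sup>*"
 by (simp add: stacked_components_def Let_def up_def)

lemma compose_ptn_squeeze:
 "compose_ptn q p = (%C. squeeze ` {x : C. fst x ~= 1}) ` stacked_components q p - {{}}"
 by (simp add: compose_ptn_def squeeze_def)

text \<open>The components of a cover by non-empty sets, and the labellings that are constant on them.\<close>

lemma components_partition:
 fixes R :: "'x set set"
 defines "E == (\<Union>B\<in>R. B \<times> B)\<^sup>*"
 shows "partition_on (\<Union>R) (\<Union>R // E)" "pdelta (\<Union>R // E) my = pdelta R my"
proof -
 have symE: "sym E" unfolding E_def by (rule sym_rtrancl) (auto simp: sym_def)
 have closed: "y : \<Union>R" if "(x, y) : E" "x : \<Union>R" for x y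
  using that unfolding E_def by (induction rule: rtrancl_induct) auto
 have trE: "trans E" unfolding E_def by (rule trans_rtrancl)
 show "partition_on (\<Union>R) (\<Union>R // E)"
 proof (rule partition_onI)
  have "(x, x) : E" for x by (simp add: E_def)
  then show "\<Union> (\<Union>R // E) = \<Union>R" "{} ~: \<Union>R // E" using closed by (fastforce simp: quotient_def)+
  fix C D assume "C : \<Union>R // E" "D : \<Union>R // E" and ne: "C ~= D"
  then obtain x y where xy: "C = E `` {x}" "D = E `` {y}" by (auto simp: quotient_def)
  show "disjnt C D"
  proof (rule ccontr)
  assume "~ disjnt C D"
  then obtain z where "(x, z) : E" "(y, z) : E" by (auto simp: disjnt_def xy)
  then have "(x, y) : E" "(y, x) : E" using symE trE by (meson symD transD)+
  then have "E `` {x} = E `` {y}" using trE by (auto dest: transD)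
  then show False using ne xy by simp
  qed
 qed
 have "(ALL C:\<Union>R // E. ALL x:C. ALL y:C. my x = my y) \<longleftrightarrow> (ALL B:R. ALL x:B. ALL y:B. my x = my y)" (is "?L \<longleftrightarrow> ?R")
 proof
  assume L: ?L
  show ?R
  proof (intro ballI)
  fix B x y assume B: "B : R" "x : B" "y : B"
  then have "(x, y) : (\<Union>B\<in>R. B \<times> B)" by blast
  then have "(x, y) : E" "(x, x) : E" unfolding E_def by auto
  moreover have "E `` {x} : \<Union>R // E" using B by (auto simp: quotient_def)
  ultimately show "my x = my y" using L by blast
  qed
 next
  assume R: ?R
  have E: "my x = my y" if "(x, y) : E" for x y
  using that unfolding E_def
  proof (induction rule: rtrancl_induct)
  case (step y z)
  then have "my y = my z" using R by blast
  then show ?case using step.IH by simp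
  qed simp
  show ?L
  proof (intro ballI)
  fix C x y assume "C : \<Union>R // E" "x : C" "y : C"
  then obtain z where "(z, x) : E" "(z, y) : E" by (auto simp: quotient_def)
  then show "my x = my y" using E[of z x] E[of z y] by simp
  qed
 qed
 then show "pdelta (\<Union>R // E) my = pdelta R my" by (simp only: pdelta_def)
qed

context
 fixes k l m p q
 assumes p: "p : partitions k l" and q: "q : partitions l m"
begin

lemma stacked_points: "\<Union>(p Un (`) up ` q) = points3 k l m"
proof -
 have "\<Union>(p Un (`) up ` q) = \<Union>p Un up ` \<Union>q" by (simp add: image_Union)
 also have "... = points k l Un up ` points l m" unfolding partitionsD(3)[OF p] partitionsD(3)[OF q] ..
 also have "up ` points l m = {1} \<times> {..<l} Un {2} \<times> {..<m}"
 proof -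
  have "(1, t) : up ` points l m" if "t < l" for t
  by (rule image_eqI[of _ _ "(0, t)"]) (use that in "auto simp: up_def points_def")
  moreover have "(2, t) : up ` points l m" if "t < m" for t
  by (rule image_eqI[of _ _ "(1, t)"]) (use that in "auto simp: up_def points_def")
  ultimately show ?thesis by (auto simp: up_def points_def)
 qed
 finally show ?thesis by (auto simp: points_def points3_def)
qed

lemma stacked_partition: "partition_on (points3 k l m) (stacked_components q p)"
 using components_partition(1)[of "p Un (`) up ` q"] unfolding stacked_points stacked_components_quotient .

lemma compose_partition: "compose_ptn q p : partitions k m"
proof -
 let ?F = "%C. squeeze ` {x : C. fst x ~= 1}"
 have "partition_on (?F (points3 k l m)) (?F ` stacked_components q p - {{}})"
 proof (rule partition_on_transform[OF stacked_partition])
  show "\<Union> (?F ` stacked_components q p) = ?F (\<Union> (stacked_components q p))" by auto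
  fix C D :: "point set" assume d: "disjnt C D"
  have "x = y" if "fst x ~= 1" "fst y ~= 1" "squeeze x = squeeze y" for x y
  using that by (auto simp: squeeze_def split: prod.splits if_splits)
  note inj = this
  show "disjnt (?F C) (?F D)" unfolding disjnt_iff
  proof (intro allI notI)
  fix z assume "z : ?F C & z : ?F D"
  then obtain x y where xy: "x : C" "fst x ~= 1" "z = squeeze x" "y : D" "fst y ~= 1" "z = squeeze y" by blast
  then have "x = y" using inj[of x y] by simp
  then show False using d xy unfolding disjnt_iff by blast
  qed
 qed
 moreover have "?F (points3 k l m) = points k m"
 proof -
  have "(0, t) : ?F (points3 k l m)" if "t < k" for t
  by (rule image_eqI[of _ _ "(0, t)"]) (use that in "auto simp: squeeze_def points3_def")
  moreover have "(1, t) : ?F (points3 k l m)" if "t < m" for t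
  by (rule image_eqI[of _ _ "(2, t)"]) (use that in "auto simp: squeeze_def points3_def")
  ultimately show ?thesis by (auto simp: points_def) (auto simp: squeeze_def points3_def)
 qed
 ultimately show ?thesis by (simp add: partitions_def compose_ptn_squeeze)
qed

text \<open>Summation over the labels of the middle row: a component that meets an outer row forces the
 label, a component inside the middle row leaves it free.\<close>

lemma compose_pdelta:
 assumes i: "i : mi n k" and j: "j : mi n m"
 shows "(SUM a:mi n l. pdelta q (label a j) * pdelta p (label i a)) =
  of_nat n ^ num_loops q p * pdelta (compose_ptn q p) (label i j)"
proof -
 let ?X = "points3 k l m" and ?C = "stacked_components q p"
 define nu where "nu = label3 i [] j"
 define h :: "point => nat => complex" where "h x c = (if fst x = 1 | c = nu x then 1 else 0)" for x c
 define S where "S = {my : ?X \<rightarrow>\<^sub>E {..<n}. ALL x:?X. fst x = 1 | my x = nu x}"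
 have finC: "finite ?C" by (rule finite_elements[OF finite_points3 stacked_partition])
 have finP: "finite (?X \<rightarrow>\<^sub>E {..<n})" by (intro finite_PiE) auto
 have nu_lt: "nu x < n" if "x : ?X" "fst x ~= 1" for x
 proof -
  have "i ! t < n" if "t < k" for t using multi_nth[OF i] that by blast
  moreover have "j ! t < n" if "t < m" for t using multi_nth[OF j] that by blast
  ultimately show ?thesis using that by (auto simp: points3_def nu_def label3_def)
 qed
 have delta: "pdelta q (label a j) * pdelta p (label i a) = pdelta ?C (\<lambda>x\<in>?X. label3 i a j x)" for a
 proof -
  have "pdelta p (label i a) = pdelta p (label3 i a j)"
  by (rule pdelta_cong_points[OF p]) (auto simp: label_def label3_def points_def)
  moreover have "pdelta q (label a j) = pdelta ((`) up ` q) (label3 i a j)"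
  unfolding pdelta_image
  by (rule pdelta_cong_points[OF q]) (auto simp: label_def label3_def points_def up_def)
  ultimately have "pdelta q (label a j) * pdelta p (label i a) = pdelta (p Un (`) up ` q) (label3 i a j)"
  by (simp add: pdelta_Un)
  also have "... = pdelta ?C (label3 i a j)"
  unfolding stacked_components_quotient by (rule components_partition(2)[symmetric])
  also have "... = pdelta ?C (\<lambda>x\<in>?X. label3 i a j x)"
  by (rule pdelta_cong) (unfold partition_onD1[OF stacked_partition, symmetric], simp)
  finally show ?thesis .
 qed
 have "(SUM a:mi n l. pdelta q (label a j) * pdelta p (label i a)) = (SUM my:S. pdelta ?C my)"
 proof (rule sum.reindex_bij_witness[where j = "%a. \<lambda>x\<in>?X. label3 i a j x" and i = "%my. map (%t. my (1, t)) [0..<l]"])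
  fix a assume a: "a : mi n l"
  show "map (%t. (\<lambda>x\<in>?X. label3 i a j x) (1, t)) [0..<l] = a"
  by (rule nth_equalityI) (use a in "auto simp: points3_def label3_def multi_indices_def")
  have "a ! t < n" if "t < l" for t using multi_nth[OF a] that by blast
  then have "label3 i a j x < n" if "x : ?X" for x
  using nu_lt[OF that] that by (auto simp: points3_def nu_def label3_def)
  then have "(\<lambda>x\<in>?X. label3 i a j x) : ?X \<rightarrow>\<^sub>E {..<n}" by (simp add: restrict_PiE_iff)
  moreover have "fst x = 1 | label3 i a j x = nu x" for x by (auto simp: nu_def label3_def split: prod.splits)
  ultimately show "(\<lambda>x\<in>?X. label3 i a j x) : S" unfolding S_def by simp
  show "pdelta ?C (\<lambda>x\<in>?X. label3 i a j x) = pdelta q (label a j) * pdelta p (label i a)" by (rule delta[symmetric])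
 next
  fix my assume m: "my : S"
  then have mP: "my : ?X \<rightarrow>\<^sub>E {..<n}" and mS: "!!x. x : ?X ==> fst x ~= 1 ==> my x = nu x" by (auto simp: S_def)
  show "map (%t. my (1, t)) [0..<l] : mi n l"
  proof -
  have "my (1, t) < n" if "t < l" for t using PiE_mem[OF mP, of "(1, t)"] that by (simp add: points3_def)
  then show ?thesis by (auto simp: multi_indices_def)
  qed
  show "(\<lambda>x\<in>?X. label3 i (map (%t. my (1, t)) [0..<l]) j x) = my"
  proof
  fix x
  show "(\<lambda>x\<in>?X. label3 i (map (%t. my (1, t)) [0..<l]) j x) x = my x"
  proof (cases "x : ?X")
  case True
  show ?thesis
  proof (cases "fst x = 1")
  case True
  then show ?thesis using \<open>x : ?X\<close> by (auto simp: points3_def label3_def)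
  next
  case False
  then have "label3 i (map (%t. my (1, t)) [0..<l]) j x = nu x" by (auto simp: label3_def nu_def split: prod.splits)
  then show ?thesis using True mS[OF True False] by simp
  qed
  next
  case False
  then show ?thesis using PiE_arb[OF mP False] by simp
  qed
  qed
 qed
 also have "... = (SUM my:?X \<rightarrow>\<^sub>E {..<n}. pdelta ?C my * (\<Prod>x\<in>?X. h x (my x)))"
 proof (rule sum.mono_neutral_cong_left[OF finP])
  show "S <= ?X \<rightarrow>\<^sub>E {..<n}" by (auto simp: S_def)
  show "ALL my:(?X \<rightarrow>\<^sub>E {..<n}) - S. pdelta ?C my * (\<Prod>x\<in>?X. h x (my x)) = 0"
  proof
  fix my assume "my : (?X \<rightarrow>\<^sub>E {..<n}) - S"
  then obtain x where "x : ?X" "fst x ~= 1" "my x ~= nu x" by (auto simp: S_def)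
  then have "(\<Prod>x\<in>?X. h x (my x)) = 0" by (intro prod_zero) (auto simp: h_def)
  then show "pdelta ?C my * (\<Prod>x\<in>?X. h x (my x)) = 0" by simp
  qed
  fix my assume "my : S"
  then have "!!x. x : ?X ==> fst x = 1 | my x = nu x" by (auto simp: S_def)
  then have "(\<Prod>x\<in>?X. h x (my x)) = 1" by (intro prod.neutral) (auto simp: h_def)
  then show "pdelta ?C my = pdelta ?C my * (\<Prod>x\<in>?X. h x (my x))" by simp
 qed
 also have "... = (\<Prod>B\<in>?C. SUM c:{..<n}. \<Prod>x\<in>B. h x c)"
  by (rule block_sum[OF stacked_partition]) auto
 also have "... = (\<Prod>B\<in>?C. (if ALL x:B. fst x = 1 then of_nat n else 1) * pdelta {squeeze ` {x : B. fst x ~= 1}} (label i j))"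
 proof (rule prod.cong[OF refl])
  fix B assume B: "B : ?C"
  have BX: "B <= ?X" by (rule partition_blockD(2)[OF stacked_partition B])
  show "(SUM c:{..<n}. \<Prod>x\<in>B. h x c) =
  (if ALL x:B. fst x = 1 then of_nat n else 1) * pdelta {squeeze ` {x : B. fst x ~= 1}} (label i j)"
  proof (cases "ALL x:B. fst x = 1")
  case True
  then have E: "{x : B. fst x ~= 1} = {}" by blast
  have "pdelta {squeeze ` {x : B. fst x ~= 1}} (label i j) = 1" unfolding E by (simp add: pdelta_def)
  moreover have "(\<Prod>x\<in>B. h x c) = 1" for c using True by (intro prod.neutral) (simp add: h_def)
  then have "(SUM c:{..<n}. \<Prod>x\<in>B. h x c) = of_nat n" by simp
  ultimately show ?thesis by (simp only: if_P[OF True] mult_1_right)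
  next
  case False
  then obtain y where y: "y : B" "fst y ~= 1" by blast
  have lab: "label i j (squeeze x) = nu x" if "x : B" "fst x ~= 1" for x
  using BX that by (auto simp: label_def squeeze_def nu_def label3_def points3_def)
  have "(\<Prod>x\<in>B. h x c) = (if c = nu y then pdelta {squeeze ` {x : B. fst x ~= 1}} (label i j) else 0)" for c
  proof (cases "ALL x:B. fst x ~= 1 --> c = nu x")
  case True
  then have lc: "label i j z = c" if "z : squeeze ` {x : B. fst x ~= 1}" for z using that lab by auto
  have "ALL C:{squeeze ` {x : B. fst x ~= 1}}. ALL x:C. ALL y:C. label i j x = label i j y"
  proof (intro ballI)
  fix C x z assume "C : {squeeze ` {x : B. fst x ~= 1}}" "x : C" "z : C"
  then show "label i j x = label i j z" using lc[of x] lc[of z] by simp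
  qed
  then have "pdelta {squeeze ` {x : B. fst x ~= 1}} (label i j) = 1" unfolding pdelta_def by (rule if_P)
  moreover have "(\<Prod>x\<in>B. h x c) = 1" using True by (intro prod.neutral) (auto simp: h_def)
  moreover have "c = nu y" using True y by blast
  ultimately show ?thesis by simp
  next
  case False
  then obtain z where z: "z : B" "fst z ~= 1" "c ~= nu z" by blast
  have "finite B" using finite_subset[OF BX finite_points3] .
  then have "(\<Prod>x\<in>B. h x c) = 0" using z by (intro prod_zero) (auto simp: h_def)
  moreover have "pdelta {squeeze ` {x : B. fst x ~= 1}} (label i j) = 0" if c: "c = nu y"
  proof -
  have "label i j (squeeze y) ~= label i j (squeeze z)" using lab[OF y] lab[OF z(1,2)] c z(3) by simp
  note ne = this
  have mem: "squeeze y : squeeze ` {x : B. fst x ~= 1}" "squeeze z : squeeze ` {x : B. fst x ~= 1}"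
  using y z(1,2) by auto
  have "~ (ALL C:{squeeze ` {x : B. fst x ~= 1}}. ALL x:C. ALL y:C. label i j x = label i j y)"
  proof
  assume const: "ALL C:{squeeze ` {x : B. fst x ~= 1}}. ALL x:C. ALL y:C. label i j x = label i j y"
  show False using bspec[OF bspec[OF bspec[OF const singletonI] mem(1)] mem(2)] ne by contradiction
  qed
  then show ?thesis unfolding pdelta_def by (rule if_not_P)
  qed
  ultimately show ?thesis by simp
  qed
  then have "(SUM c:{..<n}. \<Prod>x\<in>B. h x c) = pdelta {squeeze ` {x : B. fst x ~= 1}} (label i j)"
  using nu_lt[of y] y BX by auto
  then show ?thesis by (simp only: if_not_P[OF False] mult_1_left)
  qed
 qed
 also have "... = of_nat n ^ num_loops q p * (\<Prod>B\<in>?C. pdelta {squeeze ` {x : B. fst x ~= 1}} (label i j))"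
  unfolding prod.distrib num_loops_def using finC by (simp add: prod.inter_filter[symmetric])
 also have "(\<Prod>B\<in>?C. pdelta {squeeze ` {x : B. fst x ~= 1}} (label i j)) =
  pdelta (\<Union>B\<in>?C. {squeeze ` {x : B. fst x ~= 1}}) (label i j)"
  by (rule pdelta_UN[OF finC, symmetric])
 also have "... = pdelta (compose_ptn q p) (label i j)"
 proof -
  have "(\<Union>B\<in>?C. {squeeze ` {x : B. fst x ~= 1}}) Un {{}} = compose_ptn q p Un {{}}"
  unfolding compose_ptn_squeeze by blast
  then have "pdelta ((\<Union>B\<in>?C. {squeeze ` {x : B. fst x ~= 1}}) Un {{}}) (label i j) = pdelta (compose_ptn q p Un {{}}) (label i j)"
  by (rule arg_cong)
  moreover have "pdelta {{}} (label i j) = 1" by (simp add: pdelta_def)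
  ultimately show ?thesis unfolding pdelta_Un by simp
 qed
 finally show ?thesis .
qed

end

definition compose_gen :: "complex => nat => nat => nat => lin_ptn => lin_ptn => lin_ptn" where
 "compose_gen t k l m g f = (%r. SUM q:partitions l m. SUM p:partitions k l.
  g q * f p * t ^ num_loops q p * bv (compose_ptn q p) r)"

lemma compose_lin_gen: "compose_lin N = compose_gen (of_nat N)"
 by (intro ext) (simp add: compose_lin_def compose_gen_def)

lemma compose_gen_sum:
 "(SUM r:partitions k m. compose_gen t k l m g f r * w r) =
  (SUM q:partitions l m. SUM p:partitions k l. g q * f p * t ^ num_loops q p * w (compose_ptn q p))"
proof -
 have "(SUM r:partitions k m. compose_gen t k l m g f r * w r) =
  (SUM q:partitions l m. SUM p:partitions k l. g q * f p * t ^ num_loops q p *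
  (SUM r:partitions k m. bv (compose_ptn q p) r * w r))"
  unfolding compose_gen_def sum_distrib_right sum_distrib_left
  by (rule trans[OF sum_swap3]) (simp add: mult.assoc)
 also have "... = (SUM q:partitions l m. SUM p:partitions k l. g q * f p * t ^ num_loops q p * w (compose_ptn q p))"
  by (intro sum.cong refl) (simp add: sum_basis_vec compose_partition)
 finally show ?thesis .
qed

lemma compose_gen_in: "compose_gen t k l m g f : lin_partitions k m"
proof -
 have "compose_gen t k l m g f r = 0" if "r ~: partitions k m" for r
  unfolding compose_gen_def by (intro sum.neutral ballI) (use that compose_partition in "auto simp: basis_vec_def")
 then show ?thesis by (auto simp: lin_partitions_def)
qed

lemma ptn_map_compose:
 "ptn_map n k m (compose_gen (of_nat n) k l m g f) = cmm (mi n l) (ptn_map n l m g) (ptn_map n k l f)"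
proof (rule ptn_map_eqI)
 fix i j assume i: "i : mi n k" and j: "j : mi n m"
 have "cmm (mi n l) (ptn_map n l m g) (ptn_map n k l f) j i =
  (SUM a:mi n l. SUM q:partitions l m. SUM p:partitions k l.
  g q * f p * (pdelta q (label a j) * pdelta p (label i a)))"
  unfolding cmm_def
 proof (rule sum.cong[OF refl])
  fix a assume a: "a : mi n l"
  show "ptn_map n l m g j a * ptn_map n k l f a i = (SUM q:partitions l m. SUM p:partitions k l.
  g q * f p * (pdelta q (label a j) * pdelta p (label i a)))"
  unfolding ptn_map_eq[OF j a] ptn_map_eq[OF a i] sum_product by (intro sum.cong refl) (simp add: algebra_simps)
 qed
 also have "... = (SUM q:partitions l m. SUM p:partitions k l. g q * f p *
  (SUM a:mi n l. pdelta q (label a j) * pdelta p (label i a)))"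
  unfolding sum_distrib_left by (rule sum_swap3)
 also have "... = ptn_map n k m (compose_gen (of_nat n) k l m g f) j i"
  unfolding ptn_map_eq[OF j i] compose_gen_sum
  by (intro sum.cong refl) (simp add: compose_pdelta i j)
 finally show "ptn_map n k m (compose_gen (of_nat n) k l m g f) j i =
  cmm (mi n l) (ptn_map n l m g) (ptn_map n k l f) j i" ..
next
 fix i j assume "j ~: mi n m | i ~: mi n k"
 then show "cmm (mi n l) (ptn_map n l m g) (ptn_map n k l f) j i = 0"
  by (auto simp: cmm_def ptn_map_def)
qed

section \<open>Linear independence of the linear maps\<close>

text \<open>A refinement with as many blocks as the coarser partition is equal to it.\<close>

lemma refinement_card:
 assumes p: "partition_on X p" and q: "partition_on X q" and X: "finite X"
  and ref: "!!B x y. B : q ==> x : B ==> y : B ==> blk p x = blk p y"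
  and card: "card q <= card p"
 shows "q = p"
proof -
 define ph where "ph B = blk p (SOME x. x : B)" for B
 have fin: "finite q" "finite p" using finite_elements[OF X] p q by auto
 have ph: "ph B = blk p x" if B: "B : q" "x : B" for B x
  unfolding ph_def using ref[OF B(1) someI[of "%x. x : B", OF B(2)] B(2)] .
 have onto: "p <= ph ` q"
 proof
  fix A assume A: "A : p"
  then obtain x where x: "x : A" using partition_blockD(1)[OF p A] by blast
  have xX: "x : X" using partition_blockD(2)[OF p A] x by blast
  show "A : ph ` q"
  using ph[OF partition_blk[OF q xX]] partition_blockD(3)[OF p A x] partition_blk(1)[OF q xX] by auto
 qed
 have into: "ph B : p" "B <= ph B" if B: "B : q" for B
 proof -
  obtain x where x: "x : B" using partition_blockD(1)[OF q B] by blast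
  have "x : X" using partition_blockD(2)[OF q B] x by blast
  then show "ph B : p" using ph[OF B x] partition_blk(1)[OF p] by simp
  show "B <= ph B"
  proof
  fix y assume y: "y : B"
  have "y : X" using partition_blockD(2)[OF q B] y by blast
  then show "y : ph B" using ph[OF B y] partition_blk(2)[OF p] by simp
  qed
 qed
 have im: "ph ` q = p" using onto into(1) by blast
 then have "card (ph ` q) = card q" using card card_image_le[OF fin(1), of ph] by simp
 then have inj: "inj_on ph q" by (rule eq_card_imp_inj_on[OF fin(1)])
 have "ph B = B" if B: "B : q" for B
 proof
  show "ph B <= B"
  proof
  fix y assume y: "y : ph B"
  have yX: "y : X" using partition_blockD(2)[OF p into(1)[OF B]] y by blast
  have "ph (blk q y) = ph B"
  using ph[OF partition_blk[OF q yX]] partition_blockD(3)[OF p into(1)[OF B] y] by simp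
  then have "blk q y = B" using inj partition_blk(1)[OF q yX] B by (auto dest: inj_onD)
  then show "y : B" using partition_blk(2)[OF q yX] by simp
  qed
 qed (use into(2)[OF B] in simp)
 then have "ph ` q = q" by simp
 then show ?thesis using im by simp
qed

text \<open>Evaluating at a labelling whose level sets are the blocks of \<open>p\<close> sees only the refinements of
 \<open>p\<close>; choosing \<open>p\<close> with as many blocks as possible isolates its coefficient.\<close>

lemma ptn_map_zero:
 assumes f: "f : lin_partitions k l" and n: "k + l <= n"
  and 0: "!!i j. i : mi n k ==> j : mi n l ==> ptn_map n k l f j i = 0"
 shows "f = (%_. 0)"
proof (rule ccontr)
 let ?X = "points k l"
 assume "f ~= (%_. 0)"
 then obtain p0 where "f p0 ~= 0" by auto
 define S where "S = {p : partitions k l. f p ~= 0}"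
 have S: "finite S" "S ~= {}" using f \<open>f p0 ~= 0\<close> by (auto simp: S_def lin_partitions_def)
 then have "Max (card ` S) : card ` S" by (intro Max_in) auto
 then obtain p where p: "p : S" "card p = Max (card ` S)" by auto
 have pP: "p : partitions k l" using p by (simp add: S_def)
 note pp = partitionsD(1)[OF pP]
 have max: "card q <= card p" if "q : S" for q unfolding p(2) using S that by (intro Max_ge) auto
 have "p = blk p ` ?X"
 proof
  show "p <= blk p ` ?X"
  proof
  fix A assume A: "A : p"
  then obtain x where "x : A" "x : ?X" using partition_blockD(1,2)[OF pp A] by blast
  then show "A : blk p ` ?X" using partition_blockD(3)[OF pp A] by blast
  qed
  show "blk p ` ?X <= p" using partition_blk(1)[OF pp] by blast
 qed
 then have "card p <= card ?X" using card_image_le[OF finite_points, of "blk p" k l] by simp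
 also have "card ?X = k + l"
  unfolding points_def by (subst card_Un_disjoint) (auto simp: card_cartesian_product_singleton)
 finally have "card p <= card {..<n}" using n by simp
 then obtain e where e: "inj_on e p" "e ` p <= {..<n}"
  using inj_on_iff_card_le[OF partitionsD(2)[OF pP] finite_lessThan, of n] by blast
 define i where "i = map (%t. e (blk p (0, t))) [0..<k]"
 define j where "j = map (%t. e (blk p (1, t))) [0..<l]"
 have e_lt: "e (blk p x) < n" if "x : ?X" for x using partition_blk(1)[OF pp that] e(2) by blast
 have ij: "i : mi n k" "j : mi n l"
  using e_lt by (auto simp: multi_indices_def i_def j_def points_def)
 have lab: "label i j x = e (blk p x)" if "x : ?X" for x
  using that by (auto simp: label_def i_def j_def points_def)
 have "ptn_map n k l f j i = (SUM q:partitions k l. if q = p then f p else 0)"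
  unfolding ptn_map_eq[OF ij(2,1)]
 proof (intro sum.cong refl)
  fix q assume q: "q : partitions k l"
  note qq = partitionsD(1)[OF q]
  show "f q * pdelta q (label i j) = (if q = p then f p else 0)"
  proof (cases "q = p")
  case True
  have "ALL B:p. ALL x:B. ALL y:B. label i j x = label i j y"
  proof (intro ballI)
  fix B x y assume B: "B : p" "x : B" "y : B"
  then have "x : ?X" "y : ?X" using partition_blockD(2)[OF pp B(1)] by auto
  then show "label i j x = label i j y" using lab partition_blockD(3)[OF pp B(1)] B by simp
  qed
  then have "pdelta p (label i j) = 1" unfolding pdelta_def by (rule if_P)
  then show ?thesis using True by simp
  next
  case False
  have "f q = 0 | pdelta q (label i j) = 0"
  proof (rule ccontr)
  assume neg: "~ ?thesis"
  then have const: "ALL B:q. ALL x:B. ALL y:B. label i j x = label i j y" by (meson pdelta_def)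
  have "q = p"
  proof (rule refinement_card[OF pp qq finite_points])
  show "card q <= card p" using neg q by (intro max) (simp add: S_def)
  fix B x y assume B: "B : q" "x : B" "y : B"
  then have X: "x : ?X" "y : ?X" using partition_blockD(2)[OF qq B(1)] by auto
  have "e (blk p x) = e (blk p y)" using const B lab[OF X(1)] lab[OF X(2)] by metis
  then show "blk p x = blk p y" using inj_onD[OF e(1)] partition_blk(1)[OF pp] X by metis
  qed
  then show False using False by simp
  qed
  then show ?thesis using False by auto
  qed
 qed
 also have "... = f p" using pP by simp
 finally show False using 0[OF ij] p(1) by (simp add: S_def)
qed

lemma ptn_map_inj:
 assumes f: "f : lin_partitions k l" and g: "g : lin_partitions k l" and n: "k + l <= n"
  and eq: "!!i j. i : mi n k ==> j : mi n l ==> ptn_map n k l f j i = ptn_map n k l g j i"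
 shows "f = g"
proof -
 have "(%p. f p - g p) = (%_. 0)"
 proof (rule ptn_map_zero[OF _ n])
  show "(%p. f p - g p) : lin_partitions k l" using f g by (force simp: lin_partitions_def)
  fix i j assume ij: "i : mi n k" "j : mi n l"
  show "ptn_map n k l (%p. f p - g p) j i = 0"
  using eq[OF ij] unfolding ptn_map_eq[OF ij(2,1)] by (simp add: left_diff_distrib sum_subtractf)
 qed
 then show ?thesis by (simp add: fun_eq_iff)
qed

section \<open>Interpolation\<close>

text \<open>Rational functions with poles at 0 and 1 only.\<close>

definition ratfun :: "(complex => complex) => bool" where
 "ratfun F \<longleftrightarrow> (EX a b P. ALL x. x ~= 0 --> x ~= 1 --> F x * x ^ a * (x - 1) ^ b = poly P x)"

lemma ratfun_basic:
 "ratfun (%_. c)" "ratfun (%x. x)" "ratfun (%x. 1 / x)" "ratfun (%x. 1 / (x - 1))"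
 unfolding ratfun_def
 by (rule exI[of _ 0], rule exI[of _ 0], rule exI[of _ "[:c:]"], simp,
  rule exI[of _ 0], rule exI[of _ 0], rule exI[of _ "[:0, 1:]"], simp,
  rule exI[of _ 1], rule exI[of _ 0], rule exI[of _ 1], simp,
  rule exI[of _ 0], rule exI[of _ 1], rule exI[of _ 1], simp)

lemma ratfun_add: "ratfun F ==> ratfun G ==> ratfun (%x. F x + G x)"
proof -
 assume "ratfun F" "ratfun G"
 then obtain a b P c d Q where
  F: "!!x. x ~= 0 ==> x ~= 1 ==> F x * x ^ a * (x - 1) ^ b = poly P x" and
  G: "!!x. x ~= 0 ==> x ~= 1 ==> G x * x ^ c * (x - 1) ^ d = poly Q x"
  unfolding ratfun_def by metis
 have "(F x + G x) * x ^ (a + c) * (x - 1) ^ (b + d) =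
  poly (P * [:0, 1:] ^ c * [:-1, 1:] ^ d + Q * [:0, 1:] ^ a * [:-1, 1:] ^ b) x" if "x ~= 0" "x ~= 1" for x
  by (simp add: F[OF that, symmetric] G[OF that, symmetric] power_add algebra_simps)
 then show ?thesis unfolding ratfun_def by blast
qed

lemma ratfun_mult: "ratfun F ==> ratfun G ==> ratfun (%x. F x * G x)"
proof -
 assume "ratfun F" "ratfun G"
 then obtain a b P c d Q where
  F: "!!x. x ~= 0 ==> x ~= 1 ==> F x * x ^ a * (x - 1) ^ b = poly P x" and
  G: "!!x. x ~= 0 ==> x ~= 1 ==> G x * x ^ c * (x - 1) ^ d = poly Q x"
  unfolding ratfun_def by metis
 have "(F x * G x) * x ^ (a + c) * (x - 1) ^ (b + d) = poly (P * Q) x" if "x ~= 0" "x ~= 1" for x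
  by (simp add: F[OF that, symmetric] G[OF that, symmetric] power_add algebra_simps)
 then show ?thesis unfolding ratfun_def by blast
qed

lemma ratfun_sum: "(!!i. i : I ==> ratfun (%x. F x i)) ==> ratfun (%x. SUM i:I. F x i)"
 by (induction I rule: infinite_finite_induct) (simp_all add: ratfun_basic ratfun_add)

lemma ratfun_prod: "(!!i. i : I ==> ratfun (%x. F x i)) ==> ratfun (%x. \<Prod>i\<in>I. F x i)"
 by (induction I rule: infinite_finite_induct) (simp_all add: ratfun_basic ratfun_mult)

lemma ratfun_power: "ratfun F ==> ratfun (%x. F x ^ m)"
 by (induction m) (simp_all add: ratfun_basic ratfun_mult)

lemma ratfun_diff: "ratfun F ==> ratfun G ==> ratfun (%x. F x - G x)"
 using ratfun_add[OF _ ratfun_mult[OF ratfun_basic(1)[of "-1"]], of F G] by simp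

lemma ratfun_al: "ratfun al"
 using ratfun_mult[OF ratfun_mult[OF ratfun_basic(1)[of "-1"] ratfun_basic(3)] ratfun_basic(4)]
 by (simp add: al_def[abs_def])

lemmas ratfun_intros = ratfun_basic ratfun_add ratfun_diff ratfun_mult ratfun_sum ratfun_prod ratfun_power ratfun_al

lemma ratfun_eqI:
 assumes "ratfun F" "ratfun G" and eq: "!!M. M >= M0 ==> F (of_nat M) = G (of_nat M)" and x: "x ~= 0" "x ~= 1"
 shows "F x = G x"
proof -
 obtain a b P where P: "!!x. x ~= 0 ==> x ~= 1 ==> (F x - G x) * x ^ a * (x - 1) ^ b = poly P x"
  using ratfun_diff[OF assms(1,2)] unfolding ratfun_def by blast
 have "poly P (of_nat M) = 0" if "M >= max M0 2" for M
 proof -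
  have "(of_nat M :: complex) ~= 0" "(of_nat M :: complex) ~= 1" using that by auto
  then show ?thesis using P[of "of_nat M"] eq[of M] that by simp
 qed
 then have "of_nat ` {max M0 2..} <= {x. poly P x = 0}" by blast
 moreover have "infinite ((of_nat :: nat => complex) ` {max M0 2..})"
  by (subst finite_image_iff) (auto simp: inj_on_def infinite_Ici)
 ultimately have "infinite {x. poly P x = 0}" using finite_subset by blast
 then have "P = 0" using poly_roots_finite by blast
 then show ?thesis using P[OF x] x by simp
qed

text \<open>The square roots \<open>x\<close> of the square numbers \<open>N\<close> are natural numbers, which suffices to determine a rational function.\<close>

lemma interpolation:
 assumes in_lin: "!!x. F x : lin_partitions k l" "!!x. G x : lin_partitions k l"
  and rat: "!!r. ratfun (%x. F x r)" "!!r. ratfun (%x. G x r)"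
  and eq: "!!N i j. N >= 2 ==> i : multi_indices (N - 1) k ==> j : multi_indices (N - 1) l ==>
  ptn_map (N - 1) k l (F (xpar N 1)) j i = ptn_map (N - 1) k l (G (xpar N 1)) j i"
  and x: "x ~= 0" "x ~= 1"
 shows "F x = G x"
proof
 fix r
 show "F x r = G x r"
 proof (rule ratfun_eqI[OF rat _ x])
  fix M :: nat assume M: "M >= k + l + 2"
  have N: "M\<^sup>2 >= 2" "k + l <= M\<^sup>2 - 1"
  proof -
  have "M * 2 <= M\<^sup>2" using M by (simp add: power2_eq_square)
  then show "M\<^sup>2 >= 2" "k + l <= M\<^sup>2 - 1" using M by linarith+
  qed
  have "xpar (M\<^sup>2) 1 = of_nat M" by (simp add: xpar_def)
  then have "F (of_nat M) = G (of_nat M)"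
  using ptn_map_inj[OF in_lin N(2), of "of_nat M" "of_nat M"] eq[OF N(1)] by simp
  then show "F (of_nat M) r = G (of_nat M) r" by simp
 qed
qed

section \<open>The map on partitions is a functor\<close>

lemma Vl_ptn_map:
 assumes N: "N >= 2" and s: "s : {1, -1 :: real}" and i: "i : multi_indices (N - 1) k" and j: "j : multi_indices (N - 1) l"
 shows "ptn_map (N - 1) k l (Vl (xpar N s) k l f) j i = (SUM p:partitions k l. f p * wt (Vm N s) N p (label i j))"
 unfolding wt_def by (rule ptn_map_Vl[OF assms])

definition conj_map :: "nat => real => nat => nat => tensor_map => tensor_map" where
 "conj_map N s k l S = cmm (mi N k) (cmm (mi N l) (ctpk (Vm N s) l) S) (ctpk (Vt N s) k)"

lemma Vt_transpose: "Vt N s = (%a b. Vm N s b a)"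
 by (intro ext) (simp add: Vt_def)

lemma ctpk_V_support:
 "ctpk (Vm N s) k i j ~= 0 ==> i : multi_indices (N - 1) k & j : mi N k"
 "ctpk (Vt N s) k j i ~= 0 ==> j : mi N k & i : multi_indices (N - 1) k"
 by (rule ctp_support[of "Vm N s" "N - 1" N k]; auto simp: Vm_def split: if_splits)
  (rule ctp_support[of "Vt N s" N "N - 1" k]; auto simp: Vt_def Vm_def split: if_splits)

lemma ptn_map_Vl_conj:
 assumes N: "N >= 2" and s: "s : {1, -1 :: real}"
 shows "ptn_map (N - 1) k l (Vl (xpar N s) k l f) = conj_map N s k l (ptn_map N k l f)"
proof (rule ptn_map_eqI)
 fix i j assume ij: "j : multi_indices (N - 1) l" "i : multi_indices (N - 1) k"
 show "ptn_map (N - 1) k l (Vl (xpar N s) k l f) j i = conj_map N s k l (ptn_map N k l f) j i"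
  unfolding conj_map_def Vt_transpose ptn_map_Vl[OF N s ij(2,1)]
  by (rule conj_ptn_map[OF ij(2,1), symmetric])
next
 fix i j assume "j ~: multi_indices (N - 1) l | i ~: multi_indices (N - 1) k"
 then have "ctpk (Vm N s) l j b = 0 | ctpk (Vt N s) k a i = 0" for a b
  using ctpk_V_support by blast
 then show "conj_map N s k l (ptn_map N k l f) j i = 0"
  unfolding conj_map_def cmm_def sum_distrib_right by (intro sum.neutral ballI) auto
qed

lemma ratfun_Vb: "ratfun (%x. Vb x B Q)"
 unfolding Vb_def power2_eq_square by (intro ratfun_intros)

lemma ratfun_Vl: "(!!p. ratfun (%x. f x p)) ==> ratfun (%x. Vl x k l (f x) r)"
 unfolding Vl_def Vp_def by (intro ratfun_intros ratfun_Vb)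

lemma ratfun_tensor:
 "(!!p. ratfun (%x. f x p)) ==> (!!p. ratfun (%x. g x p)) ==> ratfun (%x. tensor_lin k l k' l' (f x) (g x) r)"
 unfolding tensor_lin_def by (intro ratfun_intros)

lemma ratfun_refl: "(!!p. ratfun (%x. f x p)) ==> ratfun (%x. refl_lin k l (f x) r)"
 unfolding refl_lin_def by (intro ratfun_intros)

lemma ratfun_compose:
 "ratfun t ==> (!!p. ratfun (%x. f x p)) ==> (!!p. ratfun (%x. g x p)) ==>
  ratfun (%x. compose_gen (t x) k l m (g x) (f x) r)"
 unfolding compose_gen_def by (intro ratfun_intros)

lemma Vl_tensor:
 assumes x: "x ~= 0" "x ~= 1"
 shows "tensor_lin k l k' l' (Vl x k l f) (Vl x k' l' g) = Vl x (k + k') (l + l') (tensor_lin k l k' l' f g)"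
proof (rule interpolation[where F = "%y. tensor_lin k l k' l' (Vl y k l f) (Vl y k' l' g)"
  and G = "%y. Vl y (k + k') (l + l') (tensor_lin k l k' l' f g)", OF tensor_lin_in Vl_in _ _ _ x])
 show "ratfun (%x. tensor_lin k l k' l' (Vl x k l f) (Vl x k' l' g) r)" for r
  by (intro ratfun_tensor ratfun_Vl ratfun_basic)
 show "ratfun (%x. Vl x (k + k') (l + l') (tensor_lin k l k' l' f g) r)" for r
  by (intro ratfun_Vl ratfun_basic)
 fix N i j assume N: "2 <= N" and ij: "i : multi_indices (N - 1) (k + k')" "j : multi_indices (N - 1) (l + l')"
 obtain a b where a: "i = a @ b" "a : multi_indices (N - 1) k" "b : multi_indices (N - 1) k'" by (rule split_multi[OF ij(1)])
 obtain c d where c: "j = c @ d" "c : multi_indices (N - 1) l" "d : multi_indices (N - 1) l'" by (rule split_multi[OF ij(2)])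
 have s: "(1 :: real) : {1, -1}" by simp
 show "ptn_map (N - 1) (k + k') (l + l') (tensor_lin k l k' l' (Vl (xpar N 1) k l f) (Vl (xpar N 1) k' l' g)) j i =
  ptn_map (N - 1) (k + k') (l + l') (Vl (xpar N 1) (k + k') (l + l') (tensor_lin k l k' l' f g)) j i"
  unfolding Vl_ptn_map[OF N s ij] tensor_lin_sum unfolding a(1) c(1) ptn_map_tensor[OF a(2) c(2) a(3) c(3)]
  Vl_ptn_map[OF N s a(2) c(2)] Vl_ptn_map[OF N s a(3) c(3)] sum_product
  by (intro sum.cong refl) (simp add: tensor_weight length_multi[OF a(2)] length_multi[OF c(2)])
qed

lemma Vl_refl:
 assumes x: "x ~= 0" "x ~= 1"
 shows "refl_lin k l (Vl x k l f) = Vl x l k (refl_lin k l f)"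
proof (rule interpolation[where F = "%y. refl_lin k l (Vl y k l f)"
  and G = "%y. Vl y l k (refl_lin k l f)", OF refl_lin_in Vl_in _ _ _ x])
 show "ratfun (%x. refl_lin k l (Vl x k l f) r)" for r by (intro ratfun_refl ratfun_Vl ratfun_basic)
 show "ratfun (%x. Vl x l k (refl_lin k l f) r)" for r by (intro ratfun_Vl ratfun_basic)
 fix N i j assume N: "2 <= N" and ij: "i : multi_indices (N - 1) l" "j : multi_indices (N - 1) k"
 have s: "(1 :: real) : {1, -1}" by simp
 show "ptn_map (N - 1) l k (refl_lin k l (Vl (xpar N 1) k l f)) j i = ptn_map (N - 1) l k (Vl (xpar N 1) l k (refl_lin k l f)) j i"
  unfolding ptn_map_refl[OF ij] Vl_ptn_map[OF N s ij] Vl_ptn_map[OF N s ij(2,1)] refl_lin_sum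
  by (intro sum.cong refl) (simp add: refl_weight)
qed

lemma basis_vec_lin: "p : partitions k l ==> bv p : lin_partitions k l"
 by (auto simp: lin_partitions_def basis_vec_def)

lemma ptn_map_basis:
 "p : partitions k l ==> j : mi n l ==> i : mi n k ==>
  ptn_map n k l (bv p) j i = pdelta p (label i j)"
 by (simp add: ptn_map_eq sum_basis_vec)

lemma pdelta_pair: "pdelta {{a, b}} my = (if my a = my b then 1 else 0)"
proof -
 have "(ALL B:{{a, b}}. ALL x:B. ALL y:B. my x = my y) \<longleftrightarrow> my a = my b" by auto
 then show ?thesis by (simp only: pdelta_def)
qed

lemma two_point_Vl:
 assumes p: "p : partitions k l" "p = {{a, b}}" "a ~= b" and x: "x ~= 0" "x ~= 1"
 shows "Vl x k l (bv p) = bv p"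
proof (rule interpolation[where F = "%y. Vl y k l (bv p)" and G = "%_. bv p",
  OF Vl_in basis_vec_lin[OF p(1)] _ _ _ x])
 show "ratfun (%x. Vl x k l (bv p) r)" for r by (intro ratfun_Vl ratfun_basic)
 fix N i j assume N: "2 <= N" and ij: "i : multi_indices (N - 1) k" "j : multi_indices (N - 1) l"
 have s: "(1 :: real) : {1, -1}" by simp
 let ?my = "label i j"
 have "a : points k l" "b : points k l" using partitionsD(3)[OF p(1)] unfolding p(2) by auto
 then have lt: "?my a < N - 1" "?my b < N - 1" using label_lt[OF ij] by auto
 have "wt (Vm N 1) N p ?my = cmm {..<N} (Vm N 1) (Vt N 1) (?my a) (?my b)"
  using p(3) by (simp add: wt_def p(2) cmm_def Vt_def)
 also have "... = pdelta p ?my" unfolding V_Vt[OF N s] using lt by (simp add: cid_def p(2) pdelta_pair)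
 finally show "ptn_map (N - 1) k l (Vl (xpar N 1) k l (bv p)) j i = ptn_map (N - 1) k l (bv p) j i"
  unfolding Vl_ptn_map[OF N s ij] ptn_map_basis[OF p(1) ij(2,1)] by (simp add: sum_basis_vec p(1))
qed (rule ratfun_basic)

subsection \<open>The projection onto the irreducible part\<close>

definition disc_ptn :: ptn where "disc_ptn = {{(0, 0)}, {(1, 0)}}"

lemma points_small:
 "points 0 0 = {}" "points 1 1 = {(0, 0), (1, 0)}" "points 0 2 = {(1, 0), (1, 1)}" "points 0 1 = {(1, 0)}"
 by (auto simp: points_def)

lemma small_partitions:
 "{} : partitions 0 0" "identity_ptn : partitions 1 1" "disc_ptn : partitions 1 1" "pair_ptn : partitions 0 2"
 "singleton_ptn : partitions 0 1"
 unfolding partitions_def mem_Collect_eq points_small identity_ptn_def disc_ptn_def pair_ptn_def singleton_ptn_def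
 by (auto simp: partition_on_def disjoint_def)

definition pi_lin :: "complex => lin_ptn" where
 "pi_lin x = (%p. bv identity_ptn p + - (1 / x * (1 / x)) * bv disc_ptn p)"

fun pi_pow :: "complex => nat => lin_ptn" where
 "pi_pow x 0 = bv {}"
| "pi_pow x (Suc l) = tensor_lin 1 1 l l (pi_lin x) (pi_pow x l)"

lemma ratfun_pi_pow: "ratfun (%x. pi_pow x l r)"
proof (induction l arbitrary: r)
 case 0
 then show ?case by (simp add: ratfun_basic)
next
 case (Suc l)
 have "ratfun (%x. pi_lin x p)" for p
 proof -
  have "ratfun (%x. bv identity_ptn p + (-1) * (1 / x * (1 / x)) * bv disc_ptn p)" by (intro ratfun_intros)
  then show ?thesis by (simp add: pi_lin_def)
 qed
 then show ?case using Suc by (simp only: pi_pow.simps) (intro ratfun_tensor)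
qed

lemma singleton_multi: "i < n ==> [i] : mi n 1"
 by (simp add: multi_indices_def)

lemma ptn_map_pi_lin:
 assumes "i < N" "j < N" and x: "x\<^sup>2 = of_nat N"
 shows "ptn_map N 1 1 (pi_lin x) [j] [i] = Pm N j i"
proof -
 note ij = singleton_multi[OF assms(2)] singleton_multi[OF assms(1)]
 have "ptn_map N 1 1 (pi_lin x) [j] [i] = ptn_map N 1 1 (bv identity_ptn) [j] [i] -
  (1 / x * (1 / x)) * ptn_map N 1 1 (bv disc_ptn) [j] [i]"
  unfolding ptn_map_eq[OF ij] pi_lin_def by (simp add: left_diff_distrib sum_subtractf sum_distrib_left)
 also have "... = pdelta identity_ptn (label [i] [j]) - 1 / of_nat N * pdelta disc_ptn (label [i] [j])"
  using ptn_map_basis[OF small_partitions(2) ij] ptn_map_basis[OF small_partitions(3) ij] x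
  by (simp add: power2_eq_square)
 also have "... = Pm N j i"
  using assms(1,2) by (auto simp: Pm_def pdelta_def identity_ptn_def disc_ptn_def label_def)
 finally show ?thesis .
qed

text \<open>The identity partition minus \<open>1/N\<close> times the two singletons represents the projection \<open>P\<close>.\<close>

lemma ptn_map_pi_pow:
 assumes x: "x\<^sup>2 = of_nat N"
 shows "ptn_map N l l (pi_pow x l) = ctpk (Pm N) l"
proof (rule ptn_map_eqI)
 show "j : mi N l ==> i : mi N l ==> ptn_map N l l (pi_pow x l) j i = ctpk (Pm N) l j i" for i j
 proof (induction l arbitrary: i j)
  case 0
  then show ?case
  using ptn_map_basis[OF small_partitions(1), of j N i] by (simp add: ctpk_def pdelta_def)
 next
  case (Suc l)
  obtain j0 js where j: "j = [j0] @ js" "j0 < N" "js : mi N l"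
  using Suc.prems(1) unfolding multi_indices_Suc by auto
  obtain i0 "is" where i: "i = [i0] @ is" "i0 < N" "is : mi N l"
  using Suc.prems(2) unfolding multi_indices_Suc by auto
  have "ptn_map N (1 + l) (1 + l) (tensor_lin 1 1 l l (pi_lin x) (pi_pow x l)) ([j0] @ js) ([i0] @ is) =
  ptn_map N 1 1 (pi_lin x) [j0] [i0] * ptn_map N l l (pi_pow x l) js is"
  by (rule ptn_map_tensor) (use i j singleton_multi in auto)
  also have "... = Pm N j0 i0 * ctpk (Pm N) l js is"
  using ptn_map_pi_lin[OF i(2) j(2) x] Suc.IH[OF j(3) i(3)] by simp
  finally show ?case unfolding i(1) j(1) using length_multi[OF j(3)] by (simp add: ctpk_def plus_1_eq_Suc)
 qed
 show "j ~: mi N l | i ~: mi N l ==> ctpk (Pm N) l j i = 0" for i j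
 proof -
  have "Pm N a b ~= 0 ==> a < N & b < N" for a b by (simp add: Pm_def split: if_splits)
  from ctp_support[of "Pm N" N N l j i, OF this] show "j ~: mi N l | i ~: mi N l ==> ctpk (Pm N) l j i = 0"
  by blast
 qed
qed

text \<open>At \<open>x = \<surd>N\<close> the left side is represented by \<open>V T\<^sub>q V\<^sup>* V T\<^sub>p V\<^sup>*\<close>, and \<open>V\<^sup>* V\<close> is the map of \<open>pi_pow\<close>.
Since \<open>pi_pow\<close> lies in every category containing the two singletons, the right side is in the image.\<close>

lemma Vl_compose:
 assumes x: "x ~= 0" "x ~= 1"
 shows "compose_gen (x\<^sup>2 - 1) k l m (Vl x l m g) (Vl x k l f) =
  Vl x k m (compose_gen (x\<^sup>2) k l m g (compose_gen (x\<^sup>2) k l l (pi_pow x l) f))"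
proof (rule interpolation[where F = "%y. compose_gen (y\<^sup>2 - 1) k l m (Vl y l m g) (Vl y k l f)"
  and G = "%y. Vl y k m (compose_gen (y\<^sup>2) k l m g (compose_gen (y\<^sup>2) k l l (pi_pow y l) f))",
  OF compose_gen_in Vl_in _ _ _ x])
 show "ratfun (%x. compose_gen (x\<^sup>2 - 1) k l m (Vl x l m g) (Vl x k l f) r)" for r
  unfolding power2_eq_square by (intro ratfun_compose ratfun_Vl ratfun_intros)
 show "ratfun (%x. Vl x k m (compose_gen (x\<^sup>2) k l m g (compose_gen (x\<^sup>2) k l l (pi_pow x l) f)) r)" for r
  unfolding power2_eq_square by (intro ratfun_compose ratfun_Vl ratfun_pi_pow ratfun_intros)
 fix N :: nat and i j assume N: "2 <= N"
 have s: "(1 :: real) : {1, -1}" by simp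
 let ?x = "xpar N 1"
 have sq: "?x\<^sup>2 = of_nat N" by (rule xpar_square[OF N s])
 have sq1: "?x\<^sup>2 - 1 = of_nat (N - 1)" unfolding sq using N by (simp add: of_nat_diff)
 let ?V = "ctpk (Vm N 1)" and ?V' = "ctpk (Vt N 1)"
 have VV: "cmm (multi_indices (N - 1) l) (?V' l) (?V l) = ctpk (Pm N) l"
  unfolding ctpk_cmm[symmetric] Vt_V[OF N s] ..
 have "ptn_map (N - 1) k m (compose_gen (?x\<^sup>2 - 1) k l m (Vl ?x l m g) (Vl ?x k l f)) =
  cmm (multi_indices (N - 1) l) (conj_map N 1 l m (ptn_map N l m g)) (conj_map N 1 k l (ptn_map N k l f))"
  unfolding sq1 ptn_map_compose ptn_map_Vl_conj[OF N s] ..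
 also have "... = conj_map N 1 k m (cmm (mi N l) (ptn_map N l m g)
  (cmm (mi N l) (cmm (multi_indices (N - 1) l) (?V' l) (?V l)) (ptn_map N k l f)))"
  unfolding conj_map_def by (simp only: cmm_assoc)
 also have "... = ptn_map (N - 1) k m (Vl ?x k m (compose_gen (?x\<^sup>2) k l m g (compose_gen (?x\<^sup>2) k l l (pi_pow ?x l) f)))"
  unfolding VV sq ptn_map_Vl_conj[OF N s] ptn_map_compose ptn_map_pi_pow[OF sq] ..
 finally show "ptn_map (N - 1) k m (compose_gen (?x\<^sup>2 - 1) k l m (Vl ?x l m g) (Vl ?x k l f)) j i =
  ptn_map (N - 1) k m (Vl ?x k m (compose_gen (?x\<^sup>2) k l m g (compose_gen (?x\<^sup>2) k l l (pi_pow ?x l) f))) j i" by simp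
qed

section \<open>The image of a linear category\<close>

locale sharp_category =
 fixes N :: nat and s :: real and K :: ptn_family
 assumes N: "N >= 2" and s: "s : {1, -1}" and K: "linear_category N K" and two: "two_singletons : K 0 2"
begin

lemmas cat = K[unfolded linear_category_def compose_lin_gen]
lemmas cat_linear = cat[THEN conjunct1, THEN spec, THEN spec]
lemmas K_lin = cat_linear[THEN conjunct1, THEN subsetD]
lemmas K_zero = cat_linear[THEN conjunct2, THEN conjunct1]
lemmas K_add = cat_linear[THEN conjunct2, THEN conjunct2, THEN conjunct1, rule_format]
lemmas K_smult = cat_linear[THEN conjunct2, THEN conjunct2, THEN conjunct2, rule_format]
lemmas K_id = cat[THEN conjunct2, THEN conjunct1]
lemmas K_pair = cat[THEN conjunct2, THEN conjunct2, THEN conjunct1]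
lemmas cat_ops = cat[THEN conjunct2, THEN conjunct2, THEN conjunct2]
lemmas K_tensor = cat_ops[THEN conjunct1, rule_format]
lemmas K_compose = cat_ops[THEN conjunct2, THEN conjunct1, rule_format]
lemmas K_invol = cat_ops[THEN conjunct2, THEN conjunct2, rule_format]

definition cap where "cap = involution_lin 0 2 (bv pair_ptn)"

lemma cap: "cap : K 2 0" unfolding cap_def by (rule K_invol[OF K_pair])

lemma pair_multi: "a < n ==> b < n ==> [a, b] : mi n 2"
 by (simp add: multi_indices_def)

lemma ptn_map_pair: "a < N ==> b < N ==> ptn_map N 0 2 (bv pair_ptn) [a, b] [] = (if a = b then 1 else 0)"
 using ptn_map_basis[OF small_partitions(4) pair_multi[of a N b], of "[]"]
 by (auto simp: pdelta_def pair_ptn_def label_def)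

lemma ptn_map_cap: "a < N ==> b < N ==> ptn_map N 2 0 cap [] [a, b] = (if a = b then 1 else 0)"
proof -
 assume ab: "a < N" "b < N"
 have "cap = refl_lin 0 2 (bv pair_ptn)"
  unfolding cap_def involution_refl by (rule arg_cong[where f = "refl_lin 0 2"]) (simp add: basis_vec_def fun_eq_iff)
 then show ?thesis
  using ptn_map_refl[of "[a, b]" N 2 "[]" 0 "bv pair_ptn"] ptn_map_pair[OF ab] pair_multi[OF ab] by simp
qed

lemma sum_multi2: "(SUM a:mi n 2. F a) = (SUM i<n. SUM j<n. F [i, j])" for F :: "nat list => complex"
 by (simp add: numeral_2_eq_2 sum_multi_indices_Suc)

lemma K_empty: "bv {} : K 0 0"
proof -
 define c where "c = compose_gen (of_nat N) 0 2 0 cap (bv pair_ptn)"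
 have c: "c : K 0 0" unfolding c_def by (rule K_compose[OF K_pair cap])
 have p0: "partitions 0 0 = {{}}" by (auto simp: partitions_def points_small partition_on_empty)
 have "c {} = ptn_map N 0 0 c [] []" by (simp add: ptn_map_eq p0 pdelta_def)
 also have "... = (SUM i<N. SUM j<N. if i = j then 1 else 0)"
  unfolding c_def ptn_map_compose cmm_def sum_multi2
  by (intro sum.cong refl) (simp add: ptn_map_cap ptn_map_pair)
 also have "... = of_nat N" by simp
 finally have c0: "c {} = of_nat N" .
 have "(%p. 1 / of_nat N * c p) = bv {}"
 proof
  fix p :: ptn
  have "p ~= {} ==> c p = 0" using K_lin[OF c] by (auto simp: lin_partitions_def p0)
  then show "1 / of_nat N * c p = bv {} p" using c0 N by (auto simp: basis_vec_def)
 qed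
 then show ?thesis using K_smult[OF c, of "1 / of_nat N"] by simp
qed

lemma two_partition: "tensor_ptn 0 1 singleton_ptn singleton_ptn : partitions 0 2"
 using tensor_partition[OF small_partitions(5) small_partitions(5)] by simp

lemma two_map:
 assumes "i = []" "j : mi N 2" shows "ptn_map N 0 2 two_singletons j i = 1"
 using ptn_map_basis[OF two_partition assms(2), of i] assms(1)
 by (simp add: two_singletons_def pdelta_def tensor_ptn_def singleton_ptn_def)

text \<open>A cup between the identity and the two singletons cuts the identity into two singletons.\<close>

lemma K_disc: "bv disc_ptn : K 1 1"
proof -
 define c where "c = compose_gen (of_nat N) 1 3 1
  (tensor_lin 2 0 1 1 cap (bv identity_ptn)) (tensor_lin 1 1 0 2 (bv identity_ptn) two_singletons)"
 have 1: "tensor_lin 2 0 1 1 cap (bv identity_ptn) : K 3 1"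
  using K_tensor[OF cap K_id] by simp
 have 2: "tensor_lin 1 1 0 2 (bv identity_ptn) two_singletons : K 1 3"
  using K_tensor[OF K_id two] by simp
 have c: "c : K 1 1" unfolding c_def by (rule K_compose[OF 2 1])
 have "c = bv disc_ptn"
 proof (rule ptn_map_inj[OF K_lin[OF c] basis_vec_lin[OF small_partitions(3)]])
  show "1 + 1 <= N" using N by simp
  fix i j assume ij: "i : mi N 1" "j : mi N 1"
  obtain i0 where i: "i = [i0]" "i0 < N" using ij(1) unfolding One_nat_def multi_indices_Suc multi_indices_0 by auto
  obtain j0 where j: "j = [j0]" "j0 < N" using ij(2) unfolding One_nat_def multi_indices_Suc multi_indices_0 by auto
  have idm: "ptn_map N 1 1 (bv identity_ptn) [b] [a] = (if a = b then 1 else 0)" if "a < N" "b < N" for a b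
  using ptn_map_basis[OF small_partitions(2) singleton_multi[OF that(2)] singleton_multi[OF that(1)]]
  by (auto simp: pdelta_def identity_ptn_def label_def)
  have t1: "ptn_map N 3 1 (tensor_lin 2 0 1 1 cap (bv identity_ptn)) [j0] [a, b, d] =
  (if a = b then 1 else 0) * (if d = j0 then 1 else 0)" if "a < N" "b < N" "d < N" for a b d
  using ptn_map_tensor[OF pair_multi[OF that(1,2)] _ singleton_multi[OF that(3)] singleton_multi[OF j(2)], of "[]" 0 cap "bv identity_ptn"]
  ptn_map_cap[OF that(1,2)] idm[OF that(3) j(2)] by simp
  have t2: "ptn_map N 1 3 (tensor_lin 1 1 0 2 (bv identity_ptn) two_singletons) [a, b, d] [i0] =
  (if i0 = a then 1 else 0)" if "a < N" "b < N" "d < N" for a b d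
  using ptn_map_tensor[OF singleton_multi[OF i(2)] singleton_multi[OF that(1)] _ pair_multi[OF that(2,3)], of "[]" 0 "bv identity_ptn" two_singletons]
  two_map[OF refl pair_multi[OF that(2,3)]] idm[OF i(2) that(1)] by simp
  have d: "(SUM d<N. p * (if d = j0 then 1 else 0) * q) = p * q" for p q :: complex
  proof -
  have "(SUM d<N. p * (if d = j0 then 1 else 0) * q) = (SUM d<N. if d = j0 then p * q else 0)"
  by (intro sum.cong refl) simp
  then show ?thesis using j by simp
  qed
  have "ptn_map N 1 1 c j i = (SUM a<N. SUM b<N. SUM d<N. (if a = b then 1 else 0) * (if d = j0 then 1 else 0) * (if i0 = a then 1 else 0))"
  unfolding c_def ptn_map_compose cmm_def i(1) j(1) numeral_3_eq_3 sum_multi_indices_Suc multi_indices_0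
  unfolding numeral_3_eq_3[symmetric] by (intro sum.cong refl) (simp add: t1 t2)
  also have "... = (SUM a<N. SUM b<N. (if a = b then 1 else 0) * (if i0 = a then 1 else 0))" unfolding d ..
  also have "... = (SUM a<N. if i0 = a then 1 else 0)"
  by (intro sum.cong refl) (simp add: sum_distrib_right[symmetric])
  also have "... = 1" using i by simp
  also have "1 = ptn_map N 1 1 (bv disc_ptn) j i"
  using ptn_map_basis[OF small_partitions(3) ij(2,1)] by (simp add: pdelta_def disc_ptn_def)
  finally show "ptn_map N 1 1 c j i = ptn_map N 1 1 (bv disc_ptn) j i" .
 qed
 then show ?thesis using c by simp
qed

lemma K_pi_pow: "pi_pow x l : K l l"
proof (induction l)
 case 0
 then show ?case using K_empty by simp
next
 case (Suc l)
 have "pi_lin x : K 1 1" unfolding pi_lin_def by (intro K_add K_id K_smult K_disc)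
 from K_tensor[OF this Suc] show ?case by (simp add: plus_1_eq_Suc)
qed

abbreviation x where "x == xpar N s"

lemma family_eq: "V_family N s K k l = Vl x k l ` K k l"
 unfolding V_family_def by (intro image_cong refl) (rule V_lin_Vl[OF N s])

lemma x_facts: "x ~= 0" "x ~= 1" "x\<^sup>2 = of_nat N" "x\<^sup>2 - 1 = of_nat (N - 1)"
 using xpar_neq[OF N s] xpar_square[OF N s] N by (simp_all add: of_nat_diff)

lemma Vl_real: "(%r. cnj (Vl x k l f r)) = Vl x k l (%p. cnj (f p))"
proof -
 have x: "cnj x = x" by (simp add: xpar_def)
 have b: "cnj (bv q r) = bv q r" for q r :: ptn by (simp add: basis_vec_def)
 have "cnj (Vb x B Q) = Vb x B Q" for B Q by (simp add: Vb_def al_def x b)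
 then show ?thesis by (simp add: Vl_def Vp_def b fun_eq_iff)
qed

theorem category: "linear_category (N - 1) (V_family N s K)"
 unfolding linear_category_def family_eq compose_lin_gen
proof (intro conjI allI ballI)
 fix k l k' l' m
 show "Vl x k l ` K k l <= lin_partitions k l" using Vl_in by blast
 have "Vl x k l (%_. 0) = (%_. 0)" by (simp add: Vl_def)
 from this[symmetric] show "(%_. 0) : Vl x k l ` K k l" by (rule image_eqI[where x = "%_. 0"]) (rule K_zero)
 fix F c assume "F : Vl x k l ` K k l"
 then obtain f where f: "f : K k l" "F = Vl x k l f" by blast
 have "Vl x k l (%p. c * f p) = (%p. c * F p)" by (simp add: f Vl_def sum_distrib_left mult.assoc)
 from this[symmetric] show "(%p. c * F p) : Vl x k l ` K k l"
  by (rule image_eqI[where x = "%p. c * f p"]) (rule K_smult[OF f(1)])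
 have "involution_lin k l F = Vl x l k (involution_lin k l f)"
  unfolding involution_refl f(2) Vl_real by (rule Vl_refl[OF x_facts(1,2)])
 then show "involution_lin k l F : Vl x l k ` K l k" by (rule image_eqI[where x = "involution_lin k l f"]) (rule K_invol[OF f(1)])
 {
  fix H assume "H : Vl x k l ` K k l"
  then obtain h where h: "h : K k l" "H = Vl x k l h" by blast
  have "Vl x k l (%p. f p + h p) = (%p. F p + H p)" by (simp add: f h Vl_def distrib_right sum.distrib)
  from this[symmetric] show "(%p. F p + H p) : Vl x k l ` K k l"
  by (rule image_eqI[where x = "%p. f p + h p"]) (rule K_add[OF f(1) h(1)])
 }
 {
  fix H assume "H : Vl x k' l' ` K k' l'"
  then obtain h where h: "h : K k' l'" "H = Vl x k' l' h" by blast
  show "tensor_lin k l k' l' F H : Vl x (k + k') (l + l') ` K (k + k') (l + l')"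
  unfolding f(2) h(2) Vl_tensor[OF x_facts(1,2)] by (intro imageI K_tensor f h)
 }
 {
  fix H assume "H : Vl x l m ` K l m"
  then obtain h where h: "h : K l m" "H = Vl x l m h" by blast
  show "compose_gen (of_nat (N - 1)) k l m H F : Vl x k m ` K k m"
  unfolding f(2) h(2) x_facts(4)[symmetric] Vl_compose[OF x_facts(1,2)]
  unfolding x_facts(3) by (intro imageI K_compose K_pi_pow f h)
 }
next
 have "Vl x 1 1 (bv identity_ptn) = bv identity_ptn"
  by (rule two_point_Vl[OF small_partitions(2) identity_ptn_def _ x_facts(1,2)]) simp
 from this[symmetric] show "bv identity_ptn : Vl x 1 1 ` K 1 1" by (rule image_eqI[where x = "bv identity_ptn"]) (rule K_id)
 have "Vl x 0 2 (bv pair_ptn) = bv pair_ptn"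
  by (rule two_point_Vl[OF small_partitions(4) pair_ptn_def _ x_facts(1,2)]) simp
 from this[symmetric] show "bv pair_ptn : Vl x 0 2 ` K 0 2" by (rule image_eqI[where x = "bv pair_ptn"]) (rule K_pair)
qed

end

section \<open>The irreducible part and its category\<close>

lemma star_hom_compose:
 assumes "star_hom A B ph" "star_hom B C ps" shows "star_hom A C (%x. ps (ph x))"
 using assms by (auto simp: star_hom_def ring_hom_def Pi_def)

lemma qsubgroup_hom:
 assumes "qsubgroup H G"
 shows "EX ph. star_hom (qalg G) (qalg H) ph & (ALL i j. i < qdim G --> j < qdim G --> ph (qfund G i j) = qfund H i j)"
 by (rule exE[OF conjunct2[OF assms[unfolded qsubgroup_def]]])
  (rule exI, erule conjE, erule conjE, rule conjI, assumption, simp)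

theorem theoremA:
  fixes N :: nat and s :: real
    and G :: "'a qgroup" and B :: "'b qgroup" and K :: ptn_family
  assumes "N \<ge> 2"
    and "is_B_sharp_plus N B"
    and "is_cmqg G" and "is_full G"
    and "qsubgroup (sym_qgroup N) G" and "qsubgroup G B"
    and "corresponds G K"
    and "two_singletons \<in> K 0 2"
    and "s \<in> {1, -1}"
  shows "is_cmqg (irr_qgroup s G)
    \<and> qsubgroup (sym_qgroup (N - 1)) (irr_qgroup s G)
    \<and> qsubgroup (irr_qgroup s G) (free_orthogonal_qgroup (N - 1))
    \<and> corresponds (irr_qgroup s G) (V_family N s K)"
proof -
 define A where "A = qalg G"
 have dim: "qdim G = N" using assms(5) by (simp add: qsubgroup_def sym_qgroup_def)
 have cm: "is_cstar_algebra A" "entries G <= car A"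
  using assms(3) unfolding is_cmqg_def Let_def A_def by blast+
 obtain De where De: "star_hom A (min_tensor A A) De"
  "!!i j. i < N ==> j < N ==> De (qfund G i j) = (\<Oplus>\<^bsub>min_tensor A A\<^esub>k\<in>{..<N}. pure_tensor A A (qfund G i k) (qfund G k j))"
  using assms(3) unfolding is_cmqg_def Let_def A_def dim by blast
 have Bdim: "qdim B = N" using assms(6) dim by (simp add: qsubgroup_def)
 obtain ph where ph: "star_hom (qalg B) A ph" "!!i j. i < N ==> j < N ==> ph (qfund B i j) = qfund G i j"
  using qsubgroup_hom[OF assms(6)] unfolding Bdim A_def by blast
 have "qsubgroup B (free_orthogonal_qgroup N)" using assms(2) by (simp add: is_B_sharp_plus_def)
 note free = this
 have fdim: "qdim (free_orthogonal_qgroup N) = N" by (simp add: free_orthogonal_qgroup_def Let_def)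
 obtain ps where ps: "star_hom (qalg (free_orthogonal_qgroup N)) (qalg B) ps"
  "!!i j. i < N ==> j < N ==> ps (qfund (free_orthogonal_qgroup N) i j) = qfund B i j"
  using qsubgroup_hom[OF free] unfolding fdim by blast
 have sA: "is_star_algebra A" using cm(1) by (simp add: is_cstar_algebra_def)
 have orth: "orthogonal_entries A N (qfund G)"
  by (rule orthogonal_entries_hom[OF sA star_hom_compose[OF ps(1) ph(1)]]) (simp add: ps(2) ph(2))
 have cat: "linear_category N K" and mor: "!!k l. Mor G k l = ptn_map N k l ` K k l"
  using assms(7) by (simp_all add: corresponds_def dim)
 interpret S: sharp_category N s K using assms cat by unfold_locales
 have "ptn_map N 0 2 two_singletons = (%j i. if j : mi N 2 & i = [] then 1 else 0)"
  by (rule ptn_map_eqI) (auto simp: S.two_map)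
 then have two: "(%j i. if j : mi N 2 & i = [] then 1 else 0) : Mor G 0 2"
  unfolding mor using assms(8) by (metis image_eqI)
 interpret comult_setting A G N s De
 proof -
  interpret cstar_alg A by unfold_locales (use cm in "auto simp: is_cstar_algebra_def")
  have "cstar_sub A (car A)" by (rule cstar_sub_carrier)
  then interpret cstar_sub A "car A" .
  show "comult_setting A G N s De"
  proof unfold_locales
  show "qalg G = A(|carrier := car A|)" by (simp add: A_def)
  show "qdim G = N" by (rule dim)
  show "qfund G i j : car A" if "i < N" "j < N" for i j
  using cm(2) that by (auto simp: entries_def dim)
  show "N >= 2" "s : {1, -1}" by fact+
  show "orthogonal_entries A N (qfund G)" by (rule orth)
  show "(%j i. if j : mi N 2 & i = [] then 1 else 0) : Mor G 0 2" by (rule two)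
  show "star_hom A (min_tensor A A) De" by (rule De(1))
  show "De (qfund G i j) = (\<Oplus>\<^bsub>min_tensor A A\<^esub>k\<in>{..<N}. pure_tensor A A (qfund G i k) (qfund G k j))"
  if "i < N" "j < N" for i j by (rule De(2)[OF that])
  fix nu y assume "cstar_seminorm (A(|carrier := star_generated A (entries G)|)) nu" "y : star_generated A (entries G)"
  then show "nu y <= cnorm A y" using assms(4) unfolding is_full_def Let_def A_def by simp
  qed
 qed
 have "corresponds irr (V_family N s K)"
  unfolding corresponds_def irr_simps(1)
 proof (intro conjI allI)
  show "linear_category (N - 1) (V_family N s K)" by (rule S.category)
  fix k l
  have "conj_V k l f = conj_map N s k l f" for f by (simp add: conj_V_def conj_map_def Vk_def Vk'_def)
  then have "Mor irr k l = (%f. ptn_map (N - 1) k l (Vl (xpar N s) k l f)) ` K k l"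
  unfolding Mor_irr mor image_image ptn_map_Vl_conj[OF S.N S.s] by simp
  then show "Mor irr k l = ptn_map (N - 1) k l ` V_family N s K k l" by (simp only: S.family_eq image_image)
 qed
 then show ?thesis using irr_cmqg sym_sub_irr[OF assms(5)] irr_sub_free_orthogonal by blast
qed

end
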